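(* For every integer $n\ge 1$ put $r_n=2+\frac{n(n+3)}{2}$. Then for every fixed integer $m\ge 2$ and every integer $n\ge 1$, $$|\mathrm{Sk}_{<E_n(x^m)}|<\omega_{r_n},\qquad |\mathrm{Sk}_{<E_n(x^m)}/{\asymp}|<\omega_{r_n-1}.$$ Consequently $|\mathrm{Sk}_{<E_n(x)}|<\omega_{10+4^n}$ for every $n\ge 1$.
   Context: $\mathrm{Sk}$ (the Skolem functions) is the smallest set of germs at $+\infty$ of positive real functions containing the constant $1$ and the identity $x$ and closed under addition, multiplication and exponentiation $(f,g)\mapsto f^g$. Germs are compared by eventual order: $f<g$ means $f(x)<g(x)$ for all sufficiently large $x$; functions that agree eventually are identified. It is known that this is a well-order on $\mathrm{Sk}$. For a positive germ $R$, $\mathrm{Sk}_{<R}=\{f\in\mathrm{Sk}: f<R\}$. $|A|$ denotes the order type (not cardinality) of a well-ordered set $A$. For positive germs, $f\asymp g$ means $f=O(g)$ and $g=O(f)$ (Archimedean equivalence); $A/{\asymp}$ is the set of $\asymp$-classes of members of $A$, with the order induced from $A$ (the classes are convex). $E_0(u)=u$, $E_{n+1}(u)=2^{E_n(u)}$. Ordinals: $\omega_0=1$ and $\omega_{k+1}=\omega^{\omega_k}$ (finite towers of ordinal exponentials, not cardinals). *)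

theory Defs
  imports Complex_Main "HOL-Library.Landau_Symbols" "HOL-Library.Multiset"
begin

section \<open>Germs at infinity\<close>

quotient_type germ = "real \<Rightarrow> real" / "\<lambda>f g. eventually (\<lambda>x. f x = g x) at_top"
  by (intro equivpI reflpI sympI transpI) (auto elim: eventually_mono eventually_elim2)

lift_definition germ_of :: "(real \<Rightarrow> real) \<Rightarrow> germ" is "\<lambda>f. f" .

instantiation germ :: "{one, plus, times, ord}"
begin

lift_definition one_germ :: germ is "\<lambda>_. 1" .

lift_definition plus_germ :: "germ \<Rightarrow> germ \<Rightarrow> germ" is "\<lambda>f g x. f x + g x"
  by (auto elim: eventually_elim2)

lift_definition times_germ :: "germ \<Rightarrow> germ \<Rightarrow> germ" is "\<lambda>f g x. f x * g x"
  by (auto elim: eventually_elim2)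

lift_definition less_germ :: "germ \<Rightarrow> germ \<Rightarrow> bool" is
  "\<lambda>f g. eventually (\<lambda>x. f x < g x) at_top"
proof -
  fix f f' g g' :: "real \<Rightarrow> real"
  assume "\<forall>\<^sub>F x in at_top. f x = f' x" "\<forall>\<^sub>F x in at_top. g x = g' x"
  then have "\<forall>\<^sub>F x in at_top. (f x < g x) = (f' x < g' x)"
    by (auto elim: eventually_elim2)
  then show "(\<forall>\<^sub>F x in at_top. f x < g x) = (\<forall>\<^sub>F x in at_top. f' x < g' x)"
    by (rule eventually_subst)
qed

text \<open>On arbitrary germs this is stronger than eventual pointwise inequality.\<close>

definition less_eq_germ :: "germ \<Rightarrow> germ \<Rightarrow> bool" where
  "f \<le> g \<longleftrightarrow> f < g \<or> f = (g :: germ)"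

instance ..

end

text \<open>The real power \<open>powr\<close> is the intended one only for positive bases; all members of
  \<open>Sk\<close> below are eventually positive.\<close>

lift_definition germ_powr :: "germ \<Rightarrow> germ \<Rightarrow> germ" is "\<lambda>f g x. f x powr g x"
  by (auto elim: eventually_elim2)

lift_definition germ_asymp :: "germ \<Rightarrow> germ \<Rightarrow> bool" is "\<lambda>f g. f \<in> O(g) \<and> g \<in> O(f)"
proof -
  fix f f' g g' :: "real \<Rightarrow> real"
  assume f: "\<forall>\<^sub>F x in at_top. f x = f' x" and g: "\<forall>\<^sub>F x in at_top. g x = g' x"
  show "(f \<in> O(g) \<and> g \<in> O(f)) = (f' \<in> O(g') \<and> g' \<in> O(f'))"
    using landau_o.big.in_cong[OF f] landau_o.big.in_cong[OF g]
      landau_o.big.cong[OF f] landau_o.big.cong[OF g] by simp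
qed

section \<open>Skolem functions\<close>

inductive_set Sk :: "germ set" where
  one: "1 \<in> Sk"
| ident: "germ_of (\<lambda>x. x) \<in> Sk"
| add: "f \<in> Sk \<Longrightarrow> g \<in> Sk \<Longrightarrow> f + g \<in> Sk"
| mult: "f \<in> Sk \<Longrightarrow> g \<in> Sk \<Longrightarrow> f * g \<in> Sk"
| powr: "f \<in> Sk \<Longrightarrow> g \<in> Sk \<Longrightarrow> germ_powr f g \<in> Sk"

definition Sk_below :: "germ \<Rightarrow> germ set" where
  "Sk_below R = {f \<in> Sk. f < R}"

fun tower2 :: "nat \<Rightarrow> real \<Rightarrow> real" where
  "tower2 0 u = u"
| "tower2 (Suc n) u = 2 powr tower2 n u"

section \<open>Order types\<close>

text \<open>Order types are compared by \<open>ordLess\<close> on (reflexive) order relations: \<open>r <o s\<close> says that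
  \<open>r\<close> and \<open>s\<close> are well-orders on their fields and that \<open>r\<close> is isomorphic to a proper initial
  segment of \<open>s\<close>.\<close>

unbundle cardinal_syntax

definition germ_order :: "germ set \<Rightarrow> germ rel" where
  "germ_order A = relation_of (\<le>) A"

definition asymp_on :: "germ set \<Rightarrow> germ rel" where
  "asymp_on A = relation_of germ_asymp A"

text \<open>The classes are convex, so distinct classes are ordered by any choice of representatives.\<close>

definition asymp_quotient_order :: "germ set \<Rightarrow> germ set rel" where
  "asymp_quotient_order A =
     relation_of (\<lambda>C D. \<exists>f\<in>C. \<exists>g\<in>D. f \<le> g) (A // asymp_on A)"

text \<open>The ordinal power \<open>\<omega>\<^sup>r\<close>: finitely supported functions from \<open>Field r\<close> to the natural
  numbers, that is, finite multisets over \<open>Field r\<close>, compared at the \<open>r\<close>-largest argument at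
  which they differ.\<close>

definition omega_power :: "'a rel \<Rightarrow> 'a multiset rel" where
  "omega_power r = relation_of
     (\<lambda>M N. M = N \<or> (\<exists>x\<in>Field r. count M x < count N x \<and>
        (\<forall>y. (x, y) \<in> r \<and> y \<noteq> x \<longrightarrow> count M y = count N y)))
     {M. set_mset M \<subseteq> Field r}"

text \<open>Hereditarily finite multisets form one type that contains a copy of every finite tower
  of ordinal powers of \<open>\<omega>\<close>.\<close>

datatype hmset = HMSet "hmset multiset"

fun omega_tower :: "nat \<Rightarrow> hmset rel" where
  "omega_tower 0 = {(HMSet {#}, HMSet {#})}"
| "omega_tower (Suc k) = dir_image (omega_power (omega_tower k)) HMSet"

definition tower_index :: "nat \<Rightarrow> nat" where
  "tower_index n = 2 + n * (n + 3) div 2"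

end

theory Submission
 imports Defs "HOL-Library.Ramsey" "HOL-Library.Sublist" "HOL-Analysis.Infinite_Sum"
  "HOL-Analysis.Elementary_Metric_Spaces" "HOL-Real_Asymp.Real_Asymp"
begin

text \<open>Order types are measured by exponents: \<open>fsz\<close> says that a set is a finite union of sets of order
 types at most \<open>\<omega>\<^sup>\<mu>\<close> with exponents \<open>\<mu>\<close> from a given stock.  In this measure unions are free and the
 exponents of products add up.  So a set is under control as soon as its members are obtained from
 boundedly many arguments under control, monotonically up to the precision that is required.

 A Skolem function is a sum of components, a component is a product of factors, and a factor is \<open>x\<close>
 or a power \<open>b\<^sup>e\<close> of Skolem functions.  By Kruskal's theorem the terms of this form are well-quasi-ordered by
 embedding (\<open>wqo_emb\<close>), and the value is monotone in the term.  Hence every set of Skolem functions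
 lies above finitely many terms.  If the value of a term above \<open>\<tau>\<close> exceeds that of \<open>\<tau>\<close> by
 little, then so do corresponding components, factors, bases and exponents, each at a scale of its
 own.  This reduces everything to the question how many values can be distinguished at a given
 scale \<open>s\<close>, that is, up to differences infinitesimal relative to \<open>s\<close> (\<open>Good\<close>, \<open>fsz_above\<close>).

 Differences and quotients of Skolem functions are compared by means of convergent expansions.  The
 monomials are obtained from powers of \<open>x\<close> by iterated exponentiation; a Skolem function is an integer plus
 a series in infinite monomials.  As no monomial lies between consecutive powers of \<open>x\<close>, there is a
 gap: two differences of Skolem functions are of the same size (\<open>\<asymp>\<close>), or differ in size at least by the
 factor \<open>x\<close> (\<open>QQ_gap\<close>).  The germs with an expansion form an ordered field \<open>tf\<close>, which contains the
 logarithms of Skolem functions.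

 The induction is on the level \<open>j\<close> of exponentials; \<open>El j m\<close> is the germ of \<open>tower2 j (x\<^sup>m)\<close>.  It is
 shown that \<open>Hset (2 * j)\<close> contains enough exponents for the sizes of values below \<open>El j m\<close>, and
 \<open>Hset (2 * j + 1)\<close> for the values up to \<open>s\<close> times \<open>El j m\<close> at any scale \<open>s\<close> (\<open>level_all\<close>).  For
 \<open>j = 0\<close> this is the gap.  For the step, consider values below the powers of some \<open>y\<close> that is at most
 \<open>El (Suc j) m\<close>.  A component of such a value is a product of a value with a logarithm
 of smaller size than \<open>ln y\<close> and of boundedly many powers \<open>b\<^sup>e\<close>, where \<open>b\<close> has a logarithm of smaller size than
 \<open>ln y\<close>, and \<open>e\<close> is of the level \<open>j\<close>.  So there is a recursion on the size of \<open>ln y\<close>, and these sizes are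
 known, because \<open>ln y\<close> is of the size of a value of the level \<open>j\<close>, or of such a value times \<open>ln x\<close>.  The
 recursion yields the sizes (\<open>classes_below\<close>) at the cost of two exponentials, and the values
 themselves (\<open>exact_below\<close>) with one more, since a sum below a given one has only boundedly many
 components of the largest size (\<open>sz_sums\<close>).  The same arguments relative to a scale restore the
 induction hypothesis (\<open>classes_at\<close>, \<open>next_Good\<close>).

 Exponents in \<open>Hset k\<close> mean order types below \<open>\<omega>\<^bsub>k+1\<^esub>\<close>.  So below \<open>tower2 n (x\<^sup>m)\<close> the order
 types are less than \<open>\<omega>\<^bsub>2n+2\<^esub>\<close> for the germs and \<open>\<omega>\<^bsub>2n+1\<^esub>\<close> for the classes, and
 \<open>2n + 2 <= tower_index n\<close>.\<close>

section \<open>Well-quasi-orders\<close>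

definition wqo_on :: "('a => 'a => bool) => 'a set => bool" where
 "wqo_on P A \<longleftrightarrow> (\<forall>s :: nat => 'a. range s \<subseteq> A \<longrightarrow> (\<exists>i j. i < j \<and> P (s i) (s j)))"

lemma wqo_onD:
 assumes "wqo_on P A" "!!i :: nat. s i \<in> A"
 obtains i j where "i < j" "P (s i) (s j)"
 using assms unfolding wqo_on_def by (metis image_subsetI)

lemma wqo_on_subset: "wqo_on P A ==> B \<subseteq> A ==> wqo_on P B"
 unfolding wqo_on_def by blast

lemma wqo_on_image:
 assumes "wqo_on P A" "!!x y. x \<in> A ==> y \<in> A ==> P x y ==> Q (f x) (f y)"
 shows "wqo_on Q (f ` A)"
 unfolding wqo_on_def
proof (intro allI impI)
 fix s :: "nat => 'b" assume "range s \<subseteq> f ` A"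
 then have "\<forall>i. \<exists>a. a \<in> A \<and> s i = f a" by blast
 then obtain t where t: "!!i. t i \<in> A" "!!i. s i = f (t i)" by metis
 obtain i j where "i < j" "P (t i) (t j)" using wqo_onD[of P A t] assms(1) t(1) by blast
 then show "\<exists>i j. i < j \<and> Q (s i) (s j)" using t assms(2) by metis
qed

lemma wqo_on_finite:
 assumes "finite A" "!!x. x \<in> A ==> P x x"
 shows "wqo_on P A"
 unfolding wqo_on_def
proof (intro allI impI)
 fix s :: "nat => 'a" assume s: "range s \<subseteq> A"
 then have "\<not> inj s" using assms(1) finite_imageD infinite_UNIV_nat finite_subset by metis
 then obtain i j where "i \<noteq> j" "s i = s j" unfolding inj_def by blast
 then show "\<exists>i j. i < j \<and> P (s i) (s j)"
  using s assms(2) by (metis linorder_neqE_nat rangeI subsetD)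
qed

text \<open>By Ramsey's theorem: an infinite set of indices without a good pair would give a bad
 sequence.\<close>

lemma wqo_on_homogeneous:
 assumes "wqo_on P A" "!!i :: nat. s i \<in> A" "infinite (I :: nat set)"
 obtains J where "J \<subseteq> I" "infinite J" "!!i j. i \<in> J ==> j \<in> J ==> i < j ==> P (s i) (s j)"
proof -
 define f where "f X = (if P (s (Min X)) (s (Max X)) then 0 else 1 :: nat)" for X
 have "\<forall>x\<in>I. \<forall>y\<in>I. x \<noteq> y \<longrightarrow> f {x, y} < 2" by (simp add: f_def)
 from Ramsey2[OF assms(3) this] obtain J t where J: "J \<subseteq> I" "infinite J"
  and t: "\<forall>x\<in>J. \<forall>y\<in>J. x \<noteq> y \<longrightarrow> f {x, y} = t" by auto
 have eq: "(f {i, j} = 0) \<longleftrightarrow> P (s i) (s j)" if "i < j" for i j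
  using that by (simp add: f_def min_def max_def)
 obtain i j where "i < j" "P (s (enumerate J i)) (s (enumerate J j))"
  using wqo_onD[OF assms(1), of "s \<circ> enumerate J"] assms(2) by auto
 moreover have "enumerate J i \<in> J" "enumerate J j \<in> J" using J(2) enumerate_in_set by auto
 moreover have "enumerate J i < enumerate J j" using \<open>i < j\<close> J(2) by (simp add: enumerate_mono)
 ultimately have "t = 0" using t eq[of "enumerate J i" "enumerate J j"] by auto
 then have "P (s i) (s j)" if "i \<in> J" "j \<in> J" "i < j" for i j
  using that t eq[of i j] by auto
 then show thesis using J that by blast
qed

lemma wqo_on_pair:
 assumes "wqo_on P A" "wqo_on Q B" "!!i :: nat. s i \<in> A" "!!i :: nat. t i \<in> B"
 obtains i j where "i < j" "P (s i) (s j)" "Q (t i) (t j)"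
proof -
 obtain J where J: "infinite J" "!!i j. i \<in> J ==> j \<in> J ==> i < j ==> P (s i) (s j)"
  by (rule wqo_on_homogeneous[where s = s, OF assms(1,3) infinite_UNIV_nat]) blast
 obtain K where K: "K \<subseteq> J" "infinite K" "!!i j. i \<in> K ==> j \<in> K ==> i < j ==> Q (t i) (t j)"
  by (rule wqo_on_homogeneous[where s = t, OF assms(2,4) J(1)]) blast
 obtain i where "i \<in> K" using K(2) by fastforce
 obtain j where "j \<in> K" "i < j" using K(2) by (meson infinite_nat_iff_unbounded)
 then show thesis using that J(2) K \<open>i \<in> K\<close> by blast
qed

lemma wqo_on_prod:
 assumes "wqo_on P A" "wqo_on Q B"
 shows "wqo_on (rel_prod P Q) (A \<times> B)"
 unfolding wqo_on_def
proof (intro allI impI)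
 fix s :: "nat => 'a \<times> 'b" assume s: "range s \<subseteq> A \<times> B"
 then have "s i \<in> A \<times> B" for i by blast
 then have "fst (s i) \<in> A" "snd (s i) \<in> B" for i by (simp_all add: mem_Times_iff)
 then obtain i j where "i < j" "P (fst (s i)) (fst (s j))" "Q (snd (s i)) (snd (s j))"
  using wqo_on_pair[OF assms, of "\<lambda>i. fst (s i)" "\<lambda>i. snd (s i)"] by blast
 then show "\<exists>i j. i < j \<and> rel_prod P Q (s i) (s j)" by (auto simp: rel_prod_sel)
qed

lemma wqo_on_Un:
 assumes "wqo_on P A" "wqo_on P B"
 shows "wqo_on P (A \<union> B)"
 unfolding wqo_on_def
proof (intro allI impI)
 fix s :: "nat => 'a" assume s: "range s \<subseteq> A \<union> B"
 have "infinite {i. s i \<in> A} \<or> infinite {i. s i \<in> B}"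
 proof -
  have "UNIV = {i. s i \<in> A} \<union> {i. s i \<in> B}" using s by blast
  then show ?thesis by (metis finite_Un infinite_UNIV_nat)
 qed
 moreover have "\<exists>i j. i < j \<and> P (s i) (s j)" if wC: "wqo_on P C" and inf: "infinite {i. s i \<in> C}" for C
 proof -
  let ?e = "enumerate {i. s i \<in> C}"
  have "!!i. s (?e i) \<in> C" using enumerate_in_set[OF inf] by auto
  then obtain i j where "i < j" "P (s (?e i)) (s (?e j))"
   by (rule wqo_onD[where s = "\<lambda>i. s (?e i)", OF wC])
  then show ?thesis using enumerate_mono[OF \<open>i < j\<close> inf] by (intro exI conjI)
 qed
 ultimately show "\<exists>i j. i < j \<and> P (s i) (s j)" using assms by blast
qed

text \<open>Without a finite basis, elements above none of their predecessors could be picked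
 forever.\<close>

lemma wqo_on_finite_basis:
 assumes "wqo_on P A"
 obtains B where "finite B" "B \<subseteq> A" "!!x. x \<in> A ==> \<exists>b\<in>B. P b x"
proof (rule ccontr)
 note basis = that
 assume no: "\<not> thesis"
 define g where "g B = (SOME x. x \<in> A \<and> (\<forall>b\<in>B. \<not> P b x))" for B
 have g: "g B \<in> A \<and> (\<forall>b\<in>B. \<not> P b (g B))" if "finite B" "B \<subseteq> A" for B
 proof -
  have "\<exists>x. x \<in> A \<and> (\<forall>b\<in>B. \<not> P b x)" using no basis[OF that] by auto
  then show ?thesis unfolding g_def by (rule someI_ex)
 qed
 define F where "F = rec_nat {} (\<lambda>_ B. insert (g B) B)"
 have F_Suc: "F (Suc n) = insert (g (F n)) (F n)" for n by (simp add: F_def)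
 have F: "finite (F n) \<and> F n \<subseteq> A" for n
 proof (induct n)
  case (Suc n)
  then show ?case using g[of "F n"] F_Suc by simp
 qed (simp add: F_def)
 have mono: "F i \<subseteq> F j" if "i <= j" for i j
  using that by (induct j) (auto simp: F_Suc le_Suc_eq)
 obtain i j where "i < j" "P (g (F i)) (g (F j))"
  using wqo_onD[OF assms, of "\<lambda>n. g (F n)"] F g by auto
 moreover have "g (F i) \<in> F (Suc i)" by (simp add: F_Suc)
 moreover have "F (Suc i) \<subseteq> F j" using \<open>i < j\<close> mono by simp
 ultimately show False using g F by blast
qed

definition bad :: "('a => 'a => bool) => (nat => 'a) => bool" where
 "bad P s \<longleftrightarrow> (\<forall>i j. i < j \<longrightarrow> \<not> P (s i) (s j))"

text \<open>The minimal bad sequence argument of Nash-Williams: among the bad sequences choose one whose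
 entries are, one after the other, as small as possible.  A bad sequence of parts of its entries
 could be spliced into it and would give a smaller one.\<close>

lemma minimal_bad_sequence:
 fixes \<mu> :: "'a => nat"
 assumes "\<not> wqo_on P A"
  and part_less: "!!y x. part y x ==> \<mu> y < \<mu> x"
  and part_A: "!!y x. part y x ==> x \<in> A ==> y \<in> A"
  and part_P: "!!a y x. part y x ==> P a y ==> P a x"
 obtains m where "bad P m" "range m \<subseteq> A" "wqo_on P {y. \<exists>i. part y (m i)}"
proof -
 define C where "C s \<longleftrightarrow> bad P s \<and> range s \<subseteq> A" for s
 define R where "R n s t \<longleftrightarrow> C t \<and> (\<forall>i<n. t i = s i) \<and>
  (\<forall>u. C u \<and> (\<forall>i<n. u i = s i) \<longrightarrow> \<mu> (t n) <= \<mu> (u n))" for n and s t :: "nat => 'a"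
 have step: "\<exists>t. R n s t" if "C s" for n s
 proof -
  let ?Q = "\<lambda>k. \<exists>u. C u \<and> (\<forall>i<n. u i = s i) \<and> \<mu> (u n) = k"
  have "?Q (\<mu> (s n))" using that by auto
  then have "?Q (Least ?Q)" by (rule LeastI)
  then obtain t where t: "C t" "\<forall>i<n. t i = s i" "\<mu> (t n) = Least ?Q" by blast
  have "\<mu> (t n) <= \<mu> (u n)" if "C u" "\<forall>i<n. u i = s i" for u
   unfolding t(3) using that by (intro Least_le) auto
  then show ?thesis using t unfolding R_def by blast
 qed
 obtain s0 where s0: "C s0" using assms(1) unfolding wqo_on_def C_def bad_def by blast
 define g where "g n s = (SOME t. R n s t)" for n s
 have g: "R n s (g n s)" if "C s" for n s
  unfolding g_def using step[OF that] by (rule someI_ex)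
 define S where "S = rec_nat s0 g"
 have CS: "C (S n)" for n
  by (induct n) (use s0 g in \<open>auto simp: S_def R_def\<close>)
 have RS: "R n (S n) (S (Suc n))" for n
  using g[OF CS] by (simp add: S_def)
 have agree: "S n' i = S n i" if "i < n" "n <= n'" for i n n'
  using that(2) by (induct n' rule: dec_induct) (use RS that(1) in \<open>auto simp: R_def\<close>)
 define m where "m n = S (Suc n) n" for n
 have m_S: "m i = S n i" if "i < n" for i n
  unfolding m_def using agree[of i "Suc i" n] that by simp
 have badm: "bad P m"
  unfolding bad_def
 proof (intro allI impI)
  fix i j :: nat assume "i < j"
  then have "m i = S (Suc j) i" "m j = S (Suc j) j" using m_S[of i "Suc j"] m_S[of j "Suc j"] by simp_all
  then show "\<not> P (m i) (m j)" using CS[of "Suc j"] \<open>i < j\<close> unfolding C_def bad_def by auto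
 qed
 have mA: "range m \<subseteq> A" unfolding m_def using CS unfolding C_def by auto
 have min: "\<mu> (m n) <= \<mu> (u n)" if "C u" "\<forall>i<n. u i = m i" for u n
  using RS[of n] that m_S unfolding R_def m_def by metis
 have "wqo_on P {y. \<exists>i. part y (m i)}"
 proof (rule ccontr)
  assume "\<not> ?thesis"
  then obtain s :: "nat => 'a" where "range s \<subseteq> {y. \<exists>i. part y (m i)}" "\<not> (\<exists>i j. i < j \<and> P (s i) (s j))"
   unfolding wqo_on_def by auto
  then have s: "!!k. \<exists>i. part (s k) (m i)" "bad P s" unfolding bad_def by auto
  then obtain f where f: "!!k. part (s k) (m (f k))" by metis
  obtain k0 where k0: "!!k. f k0 <= f k"
   by (metis ex_has_least_nat[of "\<lambda>_. True" _ f])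
  define u where "u i = (if i < f k0 then m i else s (k0 + (i - f k0)))" for i
  have "\<not> P (u i) (u j)" if "i < j" for i j
  proof -
   consider "j < f k0" | "i < f k0" "f k0 <= j" | "f k0 <= i" using that by linarith
   then show ?thesis
   proof cases
    case 1
    then show ?thesis using that badm by (simp add: u_def bad_def)
   next
    case 2
    let ?k = "k0 + (j - f k0)"
    have "i < f ?k" using 2(1) k0[of ?k] by simp
    then have "\<not> P (m i) (s ?k)" using badm f[of ?k] part_P unfolding bad_def by blast
    then show ?thesis using 2 by (simp add: u_def)
   next
    case 3
    then show ?thesis using that s(2) by (simp add: u_def bad_def)
   qed
  qed
  moreover have "s k \<in> A" for k using f part_A mA by blast
  ultimately have "C u" using mA unfolding C_def bad_def u_def by auto
  moreover have "\<forall>i<f k0. u i = m i" by (simp add: u_def)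
  ultimately have "\<mu> (m (f k0)) <= \<mu> (s k0)" using min[of u "f k0"] by (simp add: u_def)
  then show False using part_less[OF f[of k0]] by simp
 qed
 then show thesis using that badm mA by blast
qed

text \<open>Higman's lemma: head and tail of the entries of a minimal bad sequence of lists are
 well-quasi-ordered, so that some entry would embed in a later one.\<close>

lemma wqo_on_lists:
 assumes "wqo_on P A"
 shows "wqo_on (list_emb P) (lists A)"
proof (rule ccontr)
 assume "\<not> ?thesis"
 then obtain m where bad: "bad (list_emb P) m" and mA: "range m \<subseteq> lists A"
  and tails: "wqo_on (list_emb P) {y. \<exists>i. \<exists>a. m i = a # y}"
  by (rule minimal_bad_sequence[where part = "\<lambda>y x. \<exists>a. x = a # y" and \<mu> = length])
    (use that in auto)
 have ne: "m i \<noteq> []" for i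
 proof
  assume "m i = []"
  then show False using bad unfolding bad_def by (metis lessI list_emb_Nil)
 qed
 then have eq: "m i = hd (m i) # tl (m i)" for i by simp
 have hdA: "hd (m i) \<in> A" for i
  using mA ne[of i] by (metis in_listsD list.set_sel(1) rangeI subsetD)
 have "tl (m i) \<in> {y. \<exists>i. \<exists>a. m i = a # y}" for i using eq[of i] by blast
 then obtain i j where "i < j" "P (hd (m i)) (hd (m j))" "list_emb P (tl (m i)) (tl (m j))"
  using wqo_on_pair[OF assms tails, of "hd \<circ> m" "tl \<circ> m"] hdA by auto
 then have "list_emb P (m i) (m j)" by (metis eq list_emb_Cons2)
 then show False using bad \<open>i < j\<close> unfolding bad_def by blast
qed

text \<open>Dickson's lemma, from Higman's by forgetting the order of the letters.\<close>

lemma wqo_on_multisets: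
 assumes "finite S"
 shows "wqo_on (\<subseteq>#) {M. set_mset M \<subseteq> S}"
proof -
 have "wqo_on (list_emb (=)) (lists S)" using assms by (intro wqo_on_lists wqo_on_finite) auto
 moreover have "mset xs \<subseteq># mset ys" if "list_emb (=) xs ys" for xs ys :: "'a list"
  using that by (induct rule: list_emb.induct) (auto intro: subset_mset.order_trans)
 ultimately have "wqo_on (\<subseteq>#) (mset ` lists S)" by (rule wqo_on_image)
 moreover have "{M. set_mset M \<subseteq> S} \<subseteq> mset ` lists S"
 proof
  fix M assume "M \<in> {M. set_mset M \<subseteq> S}"
  moreover obtain xs where "mset xs = M" using ex_mset by blast
  ultimately show "M \<in> mset ` lists S" by force
 qed
 ultimately show ?thesis using wqo_on_subset by blast
qed

section \<open>Ordinals below epsilon zero as hereditary multisets\<close>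

declare omega_tower.simps(2) [simp del]

lemma relation_of_iff: "(x, y) \<in> relation_of P A \<longleftrightarrow> x \<in> A \<and> y \<in> A \<and> P x y"
 by (auto simp: relation_of_def)

lemma Field_relation_of: "(!!x. x \<in> A ==> P x x) ==> Field (relation_of P A) = A"
 by (auto simp: Field_def relation_of_def)

lemma omega_power_iff:
 "(M, N) \<in> omega_power r \<longleftrightarrow> set_mset M \<subseteq> Field r \<and> set_mset N \<subseteq> Field r \<and>
   (M = N \<or> (\<exists>x\<in>Field r. count M x < count N x \<and>
    (\<forall>y. (x, y) \<in> r \<and> y \<noteq> x \<longrightarrow> count M y = count N y)))"
 unfolding omega_power_def relation_of_iff by auto

lemma Field_omega_power: "Field (omega_power r) = {M. set_mset M \<subseteq> Field r}"
 unfolding omega_power_def by (rule Field_relation_of) simp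

lemma linear_orderD:
 assumes "Linear_order r"
 shows "x \<in> Field r ==> (x, x) \<in> r"
  and "(x, y) \<in> r ==> (y, z) \<in> r ==> (x, z) \<in> r"
  and "(x, y) \<in> r ==> (y, x) \<in> r ==> x = y"
  and "x \<in> Field r ==> y \<in> Field r ==> (x, y) \<in> r \<or> (y, x) \<in> r"
proof -
 have r: "refl_on (Field r) r" "trans r" "antisym r" "total_on (Field r) r"
  using assms by (auto simp: order_on_defs)
 show "x \<in> Field r ==> (x, x) \<in> r" using r(1) by (rule refl_onD)
 then show "(x, y) \<in> r \<or> (y, x) \<in> r" if "x \<in> Field r" "y \<in> Field r"
  using r(4) that unfolding total_on_def by (cases "x = y") auto
 show "(x, y) \<in> r ==> (y, z) \<in> r ==> (x, z) \<in> r" using r(2) by (rule transD)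
 show "(x, y) \<in> r ==> (y, x) \<in> r ==> x = y" using r(3) by (rule antisymD)
qed

lemma Linear_order_omega_power:
 assumes r: "Linear_order r"
 shows "Linear_order (omega_power r)"
proof -
 note lin = linear_orderD[OF r]
 define less where "less M N \<longleftrightarrow> (\<exists>x\<in>Field r. count M x < count N x \<and>
    (\<forall>y. (x, y) \<in> r \<and> y \<noteq> x \<longrightarrow> count M y = count N y))" for M N
 have le: "(M, N) \<in> omega_power r \<longleftrightarrow>
   set_mset M \<subseteq> Field r \<and> set_mset N \<subseteq> Field r \<and> (M = N \<or> less M N)" for M N
  unfolding omega_power_iff less_def ..
 have tr: "less M P" if MN: "less M N" and NP: "less N P" for M N P
 proof -
  obtain x where x: "x \<in> Field r" "count M x < count N x"
    "!!y. (x, y) \<in> r ==> y \<noteq> x ==> count M y = count N y"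
   using MN unfolding less_def by auto
  obtain z where z: "z \<in> Field r" "count N z < count P z"
    "!!y. (z, y) \<in> r ==> y \<noteq> z ==> count N y = count P y"
   using NP unfolding less_def by auto
  consider "x = z" | "(x, z) \<in> r" "x \<noteq> z" | "(z, x) \<in> r" "x \<noteq> z" using lin(4) x(1) z(1) by blast
  then show ?thesis
  proof cases
   case 1
   then show ?thesis unfolding less_def using x z by (intro bexI[of _ x]) auto
  next
   case 2
   have "count M y = count P y" if "(z, y) \<in> r" "y \<noteq> z" for y
    using x(3)[of y] z(3)[OF that] lin(2)[OF 2(1) that(1)] lin(3)[OF 2(1)] that 2 by auto
   then show ?thesis unfolding less_def using x(3)[of z] z 2 by (intro bexI[of _ z]) auto
  next
   case 3
   have "count M y = count P y" if "(x, y) \<in> r" "y \<noteq> x" for y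
    using z(3)[of y] x(3)[OF that] lin(2)[OF 3(1) that(1)] lin(3)[OF 3(1)] that 3 by auto
   then show ?thesis unfolding less_def using z(3)[of x] x 3 by (intro bexI[of _ x]) auto
  qed
 qed
 have irr: "\<not> less M M" for M unfolding less_def by auto
 have tot: "less M N \<or> less N M"
  if MN: "set_mset M \<subseteq> Field r" "set_mset N \<subseteq> Field r" "M \<noteq> N" for M N
 proof -
  let ?D = "{x \<in> set_mset M \<union> set_mset N. count M x \<noteq> count N x}"
  have "?D \<noteq> {}"
  proof
   assume "?D = {}"
   then have "count M x = count N x" for x
    by (cases "x \<in># M \<or> x \<in># N") (blast, simp add: not_in_iff)
   then show False using MN(3) multiset_eqI by blast
  qed
  moreover have "Relation.asymp_on ?D (\<lambda>x y. (x, y) \<in> r \<and> x \<noteq> y)"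
   using lin(3) by (auto simp: Relation.asymp_on_def)
  moreover have "transp_on ?D (\<lambda>x y. (x, y) \<in> r \<and> x \<noteq> y)"
   using lin(2,3) unfolding transp_on_def by blast
  ultimately obtain m where m: "m \<in> ?D" "!!x. x \<in> ?D ==> x \<noteq> m ==> \<not> ((m, x) \<in> r \<and> m \<noteq> x)"
   using Finite_Set.bex_max_element[of ?D "\<lambda>x y. (x, y) \<in> r \<and> x \<noteq> y"] by auto
  have "count M y = count N y" if "(m, y) \<in> r" "y \<noteq> m" for y
   using m(2)[of y] that by (cases "y \<in># M \<or> y \<in># N") (auto simp: not_in_iff)
  moreover have "m \<in> Field r" using m(1) MN by auto
  moreover have "count M m < count N m \<or> count N m < count M m" using m(1) by auto
  ultimately show ?thesis unfolding less_def by metis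
 qed
 show ?thesis
  unfolding order_on_defs refl_on_def trans_def antisym_def total_on_def Field_omega_power
  using tr irr tot by (auto simp: le)
qed

lemma Well_order_omega_power:
 assumes r: "Well_order r"
 shows "Well_order (omega_power r)"
proof -
 have lr: "Linear_order r" and wf: "wf (r - Id)" using r by (auto simp: well_order_on_def)
 note lin = linear_orderD[OF lr]
 have "omega_power r - Id \<subseteq> mult (r - Id)"
 proof
  fix p assume p: "p \<in> omega_power r - Id"
  obtain M N where MN: "p = (M, N)" by force
  have fM: "set_mset M \<subseteq> Field r" using p MN by (auto simp: omega_power_iff)
  obtain x where x: "x \<in> Field r" "count M x < count N x"
    "!!y. (x, y) \<in> r ==> y \<noteq> x ==> count M y = count N y"
   using p MN by (auto simp: omega_power_iff)
  let ?I = "M \<inter># N"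
  have "x \<in># N - ?I" using x(2) by (simp add: in_diff_count)
  moreover have "(k, x) \<in> r - Id" if "k \<in># M - ?I" for k
  proof -
   have "count N k < count M k" using that by (auto simp: in_diff_count split: if_splits)
   then have "\<not> ((x, k) \<in> r \<and> k \<noteq> x)" "k \<noteq> x" using x by force+
   moreover have "k \<in> Field r" using fM that by (meson in_diffD subsetD)
   ultimately show ?thesis using lin(4) x(1) by blast
  qed
  ultimately have "(?I + (M - ?I), ?I + (N - ?I)) \<in> mult (r - Id)"
   by (intro one_step_implies_mult) auto
  moreover have "?I + (M - ?I) = M" "?I + (N - ?I) = N" by (auto simp: multiset_eq_iff min_def)
  ultimately show "p \<in> mult (r - Id)" using MN by metis
 qed
 then have "wf (omega_power r - Id)" using wf_mult[OF wf] wf_subset by blast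
 then show ?thesis using Linear_order_omega_power[OF lr] by (simp add: well_order_on_def)
qed

text \<open>\<open>Hset k\<close> consists of the ordinals below \<open>\<omega>\<^bsub>k\<^esub>\<close> in Cantor normal form. The towers are
 nested, so that one linear order on hereditary multisets serves all of them.\<close>

abbreviation Hset :: "nat => hmset set" where "Hset k \<equiv> Field (omega_tower k)"

lemma Hset_0: "Hset 0 = {HMSet {#}}"
 by (auto simp: Field_def)

lemma Hset_Suc: "HMSet M \<in> Hset (Suc k) \<longleftrightarrow> set_mset M \<subseteq> Hset k"
 by (auto simp: dir_image_Field Field_omega_power omega_tower.simps(2))

lemma omega_tower_Suc_iff:
 "(HMSet M, HMSet N) \<in> omega_tower (Suc k) \<longleftrightarrow> (M, N) \<in> omega_power (omega_tower k)"
 by (auto simp: dir_image_def omega_tower.simps(2))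

lemma Well_order_omega_tower: "Well_order (omega_tower k)"
proof (induct k)
 case 0
 show ?case
  by (auto simp: well_order_on_def order_on_defs refl_on_def trans_def antisym_def total_on_def
    Field_def)
next
 case (Suc k)
 then show ?case
  by (auto intro!: Well_order_dir_image Well_order_omega_power simp: inj_on_def omega_tower.simps(2))
qed

lemma Linear_order_omega_tower: "Linear_order (omega_tower k)"
 using Well_order_omega_tower[of k] by (simp add: well_order_on_def)

lemmas omega_tower_lin = linear_orderD[OF Linear_order_omega_tower]

lemma omega_tower_coherent:
 "Hset k \<subseteq> Hset (Suc k) \<and>
  (\<forall>a\<in>Hset k. \<forall>b\<in>Hset k. (a, b) \<in> omega_tower k \<longleftrightarrow> (a, b) \<in> omega_tower (Suc k))"
proof (induct k)
 case 0
 show ?case by (auto simp: Hset_0 Hset_Suc omega_tower_Suc_iff omega_power_iff)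
next
 case (Suc k)
 have sub: "Hset k \<subseteq> Hset (Suc k)"
  and eq: "!!a b. a \<in> Hset k ==> b \<in> Hset k ==>
   (a, b) \<in> omega_tower k \<longleftrightarrow> (a, b) \<in> omega_tower (Suc k)" using Suc by auto
 have "Hset (Suc k) \<subseteq> Hset (Suc (Suc k))"
 proof
  fix a assume "a \<in> Hset (Suc k)"
  then show "a \<in> Hset (Suc (Suc k))" using sub by (cases a) (auto simp only: Hset_Suc)
 qed
 moreover have "(a, b) \<in> omega_tower (Suc k) \<longleftrightarrow> (a, b) \<in> omega_tower (Suc (Suc k))"
  if ab: "a \<in> Hset (Suc k)" "b \<in> Hset (Suc k)" for a b
 proof -
  obtain M N where MN: "a = HMSet M" "b = HMSet N" by (cases a, cases b) auto
  have M: "set_mset M \<subseteq> Hset k" and N: "set_mset N \<subseteq> Hset k" using ab MN Hset_Suc by auto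
  have cut: "count M y = count N y" if "y \<notin> Hset k" for y
   using M N that by (metis count_eq_zero_iff subsetD)
  have "(\<exists>x\<in>Hset k. count M x < count N x \<and>
      (\<forall>y. (x, y) \<in> omega_tower k \<and> y \<noteq> x \<longrightarrow> count M y = count N y)) \<longleftrightarrow>
     (\<exists>x\<in>Hset (Suc k). count M x < count N x \<and>
      (\<forall>y. (x, y) \<in> omega_tower (Suc k) \<and> y \<noteq> x \<longrightarrow> count M y = count N y))"
   (is "?L \<longleftrightarrow> ?R")
  proof
   assume ?L
   then obtain x where x: "x \<in> Hset k" "count M x < count N x"
    "!!y. (x, y) \<in> omega_tower k ==> y \<noteq> x ==> count M y = count N y" by auto
   have "count M y = count N y" if "(x, y) \<in> omega_tower (Suc k)" "y \<noteq> x" for y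
    using x eq[OF x(1)] that cut by (cases "y \<in> Hset k") auto
   then show ?R using x sub by auto
  next
   assume ?R
   then obtain x where x: "count M x < count N x"
    "!!y. (x, y) \<in> omega_tower (Suc k) ==> y \<noteq> x ==> count M y = count N y" by auto
   have xk: "x \<in> Hset k" using cut[of x] x by force
   have "count M y = count N y" if "(x, y) \<in> omega_tower k" "y \<noteq> x" for y
    using x(2)[of y] eq[OF xk, of y] that by (auto simp: Field_def)
   then show ?L using x xk by auto
  qed
  then show ?thesis using M N sub
   unfolding MN omega_tower_Suc_iff omega_power_iff by (meson subset_trans)
 qed
 ultimately show ?case by blast
qed

lemma Hset_mono: "j <= k ==> Hset j \<subseteq> Hset k"
 by (induct k rule: dec_induct) (use omega_tower_coherent in blast)+

lemma omega_tower_mono: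
 assumes "j <= k" "a \<in> Hset j" "b \<in> Hset j"
 shows "(a, b) \<in> omega_tower j \<longleftrightarrow> (a, b) \<in> omega_tower k"
 using assms(1)
proof (induct k rule: dec_induct)
 case (step k)
 then show ?case using omega_tower_coherent[of k] Hset_mono[OF step(1)] assms(2,3) by blast
qed simp

lemma Hset_exhaust: "\<exists>k. h \<in> Hset k"
proof (induct h)
 case (HMSet M)
 then obtain f where f: "!!x. x \<in># M ==> x \<in> Hset (f x)" by metis
 have "x \<in> Hset (\<Sum>y\<in>set_mset M. f y)" if "x \<in># M" for x
  using f[OF that] Hset_mono[of "f x" "\<Sum>y\<in>set_mset M. f y"] member_le_sum[of x "set_mset M" f] that
  by auto
 then show ?case using Hset_Suc by blast
qed

instantiation hmset :: linorder
begin

definition less_eq_hmset :: "hmset => hmset => bool" where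
 "less_eq_hmset a b \<longleftrightarrow> (\<exists>k. (a, b) \<in> omega_tower k)"

definition less_hmset :: "hmset => hmset => bool" where
 "less_hmset a b \<longleftrightarrow> a <= b \<and> \<not> b <= (a :: hmset)"

lemma less_eq_hmset_iff:
 assumes "a \<in> Hset k" "b \<in> Hset k"
 shows "a <= b \<longleftrightarrow> (a, b) \<in> omega_tower k"
proof
 assume "a <= b"
 then obtain j where j: "(a, b) \<in> omega_tower j" unfolding less_eq_hmset_def by blast
 then have "a \<in> Hset j" "b \<in> Hset j" by (auto simp: Field_def)
 then have "(a, b) \<in> omega_tower (max j k)" using j omega_tower_mono[of j "max j k"] by auto
 then show "(a, b) \<in> omega_tower k" using assms omega_tower_mono[of k "max j k"] by auto
qed (auto simp: less_eq_hmset_def)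

lemma Hset_common: "\<exists>k. a \<in> Hset k \<and> b \<in> Hset k \<and> c \<in> Hset k"
proof -
 obtain i j k where "a \<in> Hset i" "b \<in> Hset j" "c \<in> Hset k" using Hset_exhaust by metis
 then have "a \<in> Hset (i + j + k)" "b \<in> Hset (i + j + k)" "c \<in> Hset (i + j + k)"
  using Hset_mono[of i "i + j + k"] Hset_mono[of j "i + j + k"] Hset_mono[of k "i + j + k"] by auto
 then show ?thesis by blast
qed

instance
proof
 fix a b c :: hmset
 obtain k where k: "a \<in> Hset k" "b \<in> Hset k" "c \<in> Hset k" using Hset_common by blast
 note iff = less_eq_hmset_iff[of _ k]
 show "a < b \<longleftrightarrow> a <= b \<and> \<not> b <= a" by (simp add: less_hmset_def)
 show "a <= a" using iff[OF k(1) k(1)] omega_tower_lin(1)[OF k(1)] by simp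
 show "a <= b ==> b <= c ==> a <= c"
  using iff[OF k(1) k(2)] iff[OF k(2) k(3)] iff[OF k(1) k(3)] omega_tower_lin(2)[of a b k c] by simp
 show "a <= b ==> b <= a ==> a = b"
  using iff[OF k(1) k(2)] iff[OF k(2) k(1)] omega_tower_lin(3)[of a b k] by simp
 show "a <= b \<or> b <= a"
  using iff[OF k(1) k(2)] iff[OF k(2) k(1)] omega_tower_lin(4)[of a k b] k by simp
qed

end

text \<open>Cantor normal forms are compared at the largest exponent at which they differ. The union
 of multisets is therefore the natural (Hessenberg) sum, which is strictly monotone in both
 arguments.\<close>

lemma HMSet_less_iff:
 "HMSet M < HMSet N \<longleftrightarrow> (\<exists>x. count M x < count N x \<and> (\<forall>y>x. count M y = count N y))"
proof -
 obtain k where "HMSet M \<in> Hset k" "HMSet N \<in> Hset k" using Hset_common by metis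
 then have k: "set_mset M \<subseteq> Hset k" "set_mset N \<subseteq> Hset k"
  "HMSet M \<in> Hset (Suc k)" "HMSet N \<in> Hset (Suc k)"
  using Hset_mono[of k "Suc k"] Hset_Suc by auto
 have cut: "count M y = count N y" if "y \<notin> Hset k" for y
  using k(1,2) that by (metis count_eq_zero_iff subsetD)
 have "HMSet M < HMSet N \<longleftrightarrow> M \<noteq> N \<and> (M, N) \<in> omega_power (omega_tower k)"
  using less_eq_hmset_iff[OF k(3,4)] omega_tower_Suc_iff by (auto simp: less_le)
 also have "\<dots> \<longleftrightarrow> (\<exists>x\<in>Hset k. count M x < count N x \<and>
    (\<forall>y. (x, y) \<in> omega_tower k \<and> y \<noteq> x \<longrightarrow> count M y = count N y))"
  using k(1,2) by (auto simp: omega_power_iff)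
 also have "\<dots> \<longleftrightarrow> (\<exists>x. count M x < count N x \<and> (\<forall>y>x. count M y = count N y))"
 proof (intro iffI; elim bexE exE conjE)
  fix x assume x: "x \<in> Hset k" "count M x < count N x"
   "\<forall>y. (x, y) \<in> omega_tower k \<and> y \<noteq> x \<longrightarrow> count M y = count N y"
  have "count M y = count N y" if "y > x" for y
   using x cut that less_eq_hmset_iff[OF x(1), of y] by (cases "y \<in> Hset k") auto
  then show "\<exists>x. count M x < count N x \<and> (\<forall>y>x. count M y = count N y)" using x(2) by blast
 next
  fix x assume x: "count M x < count N x" "\<forall>y>x. count M y = count N y"
  have xk: "x \<in> Hset k" using cut[of x] x by force
  have "count M y = count N y" if "(x, y) \<in> omega_tower k" "y \<noteq> x" for y
   using x(2) that less_eq_hmset_def by (metis order_le_less)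
  then show "\<exists>x\<in>Hset k. count M x < count N x \<and>
    (\<forall>y. (x, y) \<in> omega_tower k \<and> y \<noteq> x \<longrightarrow> count M y = count N y)" using x xk by blast
 qed
 finally show ?thesis .
qed

lemma Hset_downward: "a <= b ==> b \<in> Hset k ==> a \<in> Hset k"
proof (induct k arbitrary: a b)
 case 0
 obtain M where M: "a = HMSet M" by (cases a)
 have "\<not> HMSet M < HMSet {#}" by (simp add: HMSet_less_iff)
 then show ?case using 0 M by (auto simp: Hset_0 less_le)
next
 case (Suc k)
 obtain M N where MN: "a = HMSet M" "b = HMSet N" by (cases a, cases b) auto
 show ?case
 proof (cases "a = b")
  case False
  then have "HMSet M < HMSet N" using Suc.prems(1) MN by (metis order_le_less)
  then obtain x where x: "count M x < count N x" "!!y. y > x ==> count M y = count N y"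
   unfolding HMSet_less_iff by blast
  have N: "set_mset N \<subseteq> Hset k" using Suc.prems MN Hset_Suc by auto
  have xk: "x \<in> Hset k" using x(1) N by (metis count_eq_zero_iff not_less_zero subsetD)
  have "y \<in> Hset k" if "y \<in># M" for y
  proof (cases "y > x")
   case True
   then have "y \<in># N" using x(2) that by (metis count_greater_zero_iff)
   then show ?thesis using N by auto
  next
   case False
   then show ?thesis using Suc.hyps[of y x] xk by simp
  qed
  then show ?thesis using MN Hset_Suc by blast
 qed (use Suc.prems in simp)
qed

instance hmset :: wellorder
proof
 fix P :: "hmset => bool" and a
 assume step: "!!x. (!!y. y < x ==> P y) ==> P x"
 obtain k where k: "a \<in> Hset k" using Hset_exhaust by blast
 have "wf (omega_tower k - Id)" using Well_order_omega_tower[of k] by (simp add: well_order_on_def)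
 then have "x \<in> Hset k \<longrightarrow> P x" for x
 proof (induct x rule: wf_induct_rule)
  case (less x)
  show ?case
  proof
   assume x: "x \<in> Hset k"
   show "P x"
   proof (rule step)
    fix y assume "y < x"
    then have "y \<in> Hset k" "(y, x) \<in> omega_tower k - Id"
     using Hset_downward[of y x k] x less_eq_hmset_iff[of y k x] by auto
    then show "P y" using less by blast
   qed
  qed
 qed
 then show "P a" using k by blast
qed

instantiation hmset :: "{comm_monoid_add, linordered_cancel_ab_semigroup_add}"
begin

fun hmset_elems :: "hmset => hmset multiset" where "hmset_elems (HMSet M) = M"

definition zero_hmset :: hmset where "zero_hmset = HMSet {#}"

definition plus_hmset :: "hmset => hmset => hmset" where
 "plus_hmset a b = HMSet (hmset_elems a + hmset_elems b)"

definition minus_hmset :: "hmset => hmset => hmset" where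
 "minus_hmset a b = HMSet (hmset_elems a - hmset_elems b)"

lemma HMSet_elems: "HMSet (hmset_elems a) = a" by (cases a) simp

instance
proof
 fix a b c :: hmset
 show "a + b + c = a + (b + c)" "a + b = b + a" "a + b - a = b" "a - b - c = a - (b + c)"
  "0 + a = a"
  by (simp_all add: plus_hmset_def minus_hmset_def zero_hmset_def HMSet_elems ac_simps)
 assume "a <= b"
 show "c + a <= c + b"
 proof (cases "a = b")
  case False
  then have "HMSet (hmset_elems a) < HMSet (hmset_elems b)" using \<open>a <= b\<close> by (simp add: HMSet_elems)
  then have "c + a < c + b" unfolding plus_hmset_def HMSet_less_iff by auto
  then show ?thesis by simp
 qed simp
qed

end

lemma HMSet_plus: "HMSet M + HMSet N = HMSet (M + N)"
 by (simp add: plus_hmset_def)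

lemma hmset_ge_0 [simp]: "0 <= (a :: hmset)"
proof -
 have "\<not> a < 0" unfolding zero_hmset_def by (cases a) (simp add: HMSet_less_iff)
 then show ?thesis by simp
qed

lemma hmset_le_add: "a <= a + (b :: hmset)" "b <= a + (b :: hmset)"
 using add_left_mono[of 0 b a] add_right_mono[of 0 a b] by auto

lemma Hset_add: "a \<in> Hset k ==> b \<in> Hset k ==> a + b \<in> Hset k"
proof (cases k)
 case (Suc j)
 assume "a \<in> Hset k" "b \<in> Hset k"
 then show ?thesis unfolding Suc by (cases a, cases b) (simp only: HMSet_plus Hset_Suc set_mset_union, blast)
qed (simp add: Hset_0 HMSet_plus)

lemma zero_in_Hset: "0 \<in> Hset k"
 using Hset_mono[of 0 k] by (simp add: Hset_0 zero_hmset_def)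

text \<open>The ordinal \<open>\<omega>\<^sup>x\<close>.\<close>

definition om :: "hmset => hmset" where "om x = HMSet {#x#}"

lemma om_in_Hset: "x \<in> Hset k ==> om x \<in> Hset (Suc k)"
 unfolding om_def Hset_Suc by simp

lemma less_om_iff: "HMSet M < om z \<longleftrightarrow> (\<forall>x\<in>#M. x < z)"
proof
 assume "HMSet M < om z"
 then obtain x where x: "count M x < count {#z#} x" "!!y. y > x ==> count M y = count {#z#} y"
  unfolding om_def HMSet_less_iff by blast
 have "x = z" using x(1) by (simp split: if_splits)
 then have "count M z = 0" "!!y. y > z ==> count M y = 0" using x by auto
 then show "\<forall>x\<in>#M. x < z" by (metis count_eq_zero_iff linorder_cases)
next
 assume "\<forall>x\<in>#M. x < z"
 then have "count M z = 0" "!!y. y > z ==> count M y = 0"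
  using count_eq_zero_iff by fastforce+
 then show "HMSet M < om z" unfolding om_def HMSet_less_iff by (intro exI[of _ z]) auto
qed

lemma om_less_iff [simp]: "om x < om y \<longleftrightarrow> x < y"
 unfolding om_def[of x] less_om_iff by simp

lemma om_le_iff [simp]: "om x <= om y \<longleftrightarrow> x <= y"
 using om_less_iff[of y x] by (simp add: not_less[symmetric])

lemma zero_less_om [simp]: "0 < om x"
 unfolding zero_hmset_def less_om_iff by simp

text \<open>Powers of \<open>\<omega>\<close> are closed under natural sums.\<close>

lemma add_less_om: "a < om z ==> b < om z ==> a + b < om z"
 by (cases a, cases b) (auto simp: HMSet_plus less_om_iff)

definition hone :: hmset where "hone = om 0"

lemma less_add_hone: "a < a + hone"
 using add_strict_left_mono[OF zero_less_om, of a 0] by (simp add: hone_def)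

lemma hone_in_Hset: "hone \<in> Hset (Suc k)"
 unfolding hone_def by (intro om_in_Hset zero_in_Hset)

lemma Hset_strict_bound:
 assumes "finite A" "A \<subseteq> Hset (Suc k)"
 obtains z where "z \<in> Hset (Suc k)" "!!a. a \<in> A ==> a < z"
proof -
 have "\<exists>z\<in>Hset (Suc k). \<forall>a\<in>A. a < z"
  using assms
 proof (induct A)
  case empty
  then show ?case using zero_in_Hset by blast
 next
  case (insert x A)
  then obtain z where z: "z \<in> Hset (Suc k)" "\<forall>a\<in>A. a < z" by auto
  have "z + (x + hone) \<in> Hset (Suc k)" using z insert by (intro Hset_add hone_in_Hset) auto
  moreover have "a < z + (x + hone)" if "a \<in> insert x A" for a
   using that z hmset_le_add[of z "x + hone"] hmset_le_add[of "x + hone" z] less_add_hone[of x] by force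
  ultimately show ?case by blast
 qed
 then show thesis using that by blast
qed

lemma Hset_om_bound:
 assumes "finite A" "A \<subseteq> Hset (Suc (Suc k))"
 obtains z where "z \<in> Hset (Suc k)" "!!a. a \<in> A ==> a < om z"
proof -
 have "(\<Union>a\<in>A. set_mset (hmset_elems a)) \<subseteq> Hset (Suc k)"
 proof
  fix x assume "x \<in> (\<Union>a\<in>A. set_mset (hmset_elems a))"
  then obtain a where a: "a \<in> A" "x \<in># hmset_elems a" by blast
  then have "HMSet (hmset_elems a) \<in> Hset (Suc (Suc k))" using assms by (auto simp: HMSet_elems)
  then show "x \<in> Hset (Suc k)" using a by (simp only: Hset_Suc, blast)
 qed
 moreover have "finite (\<Union>a\<in>A. set_mset (hmset_elems a))" using assms by simp
 ultimately obtain z where z: "z \<in> Hset (Suc k)"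
  "!!x. x \<in> (\<Union>a\<in>A. set_mset (hmset_elems a)) ==> x < z"
  using Hset_strict_bound by blast
 have "a < om z" if "a \<in> A" for a
  using z(2) that less_om_iff[of "hmset_elems a" z] by (auto simp: HMSet_elems)
 then show thesis using that z by blast
qed

text \<open>The ordinal \<open>\<omega>\<^bsub>k\<^esub>\<close> as a bound of all members of \<open>Hset k\<close>.\<close>

fun Om :: "nat => hmset" where
 "Om 0 = om 0"
| "Om (Suc k) = om (Om k)"

lemma Om_in_Hset: "Om k \<in> Hset (Suc k)"
 by (induct k) (auto intro: om_in_Hset zero_in_Hset)

lemma less_Om: "a \<in> Hset k ==> a < Om k"
proof (induct k arbitrary: a)
 case 0
 then show ?case using zero_less_om by (simp add: Hset_0 zero_hmset_def)
next
 case (Suc k)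
 obtain M where M: "a = HMSet M" by (cases a)
 then show ?case using Suc by (auto simp only: Hset_Suc less_om_iff Om.simps)
qed

text \<open>Multiplication by \<open>\<omega>\<^sup>c\<close> leaves room for summands below \<open>\<omega>\<^sup>c\<close> between its values.\<close>

definition shift :: "hmset => hmset => hmset" where
 "shift c r = HMSet (image_mset ((+) c) (hmset_elems r))"

lemma shift_in_Hset: "c \<in> Hset k ==> r \<in> Hset (Suc k) ==> shift c r \<in> Hset (Suc k)"
 unfolding shift_def Hset_Suc
 using Hset_Suc[of "hmset_elems r" k] Hset_add by (auto simp: HMSet_elems)

lemma shift_add_less:
 assumes "r < r'" "d < om c"
 shows "shift c r + d < shift c r'"
proof -
 obtain M N D where MN: "r = HMSet M" "r' = HMSet N" "d = HMSet D" by (cases r, cases r', cases d) auto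
 obtain x where x: "count M x < count N x" "!!y. y > x ==> count M y = count N y"
  using assms(1) unfolding MN HMSet_less_iff by blast
 have D: "count D y = 0" if "y \<ge> c" for y
  using assms(2) that unfolding MN less_om_iff by (metis count_eq_zero_iff leD)
 have cnt: "count (image_mset ((+) c) K) (c + z) = count K z" for K z
  by (induct K) auto
 have out: "count (image_mset ((+) c) K) y = 0" if "!!z. y \<noteq> c + z" for K y
  using that by (auto simp: count_eq_zero_iff)
 have "count (image_mset ((+) c) M + D) (c + x) < count (image_mset ((+) c) N) (c + x)"
  using x(1) D[of "c + x"] by (simp add: cnt hmset_le_add)
 moreover have "count (image_mset ((+) c) M + D) y = count (image_mset ((+) c) N) y"
  if "y > c + x" for y
 proof -
  have "count D y = 0" using D that hmset_le_add(1)[of c x] by fastforce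
  moreover have "count (image_mset ((+) c) M) y = count (image_mset ((+) c) N) y"
  proof (cases "\<exists>z. y = c + z")
   case True
   then obtain z where "y = c + z" by blast
   then show ?thesis using x(2)[of z] that by (simp add: cnt)
  next
   case False
   then show ?thesis by (metis out)
  qed
  ultimately show ?thesis by simp
 qed
 ultimately show ?thesis
  unfolding MN shift_def HMSet_plus HMSet_less_iff by auto
qed

declare omega_tower.simps(1) [simp del]

section \<open>Order types of quasi-orders\<close>

text \<open>For a linear quasi-order \<open>sz le Z \<mu>\<close> says that the order type of \<open>Z\<close> is at most \<open>\<omega>\<^sup>\<mu>\<close>: what lies
 below a given element is a finite union of sets of smaller exponent.  For a quasi-order that
 need not be linear the elements below \<open>q\<close> are replaced by those not above \<open>q\<close>, as in de Jongh and
 Parikh's computation of maximal order types.  The point of measuring by exponents is that unions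
 cost nothing and exponents of products add up, so no ordinal products occur.\<close>

inductive sz :: "('a => 'a => bool) => 'a set => hmset => bool" for le where
 "(!!q. q \<in> Z ==> \<exists>\<Z>. finite \<Z> \<and> {p \<in> Z. \<not> le q p} \<subseteq> \<Union>\<Z> \<and> (\<forall>Z'\<in>\<Z>. \<exists>\<mu>'. \<mu>' < \<mu> \<and> sz le Z' \<mu>'))
  ==> sz le Z \<mu>"

text \<open>\<open>fsz le U Z\<close>: a finite union of sets with exponents in \<open>U\<close>. Only the set of the available
 exponents matters below, typically some \<open>Hset k\<close>, which is closed under sums.\<close>

definition fsz :: "('a => 'a => bool) => hmset set => 'a set => bool" where
 "fsz le U Z \<longleftrightarrow> (\<exists>\<Z>. finite \<Z> \<and> Z \<subseteq> \<Union>\<Z> \<and> (\<forall>Z'\<in>\<Z>. \<exists>\<mu>\<in>U. sz le Z' \<mu>))"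

lemma sz_iff: "sz le Z \<mu> \<longleftrightarrow> (\<forall>q\<in>Z. fsz le {..<\<mu>} {p \<in> Z. \<not> le q p})"
 unfolding fsz_def lessThan_iff by (subst sz.simps) (auto simp: Bex_def)

lemma fszI: "sz le Z \<mu> ==> \<mu> \<in> U ==> fsz le U Z"
 unfolding fsz_def by (intro exI[of _ "{Z}"]) auto

lemma fsz_subset: "fsz le U Z ==> Z' \<subseteq> Z ==> fsz le U Z'"
 unfolding fsz_def by (meson subset_trans)

lemma fsz_mono: "fsz le U Z ==> U \<subseteq> V ==> fsz le V Z"
 unfolding fsz_def by (meson subsetD)

lemma fsz_UN:
 assumes "finite I" "!!i. i \<in> I ==> fsz le U (Z i)"
 shows "fsz le U (\<Union>i\<in>I. Z i)"
proof -
 obtain \<Z> where \<Z>: "!!i. i \<in> I ==> finite (\<Z> i) \<and> Z i \<subseteq> \<Union>(\<Z> i) \<and> (\<forall>Z'\<in>\<Z> i. \<exists>\<mu>\<in>U. sz le Z' \<mu>)"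
  using assms(2) unfolding fsz_def by metis
 show ?thesis
  unfolding fsz_def
 proof (intro exI[of _ "\<Union>i\<in>I. \<Z> i"] conjI ballI)
  show "finite (\<Union>i\<in>I. \<Z> i)" using \<Z> assms(1) by auto
  show "(\<Union>i\<in>I. Z i) \<subseteq> \<Union>(\<Union>i\<in>I. \<Z> i)"
  proof (intro UN_least)
   fix i assume "i \<in> I"
   then show "Z i \<subseteq> \<Union>(\<Union>i\<in>I. \<Z> i)" using \<Z>[of i] by (meson UN_upper Union_mono subset_trans)
  qed
  show "\<exists>\<mu>\<in>U. sz le Z' \<mu>" if "Z' \<in> (\<Union>i\<in>I. \<Z> i)" for Z' using \<Z> that by auto
 qed
qed

lemma fsz_empty [simp]: "fsz le U {}"
 using fsz_UN[of "{}"] by simp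

lemma fsz_Un: "fsz le U Z ==> fsz le U Z' ==> fsz le U (Z \<union> Z')"
 using fsz_UN[of "{True, False}" le U "\<lambda>b. if b then Z else Z'"] by (simp add: Un_commute)

lemma sz_subset: "sz le Z \<mu> ==> Z' \<subseteq> Z ==> sz le Z' \<mu>"
 unfolding sz_iff
proof
 fix q assume a: "\<forall>q\<in>Z. fsz le {..<\<mu>} {p \<in> Z. \<not> le q p}" "Z' \<subseteq> Z" "q \<in> Z'"
 then have "fsz le {..<\<mu>} {p \<in> Z. \<not> le q p}" by auto
 then show "fsz le {..<\<mu>} {p \<in> Z'. \<not> le q p}" by (rule fsz_subset) (use a(2) in auto)
qed

lemma fsz_sz: "fsz le {..<\<mu>} Z ==> sz le Z \<mu>"
 unfolding sz_iff by (auto elim: fsz_subset)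

lemma sz_trivial: "(!!p q. p \<in> Z ==> q \<in> Z ==> le q p) ==> sz le Z \<mu>"
 unfolding sz_iff by (auto intro: fsz_subset[OF fsz_empty])

lemma fsz_trivial: "(!!p q. p \<in> Z ==> q \<in> Z ==> le q p) ==> 0 \<in> U ==> fsz le U Z"
 by (rule fszI[OF sz_trivial])

lemma fsz_finite:
 assumes "finite Z" "!!p. p \<in> Z ==> le p p" "0 \<in> U"
 shows "fsz le U Z"
 using fsz_UN[of Z le U "\<lambda>p. {p}"] assms fsz_trivial[of "{_}" le U] by auto

lemma sz_induct [consumes 1, case_names step]:
 assumes "sz le Z \<mu>"
  and step: "!!Z \<mu>. sz le Z \<mu> ==> (!!q. q \<in> Z ==> \<exists>\<Z>. finite \<Z> \<and> {p \<in> Z. \<not> le q p} \<subseteq> \<Union>\<Z> \<and>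
   (\<forall>Z'\<in>\<Z>. \<exists>\<mu>'. \<mu>' < \<mu> \<and> P Z' \<mu>')) ==> P Z \<mu>"
 shows "P Z \<mu>"
 using assms(1)
proof induct
 case (1 Z \<mu>)
 have w: "\<exists>\<Z>. finite \<Z> \<and> {p \<in> Z. \<not> le q p} \<subseteq> \<Union>\<Z> \<and>
   (\<forall>Z'\<in>\<Z>. \<exists>\<mu>'. \<mu>' < \<mu> \<and> Q Z' \<mu>')" if Q: "!!Z' \<mu>'. sz le Z' \<mu>' ==> P Z' \<mu>' ==> Q Z' \<mu>'" and q: "q \<in> Z" for q Q
 proof -
  obtain \<Z> where \<Z>: "finite \<Z>" "{p \<in> Z. \<not> le q p} \<subseteq> \<Union>\<Z>"
   "\<forall>Z'\<in>\<Z>. \<exists>\<mu>'. \<mu>' < \<mu> \<and> sz le Z' \<mu>' \<and> P Z' \<mu>'" using 1[OF q] by auto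
  have "\<forall>Z'\<in>\<Z>. \<exists>\<mu>'. \<mu>' < \<mu> \<and> Q Z' \<mu>'" using \<Z>(3) Q by meson
  then show ?thesis using \<Z>(1,2) by (intro exI[of _ \<Z>]) simp
 qed
 have "sz le Z \<mu>" by (rule sz.intros, rule w)
 then show ?case by (rule step) (rule w)
qed

lemma sz_rel_aux:
 assumes "sz le Z \<mu>"
  and mono: "!!z z' w w'. z \<in> D ==> z' \<in> D ==> w \<in> W0 ==> w' \<in> W0 ==> E z w ==> E z' w' ==> le z z' ==> le' w w'"
  and "W \<subseteq> W0" "!!w. w \<in> W ==> \<exists>z\<in>Z \<inter> D. E z w"
 shows "sz le' W \<mu>"
proof -
 define P where "P Z \<mu> \<longleftrightarrow> (\<forall>W. W \<subseteq> W0 \<and> (\<forall>w\<in>W. \<exists>z\<in>Z \<inter> D. E z w) \<longrightarrow> sz le' W \<mu>)" for Z \<mu>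
 have PD: "sz le' W \<mu>" if "P Z \<mu>" "W \<subseteq> W0" "\<forall>w\<in>W. \<exists>z\<in>Z \<inter> D. E z w" for Z \<mu> W
  using that unfolding P_def by blast
 have "P Z \<mu>"
  using assms(1)
 proof (induct rule: sz_induct)
  case (step Z \<mu>)
  show ?case
   unfolding P_def
  proof (intro allI impI, elim conjE)
   fix W assume W: "W \<subseteq> W0" "\<forall>w\<in>W. \<exists>z\<in>Z \<inter> D. E z w"
   show "sz le' W \<mu>"
   proof (rule sz.intros)
    fix q assume q: "q \<in> W"
    then obtain z where z: "z \<in> Z" "z \<in> D" "E z q" using W by blast
    obtain \<Z> where \<Z>: "finite \<Z>" "{p \<in> Z. \<not> le z p} \<subseteq> \<Union>\<Z>"
     "\<forall>Z'\<in>\<Z>. \<exists>\<mu>'. \<mu>' < \<mu> \<and> P Z' \<mu>'" using step(2)[OF z(1)] by auto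
    let ?W = "\<lambda>Z'. {w \<in> W. \<exists>z\<in>Z' \<inter> D. E z w}"
    have "{p \<in> W. \<not> le' q p} \<subseteq> \<Union>(?W ` \<Z>)"
    proof
     fix p assume p: "p \<in> {p \<in> W. \<not> le' q p}"
     then obtain z' where z': "z' \<in> Z" "z' \<in> D" "E z' p" using W by blast
     have "q \<in> W0" "p \<in> W0" using p q W by auto
     then have "\<not> le z z'" using mono[OF z(2) z'(2) _ _ z(3) z'(3)] p by auto
     then obtain Z' where "Z' \<in> \<Z>" "z' \<in> Z'" using \<Z>(2) z' by auto
     then show "p \<in> \<Union>(?W ` \<Z>)" using z' p by auto
    qed
    moreover have "\<forall>W'\<in>?W ` \<Z>. \<exists>\<mu>'. \<mu>' < \<mu> \<and> sz le' W' \<mu>'"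
    proof
     fix W' assume "W' \<in> ?W ` \<Z>"
     then obtain Z' where Z': "Z' \<in> \<Z>" "W' = ?W Z'" by auto
     then obtain \<mu>' where \<mu>': "\<mu>' < \<mu>" "P Z' \<mu>'" using \<Z>(3) by auto
     have "sz le' W' \<mu>'" using W(1) Z'(2) by (intro PD[OF \<mu>'(2)]) auto
     then show "\<exists>\<mu>'. \<mu>' < \<mu> \<and> sz le' W' \<mu>'" using \<mu>'(1) by auto
    qed
    ultimately show "\<exists>\<W>. finite \<W> \<and> {p \<in> W. \<not> le' q p} \<subseteq> \<Union>\<W> \<and>
      (\<forall>W'\<in>\<W>. \<exists>\<mu>'. \<mu>' < \<mu> \<and> sz le' W' \<mu>')"
     using \<Z>(1) by (intro exI[of _ "?W ` \<Z>"]) simp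
   qed
  qed
 qed
 then show ?thesis using assms(3,4) by (intro PD) auto
qed

text \<open>All transfers between germs, their logarithms and their components are of this kind. The
 correspondence \<open>E\<close> need not be a function.\<close>

lemma fsz_rel:
 assumes "fsz le U Z"
  and "!!w. w \<in> W ==> \<exists>z\<in>Z. E z w"
  and mono: "!!z z' w w'. z \<in> Z ==> z' \<in> Z ==> w \<in> W ==> w' \<in> W ==>
   E z w ==> E z' w' ==> le z z' ==> le' w w'"
 shows "fsz le' U W"
proof -
 obtain \<Z> where \<Z>: "finite \<Z>" "Z \<subseteq> \<Union>\<Z>" "!!Z'. Z' \<in> \<Z> ==> \<exists>\<mu>\<in>U. sz le Z' \<mu>"
  using assms(1) unfolding fsz_def by blast
 let ?W = "\<lambda>Z'. {w \<in> W. \<exists>z\<in>Z' \<inter> Z. E z w}"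
 have "fsz le' U (\<Union>Z'\<in>\<Z>. ?W Z')"
 proof (rule fsz_UN[OF \<Z>(1)])
  fix Z' assume "Z' \<in> \<Z>"
  then obtain \<mu> where \<mu>: "\<mu> \<in> U" "sz le Z' \<mu>" using \<Z>(3) by blast
  have "sz le' (?W Z') \<mu>" by (rule sz_rel_aux[OF \<mu>(2), of Z W E]) (use mono in auto)
  then show "fsz le' U (?W Z')" using \<mu>(1) by (rule fszI)
 qed
 moreover have "W \<subseteq> (\<Union>Z'\<in>\<Z>. ?W Z')"
 proof
  fix w assume w: "w \<in> W"
  then obtain z where z: "z \<in> Z" "E z w" using assms(2) by blast
  then obtain Z' where "Z' \<in> \<Z>" "z \<in> Z'" using \<Z>(2) by auto
  then show "w \<in> (\<Union>Z'\<in>\<Z>. ?W Z')" using w z by auto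
 qed
 ultimately show ?thesis by (rule fsz_subset)
qed

lemma fsz_image:
 assumes "fsz le U Z" "W \<subseteq> f ` Z"
  and "!!p q. p \<in> Z ==> q \<in> Z ==> le p q ==> le' (f p) (f q)"
 shows "fsz le' U W"
 by (rule fsz_rel[OF assms(1), where E = "\<lambda>z w. w = f z"]) (use assms(2,3) in auto)

lemma fsz_order_mono:
 assumes "fsz le U Z" "!!p q. p \<in> Z ==> q \<in> Z ==> le p q ==> le' p q"
 shows "fsz le' U Z"
 by (rule fsz_image[OF assms(1), of _ id]) (use assms(2) in auto)

lemma sz_order_mono:
 assumes "sz le Z \<mu>" "!!p q. p \<in> Z ==> q \<in> Z ==> le p q ==> le' p q"
 shows "sz le' Z \<mu>"
 by (rule sz_rel_aux[OF assms(1), of Z Z "(=)"]) (use assms(2) in auto)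

text \<open>The pairs not above \<open>(a, b)\<close> are not above \<open>a\<close> in the first or not above \<open>b\<close> in the second
 component. So the exponents add up, by a double induction.\<close>

lemma sz_prod:
 assumes "sz le1 A \<alpha>" "sz le2 B \<beta>"
 shows "sz (rel_prod le1 le2) (A \<times> B) (\<alpha> + \<beta>)"
proof -
 define P where "P A \<alpha> \<longleftrightarrow> (\<forall>B \<beta>. sz le2 B \<beta> \<longrightarrow> sz (rel_prod le1 le2) (A \<times> B) (\<alpha> + \<beta>))" for A \<alpha>
 have PD: "sz (rel_prod le1 le2) (A \<times> B) (\<alpha> + \<beta>)" if "P A \<alpha>" "sz le2 B \<beta>" for A \<alpha> B \<beta>
  using that unfolding P_def by blast
 have "P A \<alpha>"
  using assms(1)
 proof (induct rule: sz_induct)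
  case A: (step A \<alpha>)
  have "sz (rel_prod le1 le2) (A \<times> B) (\<alpha> + \<beta>)" if "sz le2 B \<beta>" for B \<beta>
   using that
  proof (induct rule: sz_induct)
   case B: (step B \<beta>)
   show ?case
   proof (rule sz.intros)
    fix q assume "q \<in> A \<times> B"
    then obtain a b where q: "q = (a, b)" "a \<in> A" "b \<in> B" by blast
    obtain \<A> where \<A>: "finite \<A>" "{p \<in> A. \<not> le1 a p} \<subseteq> \<Union>\<A>"
     "\<forall>A'\<in>\<A>. \<exists>\<mu>. \<mu> < \<alpha> \<and> P A' \<mu>" using A(2)[OF q(2)] by auto
    obtain \<B> where \<B>: "finite \<B>" "{p \<in> B. \<not> le2 b p} \<subseteq> \<Union>\<B>"
     "\<forall>B'\<in>\<B>. \<exists>\<mu>. \<mu> < \<beta> \<and> sz (rel_prod le1 le2) (A \<times> B') (\<alpha> + \<mu>)"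
     using B(2)[OF q(3)] by auto
    let ?S = "(\<lambda>A'. A' \<times> B) ` \<A> \<union> (\<lambda>B'. A \<times> B') ` \<B>"
    have "\<exists>\<mu>'. \<mu>' < \<alpha> + \<beta> \<and> sz (rel_prod le1 le2) Z' \<mu>'" if "Z' \<in> ?S" for Z'
     using that
    proof
     assume "Z' \<in> (\<lambda>A'. A' \<times> B) ` \<A>"
     then obtain A' where A': "A' \<in> \<A>" "Z' = A' \<times> B" by auto
     then obtain \<mu> where "\<mu> < \<alpha>" "P A' \<mu>" using \<A>(3) by auto
     then show ?thesis using PD[OF _ B(1)] A'(2)
      by (intro exI[of _ "\<mu> + \<beta>"]) (simp add: add_strict_right_mono)
    next
     assume "Z' \<in> (\<lambda>B'. A \<times> B') ` \<B>"
     then obtain \<mu> where "\<mu> < \<beta>" "sz (rel_prod le1 le2) Z' (\<alpha> + \<mu>)" using \<B>(3) by auto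
     then show ?thesis by (intro exI[of _ "\<alpha> + \<mu>"]) (simp add: add_strict_left_mono)
    qed
    moreover have "{p \<in> A \<times> B. \<not> rel_prod le1 le2 q p} \<subseteq> \<Union>?S"
    proof
     fix p assume p: "p \<in> {p \<in> A \<times> B. \<not> rel_prod le1 le2 q p}"
     then obtain a' b' where p': "p = (a', b')" "a' \<in> A" "b' \<in> B" "\<not> le1 a a' \<or> \<not> le2 b b'"
      using q(1) by auto
     then have "a' \<in> \<Union>\<A> \<or> b' \<in> \<Union>\<B>" using \<A>(2) \<B>(2) by blast
     then show "p \<in> \<Union>?S" using p' by auto
    qed
    ultimately show "\<exists>\<Z>. finite \<Z> \<and> {p \<in> A \<times> B. \<not> rel_prod le1 le2 q p} \<subseteq> \<Union>\<Z> \<and>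
      (\<forall>Z'\<in>\<Z>. \<exists>\<mu>'. \<mu>' < \<alpha> + \<beta> \<and> sz (rel_prod le1 le2) Z' \<mu>')"
     using \<A>(1) \<B>(1) by (intro exI[of _ ?S]) simp
   qed
  qed
  then show ?case unfolding P_def by blast
 qed
 then show ?thesis using assms(2) by (rule PD)
qed

lemma fsz_prod:
 assumes "fsz le1 U A" "fsz le2 V B" "!!u v. u \<in> U ==> v \<in> V ==> u + v \<in> W"
 shows "fsz (rel_prod le1 le2) W (A \<times> B)"
proof -
 obtain \<A> where \<A>: "finite \<A>" "A \<subseteq> \<Union>\<A>" "!!A'. A' \<in> \<A> ==> \<exists>\<mu>\<in>U. sz le1 A' \<mu>"
  using assms(1) unfolding fsz_def by blast
 obtain \<B> where \<B>: "finite \<B>" "B \<subseteq> \<Union>\<B>" "!!B'. B' \<in> \<B> ==> \<exists>\<mu>\<in>V. sz le2 B' \<mu>"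
  using assms(2) unfolding fsz_def by blast
 have "\<exists>\<mu>\<in>W. sz (rel_prod le1 le2) Z' \<mu>" if "Z' \<in> (\<lambda>(A', B'). A' \<times> B') ` (\<A> \<times> \<B>)" for Z'
 proof -
  from that obtain A' B' where "A' \<in> \<A>" "B' \<in> \<B>" "Z' = A' \<times> B'" by auto
  then show ?thesis using \<A>(3) \<B>(3) sz_prod assms(3) by metis
 qed
 moreover have "A \<times> B \<subseteq> \<Union>((\<lambda>(A', B'). A' \<times> B') ` (\<A> \<times> \<B>))" using \<A>(2) \<B>(2) by fastforce
 ultimately show ?thesis
  unfolding fsz_def using \<A>(1) \<B>(1) by (intro exI[of _ "(\<lambda>(A', B'). A' \<times> B') ` (\<A> \<times> \<B>)"]) auto
qed

lemma fsz_image2: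
 assumes "fsz le1 U A" "fsz le2 V B" "!!u v. u \<in> U ==> v \<in> V ==> u + v \<in> W"
  and "!!c. c \<in> C ==> \<exists>a\<in>A. \<exists>b\<in>B. c = f a b"
  and "!!a a' b b'. a \<in> A ==> a' \<in> A ==> b \<in> B ==> b' \<in> B ==>
   le1 a a' ==> le2 b b' ==> le3 (f a b) (f a' b')"
 shows "fsz le3 W C"
 by (rule fsz_image[OF fsz_prod[OF assms(1-3)], of _ "\<lambda>(a, b). f a b"])
   (use assms(4,5) in \<open>fastforce+\<close>)

text \<open>A fine order costs the exponent of its quotient by a coarse one plus a bound for the
 exponents of the classes, as for a product.\<close>

lemma sz_lexicographic:
 assumes "sz le1 Z \<nu>"
  and cls: "!!q. q \<in> D ==> sz le2 {p \<in> D. le1 p q \<and> le1 q p} \<alpha>"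
  and tot: "!!p q. p \<in> D ==> q \<in> D ==> \<not> le2 q p ==> le1 p q"
  and refl: "!!q. q \<in> D ==> le1 q q"
 shows "sz le2 (Z \<inter> D) (\<alpha> + \<nu>)"
 using assms(1)
proof (induct rule: sz_induct)
 case (step Z \<nu>)
 show ?case
  unfolding sz_iff
 proof
  fix q assume q: "q \<in> Z \<inter> D"
  obtain \<Z> where \<Z>: "finite \<Z>" "{p \<in> Z. \<not> le1 q p} \<subseteq> \<Union>\<Z>"
   "!!Z'. Z' \<in> \<Z> ==> \<exists>\<mu>. \<mu> < \<nu> \<and> sz le2 (Z' \<inter> D) (\<alpha> + \<mu>)" using step(2)[of q] q by auto
  have "fsz le2 {..<\<alpha> + \<nu>} (\<Union>Z'\<in>\<Z>. Z' \<inter> D)"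
  proof (rule fsz_UN[OF \<Z>(1)])
   fix Z' assume "Z' \<in> \<Z>"
   then obtain \<mu> where "\<mu> < \<nu>" "sz le2 (Z' \<inter> D) (\<alpha> + \<mu>)" using \<Z>(3) by blast
   then show "fsz le2 {..<\<alpha> + \<nu>} (Z' \<inter> D)" by (intro fszI) auto
  qed
  moreover have "fsz le2 {..<\<alpha> + \<nu>} {p \<in> D. le1 p q \<and> le1 q p \<and> \<not> le2 q p}"
  proof -
   have "fsz le2 {..<\<alpha>} {p \<in> {p \<in> D. le1 p q \<and> le1 q p}. \<not> le2 q p}"
    using cls[of q] q refl unfolding sz_iff by blast
   then show ?thesis
    using hmset_le_add(1)[of \<alpha> \<nu>] by (elim fsz_mono[THEN fsz_subset]) auto
  qed
  ultimately have "fsz le2 {..<\<alpha> + \<nu>}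
    ((\<Union>Z'\<in>\<Z>. Z' \<inter> D) \<union> {p \<in> D. le1 p q \<and> le1 q p \<and> \<not> le2 q p})" by (rule fsz_Un)
  then show "fsz le2 {..<\<alpha> + \<nu>} {p \<in> Z \<inter> D. \<not> le2 q p}"
   by (rule fsz_subset) (use \<Z>(2) tot q in blast)
 qed
qed

lemma fsz_lexicographic:
 assumes "fsz le1 U Z"
  and "!!q. q \<in> Z ==> sz le2 {p \<in> Z. le1 p q \<and> le1 q p} \<alpha>"
  and "!!p q. p \<in> Z ==> q \<in> Z ==> \<not> le2 q p ==> le1 p q"
  and "!!q. q \<in> Z ==> le1 q q"
  and "!!u. u \<in> U ==> \<alpha> + u \<in> V"
 shows "fsz le2 V Z"
proof -
 obtain \<Z> where \<Z>: "finite \<Z>" "Z \<subseteq> \<Union>\<Z>" "!!Z'. Z' \<in> \<Z> ==> \<exists>\<mu>\<in>U. sz le1 Z' \<mu>"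
  using assms(1) unfolding fsz_def by blast
 have "fsz le2 V (\<Union>Z'\<in>\<Z>. Z' \<inter> Z)"
 proof (rule fsz_UN[OF \<Z>(1)])
  fix Z' assume "Z' \<in> \<Z>"
  then obtain \<mu> where \<mu>: "\<mu> \<in> U" "sz le1 Z' \<mu>" using \<Z>(3) by blast
  have "sz le2 (Z' \<inter> Z) (\<alpha> + \<mu>)" by (rule sz_lexicographic[OF \<mu>(2)]) (use assms(2-4) in auto)
  then show "fsz le2 V (Z' \<inter> Z)" using assms(5) \<mu>(1) fszI by blast
 qed
 then show ?thesis by (rule fsz_subset) (use \<Z>(2) in blast)
qed

text \<open>From exponents to ordinals: \<open>bnd le Z h\<close> says that the order type is at most \<open>h\<close>.\<close>

inductive bnd :: "('a => 'a => bool) => 'a set => hmset => bool" for le where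
 bndI: "(!!q. q \<in> Z ==> \<exists>h'. h' < h \<and> bnd le {p \<in> Z. \<not> le q p} h') ==> bnd le Z h"

lemma bndD: "bnd le Z h ==> q \<in> Z ==> \<exists>h'. h' < h \<and> bnd le {p \<in> Z. \<not> le q p} h'"
 by (erule bnd.cases) blast

lemma bnd_subset: "bnd le Z h ==> Z' \<subseteq> Z ==> bnd le Z' h"
proof (induct arbitrary: Z' rule: bnd.induct)
 case (bndI Z h)
 show ?case
 proof (rule bnd.bndI)
  fix q assume "q \<in> Z'"
  then obtain h' where h': "h' < h" "!!Z''. Z'' \<subseteq> {p \<in> Z. \<not> le q p} ==> bnd le Z'' h'"
   using bndI by blast
  have "{p \<in> Z'. \<not> le q p} \<subseteq> {p \<in> Z. \<not> le q p}" using bndI.prems by auto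
  then show "\<exists>h'. h' < h \<and> bnd le {p \<in> Z'. \<not> le q p} h'" using h' by blast
 qed
qed

lemma bnd_Un:
 assumes "bnd le A a" "bnd le B b"
 shows "bnd le (A \<union> B) (a + b)"
 using assms
proof (induct "a + b" arbitrary: A B a b rule: less_induct)
 case less
 show ?case
 proof (rule bndI)
  fix q assume "q \<in> A \<union> B"
  then show "\<exists>h'. h' < a + b \<and> bnd le {p \<in> A \<union> B. \<not> le q p} h'"
  proof
   assume "q \<in> A"
   then obtain a' where a': "a' < a" "bnd le {p \<in> A. \<not> le q p} a'" using bndD[OF less.prems(1)] by auto
   then have lt: "a' + b < a + b" by (simp add: add_strict_right_mono)
   have "bnd le ({p \<in> A. \<not> le q p} \<union> B) (a' + b)" by (rule less.hyps[OF lt a'(2) less.prems(2)])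
   then have "bnd le {p \<in> A \<union> B. \<not> le q p} (a' + b)" by (rule bnd_subset) auto
   then show ?thesis using lt by blast
  next
   assume "q \<in> B"
   then obtain b' where b': "b' < b" "bnd le {p \<in> B. \<not> le q p} b'" using bndD[OF less.prems(2)] by auto
   then have lt: "a + b' < a + b" by (simp add: add_strict_left_mono)
   have "bnd le (A \<union> {p \<in> B. \<not> le q p}) (a + b')" by (rule less.hyps[OF lt less.prems(1) b'(2)])
   then have "bnd le {p \<in> A \<union> B. \<not> le q p} (a + b')" by (rule bnd_subset) auto
   then show ?thesis using lt by blast
  qed
 qed
qed

lemma bnd_Union:
 assumes "finite \<Z>" "!!Z. Z \<in> \<Z> ==> \<exists>\<mu>. P \<mu> \<and> bnd le Z \<mu>" "P 0" "!!a b. P a ==> P b ==> P (a + b)"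
 shows "\<exists>h. P h \<and> bnd le (\<Union>\<Z>) h"
 using assms(1,2)
proof induct
 case empty
 then show ?case using assms(3) by (auto intro: bndI)
next
 case (insert Z \<Z>)
 obtain h h' where "P h" "bnd le (\<Union>\<Z>) h" "P h'" "bnd le Z h'" using insert by blast
 then have "P (h' + h) \<and> bnd le (Z \<union> \<Union>\<Z>) (h' + h)" using bnd_Un assms(4) by blast
 then show ?case by auto
qed

lemma sz_imp_bnd: "sz le Z \<mu> ==> bnd le Z (om \<mu>)"
proof (induct rule: sz_induct)
 case (step Z \<mu>)
 show ?case
 proof (rule bndI)
  fix q assume "q \<in> Z"
  then obtain \<Z> where \<Z>: "finite \<Z>" "{p \<in> Z. \<not> le q p} \<subseteq> \<Union>\<Z>"
   "!!Z'. Z' \<in> \<Z> ==> \<exists>\<mu>'. \<mu>' < \<mu> \<and> bnd le Z' (om \<mu>')" using step(2) by meson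
  have "\<exists>h. h < om \<mu> \<and> bnd le (\<Union>\<Z>) h"
  proof (rule bnd_Union[OF \<Z>(1)])
   fix Z' assume "Z' \<in> \<Z>"
   then obtain \<mu>' where "\<mu>' < \<mu>" "bnd le Z' (om \<mu>')" using \<Z>(3) by auto
   then show "\<exists>h. h < om \<mu> \<and> bnd le Z' h" by (intro exI[of _ "om \<mu>'"]) simp
  qed (simp_all add: add_less_om)
  then show "\<exists>h'. h' < om \<mu> \<and> bnd le {p \<in> Z. \<not> le q p} h'" using bnd_subset \<Z>(2) by blast
 qed
qed

text \<open>The rank of \<open>q\<close> is the least bound for the elements not above \<open>q\<close>.\<close>

lemma bnd_rank:
 assumes "bnd le Z h"
  and tot: "!!p q. p \<in> Z ==> q \<in> Z ==> le p q \<or> le q p"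
  and tr: "!!p q r. p \<in> Z ==> q \<in> Z ==> r \<in> Z ==> le p q ==> le q r ==> le p r"
 obtains r where "!!p. p \<in> Z ==> r p < h" "!!p q. p \<in> Z ==> q \<in> Z ==> \<not> le q p ==> r p < r q"
proof -
 define B where "B q h' \<longleftrightarrow> bnd le {p \<in> Z. \<not> le q p} h'" for q h'
 define r where "r q = (LEAST h'. B q h')" for q
 have ex: "\<exists>h'. h' < h \<and> B q h'" if "q \<in> Z" for q using bndD[OF assms(1) that] unfolding B_def .
 have r: "B q (r q)" if "q \<in> Z" for q unfolding r_def using ex[OF that] by (meson LeastI)
 have "r p < h" if "p \<in> Z" for p
  using ex[OF that] unfolding r_def by (meson Least_le le_less_trans)
 moreover have "r p < r q" if pq: "p \<in> Z" "q \<in> Z" "\<not> le q p" for p q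
 proof -
  have "p \<in> {p \<in> Z. \<not> le q p}" using pq by simp
  from bndD[OF r[OF pq(2), unfolded B_def] this] obtain h' where
   h': "h' < r q" "bnd le {x \<in> {p \<in> Z. \<not> le q p}. \<not> le p x} h'" by blast
  have "{x \<in> Z. \<not> le p x} \<subseteq> {x \<in> {p \<in> Z. \<not> le q p}. \<not> le p x}"
   using tr[of p q] tot[of p q] pq by blast
  then have "B p h'" unfolding B_def using h'(2) bnd_subset by blast
  then show ?thesis using h'(1) unfolding r_def[of p] by (meson Least_le le_less_trans)
 qed
 ultimately show thesis using that by blast
qed

lemma fsz_rank:
 assumes "fsz le (Hset k) Z"
  and "!!p q. p \<in> Z ==> q \<in> Z ==> le p q \<or> le q p"
  and "!!p q r. p \<in> Z ==> q \<in> Z ==> r \<in> Z ==> le p q ==> le q r ==> le p r"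
 obtains r h where "h \<in> Hset (Suc k)" "!!p. p \<in> Z ==> r p < h"
  "!!p q. p \<in> Z ==> q \<in> Z ==> \<not> le q p ==> r p < r q"
proof -
 obtain \<Z> where \<Z>: "finite \<Z>" "Z \<subseteq> \<Union>\<Z>" "!!Z'. Z' \<in> \<Z> ==> \<exists>\<mu>\<in>Hset k. sz le Z' \<mu>"
  using assms(1) unfolding fsz_def by blast
 have "\<exists>h. h \<in> Hset (Suc k) \<and> bnd le (\<Union>\<Z>) h"
  by (rule bnd_Union[OF \<Z>(1)])
    (use \<Z>(3) sz_imp_bnd om_in_Hset zero_in_Hset Hset_add in \<open>blast+\<close>)
 then obtain h where h: "h \<in> Hset (Suc k)" "bnd le Z h" using bnd_subset \<Z>(2) by blast
 show thesis by (rule bnd_rank[OF h(2) assms(2,3)]) (assumption | rule that[OF h(1)])+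
qed

section \<open>Convergent series over a group of monomials\<close>

type_synonym fn = "real => real"

abbreviation eventually_real :: "(real => bool) => bool" (binder "EV " 10) where
 "eventually_real Q \<equiv> eventually Q at_top"

definition eveq :: "fn => fn => bool" (infix "\<doteq>" 50) where
 "f \<doteq> g \<longleftrightarrow> eventually (\<lambda>x. f x = g x) at_top"

lemma eveq_refl [simp]: "f \<doteq> f" by (simp add: eveq_def)
lemma eveq_sym: "f \<doteq> g ==> g \<doteq> f" unfolding eveq_def by (auto elim: eventually_mono)
lemma eveq_trans [trans]: "f \<doteq> g ==> g \<doteq> h ==> f \<doteq> h"
 unfolding eveq_def by (auto elim: eventually_elim2)
lemma eveq_add: "f \<doteq> f' ==> g \<doteq> g' ==> (\<lambda>x. f x + g x) \<doteq> (\<lambda>x. f' x + g' x)"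
 unfolding eveq_def by (auto elim: eventually_elim2)
lemma eveq_mult: "f \<doteq> f' ==> g \<doteq> g' ==> (\<lambda>x. f x * g x) \<doteq> (\<lambda>x. f' x * g' x)"
 unfolding eveq_def by (auto elim: eventually_elim2)
lemma eveq_comp: "f \<doteq> g ==> (\<lambda>x. h (f x)) \<doteq> (\<lambda>x. h (g x))"
 unfolding eveq_def by (auto elim: eventually_mono)

definition vanish :: "fn => bool" where "vanish f \<longleftrightarrow> (f \<longlongrightarrow> 0) at_top"
definition tinf :: "fn => bool" where "tinf f \<longleftrightarrow> filterlim f at_top at_top"

definition ev_closed :: "(fn => bool) => bool" where
 "ev_closed T \<longleftrightarrow> (\<forall>f g. f \<doteq> g \<longrightarrow> T f \<longrightarrow> T g)"

lemma ev_closedD: "ev_closed T ==> f \<doteq> g ==> T f ==> T g"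
 unfolding ev_closed_def by blast

lemma ev_closed_vanish [simp]: "ev_closed vanish"
 unfolding ev_closed_def vanish_def eveq_def by (auto simp: tendsto_cong)

lemma ev_closed_tinf [simp]: "ev_closed tinf"
 unfolding ev_closed_def tinf_def eveq_def by (auto simp: filterlim_cong)

lemma ev_closed_True [simp]: "ev_closed (\<lambda>_. True)"
 by (simp add: ev_closed_def)

lemma ev_closed_conj [simp]: "ev_closed T ==> ev_closed T' ==> ev_closed (\<lambda>f. T f \<and> T' f)"
 unfolding ev_closed_def by blast

lemma ev_closed_times [simp]: "ev_closed T ==> ev_closed (\<lambda>f. T (\<lambda>x. m x * f x))"
 unfolding ev_closed_def by (metis eveq_mult eveq_refl)

lemma vanish_mult: "vanish f ==> vanish g ==> vanish (\<lambda>x. f x * g x)"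
 unfolding vanish_def using tendsto_mult_zero by blast

lemma tinf_mult: "tinf f ==> tinf g ==> tinf (\<lambda>x. f x * g x)"
 unfolding tinf_def by (rule filterlim_at_top_mult_at_top)

text \<open>Words are finite multisets of functions; a word denotes the product of its letters.\<close>

definition mp :: "fn multiset => fn" where "mp w x = (\<Prod>s\<in>#w. s x)"

lemma mp_empty [simp]: "mp {#} = (\<lambda>x. 1)" by (rule ext) (simp add: mp_def)
lemma mp_union: "mp (u + v) x = mp u x * mp v x" by (simp add: mp_def)
lemma mp_add: "mp (add_mset s v) x = s x * mp v x" by (simp add: mp_def)

definition good :: "fn set => real => real => bool" where
 "good S r x \<longleftrightarrow> (\<forall>s\<in>S. 0 < s x \<and> s x <= r)"

lemma mp_bounds:
 assumes "good S r x" "set_mset w \<subseteq> S"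
 shows "0 < mp w x \<and> mp w x <= r ^ size w"
 using assms(2)
proof (induct w)
 case (add s w)
 then have "0 < s x" "s x <= r" using assms(1) by (auto simp: good_def)
 then have "s x * mp w x <= r * r ^ size w" using add by (intro mult_mono) auto
 then show ?case using add \<open>0 < s x\<close> by (simp add: mp_add)
qed simp

text \<open>\<open>ser S r Q N z\<close>: where all letters in \<open>S\<close> are positive and at most \<open>r\<close>, the function \<open>z\<close> is a
 series in words over \<open>S\<close> with the property \<open>Q\<close>, and its majorant at \<open>r\<close> is at most \<open>N\<close>.\<close>

definition ser_rep :: "fn set => real => (fn multiset => bool) => fn =>
  (nat => real) => (nat => fn multiset) => real => bool" where
 "ser_rep S r Q z c w K \<longleftrightarrow> (\<forall>i. set_mset (w i) \<subseteq> S \<and> (c i \<noteq> 0 \<longrightarrow> Q (w i))) \<and>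
   ((\<lambda>i. \<bar>c i\<bar> * r ^ size (w i)) has_sum K) UNIV \<and>
   (\<forall>x. good S r x \<longrightarrow> ((\<lambda>i. c i * mp (w i) x) has_sum z x) UNIV)"

definition ser :: "fn set => real => (fn multiset => bool) => real => fn => bool" where
 "ser S r Q N z \<longleftrightarrow> (\<exists>c w K. ser_rep S r Q z c w K \<and> K <= N)"

lemma ser_repD:
 assumes "ser_rep S r Q z c w K"
 shows "set_mset (w i) \<subseteq> S" "c i \<noteq> 0 ==> Q (w i)"
  "((\<lambda>i. \<bar>c i\<bar> * r ^ size (w i)) has_sum K) UNIV"
  "good S r x ==> ((\<lambda>i. c i * mp (w i) x) has_sum z x) UNIV"
 using assms unfolding ser_rep_def by auto

lemma words_summable:
 assumes "(\<lambda>i. \<bar>c i\<bar> * r ^ size (w i)) summable_on I" "!!i. i \<in> I ==> set_mset (w i) \<subseteq> S" "good S r x"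
 shows "(\<lambda>i. c i * mp (w i) x) summable_on I"
proof (rule abs_summable_summable, rule abs_summable_on_comparison_test')
 show "(\<lambda>i. \<bar>c i\<bar> * r ^ size (w i)) summable_on I" by fact
 fix i assume "i \<in> I"
 then have "0 < mp (w i) x" "mp (w i) x <= r ^ size (w i)" using mp_bounds[OF assms(3)] assms(2) by auto
 then show "norm (c i * mp (w i) x) <= \<bar>c i\<bar> * r ^ size (w i)"
  by (simp add: abs_mult mult_left_mono)
qed

lemma serI:
 fixes I :: "'i set"
 assumes "countable I" "!!i. i \<in> I ==> set_mset (w i) \<subseteq> S" "!!i. i \<in> I ==> c i \<noteq> 0 ==> Q (w i)"
  and K: "((\<lambda>i. \<bar>c i\<bar> * r ^ size (w i)) has_sum K) I" "K <= N"
  and z: "!!x. good S r x ==> ((\<lambda>i. c i * mp (w i) x) has_sum z x) I"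
 shows "ser S r Q N z"
proof -
 define g where "g = to_nat_on I"
 have inj: "inj_on g I" unfolding g_def using assms(1) by (rule inj_on_to_nat_on)
 define h where "h = the_inv_into I g"
 have h: "h (g i) = i" if "i \<in> I" for i unfolding h_def using the_inv_into_f_f[OF inj that] .
 define c' where "c' n = (if n \<in> g ` I then c (h n) else 0)" for n
 define w' where "w' n = (if n \<in> g ` I then w (h n) else {#})" for n
 have transfer: "((\<lambda>n. F (c' n) (w' n)) has_sum y) UNIV"
  if "((\<lambda>i. F (c i) (w i)) has_sum y) I" "!!v. F 0 v = 0" for F :: "real => fn multiset => real" and y
 proof -
  have "((\<lambda>n. F (c' n) (w' n)) has_sum y) (g ` I)"
   unfolding has_sum_reindex[OF inj] comp_def
   using that(1) by (rule has_sum_cong[THEN iffD1, rotated]) (simp add: c'_def w'_def h)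
  then show ?thesis
   by (rule has_sum_cong_neutral[THEN iffD1, rotated -1]) (auto simp: c'_def that(2))
 qed
 show ?thesis
  unfolding ser_def ser_rep_def
 proof (rule exI[of _ c'], rule exI[of _ w'], rule exI[of _ K], intro conjI allI impI)
  fix n
  consider i where "i \<in> I" "n = g i" | "n \<notin> g ` I" by blast
  then have "set_mset (w' n) \<subseteq> S \<and> (c' n \<noteq> 0 \<longrightarrow> Q (w' n))"
   using assms(2,3) h by cases (simp_all add: w'_def c'_def)
  then show "set_mset (w' n) \<subseteq> S" "c' n \<noteq> 0 ==> Q (w' n)" by auto
 qed (use K z transfer[of "\<lambda>a v. \<bar>a\<bar> * r ^ size v"] transfer[of "\<lambda>a v. a * mp v x" for x] in auto)
qed

lemma ser_norm:
 assumes "ser S r Q N z" "good S r x"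
 shows "\<bar>z x\<bar> <= N"
proof -
 obtain c w K where rep: "ser_rep S r Q z c w K" and "K <= N" using assms(1) unfolding ser_def by blast
 note cw = ser_repD(1)[OF rep] ser_repD(3)[OF rep] \<open>K <= N\<close> ser_repD(4)[OF rep assms(2)]
 have "(\<lambda>i. norm (c i * mp (w i) x)) summable_on UNIV"
  by (rule summable_on_iff_abs_summable_on_real[THEN iffD1, OF has_sum_imp_summable[OF cw(4)]])
 then obtain a where a: "((\<lambda>i. norm (c i * mp (w i) x)) has_sum a) UNIV" unfolding summable_on_def by blast
 have "norm (z x) <= a" using norm_has_sum_bound[OF a cw(4)] .
 also have "a <= K"
  by (rule has_sum_mono[OF a cw(2)])
    (use mp_bounds[OF assms(2) cw(1)] in \<open>auto simp: abs_mult less_imp_le intro!: mult_left_mono\<close>)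
 finally show ?thesis using cw(3) by simp
qed

lemma ser_mono:
 assumes "ser S r Q N z" "S \<subseteq> S'" "0 <= r'" "r' <= r" "!!w. set_mset w \<subseteq> S ==> Q w ==> Q' w" "N <= N'"
 shows "ser S' r' Q' N' z"
proof -
 obtain c w K where rep1: "ser_rep S r Q z c w K" and KN: "K <= N"
  using assms(1) unfolding ser_def by auto
 note cw = ser_repD(1)[OF rep1] ser_repD(2)[OF rep1] ser_repD(3)[OF rep1] KN ser_repD(4)[OF rep1]
 have le: "\<bar>c i\<bar> * r' ^ size (w i) <= \<bar>c i\<bar> * r ^ size (w i)" for i
  using assms(3,4) by (intro mult_left_mono power_mono) auto
 have "(\<lambda>i. \<bar>c i\<bar> * r' ^ size (w i)) summable_on UNIV"
  by (rule summable_on_comparison_test[OF has_sum_imp_summable[OF cw(3)] le]) (use assms(3) in auto)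
 then obtain K' where K': "((\<lambda>i. \<bar>c i\<bar> * r' ^ size (w i)) has_sum K') UNIV" unfolding summable_on_def by blast
 have "K' <= K" by (rule has_sum_mono[OF K' cw(3) le])
 moreover have "good S r x" if "good S' r' x" for x using that assms(2,4) unfolding good_def by fastforce
 moreover have "set_mset (w i) \<subseteq> S'" for i using cw(1)[of i] assms(2) by (rule subset_trans)
 ultimately show ?thesis
  by (intro serI[OF _ _ _ K', of S' Q' N' z]) (use cw assms in auto)
qed

lemma ser_single:
 assumes "set_mset w \<subseteq> S" "Q w"
 shows "ser S r Q (\<bar>a\<bar> * r ^ size w) (\<lambda>x. a * mp w x)"
 by (rule serI[of "{()}" "\<lambda>_. w" S "\<lambda>_. a" Q r "\<bar>a\<bar> * r ^ size w"])
   (use assms in \<open>auto intro: has_sum_finiteI\<close>)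

lemma ser_add:
 assumes "ser S r Q N y" "ser S r Q N' z"
 shows "ser S r Q (N + N') (\<lambda>x. y x + z x)"
proof -
 obtain c w K where rep1: "ser_rep S r Q y c w K" and KN: "K <= N"
  using assms(1) unfolding ser_def by auto
 note cw = ser_repD(1)[OF rep1] ser_repD(2)[OF rep1] ser_repD(3)[OF rep1] KN ser_repD(4)[OF rep1]
 obtain d v L where rep2: "ser_rep S r Q z d v L" and LN: "L <= N'"
  using assms(2) unfolding ser_def by auto
 note dv = ser_repD(1)[OF rep2] ser_repD(2)[OF rep2] ser_repD(3)[OF rep2] LN ser_repD(4)[OF rep2]
 have sum: "((case_sum f g) has_sum (a + b)) UNIV"
  if "(f has_sum a) UNIV" "(g has_sum b) UNIV" for f g :: "nat => real" and a b
 proof -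
  have "((case_sum f g) has_sum a) (range Inl)" "((case_sum f g) has_sum b) (range Inr)"
   using that by (simp_all add: has_sum_reindex comp_def)
  then have "((case_sum f g) has_sum (a + b)) (range Inl \<union> range Inr)" by (rule has_sum_Un_disjoint) auto
  then show ?thesis by (simp add: UNIV_sum)
 qed
 have case1: "(\<lambda>i. \<bar>case_sum c d i\<bar> * r ^ size (case_sum w v i)) =
   case_sum (\<lambda>i. \<bar>c i\<bar> * r ^ size (w i)) (\<lambda>i. \<bar>d i\<bar> * r ^ size (v i))"
  and case2: "(\<lambda>i. case_sum c d i * mp (case_sum w v i) x) =
   case_sum (\<lambda>i. c i * mp (w i) x) (\<lambda>i. d i * mp (v i) x)" for x
  by (auto simp: fun_eq_iff split: sum.split)
 show ?thesis
  by (rule serI[of "UNIV :: (nat + nat) set" "case_sum w v" S "case_sum c d" Q r "K + L"])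
    (use cw dv sum in \<open>auto simp: case1 case2 split: sum.splits intro!: add_mono\<close>)
qed

lemma ser_mult:
 assumes "ser S r Q N y" "ser S r Q' N' z" "0 <= r" "!!u v. Q u ==> Q' v ==> Q'' (u + v)"
 shows "ser S r Q'' (N * N') (\<lambda>x. y x * z x)"
proof -
 obtain c w K where rep1: "ser_rep S r Q y c w K" and KN: "K <= N"
  using assms(1) unfolding ser_def by auto
 note cw = ser_repD(1)[OF rep1] ser_repD(2)[OF rep1] ser_repD(3)[OF rep1] KN ser_repD(4)[OF rep1]
 obtain d v L where rep2: "ser_rep S r Q' z d v L" and LN: "L <= N'"
  using assms(2) unfolding ser_def by auto
 note dv = ser_repD(1)[OF rep2] ser_repD(2)[OF rep2] ser_repD(3)[OF rep2] LN ser_repD(4)[OF rep2]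
 define e where "e = (\<lambda>(i, j). c i * d j)"
 define u where "u = (\<lambda>(i, j). w i + v j)"
 have e1: "(\<lambda>j. \<bar>e (i, j)\<bar> * r ^ size (u (i, j))) =
   (\<lambda>j. (\<bar>c i\<bar> * r ^ size (w i)) * (\<bar>d j\<bar> * r ^ size (v j)))" for i
  by (simp add: e_def u_def abs_mult power_add mult_ac)
 have e2: "(\<lambda>j. e (i, j) * mp (u (i, j)) x) = (\<lambda>j. (c i * mp (w i) x) * (d j * mp (v j) x))" for i x
  by (simp add: e_def u_def mp_union mult_ac)
 have i1: "((\<lambda>j. \<bar>e (i, j)\<bar> * r ^ size (u (i, j))) has_sum (\<bar>c i\<bar> * r ^ size (w i)) * L) UNIV" for i
  unfolding e1 using dv(3) by (rule has_sum_cmult_right)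
 have o1: "((\<lambda>i. (\<bar>c i\<bar> * r ^ size (w i)) * L) has_sum K * L) UNIV"
  using cw(3) by (rule has_sum_cmult_left)
 have s1: "(\<lambda>p. \<bar>e p\<bar> * r ^ size (u p)) summable_on Sigma UNIV (\<lambda>_. UNIV)"
  by (rule summable_on_SigmaI[OF i1 has_sum_imp_summable[OF o1]]) (use assms(3) in auto)
 have words: "set_mset (u p) \<subseteq> S" for p using cw(1) dv(1) by (auto simp: u_def split: prod.splits)
 have h1: "((\<lambda>p. \<bar>e p\<bar> * r ^ size (u p)) has_sum K * L) (Sigma UNIV (\<lambda>_. UNIV))"
  by (rule has_sum_SigmaI[OF i1 o1 s1])
 have h2: "((\<lambda>p. e p * mp (u p) x) has_sum y x * z x) (Sigma UNIV (\<lambda>_. UNIV))" if "good S r x" for x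
 proof (rule has_sum_SigmaI)
  show "((\<lambda>j. e (i, j) * mp (u (i, j)) x) has_sum (c i * mp (w i) x) * z x) UNIV" for i
   unfolding e2 using dv(5)[OF that] by (rule has_sum_cmult_right)
  show "((\<lambda>i. (c i * mp (w i) x) * z x) has_sum y x * z x) UNIV"
   using cw(5)[OF that] by (rule has_sum_cmult_left)
  show "(\<lambda>p. e p * mp (u p) x) summable_on Sigma UNIV (\<lambda>_. UNIV)"
   by (rule words_summable[OF s1 words that])
 qed
 have nn: "0 <= K" "0 <= L" using has_sum_nonneg[OF cw(3)] has_sum_nonneg[OF dv(3)] assms(3) by auto
 have "K * L <= N * N'" using cw(4) dv(4) nn by (intro mult_mono) auto
 with h1 h2 words show ?thesis
  by (intro serI[of "Sigma UNIV (\<lambda>_. UNIV)" u S e Q'' r "K * L"])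
    (use assms(4) cw(2) dv(2) in \<open>auto simp: e_def u_def\<close>)
qed

lemma ser_cmult:
 assumes "ser S r Q N z" "0 <= r"
 shows "ser S r Q (\<bar>a\<bar> * N) (\<lambda>x. a * z x)"
 using ser_mult[OF ser_single[of "{#}" S "\<lambda>w. w = {#}" r a] assms(1), of Q] assms(2) by simp

lemma ser_has_sum:
 fixes z :: "nat => fn"
 assumes "!!n. ser S r Q (N n) (z n)" "(N has_sum K) UNIV" "0 <= r"
  and Z: "!!x. good S r x ==> ((\<lambda>n. z n x) has_sum Z x) UNIV"
 shows "ser S r Q K Z"
proof -
 have "\<forall>n. \<exists>c w L. ser_rep S r Q (z n) c w L \<and> L <= N n"
  using assms(1) unfolding ser_def by blast
 then obtain c w L where rep: "!!n. ser_rep S r Q (z n) (c n) (w n) (L n)" and LN: "!!n. L n <= N n" by metis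
 note cw = ser_repD(1)[OF rep] ser_repD(2)[OF rep] ser_repD(3)[OF rep] LN ser_repD(4)[OF rep]
 define e where "e = (\<lambda>(n, i). c n i)"
 define u where "u = (\<lambda>(n, i). w n i)"
 have nn: "0 <= L n" for n using has_sum_nonneg[OF cw(3)] assms(3) by auto
 have "L summable_on UNIV"
  by (rule summable_on_comparison_test[OF has_sum_imp_summable[OF assms(2)]]) (use cw(4) nn in auto)
 then obtain M where M: "(L has_sum M) UNIV" unfolding summable_on_def by blast
 have "M <= K" by (rule has_sum_mono[OF M assms(2) cw(4)])
 have i1: "((\<lambda>i. \<bar>e (n, i)\<bar> * r ^ size (u (n, i))) has_sum L n) UNIV" for n
  using cw(3) by (simp add: e_def u_def)
 have s1: "(\<lambda>p. \<bar>e p\<bar> * r ^ size (u p)) summable_on Sigma UNIV (\<lambda>_. UNIV)"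
  by (rule summable_on_SigmaI[OF i1 has_sum_imp_summable[OF M]]) (use assms(3) in auto)
 have words: "set_mset (u p) \<subseteq> S" for p using cw(1) by (auto simp: u_def split: prod.splits)
 have h2: "((\<lambda>p. e p * mp (u p) x) has_sum Z x) (Sigma UNIV (\<lambda>_. UNIV))" if "good S r x" for x
  by (rule has_sum_SigmaI[OF _ Z[OF that] words_summable[OF s1 words that]])
    (use cw(5)[OF that] in \<open>simp add: e_def u_def\<close>)
 show ?thesis
  by (rule serI[OF _ _ _ has_sum_SigmaI[OF i1 M s1] \<open>M <= K\<close> h2])
    (use words cw(2) in \<open>auto simp: e_def u_def\<close>)
qed

lemma ser_power:
 assumes "ser S r Q N z" "0 <= r" "!!u v. Q u ==> Q v ==> Q (u + v)"
 shows "ser S r Q (N ^ Suc n) (\<lambda>x. z x ^ Suc n)"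
proof (induct n)
 case (Suc n)
 have "ser S r Q (N * N ^ Suc n) (\<lambda>x. z x * z x ^ Suc n)"
  by (rule ser_mult[of S r Q N z Q]) (use Suc assms in auto)
 then show ?case by simp
qed (use assms(1) in simp)

text \<open>The majorant of the sum is dominated by the geometric series in \<open>N\<close>.\<close>

lemma ser_power_series:
 fixes \<phi> :: "nat => real"
 assumes "ser S r Q N z" "0 <= r" "!!u v. Q u ==> Q v ==> Q (u + v)" "0 <= N" "N < 1"
  and \<phi>: "!!n. \<bar>\<phi> n\<bar> <= 1"
  and Z: "!!x. good S r x ==> (\<lambda>n. \<phi> n * z x ^ Suc n) sums Z x"
 shows "ser S r Q (N / (1 - N)) Z"
proof (rule ser_has_sum[of S r Q "\<lambda>n. N ^ Suc n" "\<lambda>n x. \<phi> n * z x ^ Suc n"])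
 show "ser S r Q (N ^ Suc n) (\<lambda>x. \<phi> n * z x ^ Suc n)" for n
  by (rule ser_mono[OF ser_cmult[where a = "\<phi> n", OF ser_power[where n = n, OF assms(1-3)] assms(2)]])
    (use assms(2,4) \<phi> in \<open>auto intro!: mult_left_le_one_le\<close>)
 have "(\<lambda>n. N * N ^ n) sums (N * (1 / (1 - N)))"
  using assms(4,5) by (intro sums_mult geometric_sums) auto
 then show "((\<lambda>n. N ^ Suc n) has_sum (N / (1 - N))) UNIV"
  using assms(4) by (intro sums_nonneg_imp_has_sum) auto
 show "((\<lambda>n. \<phi> n * z x ^ Suc n) has_sum Z x) UNIV" if "good S r x" for x
 proof (rule norm_summable_imp_has_sum[OF _ Z[OF that]])
  have zN: "\<bar>z x\<bar> <= N" using ser_norm[OF assms(1) that] .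
  have "norm (\<phi> n * z x ^ Suc n) <= N ^ Suc n" for n
  proof -
   have "\<bar>\<phi> n\<bar> * \<bar>z x\<bar> ^ Suc n <= 1 * N ^ Suc n"
    by (intro mult_mono \<phi> power_mono zN) auto
   then show ?thesis by (simp only: real_norm_def abs_mult power_abs mult_1)
  qed
  moreover have "summable (\<lambda>n. N ^ Suc n)" using assms(4,5) summable_Suc_iff[of "\<lambda>n. N ^ n"] summable_geometric[of N] by simp
  ultimately show "summable (\<lambda>n. norm (\<phi> n * z x ^ Suc n))"
   by (rule_tac summable_comparison_test'[of "\<lambda>n. N ^ Suc n" 0]) (simp_all only: real_norm_def abs_abs)
 qed
qed (use assms in auto)

text \<open>Lowering the bound on the letters makes the majorant of a series without constant term as
 small as desired, and infinitesimal letters are eventually below any bound.\<close>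

lemma ser_shrink:
 assumes "ser S r (\<lambda>w. w \<noteq> {#} \<and> Q w) N z" "0 < r" "0 < \<epsilon>"
 obtains r' where "0 < r'" "r' <= r" "ser S r' (\<lambda>w. w \<noteq> {#} \<and> Q w) \<epsilon> z"
proof -
 let ?Q = "\<lambda>w. w \<noteq> {#} \<and> Q w"
 obtain c w K where rep1: "ser_rep S r ?Q z c w K" and KN: "K <= N"
  using assms(1) unfolding ser_def by auto
 note cw = ser_repD(1)[OF rep1] ser_repD(2)[OF rep1] ser_repD(3)[OF rep1] KN ser_repD(4)[OF rep1]
 have K0: "0 <= K" using has_sum_nonneg[OF cw(3)] assms(2) by auto
 define t where "t = min 1 (\<epsilon> / (K + 1))"
 have t: "0 < t" "t <= 1" "t * K <= \<epsilon>"
 proof -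
  show "0 < t" "t <= 1" using K0 assms(3) by (auto simp: t_def)
  have "t * K <= \<epsilon> / (K + 1) * K" using K0 by (intro mult_right_mono) (auto simp: t_def)
  also have "\<dots> <= \<epsilon>" using K0 assms(3) by (simp add: field_simps)
  finally show "t * K <= \<epsilon>" .
 qed
 have le: "\<bar>c i\<bar> * (t * r) ^ size (w i) <= t * (\<bar>c i\<bar> * r ^ size (w i))" for i
 proof (cases "c i = 0")
  case False
  then have "size (w i) \<noteq> 0" using cw(2) by auto
  then have "1 <= size (w i)" by linarith
  then have "t ^ size (w i) <= t ^ 1" using t by (intro power_decreasing) auto
  then have "t ^ size (w i) * (\<bar>c i\<bar> * r ^ size (w i)) <= t * (\<bar>c i\<bar> * r ^ size (w i))"
   using assms(2) by (intro mult_right_mono) auto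
  then show ?thesis by (simp add: power_mult_distrib mult_ac)
 qed simp
 have tK: "((\<lambda>i. t * (\<bar>c i\<bar> * r ^ size (w i))) has_sum t * K) UNIV"
  using cw(3) by (rule has_sum_cmult_right)
 have "(\<lambda>i. \<bar>c i\<bar> * (t * r) ^ size (w i)) summable_on UNIV"
  by (rule summable_on_comparison_test[OF has_sum_imp_summable[OF tK] le]) (use t assms(2) in auto)
 then obtain L where L: "((\<lambda>i. \<bar>c i\<bar> * (t * r) ^ size (w i)) has_sum L) UNIV" unfolding summable_on_def by blast
 have "L <= \<epsilon>" using has_sum_mono[OF L tK le] t by simp
 have tr: "t * r <= r" using t assms(2) by (simp add: mult_left_le_one_le)
 have "good S r x" if "good S (t * r) x" for x using that tr unfolding good_def by fastforce
 then have "ser S (t * r) ?Q \<epsilon> z"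
  by (intro serI[OF _ _ _ L \<open>L <= \<epsilon>\<close>]) (use cw in auto)
 then show thesis using that[of "t * r"] t assms(2) tr by auto
qed

locale mgrp =
 fixes G :: "fn set"
 assumes G_one: "(\<lambda>x. 1) \<in> G"
  and G_mult: "m \<in> G ==> m' \<in> G ==> (\<lambda>x. m x * m' x) \<in> G"
  and G_inverse: "m \<in> G ==> (\<lambda>x. inverse (m x)) \<in> G"
  and G_pos: "m \<in> G ==> eventually (\<lambda>x. 0 < m x) at_top"
  and G_cong: "m \<in> G ==> m \<doteq> m' ==> m' \<in> G"
  and G_cases: "m \<in> G ==> m \<doteq> (\<lambda>x. 1) \<or> vanish m \<or> tinf m"

definition smalls :: "fn set => fn set" where "smalls G = {m \<in> G. vanish m}"

text \<open>\<open>AQ G T f\<close>: eventually \<open>f\<close> is a monomial times a series in infinitesimal monomials, and all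
 monomials of the product have the property \<open>T\<close>.\<close>

definition AQ :: "fn set => (fn => bool) => fn => bool" where
 "AQ G T f \<longleftrightarrow> (\<exists>M S r N z. M \<in> G \<and> finite S \<and> S \<subseteq> smalls G \<and> 0 < r \<and>
   ser S r (\<lambda>w. T (\<lambda>x. M x * mp w x)) N z \<and> f \<doteq> (\<lambda>x. M x * z x))"

lemma AQI:
 "M \<in> G ==> finite S ==> S \<subseteq> smalls G ==> 0 < r ==>
  ser S r (\<lambda>w. T (\<lambda>x. M x * mp w x)) N z ==> f \<doteq> (\<lambda>x. M x * z x) ==> AQ G T f"
 unfolding AQ_def by blast

lemma AQE:
 assumes "AQ G T f"
 obtains M S r N z where "M \<in> G" "finite S" "S \<subseteq> smalls G" "0 < r"
  "ser S r (\<lambda>w. T (\<lambda>x. M x * mp w x)) N z" "f \<doteq> (\<lambda>x. M x * z x)"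
 using assms unfolding AQ_def by blast

lemma AQ_cong: "AQ G T f ==> f \<doteq> g ==> AQ G T g"
 by (meson AQE AQI eveq_sym eveq_trans)

lemma AQ_group_mono: "AQ G T f ==> G \<subseteq> G' ==> AQ G' T f"
 unfolding AQ_def smalls_def by blast

context mgrp
begin

lemma mp_in_G: "set_mset w \<subseteq> G ==> mp w \<in> G"
proof (induct w)
 case (add s w)
 then have "(\<lambda>x. s x * mp w x) \<in> G" by (intro G_mult) auto
 then show ?case by (simp add: mp_add[abs_def])
qed (simp add: G_one)

lemma smalls_words: "S \<subseteq> smalls G ==> set_mset w \<subseteq> S ==> mp w \<in> G"
 by (rule mp_in_G) (auto simp: smalls_def)

lemma mp_vanish: "S \<subseteq> smalls G ==> set_mset w \<subseteq> S ==> w \<noteq> {#} ==> vanish (mp w)"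
proof (induct w)
 case (add s w)
 have s: "vanish s" using add by (auto simp: smalls_def)
 show ?case
 proof (cases "w = {#}")
  case True
  then show ?thesis using s by (simp add: mp_add[abs_def])
 next
  case False
  then have "vanish (mp w)" using add by auto
  then show ?thesis using vanish_mult[OF s] by (simp add: mp_add[abs_def])
 qed
qed simp

lemma eventually_good:
 assumes "finite S" "S \<subseteq> smalls G" "0 < r"
 shows "eventually (good S r) at_top"
proof -
 have "EV x. 0 < s x \<and> s x <= r" if "s \<in> S" for s
 proof -
  have "s \<in> G" "(s \<longlongrightarrow> 0) at_top" using that assms(2) by (auto simp: smalls_def vanish_def)
  then have "EV x. s x < r" using assms(3) order_tendstoD(2) by blast
  with G_pos[OF \<open>s \<in> G\<close>] show ?thesis by eventually_elim auto
 qed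
 then show ?thesis unfolding good_def using assms(1) by (simp add: eventually_ball_finite)
qed

lemma AQ_mono:
 assumes "AQ G T f" "!!m. m \<in> G ==> T m ==> T' m"
 shows "AQ G T' f"
 using assms(1)
proof (rule AQE)
 fix M S r N z
 assume a: "M \<in> G" "finite S" "S \<subseteq> smalls G" "0 < r" "ser S r (\<lambda>w. T (\<lambda>x. M x * mp w x)) N z"
  "f \<doteq> (\<lambda>x. M x * z x)"
 have "ser S r (\<lambda>w. T' (\<lambda>x. M x * mp w x)) N z"
  by (rule ser_mono[OF a(5)]) (use a assms(2) G_mult smalls_words in auto)
 then show ?thesis using a by (intro AQI)
qed

lemma AQ_monomial:
 assumes "m \<in> G" "T m"
 shows "AQ G T (\<lambda>x. c * m x)"
proof (rule AQI[of m G "{}" 1 T "\<bar>c\<bar> * 1 ^ size {#}" "\<lambda>x. c * mp {#} x"])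
 show "ser {} 1 (\<lambda>w. T (\<lambda>x. m x * mp w x)) (\<bar>c\<bar> * 1 ^ size {#}) (\<lambda>x. c * mp {#} x)"
  using ser_single[of "{#}" "{}" "\<lambda>w. T (\<lambda>x. m x * mp w x)" 1 c] assms by simp
qed (use assms in \<open>auto simp: mult.commute\<close>)

lemma AQ_cmult: "AQ G T f ==> AQ G T (\<lambda>x. a * f x)"
proof (erule AQE)
 fix M S r N z
 assume a: "M \<in> G" "finite S" "S \<subseteq> smalls G" "0 < r" "ser S r (\<lambda>w. T (\<lambda>x. M x * mp w x)) N z"
  "f \<doteq> (\<lambda>x. M x * z x)"
 show "AQ G T (\<lambda>x. a * f x)"
  by (rule AQI[OF a(1-4) ser_cmult[where a = a, OF a(5)]])
    (use a eveq_mult[OF eveq_refl a(6), of "\<lambda>_. a"] in \<open>auto simp: mult_ac\<close>)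
qed

lemma AQ_zero: "AQ G T (\<lambda>x. 0)"
proof (rule AQI[of "\<lambda>_. 1" G "{}" 1 T 0 "\<lambda>x. 0"])
 show "ser {} 1 (\<lambda>w. T (\<lambda>x. 1 * mp w x)) 0 (\<lambda>x. 0)"
  by (rule serI[of "{}::nat set" _ _ "\<lambda>_. 0"]) auto
qed (auto simp: G_one)

lemma AQ_mult:
 assumes "AQ G T1 f" "AQ G T2 g"
  and T: "!!m m'. m \<in> G ==> m' \<in> G ==> T1 m ==> T2 m' ==> T3 (\<lambda>x. m x * m' x)"
 shows "AQ G T3 (\<lambda>x. f x * g x)"
proof -
 obtain M S r N y where a: "M \<in> G" "finite S" "S \<subseteq> smalls G" "0 < r"
  "ser S r (\<lambda>w. T1 (\<lambda>x. M x * mp w x)) N y" "f \<doteq> (\<lambda>x. M x * y x)" using assms(1) by (rule AQE)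
 obtain M' S' r' N' z where b: "M' \<in> G" "finite S'" "S' \<subseteq> smalls G" "0 < r'"
  "ser S' r' (\<lambda>w. T2 (\<lambda>x. M' x * mp w x)) N' z" "g \<doteq> (\<lambda>x. M' x * z x)" using assms(2) by (rule AQE)
 let ?S = "S \<union> S'" and ?r = "min r r'"
 have y: "ser ?S ?r (\<lambda>w. (\<lambda>x. M x * mp w x) \<in> G \<and> T1 (\<lambda>x. M x * mp w x)) N y"
  by (rule ser_mono[OF a(5)]) (use a b G_mult smalls_words in auto)
 have z: "ser ?S ?r (\<lambda>w. (\<lambda>x. M' x * mp w x) \<in> G \<and> T2 (\<lambda>x. M' x * mp w x)) N' z"
  by (rule ser_mono[OF b(5)]) (use a b G_mult smalls_words in auto)
 have eq: "(\<lambda>x. (M x * mp u x) * (M' x * mp v x)) = (\<lambda>x. (M x * M' x) * mp (u + v) x)" for u v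
  by (simp add: mp_union mult_ac)
 have yz: "ser ?S ?r (\<lambda>w. T3 (\<lambda>x. (M x * M' x) * mp w x)) (N * N') (\<lambda>x. y x * z x)"
 proof (rule ser_mult[OF y z])
  fix u v assume "(\<lambda>x. M x * mp u x) \<in> G \<and> T1 (\<lambda>x. M x * mp u x)"
   "(\<lambda>x. M' x * mp v x) \<in> G \<and> T2 (\<lambda>x. M' x * mp v x)"
  then have "T3 (\<lambda>x. (M x * mp u x) * (M' x * mp v x))" using T by blast
  then show "T3 (\<lambda>x. (M x * M' x) * mp (u + v) x)" unfolding eq .
 qed (use a(4) b(4) in auto)
 show ?thesis
  by (rule AQI[OF _ _ _ _ yz]) (use a b G_mult eveq_mult[OF a(6) b(6)] in \<open>auto simp: mult_ac\<close>)
qed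

lemma AQ_add_aux:
 assumes a: "M \<in> G" "finite S" "S \<subseteq> smalls G" "0 < r"
  "ser S r (\<lambda>w. T (\<lambda>x. M x * mp w x)) N y" "f \<doteq> (\<lambda>x. M x * y x)"
  and b: "M' \<in> G" "finite S'" "S' \<subseteq> smalls G" "0 < r'"
  "ser S' r' (\<lambda>w. T (\<lambda>x. M' x * mp w x)) N' z" "g \<doteq> (\<lambda>x. M' x * z x)"
  and q: "(\<lambda>x. M' x * inverse (M x)) \<doteq> (\<lambda>x. 1) \<or> vanish (\<lambda>x. M' x * inverse (M x))"
  and T: "ev_closed T"
 shows "AQ G T (\<lambda>x. f x + g x)"
proof -
 let ?q = "\<lambda>x. M' x * inverse (M x)"
 define u where "u = (if vanish ?q then {#?q#} else {#})"
 have qG: "?q \<in> G" using a(1) b(1) G_mult G_inverse by blast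
 have ne: "EV x. M x \<noteq> 0" using G_pos[OF a(1)] by eventually_elim auto
 have Mu: "(\<lambda>x. M x * mp u x) \<doteq> M'"
 proof (cases "vanish ?q")
  case True
  then have "mp u = ?q" by (rule_tac ext) (simp add: u_def mp_add)
  then show ?thesis using ne unfolding eveq_def by (auto elim: eventually_mono)
 next
  case False
  then have q1: "EV x. ?q x = 1" using q by (simp add: eveq_def)
  have u1: "mp u = (\<lambda>x. 1)" using False by (simp add: u_def)
  from q1 ne show ?thesis unfolding eveq_def u1 by eventually_elim (simp add: field_simps)
 qed
 let ?S = "S \<union> S' \<union> set_mset u" and ?r = "min r r'"
 have S: "finite ?S" "?S \<subseteq> smalls G" using a b qG by (auto simp: u_def smalls_def)
 have y: "ser ?S ?r (\<lambda>w. T (\<lambda>x. M x * mp w x)) N y"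
  by (rule ser_mono[OF a(5)]) (use a b in auto)
 have z1: "ser ?S ?r (\<lambda>w. T (\<lambda>x. M' x * mp w x)) N' z"
  by (rule ser_mono[OF b(5)]) (use a b in auto)
 have z2: "ser ?S ?r (\<lambda>w. w = u) (\<bar>1\<bar> * ?r ^ size u) (\<lambda>x. 1 * mp u x)" by (rule ser_single) auto
 have z: "ser ?S ?r (\<lambda>w. T (\<lambda>x. M x * mp w x)) (\<bar>1\<bar> * ?r ^ size u * N') (\<lambda>x. 1 * mp u x * z x)"
 proof (rule ser_mult[OF z2 z1])
  fix v w assume v: "v = u" and w: "T (\<lambda>x. M' x * mp w x)"
  have "(\<lambda>x. M x * mp (v + w) x) = (\<lambda>x. (M x * mp u x) * mp w x)" by (simp add: v mp_union mult_ac)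
  moreover have "(\<lambda>x. M' x * mp w x) \<doteq> (\<lambda>x. (M x * mp u x) * mp w x)"
   using eveq_mult[OF eveq_sym[OF Mu] eveq_refl] .
  ultimately show "T (\<lambda>x. M x * mp (v + w) x)" using w ev_closedD[OF T] by metis
 qed (use a(4) b(4) in auto)
 have "(\<lambda>x. f x + g x) \<doteq> (\<lambda>x. M x * y x + M' x * z x)" using eveq_add[OF a(6) b(6)] .
 also have "\<dots> \<doteq> (\<lambda>x. M x * y x + (M x * mp u x) * z x)"
  by (intro eveq_add eveq_mult eveq_refl eveq_sym[OF Mu])
 finally have "(\<lambda>x. f x + g x) \<doteq> (\<lambda>x. M x * (y x + 1 * mp u x * z x))" by (simp add: algebra_simps)
 then show ?thesis using a(1,4) b(4) by (intro AQI[OF _ S _ ser_add[OF y z]]) auto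
qed

lemma AQ_add:
 assumes "AQ G T f" "AQ G T g" and T: "ev_closed T"
 shows "AQ G T (\<lambda>x. f x + g x)"
proof -
 obtain M S r N y where a: "M \<in> G" "finite S" "S \<subseteq> smalls G" "0 < r"
  "ser S r (\<lambda>w. T (\<lambda>x. M x * mp w x)) N y" "f \<doteq> (\<lambda>x. M x * y x)" using assms(1) by (rule AQE)
 obtain M' S' r' N' z where b: "M' \<in> G" "finite S'" "S' \<subseteq> smalls G" "0 < r'"
  "ser S' r' (\<lambda>w. T (\<lambda>x. M' x * mp w x)) N' z" "g \<doteq> (\<lambda>x. M' x * z x)" using assms(2) by (rule AQE)
 have "(\<lambda>x. M' x * inverse (M x)) \<in> G" using a(1) b(1) G_mult G_inverse by blast
 from G_cases[OF this] consider
   "(\<lambda>x. M' x * inverse (M x)) \<doteq> (\<lambda>x. 1) \<or> vanish (\<lambda>x. M' x * inverse (M x))"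
  | "tinf (\<lambda>x. M' x * inverse (M x))" by blast
 then show ?thesis
 proof cases
  case 1
  then show ?thesis by (rule AQ_add_aux[OF a b _ T])
 next
  case 2
  then have "vanish (\<lambda>x. inverse (M' x * inverse (M x)))"
   unfolding tinf_def vanish_def by (rule tendsto_inverse_0_at_top)
  then have "vanish (\<lambda>x. M x * inverse (M' x))" by (simp add: mult.commute)
  then have "AQ G T (\<lambda>x. g x + f x)" by (intro AQ_add_aux[OF b a _ T]) auto
  then show ?thesis by (simp add: add.commute)
 qed
qed

text \<open>A series all of whose monomials are infinitesimal is a series without constant term in
 infinitesimal monomials: by Dickson's lemma finitely many of the infinitesimal monomials divide
 all others, and these are taken as additional letters.\<close>

lemma AQ_small_ser:
 assumes "AQ G (\<lambda>h. vanish h \<and> T h) f" "0 < \<epsilon>"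
 obtains S r z where "finite S" "S \<subseteq> smalls G" "0 < r"
  "ser S r (\<lambda>w. w \<noteq> {#} \<and> T (mp w)) \<epsilon> z" "f \<doteq> z"
proof -
 obtain M S r N z where a: "M \<in> G" "finite S" "S \<subseteq> smalls G" "0 < r"
  "ser S r (\<lambda>w. vanish (\<lambda>x. M x * mp w x) \<and> T (\<lambda>x. M x * mp w x)) N z" "f \<doteq> (\<lambda>x. M x * z x)"
  using assms(1) by (rule AQE)
 obtain c w K where rep: "ser_rep S r (\<lambda>w. vanish (\<lambda>x. M x * mp w x) \<and> T (\<lambda>x. M x * mp w x)) z c w K"
  using a(5) unfolding ser_def by blast
 note cw = ser_repD[OF rep]
 let ?W = "{w. set_mset w \<subseteq> S \<and> vanish (\<lambda>x. M x * mp w x)}"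
 have "wqo_on (\<subseteq>#) ?W" by (rule wqo_on_subset[OF wqo_on_multisets[OF a(2)]]) auto
 then obtain B where B: "finite B" "B \<subseteq> ?W" "!!w. w \<in> ?W ==> \<exists>b\<in>B. b \<subseteq># w"
  by (rule wqo_on_finite_basis) blast
 define \<beta> where "\<beta> w = (SOME b. b \<in> B \<and> b \<subseteq># w)" for w
 have \<beta>: "\<beta> (w i) \<in> B \<and> \<beta> (w i) \<subseteq># w i" if "c i \<noteq> 0" for i
 proof -
  have "w i \<in> ?W" using cw(1,2) that by blast
  then have "\<exists>b. b \<in> B \<and> b \<subseteq># w i" using B(3) by blast
  then show ?thesis unfolding \<beta>_def by (rule someI_ex)
 qed
 define g where "g b = (\<lambda>x. M x * mp b x)" for b
 define w' where "w' i = (if c i = 0 then {#} else add_mset (g (\<beta> (w i))) (w i - \<beta> (w i)))" for i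
 let ?S = "S \<union> g ` B" and ?r = "min r 1"
 define C where "C = (\<Sum>b\<in>B. 1 / r ^ size b)"
 have gB: "g b \<in> smalls G" if "b \<in> B" for b
  using that B(2) a(1) smalls_words[OF a(3)] G_mult by (auto simp: g_def smalls_def)
 have S: "finite ?S" "?S \<subseteq> smalls G" using a B(1) gB by auto
 have mpw: "mp (w' i) = (\<lambda>x. M x * mp (w i) x)" if "c i \<noteq> 0" for i
 proof
  fix x
  have "w i = \<beta> (w i) + (w i - \<beta> (w i))" using \<beta>[OF that] by simp
  then have "mp (w i) x = mp (\<beta> (w i)) x * mp (w i - \<beta> (w i)) x" by (metis mp_union)
  then show "mp (w' i) x = M x * mp (w i) x" using that by (simp add: w'_def mp_add g_def mult_ac)
 qed
 have wS: "set_mset (w' i) \<subseteq> ?S" for i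
 proof (cases "c i = 0")
  case False
  have "set_mset (w i - \<beta> (w i)) \<subseteq> S" using cw(1)[of i] by (meson in_diffD subset_iff)
  then show ?thesis using \<beta>[OF False] False by (auto simp: w'_def)
 qed (simp add: w'_def)
 have le: "\<bar>c i\<bar> * ?r ^ size (w' i) <= C * (\<bar>c i\<bar> * r ^ size (w i))" for i
 proof (cases "c i = 0")
  case False
  let ?b = "\<beta> (w i)"
  have b: "?b \<in> B" "size ?b <= size (w i)" using \<beta>[OF False] by (auto simp: size_mset_mono)
  have "?r ^ size (w' i) = ?r * ?r ^ (size (w i) - size ?b)"
   using False \<beta>[OF False] by (simp add: w'_def size_Diff_submset)
  also have "\<dots> <= 1 * r ^ (size (w i) - size ?b)"
   using a(4) by (intro mult_mono power_mono) auto
  also have "\<dots> = 1 / r ^ size ?b * r ^ size (w i)"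
   using a(4) b(2) by (simp add: power_diff)
  also have "\<dots> <= C * r ^ size (w i)"
   unfolding C_def using a(4) b(1) B(1)
   by (intro mult_right_mono member_le_sum[of ?b B "\<lambda>b. 1 / r ^ size b"]) auto
  finally have "\<bar>c i\<bar> * ?r ^ size (w' i) <= \<bar>c i\<bar> * (C * r ^ size (w i))" by (rule mult_left_mono) simp
  then show ?thesis by (simp add: mult_ac)
 qed simp
 have CK: "((\<lambda>i. C * (\<bar>c i\<bar> * r ^ size (w i))) has_sum C * K) UNIV"
  using cw(3) by (rule has_sum_cmult_right)
 have "(\<lambda>i. \<bar>c i\<bar> * ?r ^ size (w' i)) summable_on UNIV"
  by (rule summable_on_comparison_test[OF has_sum_imp_summable[OF CK] le]) (use a(4) in auto)
 then obtain L where L: "((\<lambda>i. \<bar>c i\<bar> * ?r ^ size (w' i)) has_sum L) UNIV" unfolding summable_on_def by blast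
 have "ser ?S ?r (\<lambda>w. w \<noteq> {#} \<and> T (mp w)) L (\<lambda>x. M x * z x)"
 proof (rule serI[OF _ _ _ L order.refl])
  fix x assume "good ?S ?r x"
  then have "good S r x" unfolding good_def by auto
  then have "((\<lambda>i. M x * (c i * mp (w i) x)) has_sum M x * z x) UNIV"
   using cw(4) by (intro has_sum_cmult_right)
  moreover have "M x * (c i * mp (w i) x) = c i * mp (w' i) x" for i
   using mpw[of i] by (cases "c i = 0") (auto simp: mult_ac)
  ultimately show "((\<lambda>i. c i * mp (w' i) x) has_sum M x * z x) UNIV" by simp
 qed (use wS cw(2) mpw in \<open>auto simp: w'_def\<close>)
 then obtain r' where "0 < r'" "ser ?S r' (\<lambda>w. w \<noteq> {#} \<and> T (mp w)) \<epsilon> (\<lambda>x. M x * z x)"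
  using ser_shrink[of ?S ?r "\<lambda>w. T (mp w)" L _ \<epsilon>] a(4) assms(2) by auto
 then show thesis using that S a(6) by blast
qed

lemma AQ_of_small_ser:
 assumes "finite S" "S \<subseteq> smalls G" "0 < r" "ser S r (\<lambda>w. w \<noteq> {#} \<and> T (mp w)) N z" "f \<doteq> z"
 shows "AQ G (\<lambda>h. vanish h \<and> T h) f"
proof (rule AQI[OF G_one assms(1-3)])
 show "ser S r (\<lambda>w. vanish (\<lambda>x. 1 * mp w x) \<and> T (\<lambda>x. 1 * mp w x)) N z"
  by (rule ser_mono[OF assms(4)]) (use assms mp_vanish[OF assms(2)] in auto)
qed (use assms in auto)

lemma AQ_vanish:
 assumes "AQ G vanish f"
 shows "vanish f"
 unfolding vanish_def
proof (rule tendstoI)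
 fix e :: real assume "0 < e"
 have "AQ G (\<lambda>h. vanish h \<and> True) f" using assms by simp
 then obtain S r z where a: "finite S" "S \<subseteq> smalls G" "0 < r"
  "ser S r (\<lambda>w. w \<noteq> {#} \<and> True) (e / 2) z" "f \<doteq> z" by (rule AQ_small_ser[of _ _ "e/2"]) (use \<open>0 < e\<close> in auto)
 have "EV x. good S r x" using eventually_good[OF a(1-3)] .
 with a(5)[unfolded eveq_def] show "EV x. dist (f x) 0 < e"
 proof eventually_elim
  case (elim x)
  then show ?case using ser_norm[OF a(4), of x] \<open>0 < e\<close> by auto
 qed
qed

text \<open>A series without constant term has arbitrarily small majorant after shrinking, so that it
 can be substituted into a power series. Instances are the expansions of \<open>ln (1 + f)\<close>, \<open>exp f\<close>
 and \<open>1 / (1 + f)\<close>.\<close>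

lemma AQ_power_series:
 fixes \<phi> :: "nat => real"
 assumes "AQ G (\<lambda>h. vanish h \<and> T h) f"
  and T: "!!g h. T g ==> T h ==> T (\<lambda>x. g x * h x)"
  and \<phi>: "!!n. \<bar>\<phi> n\<bar> <= 1" "!!t. \<bar>t\<bar> <= 1/2 ==> (\<lambda>n. \<phi> n * t ^ Suc n) sums F t"
 shows "AQ G (\<lambda>h. vanish h \<and> T h) (\<lambda>x. F (f x))"
proof -
 obtain S r z where a: "finite S" "S \<subseteq> smalls G" "0 < r"
  "ser S r (\<lambda>w. w \<noteq> {#} \<and> T (mp w)) (1/2) z" "f \<doteq> z" by (rule AQ_small_ser[OF assms(1), of "1/2"]) auto
 have "ser S r (\<lambda>w. w \<noteq> {#} \<and> T (mp w)) ((1/2) / (1 - 1/2)) (\<lambda>x. F (z x))"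
 proof (rule ser_power_series[OF a(4), of \<phi>])
  show "u + v \<noteq> {#} \<and> T (mp (u + v))" if "u \<noteq> {#} \<and> T (mp u)" "v \<noteq> {#} \<and> T (mp v)" for u v
   using that T[of "mp u" "mp v"] by (simp add: mp_union[abs_def])
  show "(\<lambda>n. \<phi> n * z x ^ Suc n) sums F (z x)" if "good S r x" for x
   using ser_norm[OF a(4) that] by (rule \<phi>(2))
 qed (use a(3) \<phi>(1) in auto)
 then show ?thesis by (rule AQ_of_small_ser[OF a(1-3)]) (rule eveq_comp[OF a(5)])
qed

lemma AQ_ln:
 assumes "AQ G (\<lambda>h. vanish h \<and> T h) f" "!!g h. T g ==> T h ==> T (\<lambda>x. g x * h x)"
 shows "AQ G (\<lambda>h. vanish h \<and> T h) (\<lambda>x. ln (1 + f x))"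
proof (rule AQ_power_series[OF assms, of "\<lambda>n. (-1) ^ n / real (Suc n)" "\<lambda>t. ln (1 + t)"])
 fix t :: real assume t: "\<bar>t\<bar> <= 1/2"
 have "(\<lambda>n. - ((-t) ^ n) / real n) sums ln (1 + t)" using t by (intro ln_series') auto
 then have "(\<lambda>n. - ((-t) ^ Suc n) / real (Suc n)) sums ln (1 + t)"
  by (subst sums_Suc_iff) simp
 moreover have "(\<lambda>n. - ((-t) ^ Suc n) / real (Suc n)) = (\<lambda>n. (-1) ^ n / real (Suc n) * t ^ Suc n)"
  by (rule ext) (simp add: power_minus[of t])
 ultimately show "(\<lambda>n. (-1) ^ n / real (Suc n) * t ^ Suc n) sums ln (1 + t)" by (simp only:)
qed auto

lemma AQ_exp:
 assumes "AQ G (\<lambda>h. vanish h \<and> T h) f" "!!g h. T g ==> T h ==> T (\<lambda>x. g x * h x)"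
 shows "AQ G (\<lambda>h. vanish h \<and> T h) (\<lambda>x. exp (f x) - 1)"
proof (rule AQ_power_series[OF assms, of "\<lambda>n. 1 / fact (Suc n)" "\<lambda>t. exp t - 1"])
 show "\<bar>1 / fact (Suc n)\<bar> <= (1 :: real)" for n using fact_ge_1[of "Suc n", where 'a = real] by (simp add: field_simps)
 fix t :: real
 have "(\<lambda>n. t ^ n /\<^sub>R fact n) sums exp t" by (rule exp_converges)
 then have "(\<lambda>n. t ^ Suc n /\<^sub>R fact (Suc n)) sums (exp t - t ^ 0 /\<^sub>R fact 0)" by (subst sums_Suc_iff) simp
 then show "(\<lambda>n. 1 / fact (Suc n) * t ^ Suc n) sums (exp t - 1)" by (simp add: divide_inverse mult_ac)
qed auto

lemma AQ_reciprocal: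
 assumes "AQ G vanish f"
 shows "AQ G vanish (\<lambda>x. 1 / (1 + f x) - 1)"
proof -
 have "AQ G (\<lambda>h. vanish h \<and> True) (\<lambda>x. 1 / (1 + f x) - 1)"
 proof (rule AQ_power_series[of "\<lambda>_. True" f "\<lambda>n. (-1) ^ Suc n" "\<lambda>t. 1 / (1 + t) - 1"])
  fix t :: real assume t: "\<bar>t\<bar> <= 1/2"
  then have "(\<lambda>n. (-t) * (-t) ^ n) sums ((-t) * (1 / (1 - (-t))))"
   by (intro sums_mult geometric_sums) auto
  moreover have "(-t) * (1 / (1 - (-t))) = 1 / (1 + t) - 1" using t by (simp add: field_simps abs_if split: if_splits)
  moreover have "(\<lambda>n. (-t) * (-t) ^ n) = (\<lambda>n. (-1) ^ Suc n * t ^ Suc n)"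
  proof
   fix n
   have "(-t) * (-t) ^ n = ((-1) * t) ^ Suc n" by simp
   then show "(-t) * (-t) ^ n = (-1) ^ Suc n * t ^ Suc n" by (simp only: power_mult_distrib)
  qed
  ultimately show "(\<lambda>n. (-1) ^ Suc n * t ^ Suc n) sums (1 / (1 + t) - 1)" by (simp only:)
 qed (use assms in auto)
 then show ?thesis by simp
qed

end

lemma ser_restrict:
 assumes "ser S r Q N z" "0 <= r"
 obtains z1 where "ser S r (\<lambda>w. Q w \<and> R w) N z1" "ser S r (\<lambda>w. Q w \<and> \<not> R w) N (\<lambda>x. z x - z1 x)"
proof -
 obtain c w K where rep: "ser_rep S r Q z c w K" and KN: "K <= N" using assms(1) unfolding ser_def by blast
 note cw = ser_repD[OF rep]
 have part: "ser S r (\<lambda>w. Q w \<and> P w) N (\<lambda>x. \<Sum>\<^sub>\<infinity>i\<in>{i. P (w i)}. c i * mp (w i) x)" for P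
 proof -
  let ?I = "{i. P (w i)}"
  have sm: "(\<lambda>i. \<bar>c i\<bar> * r ^ size (w i)) summable_on ?I"
   by (rule summable_on_subset_banach[OF has_sum_imp_summable[OF cw(3)]]) auto
  then obtain L where L: "((\<lambda>i. \<bar>c i\<bar> * r ^ size (w i)) has_sum L) ?I" unfolding summable_on_def by blast
  have "L <= K" by (rule has_sum_mono2[OF L cw(3)]) (use assms(2) in auto)
  then have "L <= N" using KN by simp
  show ?thesis
   by (rule serI[OF _ _ _ L \<open>L <= N\<close>])
     (use cw words_summable[OF sm cw(1)] in \<open>auto intro: has_sum_infsum\<close>)
 qed
 let ?z1 = "\<lambda>x. \<Sum>\<^sub>\<infinity>i\<in>{i. R (w i)}. c i * mp (w i) x"
 let ?z2 = "\<lambda>x. \<Sum>\<^sub>\<infinity>i\<in>{i. \<not> R (w i)}. c i * mp (w i) x"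
 have split: "?z2 x = z x - ?z1 x" if "good S r x" for x
 proof -
  have s: "(\<lambda>i. c i * mp (w i) x) summable_on A" for A
   by (rule summable_on_subset_banach[OF has_sum_imp_summable[OF cw(4)[OF that]]]) auto
  have "infsum (\<lambda>i. c i * mp (w i) x) ({i. R (w i)} \<union> {i. \<not> R (w i)}) = ?z1 x + ?z2 x"
   by (intro infsum_Un_disjoint s) auto
  moreover have "{i. R (w i)} \<union> {i. \<not> R (w i)} = UNIV" by auto
  ultimately show ?thesis using infsumI[OF cw(4)[OF that]] by simp
 qed
 have "ser S r (\<lambda>w. Q w \<and> \<not> R w) N (\<lambda>x. z x - ?z1 x)"
 proof -
  obtain d v L where r2: "ser_rep S r (\<lambda>w. Q w \<and> \<not> R w) ?z2 d v L" "L <= N"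
   using part[of "\<lambda>w. \<not> R w"] unfolding ser_def by blast
  have "ser_rep S r (\<lambda>w. Q w \<and> \<not> R w) (\<lambda>x. z x - ?z1 x) d v L"
   using r2(1) split unfolding ser_rep_def by simp
  then show ?thesis using r2(2) unfolding ser_def by blast
 qed
 then show thesis using part[of R] that by blast
qed

context mgrp
begin

lemma eventually_ne: "m \<in> G ==> EV x. m x \<noteq> 0"
 by (drule G_pos) (auto elim: eventually_mono)

lemma eveq_cancel:
 assumes "(\<lambda>x. m x * f x) \<doteq> (\<lambda>x. m' x * g x)" "m \<doteq> m'" "m \<in> G"
 shows "f \<doteq> g"
 using assms(1,2) eventually_ne[OF assms(3)] unfolding eveq_def by eventually_elim simp

text \<open>Eventually equal monomials over a finite set of letters are equal from a point on that does
 not depend on the monomials: the pairs of words with eventually equal monomials form a monoid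
 that is closed under differences, and such a monoid is generated by its finitely many minimal
 elements.\<close>

lemma uniform_threshold:
 assumes "finite S" "S \<subseteq> G"
 obtains X where "!!u v x. set_mset u \<subseteq> S ==> set_mset v \<subseteq> S ==> mp u \<doteq> mp v ==> X <= x ==> mp u x = mp v x"
proof -
 let ?M = "{w. set_mset w \<subseteq> S}"
 let ?R = "{(u, v). u \<in> ?M \<and> v \<in> ?M \<and> mp u \<doteq> mp v} - {({#}, {#})}"
 have "wqo_on (rel_prod (\<subseteq>#) (\<subseteq>#)) ?R"
  by (rule wqo_on_subset[OF wqo_on_prod[OF wqo_on_multisets wqo_on_multisets]]) (use assms(1) in auto)
 then obtain B where B: "finite B" "B \<subseteq> ?R" "!!p. p \<in> ?R ==> \<exists>b\<in>B. rel_prod (\<subseteq>#) (\<subseteq>#) b p"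
  by (rule wqo_on_finite_basis) blast
 have "\<forall>b\<in>B. EV x. mp (fst b) x = mp (snd b) x" using B(2) unfolding eveq_def by auto
 then have "EV x. \<forall>b\<in>B. mp (fst b) x = mp (snd b) x" using B(1) by (simp add: eventually_ball_finite)
 then obtain X where X: "!!x b. X <= x ==> b \<in> B ==> mp (fst b) x = mp (snd b) x"
  unfolding eventually_at_top_linorder by blast
 have "mp u x = mp v x" if "X <= x" "set_mset u \<subseteq> S" "set_mset v \<subseteq> S" "mp u \<doteq> mp v" for u v x
  using that
 proof (induct "size u + size v" arbitrary: u v rule: less_induct)
  case less
  show ?case
  proof (cases "u = {#} \<and> v = {#}")
   case False
   then have "(u, v) \<in> ?R" using less.prems by auto
   from B(3)[OF this] obtain b where "b \<in> B" "rel_prod (\<subseteq>#) (\<subseteq>#) b (u, v)" by auto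
   then obtain u0 v0 where b: "(u0, v0) \<in> B" "u0 \<subseteq># u" "v0 \<subseteq># v" by (cases b) auto
   have b': "mp u0 \<doteq> mp v0" "set_mset u0 \<subseteq> S" "u0 \<noteq> {#} \<or> v0 \<noteq> {#}" using b(1) B(2) by auto
   have uv: "u = u0 + (u - u0)" "v = v0 + (v - v0)" using b by auto
   have e: "mp u y = mp u0 y * mp (u - u0) y" "mp v y = mp v0 y * mp (v - v0) y" for y
    using uv mp_union by metis+
   have "(\<lambda>y. mp u0 y * mp (u - u0) y) \<doteq> (\<lambda>y. mp v0 y * mp (v - v0) y)"
    using less.prems(4) unfolding eveq_def e by simp
   moreover have "mp u0 \<in> G" using b'(2) assms(2) by (intro mp_in_G) (rule subset_trans)
   ultimately have "mp (u - u0) \<doteq> mp (v - v0)" using eveq_cancel[OF _ b'(1)] by simp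
   moreover have "size (u - u0) + size (v - v0) < size u + size v"
    using b b'(3) size_mset_mono[OF b(2)] size_mset_mono[OF b(3)] nonempty_has_size[of u0] nonempty_has_size[of v0]
    by (auto simp: size_Diff_submset)
   moreover have "set_mset (u - u0) \<subseteq> S" "set_mset (v - v0) \<subseteq> S"
    using less.prems(2,3) by (meson in_diffD subset_iff)+
   ultimately have "mp (u - u0) x = mp (v - v0) x" using less.hyps[of "u - u0" "v - v0"] less.prems(1) by simp
   moreover have "mp u0 x = mp v0 x" using X[OF less.prems(1) b(1)] by simp
   ultimately show ?thesis by (simp add: e)
  qed simp
 qed
 then show thesis using that by blast
qed

text \<open>By the uniform threshold the words eventually all denote the same function at once, so
 that their coefficients can be added.\<close>

lemma ser_one_monomial:
 assumes S: "finite S" "S \<subseteq> smalls G" "0 < r" and z: "ser S r Q N z"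
  and one: "!!u v. set_mset u \<subseteq> S ==> set_mset v \<subseteq> S ==> Q u ==> Q v ==> mp u \<doteq> mp v"
 shows "z \<doteq> (\<lambda>x. 0) \<or> (\<exists>a v. set_mset v \<subseteq> S \<and> Q v \<and> z \<doteq> (\<lambda>x. a * mp v x))"
proof -
 obtain c w K where rep: "ser_rep S r Q z c w K" using z unfolding ser_def by blast
 note cw = ser_repD[OF rep]
 obtain X where X: "!!u v x. set_mset u \<subseteq> S ==> set_mset v \<subseteq> S ==> mp u \<doteq> mp v ==> X <= x ==> mp u x = mp v x"
  by (rule uniform_threshold[of S]) (use S in \<open>auto simp: smalls_def\<close>)
 have ev: "EV x. good S r x \<and> X <= x"
  using eventually_good[OF S] eventually_ge_at_top by (rule eventually_conj)
 show ?thesis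
 proof (cases "\<exists>i. c i \<noteq> 0")
  case False
  then have "z x = 0" if "good S r x" for x using infsumI[OF cw(4)[OF that]] by simp
  then have "z \<doteq> (\<lambda>x. 0)" using ev unfolding eveq_def by (auto elim: eventually_mono)
  then show ?thesis ..
 next
  case True
  then obtain j where j: "c j \<noteq> 0" by blast
  let ?v = "w j"
  have "z x = (\<Sum>\<^sub>\<infinity>i. c i) * mp ?v x" if "good S r x" "X <= x" for x
  proof -
   have "c i * mp (w i) x = c i * mp ?v x" for i
    using X[OF cw(1) cw(1) one[OF cw(1) cw(1) cw(2) cw(2)] that(2), of i j] j by (cases "c i = 0") auto
   then have "(\<lambda>i. c i * mp (w i) x) = (\<lambda>i. c i * mp ?v x)" by (rule ext)
   then have "((\<lambda>i. c i * mp ?v x) has_sum z x) UNIV" using cw(4)[OF that(1)] by (simp only:)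
   then have "z x = (\<Sum>\<^sub>\<infinity>i. c i * mp ?v x)" by (rule infsumI[symmetric])
   also have "\<dots> = (\<Sum>\<^sub>\<infinity>i. c i) * mp ?v x" by (rule infsum_cmult_left')
   finally show ?thesis .
  qed
  then have "z \<doteq> (\<lambda>x. (\<Sum>\<^sub>\<infinity>i. c i) * mp ?v x)" using ev unfolding eveq_def by (auto elim: eventually_mono)
  then show ?thesis using cw(1,2) j by blast
 qed
qed

lemma G_compare:
 assumes "m \<in> G" "m' \<in> G"
 shows "m \<doteq> m' \<or> vanish (\<lambda>x. m x * inverse (m' x)) \<or> vanish (\<lambda>x. m' x * inverse (m x))"
proof -
 from G_cases[OF G_mult[OF assms(1) G_inverse[OF assms(2)]]] show ?thesis
 proof (elim disjE)
  assume "(\<lambda>x. m x * inverse (m' x)) \<doteq> (\<lambda>x. 1)"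
  then have "m \<doteq> m'" unfolding eveq_def using eventually_ne[OF assms(2)]
   by eventually_elim (simp add: field_simps)
  then show ?thesis ..
 next
  assume "tinf (\<lambda>x. m x * inverse (m' x))"
  then have "vanish (\<lambda>x. inverse (m x * inverse (m' x)))"
   unfolding tinf_def vanish_def by (rule tendsto_inverse_0_at_top)
  then show ?thesis by (simp add: mult.commute)
 qed simp
qed

text \<open>The leading term: the monomials of a series are well-ordered downwards, again by Dickson's
 lemma, so there is a largest monomial whose total coefficient is not zero, unless the series
 vanishes.\<close>

lemma leading_term:
 assumes f: "AQ G T f" and T: "ev_closed T"
 shows "f \<doteq> (\<lambda>x. 0) \<or> (\<exists>c m d. c \<noteq> 0 \<and> m \<in> G \<and> T m \<and>
  AQ G (\<lambda>h. vanish h \<and> T (\<lambda>x. m x * h x)) d \<and> f \<doteq> (\<lambda>x. c * m x * (1 + d x)))"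
proof -
 obtain M S r N z where a: "M \<in> G" "finite S" "S \<subseteq> smalls G" "0 < r"
  "ser S r (\<lambda>w. T (\<lambda>x. M x * mp w x)) N z" "f \<doteq> (\<lambda>x. M x * z x)"
  using f by (rule AQE)
 let ?Q = "\<lambda>w. T (\<lambda>x. M x * mp w x)"
 obtain c w K where rep: "ser_rep S r ?Q z c w K" using a(5) unfolding ser_def by blast
 note cw = ser_repD[OF rep]
 obtain X where X: "!!u v x. set_mset u \<subseteq> S ==> set_mset v \<subseteq> S ==> mp u \<doteq> mp v ==> X <= x ==> mp u x = mp v x"
  by (rule uniform_threshold[of S]) (use a in \<open>auto simp: smalls_def\<close>)
 have ev: "EV x. good S r x \<and> X <= x"
  using eventually_good[OF a(2-4)] eventually_ge_at_top by (rule eventually_conj)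
 \<comment> \<open>A canonical word for every monomial.\<close>
 define \<kappa> where "\<kappa> u = (SOME v. set_mset v \<subseteq> S \<and> mp v \<doteq> mp u)" for u
 have \<kappa>: "set_mset (\<kappa> u) \<subseteq> S \<and> mp (\<kappa> u) \<doteq> mp u" if "set_mset u \<subseteq> S" for u
  unfolding \<kappa>_def by (rule someI[of _ u]) (use that in simp)
 have \<kappa>_eq: "\<kappa> u = \<kappa> v" if "mp u \<doteq> mp v" for u v
 proof -
  have "(\<lambda>t. set_mset t \<subseteq> S \<and> mp t \<doteq> mp u) = (\<lambda>t. set_mset t \<subseteq> S \<and> mp t \<doteq> mp v)"
   using that eveq_trans eveq_sym by blast
  then show ?thesis unfolding \<kappa>_def by simp
 qed
 define k where "k i = \<kappa> (w i)" for i
 have k: "set_mset (k i) \<subseteq> S" "mp (k i) \<doteq> mp (w i)" for i unfolding k_def using \<kappa>[OF cw(1)] by auto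
 have kw: "mp (w i) x = mp (k i) x" if "X <= x" for i x
  using X[OF k(1) cw(1) k(2) that] by simp
 define A where "A v = (\<Sum>\<^sub>\<infinity>i\<in>{i. k i = v}. c i)" for v
 have regroup: "((\<lambda>v. A v * mp v x) has_sum y) V"
  if x: "good S r x" "X <= x" and y: "((\<lambda>i. c i * mp (w i) x) has_sum y) {i. k i \<in> V}" for x y V
 proof -
  let ?h = "\<lambda>i. (k i, i)"
  have "((\<lambda>(v, i). c i * mp (w i) x) has_sum y) (?h ` {i. k i \<in> V})"
   using y by (subst has_sum_reindex) (auto simp: inj_on_def comp_def)
  moreover have "?h ` {i. k i \<in> V} = Sigma V (\<lambda>v. {i. k i = v})" by auto
  ultimately have sg: "((\<lambda>(v, i). c i * mp (w i) x) has_sum y) (Sigma V (\<lambda>v. {i. k i = v}))" by simp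
  show ?thesis
  proof (rule has_sum_Sigma'[OF sg])
   fix v assume "v \<in> V"
   have "(\<lambda>i. c i * mp (w i) x) summable_on {i. k i = v}"
    by (rule summable_on_subset_banach[OF has_sum_imp_summable[OF cw(4)[OF x(1)]]]) auto
   then have "((\<lambda>i. c i * mp (w i) x) has_sum (\<Sum>\<^sub>\<infinity>i\<in>{i. k i = v}. c i * mp (w i) x)) {i. k i = v}"
    by (rule has_sum_infsum)
   moreover have "(\<Sum>\<^sub>\<infinity>i\<in>{i. k i = v}. c i * mp (w i) x) = (\<Sum>\<^sub>\<infinity>i\<in>{i. k i = v}. c i * mp v x)"
    by (rule infsum_cong) (use kw[OF x(2)] in auto)
   moreover have "\<dots> = A v * mp v x" unfolding A_def by (rule infsum_cmult_left')
   ultimately show "((\<lambda>i. case (v, i) of (v, i) => c i * mp (w i) x) has_sum A v * mp v x) {i. k i = v}" by simp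
  qed
 qed
 define V where "V = {v \<in> range k. A v \<noteq> 0}"
 have VS: "set_mset v \<subseteq> S" if "v \<in> V" for v using that k(1) by (auto simp: V_def)
 have VQ: "?Q v" if "v \<in> V" for v
 proof -
  have "\<exists>i. k i = v \<and> c i \<noteq> 0"
  proof (rule ccontr)
   assume "\<not> ?thesis"
   then have "A v = 0" unfolding A_def by (intro infsum_0) auto
   then show False using that by (simp add: V_def)
  qed
  then obtain i where i: "k i = v" "c i \<noteq> 0" by blast
  have "(\<lambda>x. M x * mp (w i) x) \<doteq> (\<lambda>x. M x * mp v x)"
   using eveq_mult[OF eveq_refl eveq_sym[OF k(2)]] i(1) by blast
  then show ?thesis using ev_closedD[OF T] cw(2)[OF i(2)] by blast
 qed
 show ?thesis
 proof (cases "V = {}")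
  case True
  have "z x = 0" if "good S r x" "X <= x" for x
  proof -
   have "((\<lambda>v. A v * mp v x) has_sum z x) (range k)"
    by (rule regroup[OF that]) (use cw(4)[OF that(1)] in auto)
   moreover have "((\<lambda>v. A v * mp v x) has_sum 0) (range k)"
    by (rule has_sum_0) (use True in \<open>auto simp: V_def\<close>)
   ultimately show ?thesis by (rule has_sum_unique)
  qed
  then have "z \<doteq> (\<lambda>x. 0)" using ev unfolding eveq_def by (auto elim: eventually_mono)
  then have "(\<lambda>x. M x * z x) \<doteq> (\<lambda>x. M x * 0)" by (intro eveq_mult) auto
  then have "f \<doteq> (\<lambda>x. 0)" using eveq_trans[OF a(6)] by simp
  then show ?thesis ..
 next
  case False
  let ?gt = "{(u, v). set_mset u \<subseteq> S \<and> set_mset v \<subseteq> S \<and> vanish (\<lambda>x. mp v x * inverse (mp u x))}"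
  have "wf ?gt"
   unfolding wf_iff_no_infinite_down_chain
  proof
   assume "\<exists>s. \<forall>i. (s (Suc i), s i) \<in> ?gt"
   then obtain s where s: "!!i. (s (Suc i), s i) \<in> ?gt" by blast
   then have sS: "set_mset (s i) \<subseteq> S" for i by auto
   have chain: "vanish (\<lambda>x. mp (s i) x * inverse (mp (s j) x))" if "i < j" for i j
    using that
   proof (induct j)
    case (Suc j)
    show ?case
    proof (cases "i = j")
     case False
     then have "vanish (\<lambda>x. mp (s i) x * inverse (mp (s j) x))" using Suc by simp
     moreover have "vanish (\<lambda>x. mp (s j) x * inverse (mp (s (Suc j)) x))" using s[of j] by simp
     ultimately have "vanish (\<lambda>x. (mp (s i) x * inverse (mp (s j) x)) * (mp (s j) x * inverse (mp (s (Suc j)) x)))"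
      by (rule vanish_mult)
     moreover have "mp (s j) \<in> G" using smalls_words[OF a(3) sS] .
     ultimately show ?thesis
      by (elim ev_closedD[OF ev_closed_vanish, rotated])
        (use eventually_ne[of "mp (s j)"] in \<open>auto simp: eveq_def field_simps elim!: eventually_mono\<close>)
    qed (use s[of j] in auto)
   qed simp
   obtain i j where ij: "i < j" "s i \<subseteq># s j"
    by (rule wqo_onD[where s = s, OF wqo_on_multisets[OF a(2)]]) (use sS in auto)
   have e: "mp (s j) x = mp (s i) x * mp (s j - s i) x" for x
    by (metis ij(2) mp_union subset_mset.add_diff_inverse)
   have "EV x. mp (s j - s i) x <= 1 \<and> 0 < mp (s j - s i) x"
   proof -
    have "set_mset (s j - s i) \<subseteq> S" using sS by (meson in_diffD subset_iff)
    then have "0 < mp (s j - s i) x \<and> mp (s j - s i) x <= 1 ^ size (s j - s i)" if "good S 1 x" for x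
     using mp_bounds[OF that] by blast
    then show ?thesis using eventually_good[OF a(2,3), of 1] by (auto elim: eventually_mono)
   qed
   moreover have "EV x. 0 < mp (s i) x" using G_pos[OF smalls_words[OF a(3) sS]] .
   ultimately have "EV x. 1 <= mp (s i) x * inverse (mp (s j) x)"
    by eventually_elim (simp add: e field_simps)
   moreover have "EV x. mp (s i) x * inverse (mp (s j) x) < 1"
    using chain[OF ij(1)] unfolding vanish_def by (rule order_tendstoD) simp
   ultimately have "EV x. False" by eventually_elim simp
   then show False by simp
  qed
  then obtain v where v: "v \<in> V" "!!u. u \<in> V ==> (u, v) \<notin> ?gt" using False by (meson wfE_min' ex_in_conv)
  have below: "vanish (\<lambda>x. mp u x * inverse (mp v x))" if "u \<in> V" "u \<noteq> v" for u
  proof -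
   have "\<not> mp u \<doteq> mp v"
   proof
    assume eq: "mp u \<doteq> mp v"
    have "u \<in> range k" "v \<in> range k" using that(1) v(1) by (auto simp: V_def)
    then obtain i j where "u = \<kappa> (w i)" "v = \<kappa> (w j)" unfolding k_def by blast
    moreover from this have "mp (w i) \<doteq> mp (w j)"
     using eq \<kappa>[OF cw(1)] by (metis eveq_sym eveq_trans)
    ultimately show False using \<kappa>_eq that(2) by metis
   qed
   moreover have "\<not> vanish (\<lambda>x. mp v x * inverse (mp u x))"
    using v(2)[OF that(1)] VS that(1) v(1) by auto
   ultimately show ?thesis
    using G_compare[of "mp u" "mp v"] smalls_words[OF a(3)] VS that(1) v(1) by blast
  qed
  let ?I = "{i. k i \<in> V - {v}}"
  let ?y = "\<lambda>x. \<Sum>\<^sub>\<infinity>i\<in>?I. c i * mp (w i) x"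
  have sm: "(\<lambda>i. \<bar>c i\<bar> * r ^ size (w i)) summable_on ?I"
   by (rule summable_on_subset_banach[OF has_sum_imp_summable[OF cw(3)]]) auto
  then obtain L where L: "((\<lambda>i. \<bar>c i\<bar> * r ^ size (w i)) has_sum L) ?I" unfolding summable_on_def by blast
  have mv: "mp v \<in> G" using smalls_words[OF a(3)] VS v(1) by blast
  let ?m = "\<lambda>x. M x * mp v x"
  have "ser S r (\<lambda>u. vanish (\<lambda>x. inverse (mp v x) * mp u x) \<and> T (\<lambda>x. ?m x * (inverse (mp v x) * mp u x))) L ?y"
  proof (rule serI[OF _ _ _ L order.refl])
   fix i assume i: "i \<in> ?I" "c i \<noteq> 0"
   have "vanish (\<lambda>x. mp (k i) x * inverse (mp v x))" using below i(1) by blast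
   then have "vanish (\<lambda>x. inverse (mp v x) * mp (w i) x)"
    by (rule ev_closedD[OF ev_closed_vanish, rotated])
      (use k(2)[of i] in \<open>auto simp: eveq_def elim!: eventually_mono\<close>)
   moreover have "T (\<lambda>x. ?m x * (inverse (mp v x) * mp (w i) x))"
    using cw(2)[OF i(2)]
    by (rule ev_closedD[OF T, rotated])
      (use eventually_ne[OF mv] in \<open>auto simp: eveq_def elim!: eventually_mono\<close>)
   ultimately show "vanish (\<lambda>x. inverse (mp v x) * mp (w i) x) \<and> T (\<lambda>x. ?m x * (inverse (mp v x) * mp (w i) x))" by blast
  qed (use cw words_summable[OF sm cw(1)] in \<open>auto intro: has_sum_infsum\<close>)
  then have "AQ G (\<lambda>h. vanish h \<and> T (\<lambda>x. ?m x * h x)) (\<lambda>x. inverse (mp v x) * ?y x)"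
   by (intro AQI[OF G_inverse[OF mv] a(2-4)]) auto
  then have d: "AQ G (\<lambda>h. vanish h \<and> T (\<lambda>x. ?m x * h x)) (\<lambda>x. inverse (A v) * (inverse (mp v x) * ?y x))"
   by (rule AQ_cmult)
  have zx: "z x = A v * mp v x + ?y x" if "good S r x" "X <= x" for x
  proof -
   have "((\<lambda>u. A u * mp u x) has_sum z x) (range k)"
    by (rule regroup[OF that]) (use cw(4)[OF that(1)] in auto)
   then have 1: "((\<lambda>u. A u * mp u x) has_sum z x) V"
    by (rule has_sum_cong_neutral[THEN iffD1, rotated -1]) (auto simp: V_def)
   have "((\<lambda>i. c i * mp (w i) x) has_sum ?y x) ?I"
    using words_summable[OF sm cw(1) that(1)] by (auto intro: has_sum_infsum)
   then have "((\<lambda>u. A u * mp u x) has_sum ?y x) (V - {v})" by (rule regroup[OF that])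
   moreover have "((\<lambda>u. A u * mp u x) has_sum (A v * mp v x)) {v}" by (intro has_sum_finiteI) auto
   ultimately have "((\<lambda>u. A u * mp u x) has_sum (A v * mp v x + ?y x)) ({v} \<union> (V - {v}))"
    by (intro has_sum_Un_disjoint) auto
   moreover have "{v} \<union> (V - {v}) = V" using v(1) by auto
   ultimately have "((\<lambda>u. A u * mp u x) has_sum (A v * mp v x + ?y x)) V" by (simp only:)
   then show ?thesis by (rule has_sum_unique[OF 1])
  qed
  have Av: "A v \<noteq> 0" using v(1) by (simp add: V_def)
  have "f \<doteq> (\<lambda>x. A v * ?m x * (1 + inverse (A v) * (inverse (mp v x) * ?y x)))"
   unfolding eveq_def using a(6)[unfolded eveq_def] ev eventually_ne[OF mv]
  proof eventually_elim
   case (elim x)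
   then show ?case using zx[of x] Av by (simp add: field_simps)
  qed
  moreover have "?m \<in> G" using a(1) mv by (rule G_mult)
  ultimately show ?thesis using Av VQ[OF v(1)] d by (intro disjI2 exI conjI)
 qed
qed

text \<open>There are no monomials between the infinite ones, the constant and the infinitesimal
 ones.\<close>

lemma AQ_split:
 assumes "AQ G T f" and T: "ev_closed T"
 obtains p c d where "AQ G (\<lambda>h. tinf h \<and> T h) p" "AQ G (\<lambda>h. vanish h \<and> T h) d"
  "f \<doteq> (\<lambda>x. p x + c + d x)"
proof -
 obtain M S r N z where a: "M \<in> G" "finite S" "S \<subseteq> smalls G" "0 < r"
  "ser S r (\<lambda>w. T (\<lambda>x. M x * mp w x)) N z" "f \<doteq> (\<lambda>x. M x * z x)"
  using assms(1) by (rule AQE)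
 let ?h = "\<lambda>w x. M x * mp w x"
 obtain z1 where z1: "ser S r (\<lambda>w. T (?h w) \<and> tinf (?h w)) N z1"
  and z2: "ser S r (\<lambda>w. T (?h w) \<and> \<not> tinf (?h w)) N (\<lambda>x. z x - z1 x)"
  by (rule ser_restrict[OF a(5), of "\<lambda>w. tinf (?h w)"]) (use a(4) in auto)
 obtain z3 where z3: "ser S r (\<lambda>w. (T (?h w) \<and> \<not> tinf (?h w)) \<and> vanish (?h w)) N z3"
  and z4: "ser S r (\<lambda>w. (T (?h w) \<and> \<not> tinf (?h w)) \<and> \<not> vanish (?h w)) N (\<lambda>x. z x - z1 x - z3 x)"
  by (rule ser_restrict[OF z2, of "\<lambda>w. vanish (?h w)"]) (use a(4) in auto)
 have p: "AQ G (\<lambda>h. tinf h \<and> T h) (\<lambda>x. M x * z1 x)"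
  by (rule AQI[OF a(1-4) ser_mono[OF z1]]) (use a(4) in auto)
 have d: "AQ G (\<lambda>h. vanish h \<and> T h) (\<lambda>x. M x * z3 x)"
  by (rule AQI[OF a(1-4) ser_mono[OF z3]]) (use a(4) in auto)
 have one: "?h w \<doteq> (\<lambda>x. 1)"
  if "set_mset w \<subseteq> S" "(T (?h w) \<and> \<not> tinf (?h w)) \<and> \<not> vanish (?h w)" for w
  using G_cases[OF G_mult[OF a(1) smalls_words[OF a(3) that(1)]]] that(2) by blast
 have "\<exists>c. (\<lambda>x. M x * (z x - z1 x - z3 x)) \<doteq> (\<lambda>x. c)"
 proof -
  have "(\<lambda>x. z x - z1 x - z3 x) \<doteq> (\<lambda>x. 0) \<or> (\<exists>a v. set_mset v \<subseteq> S \<and>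
    ((T (?h v) \<and> \<not> tinf (?h v)) \<and> \<not> vanish (?h v)) \<and> (\<lambda>x. z x - z1 x - z3 x) \<doteq> (\<lambda>x. a * mp v x))"
  proof (rule ser_one_monomial[OF a(2-4) z4])
   fix u v assume uv: "set_mset u \<subseteq> S" "set_mset v \<subseteq> S"
    "(T (?h u) \<and> \<not> tinf (?h u)) \<and> \<not> vanish (?h u)" "(T (?h v) \<and> \<not> tinf (?h v)) \<and> \<not> vanish (?h v)"
   have "?h u \<doteq> ?h v" by (rule eveq_trans[OF one[OF uv(1,3)] eveq_sym[OF one[OF uv(2,4)]]])
   then show "mp u \<doteq> mp v" by (rule eveq_cancel[OF _ eveq_refl a(1)])
  qed
  then show ?thesis
  proof (elim disjE exE conjE)
   assume "(\<lambda>x. z x - z1 x - z3 x) \<doteq> (\<lambda>x. 0)"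
   then have "(\<lambda>x. M x * (z x - z1 x - z3 x)) \<doteq> (\<lambda>x. 0)"
    using eveq_mult[OF eveq_refl, of _ "\<lambda>x. 0" M] by simp
   then show ?thesis by blast
  next
   fix b v assume v: "set_mset v \<subseteq> S" "T (?h v)" "\<not> tinf (?h v)" "\<not> vanish (?h v)"
    and eq: "(\<lambda>x. z x - z1 x - z3 x) \<doteq> (\<lambda>x. b * mp v x)"
   have "?h v \<doteq> (\<lambda>x. 1)" using one v by blast
   with eq have "(\<lambda>x. M x * (z x - z1 x - z3 x)) \<doteq> (\<lambda>x. b)"
    unfolding eveq_def by eventually_elim (simp add: mult_ac)
   then show ?thesis by blast
  qed
 qed
 then obtain c where c: "(\<lambda>x. M x * (z x - z1 x - z3 x)) \<doteq> (\<lambda>x. c)" by blast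
 have "f \<doteq> (\<lambda>x. M x * z1 x + c + M x * z3 x)"
  using a(6) c unfolding eveq_def by eventually_elim (simp add: algebra_simps)
 then show thesis using that p d by blast
qed

end

section \<open>The monomials of Skolem functions\<close>

definition super :: "fn => bool" where
 "super m \<longleftrightarrow> (\<forall>K::real. EV x. exp (K * ln x) <= m x)"

lemma super_tinf: "super m ==> tinf m"
 unfolding super_def tinf_def
proof -
 assume a: "\<forall>K::real. EV x. exp (K * ln x) <= m x"
 have "filterlim (\<lambda>x::real. exp (1 * ln x)) at_top at_top" by real_asymp
 then show "filterlim m at_top at_top" by (rule filterlim_at_top_mono) (use a in blast)
qed

lemma tinf_inverse_vanish: "tinf (\<lambda>x. inverse (m x)) ==> vanish m"
 unfolding tinf_def vanish_def by (drule tendsto_inverse_0_at_top) simp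

text \<open>A group of monomials in which nothing lies between the powers of the identity, and whose
 logarithms are purely infinite series with coefficients linear in the logarithm; the coefficient
 of the logarithm has an integer as its constant term.\<close>

locale ogrp = mgrp +
 assumes G_gap: "m \<in> G ==> (\<exists>k::int. m \<doteq> (\<lambda>x. exp (k * ln x))) \<or> super m \<or> super (\<lambda>x. inverse (m x))"
  and G_ln: "m \<in> G ==> \<exists>p q n. AQ G tinf p \<and> AQ G tinf q \<and> m \<doteq> (\<lambda>x. exp (p x + ln x * (real_of_int n + q x)))"

text \<open>One more exponentiation: the monomials with logarithms over \<open>G\<close> of the kind demanded in
 \<open>ogrp\<close>. By \<open>ogrp_nxt\<close> the construction can be iterated.\<close>

definition nxt :: "fn set => fn set" where
 "nxt G = {m. \<exists>p q n. AQ G tinf p \<and> AQ G tinf q \<and> m \<doteq> (\<lambda>x. exp (p x + ln x * (real_of_int n + q x)))}"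

lemma tinf_of_quotient:
 assumes lim: "((\<lambda>x. f x / m x) \<longlongrightarrow> c) at_top" and c: "c \<noteq> 0" and m: "tinf m"
 shows "tinf f \<or> tinf (\<lambda>x. - f x)"
proof -
 have eq: "EV x. f x / m x * m x = f x"
  using m[unfolded tinf_def filterlim_at_top, rule_format, of 1] by eventually_elim simp
 show ?thesis
 proof (cases "c > 0")
  case True
  from filterlim_tendsto_pos_mult_at_top[OF lim True m[unfolded tinf_def]] show ?thesis
   using filterlim_cong[OF refl refl eq] unfolding tinf_def by blast
 next
  case False
  then have "0 < - c" using c by simp
  from filterlim_tendsto_pos_mult_at_top[OF tendsto_minus[OF lim] this m[unfolded tinf_def]]
  have "filterlim (\<lambda>x. - (f x / m x * m x)) at_top at_top" by simp
  moreover have "EV x. - (f x / m x * m x) = - f x" using eq by eventually_elim simp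
  ultimately show ?thesis unfolding tinf_def by (intro disjI2) (rule filterlim_cong[OF refl refl, THEN iffD1, rotated])
 qed
qed

lemma gap_cases:
 assumes "(\<exists>k::int. m \<doteq> (\<lambda>x. exp (k * ln x))) \<or> super m \<or> super (\<lambda>x. inverse (m x))"
 shows "m \<doteq> (\<lambda>x. 1) \<or> vanish m \<or> tinf m"
 using assms
proof (elim disjE exE)
 fix k :: int assume m: "m \<doteq> (\<lambda>x. exp (k * ln x))"
 consider "k = 0" | "k > 0" | "k < 0" by linarith
 then show ?thesis
 proof cases
  case 1
  then show ?thesis using m by simp
 next
  case 2
  then have "0 < real_of_int k" by simp
  then have "filterlim (\<lambda>x. exp (real_of_int k * ln x)) at_top at_top" by real_asymp
  then show ?thesis using m ev_closedD[OF ev_closed_tinf eveq_sym] unfolding tinf_def by blast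
 next
  case 3
  then have "real_of_int k < 0" by simp
  then have "((\<lambda>x. exp (real_of_int k * ln x)) \<longlongrightarrow> 0) at_top" by real_asymp
  then show ?thesis using m ev_closedD[OF ev_closed_vanish eveq_sym] unfolding vanish_def by blast
 qed
qed (use super_tinf tinf_inverse_vanish in blast)+

context ogrp
begin

lemma tinf_ge_ident:
 assumes "m \<in> G" "tinf m"
 shows "EV x. x <= m x"
proof -
 have x: "EV x. 1 < x" by (rule eventually_gt_at_top)
 have big: "EV x. 2 <= m x" using assms(2) unfolding tinf_def filterlim_at_top by blast
 from G_gap[OF assms(1)] show ?thesis
 proof (elim disjE exE)
  fix k :: int assume m: "m \<doteq> (\<lambda>x. exp (k * ln x))"
  have "k \<ge> 1"
  proof (rule ccontr)
   assume k: "\<not> k \<ge> 1"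
   have "EV x. False" using m[unfolded eveq_def] big x
   proof eventually_elim
    case (elim x)
    have "real_of_int k * ln x <= 0" using k elim by (intro mult_nonpos_nonneg) auto
    then show ?case using elim by (metis exp_le_one_iff not_numeral_le_zero numeral_le_one_iff order_trans semiring_norm(69))
   qed
   then show False by simp
  qed
  show ?thesis using m[unfolded eveq_def] x
  proof eventually_elim
   case (elim x)
   have "x = exp (1 * ln x)" using elim by simp
   also have "\<dots> <= exp (k * ln x)" using elim \<open>k \<ge> 1\<close> by (subst exp_le_cancel_iff, intro mult_right_mono) auto
   finally show ?case using elim by simp
  qed
 next
  assume "super m"
  then have "EV x. exp (1 * ln x) <= m x" unfolding super_def by blast
  then show ?thesis using x by eventually_elim simp
 next
  assume "super (\<lambda>x. inverse (m x))"
  then have "vanish m" using super_tinf tinf_inverse_vanish by blast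
  then have "EV x. m x < 1" unfolding vanish_def by (rule order_tendstoD) simp
  then have "EV x. False" using big by eventually_elim simp
  then show ?thesis by simp
 qed
qed

text \<open>The leading monomial of an infinite series is one of its monomials, hence infinite.\<close>

lemma tinf_leading:
 assumes "AQ G tinf p"
 shows "p \<doteq> (\<lambda>x. 0) \<or> (\<exists>c m. c \<noteq> 0 \<and> m \<in> G \<and> tinf m \<and> ((\<lambda>x. p x / m x) \<longlongrightarrow> c) at_top)"
 using leading_term[OF assms ev_closed_tinf]
proof (elim disjE exE conjE)
 fix c m d assume a: "c \<noteq> 0" "m \<in> G" "tinf m" "AQ G (\<lambda>h. vanish h \<and> tinf (\<lambda>x. m x * h x)) d"
  "p \<doteq> (\<lambda>x. c * m x * (1 + d x))"
 have "vanish d" by (rule AQ_vanish[OF AQ_mono[OF a(4)]]) auto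
 then have "((\<lambda>x. c * (1 + d x)) \<longlongrightarrow> c * (1 + 0)) at_top" unfolding vanish_def by (intro tendsto_intros)
 moreover have "EV x. c * (1 + d x) = p x / m x"
  using a(5)[unfolded eveq_def] eventually_ne[OF a(2)] by eventually_elim simp
 ultimately have "((\<lambda>x. p x / m x) \<longlongrightarrow> c) at_top" by (simp add: tendsto_cong)
 then show ?thesis using a(1-3) by blast
qed simp

lemma quotient_by_ln:
 assumes m: "m \<in> G" "tinf m" and z: "((\<lambda>x. z x / m x) \<longlongrightarrow> c) at_top" "c \<noteq> 0"
 shows "tinf (\<lambda>x. z x / ln x) \<or> tinf (\<lambda>x. - (z x / ln x))"
proof (rule tinf_of_quotient[OF _ z(2)])
 have "filterlim (\<lambda>x::real. x / ln x) at_top at_top" by real_asymp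
 moreover have "EV x. x / ln x <= m x / ln x"
  using tinf_ge_ident[OF m] eventually_gt_at_top[of 1] by eventually_elim (simp add: divide_right_mono)
 ultimately show "tinf (\<lambda>x. m x / ln x)" unfolding tinf_def by (rule filterlim_at_top_mono)
 have "EV x. z x / m x = z x / ln x / (m x / ln x)"
  using eventually_gt_at_top[of 1] by eventually_elim simp
 from tendsto_cong[THEN iffD1, OF this z(1)] show "((\<lambda>x. z x / ln x / (m x / ln x)) \<longlongrightarrow> c) at_top" .
qed

text \<open>An exponent other than an integral multiple of the logarithm dominates the logarithm: its two
 parts cannot cancel, because the quotient of their leading monomials is never of the size of the
 logarithm.\<close>

lemma exponent_dominates:
 fixes n :: int
 assumes p: "AQ G tinf p" and q: "AQ G tinf q"
 defines "z \<equiv> \<lambda>x. p x + ln x * (real_of_int n + q x)"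
 shows "z \<doteq> (\<lambda>x. real_of_int n * ln x) \<or> tinf (\<lambda>x. z x / ln x) \<or> tinf (\<lambda>x. - (z x / ln x))"
proof -
 have gt1: "EV x. 1 < x" by (rule eventually_gt_at_top)
 have n0: "((\<lambda>x. real_of_int n / m x) \<longlongrightarrow> 0) at_top" if "tinf m" for m
  using that unfolding tinf_def by (rule tendsto_divide_0[OF tendsto_const filterlim_at_top_imp_at_infinity])
 have l0: "((\<lambda>x::real. 1 / ln x) \<longlongrightarrow> 0) at_top" "((\<lambda>x::real. ln x / x) \<longlongrightarrow> 0) at_top" by real_asymp+
 \<comment> \<open>The case that the coefficient of the logarithm dominates.\<close>
 have qdom: ?thesis if m': "m' \<in> G" "tinf m'" "((\<lambda>x. q x / m' x) \<longlongrightarrow> c') at_top" "c' \<noteq> 0"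
  and pm: "((\<lambda>x. p x / (ln x * m' x)) \<longlongrightarrow> 0) at_top" for m' c'
 proof -
  have "((\<lambda>x. p x / (ln x * m' x) + (real_of_int n / m' x + q x / m' x)) \<longlongrightarrow> 0 + (0 + c')) at_top"
   by (intro tendsto_add pm n0 m')
  moreover have "EV x. p x / (ln x * m' x) + (real_of_int n / m' x + q x / m' x) = z x / (ln x * m' x)"
   using eventually_ne[OF m'(1)] gt1 unfolding z_def by eventually_elim (simp add: field_simps)
  ultimately have "((\<lambda>x. z x / ln x / m' x) \<longlongrightarrow> c') at_top" by (simp add: tendsto_cong)
  from tinf_of_quotient[OF this m'(4,2)] show ?thesis ..
 qed
 from tinf_leading[OF p] consider "p \<doteq> (\<lambda>x. 0)"
  | m c where "c \<noteq> 0" "m \<in> G" "tinf m" "((\<lambda>x. p x / m x) \<longlongrightarrow> c) at_top" by blast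
 then show ?thesis
 proof cases
  case 1
  from tinf_leading[OF q] consider "q \<doteq> (\<lambda>x. 0)"
   | m' c' where "c' \<noteq> 0" "m' \<in> G" "tinf m'" "((\<lambda>x. q x / m' x) \<longlongrightarrow> c') at_top" by blast
  then show ?thesis
  proof cases
   case 1
   then have "z \<doteq> (\<lambda>x. real_of_int n * ln x)"
    using \<open>p \<doteq> (\<lambda>x. 0)\<close> unfolding z_def eveq_def by eventually_elim simp
   then show ?thesis ..
  next
   case 2
   have "((\<lambda>x. p x / (ln x * m' x)) \<longlongrightarrow> 0) at_top"
    using \<open>p \<doteq> (\<lambda>x. 0)\<close> unfolding eveq_def by (intro tendsto_eventually) (auto elim: eventually_mono)
   then show ?thesis using qdom[OF 2(2-4,1)] by blast
  qed
 next
  case 2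
  from tinf_leading[OF q] consider "q \<doteq> (\<lambda>x. 0)"
   | m' c' where "c' \<noteq> 0" "m' \<in> G" "tinf m'" "((\<lambda>x. q x / m' x) \<longlongrightarrow> c') at_top" by blast
  then show ?thesis
  proof cases
   case 1
   have "EV x. \<bar>ln x / m x\<bar> <= ln x / x"
    using tinf_ge_ident[OF 2(2,3)] gt1 by eventually_elim (simp add: divide_left_mono)
   then have "((\<lambda>x. ln x / m x) \<longlongrightarrow> 0) at_top" by (intro tendsto_rabs_zero_cancel[OF tendsto_sandwich[OF _ _ tendsto_const l0(2)]]) auto
   then have "((\<lambda>x. p x / m x + ln x / m x * real_of_int n) \<longlongrightarrow> c + 0 * real_of_int n) at_top"
    by (intro tendsto_add tendsto_mult 2 tendsto_const)
   moreover have "EV x. p x / m x + ln x / m x * real_of_int n = z x / m x"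
    using 1[unfolded eveq_def] eventually_ne[OF 2(2)] unfolding z_def by eventually_elim (simp add: field_simps)
   ultimately have "((\<lambda>x. z x / m x) \<longlongrightarrow> c) at_top" by (simp add: tendsto_cong)
   then show ?thesis using quotient_by_ln[OF 2(2,3) _ 2(1)] by blast
  next
   case (2 m' c')
   note m = \<open>c \<noteq> 0\<close> \<open>m \<in> G\<close> \<open>tinf m\<close> \<open>((\<lambda>x. p x / m x) \<longlongrightarrow> c) at_top\<close>
   have "(\<lambda>x. m x * inverse (m' x)) \<in> G" using m(2) 2(2) G_mult G_inverse by blast
   from G_cases[OF this] show ?thesis
   proof (elim disjE)
    assume t: "tinf (\<lambda>x. m x * inverse (m' x))"
    have "EV x. \<bar>ln x * m' x / m x\<bar> <= ln x / x"
     using tinf_ge_ident[OF \<open>(\<lambda>x. m x * inverse (m' x)) \<in> G\<close> t] gt1 G_pos[OF m(2)] G_pos[OF 2(2)]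
    proof eventually_elim
     case (elim x)
     then have "x * m' x <= m x" by (simp add: field_simps)
     then have "ln x * m' x * x <= ln x * m x" using elim
      by (metis ln_gt_zero mult.assoc mult.commute mult_le_cancel_left_pos)
     then show ?case using elim by (simp add: field_simps)
    qed
    then have r0: "((\<lambda>x. ln x * m' x / m x) \<longlongrightarrow> 0) at_top"
     by (intro tendsto_rabs_zero_cancel[OF tendsto_sandwich[OF _ _ tendsto_const l0(2)]]) auto
    have "((\<lambda>x. p x / m x + ln x * m' x / m x * (real_of_int n / m' x + q x / m' x)) \<longlongrightarrow> c + 0 * (0 + c')) at_top"
     by (intro tendsto_add tendsto_mult m r0 n0 2)
    moreover have "EV x. p x / m x + ln x * m' x / m x * (real_of_int n / m' x + q x / m' x) = z x / m x"
     using eventually_ne[OF m(2)] eventually_ne[OF 2(2)] unfolding z_def by eventually_elim (simp add: field_simps)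
    ultimately have "((\<lambda>x. z x / m x) \<longlongrightarrow> c) at_top" by (simp add: tendsto_cong)
    then show ?thesis using quotient_by_ln[OF m(2,3) _ m(1)] by blast
   next
    have pq: "((\<lambda>x. p x / (ln x * m' x)) \<longlongrightarrow> 0) at_top" if "((\<lambda>x. m x * inverse (m' x)) \<longlongrightarrow> t) at_top" for t
    proof -
     have "((\<lambda>x. p x / m x * (m x * inverse (m' x)) * (1 / ln x)) \<longlongrightarrow> c * t * 0) at_top"
      by (intro tendsto_mult m that l0)
     moreover have "EV x. p x / m x * (m x * inverse (m' x)) * (1 / ln x) = p x / (ln x * m' x)"
      using eventually_ne[OF m(2)] eventually_ne[OF 2(2)] by eventually_elim (simp add: field_simps)
     ultimately show ?thesis by (simp add: tendsto_cong)
    qed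
    assume "(\<lambda>x. m x * inverse (m' x)) \<doteq> (\<lambda>x. 1)"
    then have "((\<lambda>x. m x * inverse (m' x)) \<longlongrightarrow> 1) at_top" unfolding eveq_def by (rule tendsto_eventually)
    then show ?thesis using qdom[OF 2(2-4,1)] pq by blast
   next
    assume "vanish (\<lambda>x. m x * inverse (m' x))"
    then have v: "((\<lambda>x. m x * inverse (m' x)) \<longlongrightarrow> 0) at_top" by (simp add: vanish_def)
    have "((\<lambda>x. p x / m x * (m x * inverse (m' x)) * (1 / ln x)) \<longlongrightarrow> c * 0 * 0) at_top"
     by (intro tendsto_mult m v l0)
    moreover have "EV x. p x / m x * (m x * inverse (m' x)) * (1 / ln x) = p x / (ln x * m' x)"
     using eventually_ne[OF m(2)] eventually_ne[OF 2(2)] by eventually_elim (simp add: field_simps)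
    ultimately have "((\<lambda>x. p x / (ln x * m' x)) \<longlongrightarrow> 0) at_top" by (simp add: tendsto_cong)
    then show ?thesis using qdom[OF 2(2-4,1)] by blast
   qed
  qed
 qed
qed

lemma exp_gap:
 assumes "AQ G tinf p" "AQ G tinf q" "m \<doteq> (\<lambda>x. exp (p x + ln x * (real_of_int n + q x)))"
 shows "(\<exists>k::int. m \<doteq> (\<lambda>x. exp (k * ln x))) \<or> super m \<or> super (\<lambda>x. inverse (m x))"
proof -
 let ?z = "\<lambda>x. p x + ln x * (real_of_int n + q x)"
 have sup: "super h" if "tinf (\<lambda>x. z x / ln x)" "h \<doteq> (\<lambda>x. exp (z x))" for h z
  unfolding super_def
 proof
  fix K :: real
  have "EV x. K <= z x / ln x" using that(1) unfolding tinf_def filterlim_at_top by blast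
  then show "EV x. exp (K * ln x) <= h x"
   using that(2)[unfolded eveq_def] eventually_gt_at_top[of 1] by eventually_elim (simp add: field_simps)
 qed
 have inv: "(\<lambda>x. inverse (m x)) \<doteq> (\<lambda>x. exp (- ?z x))"
  using assms(3) unfolding eveq_def by eventually_elim (metis exp_minus)
 from exponent_dominates[OF assms(1,2), of n] show ?thesis
 proof (elim disjE)
  assume "?z \<doteq> (\<lambda>x. real_of_int n * ln x)"
  then have "m \<doteq> (\<lambda>x. exp (n * ln x))" using assms(3) unfolding eveq_def by eventually_elim simp
  then show ?thesis by blast
 next
  assume "tinf (\<lambda>x. ?z x / ln x)"
  from sup[OF this assms(3)] show ?thesis by blast
 next
  assume "tinf (\<lambda>x. - (?z x / ln x))"
  then have "tinf (\<lambda>x. (- ?z x) / ln x)" by (simp add: minus_divide_left)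
  from sup[OF this inv] show ?thesis by blast
 qed
qed

lemma subset_nxt: "G \<subseteq> nxt G"
 using G_ln unfolding nxt_def by blast

lemma ogrp_nxt: "ogrp (nxt G)"
proof -
 have gap: "(\<exists>k::int. m \<doteq> (\<lambda>x. exp (k * ln x))) \<or> super m \<or> super (\<lambda>x. inverse (m x))" if "m \<in> nxt G" for m
  using that exp_gap unfolding nxt_def by blast
 show ?thesis
 proof
  show "(\<lambda>x. 1) \<in> nxt G" using subset_nxt G_one by blast
  fix m m' assume m: "m \<in> nxt G"
  then obtain p q n where a: "AQ G tinf p" "AQ G tinf q" "m \<doteq> (\<lambda>x. exp (p x + ln x * (real_of_int n + q x)))"
   unfolding nxt_def by blast
  show "EV x. 0 < m x" using a(3) unfolding eveq_def by eventually_elim simp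
  show "m' \<in> nxt G" if "m \<doteq> m'" using a that eveq_trans[OF eveq_sym[OF that] a(3)] unfolding nxt_def by blast
  show "(\<lambda>x. inverse (m x)) \<in> nxt G"
  proof -
   have "exp (-1 * p x + ln x * (real_of_int (- n) + -1 * q x)) = inverse (exp (p x + ln x * (real_of_int n + q x)))" for x
    by (subst exp_minus[symmetric]) (simp add: algebra_simps)
   then have "(\<lambda>x. inverse (m x)) \<doteq> (\<lambda>x. exp (-1 * p x + ln x * (real_of_int (- n) + -1 * q x)))"
    using a(3) unfolding eveq_def by (auto elim: eventually_mono)
   then show ?thesis using AQ_cmult[OF a(1)] AQ_cmult[OF a(2)] unfolding nxt_def by blast
  qed
  show "m \<doteq> (\<lambda>x. 1) \<or> vanish m \<or> tinf m" using gap_cases[OF gap[OF m]] .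
  show "(\<exists>k::int. m \<doteq> (\<lambda>x. exp (k * ln x))) \<or> super m \<or> super (\<lambda>x. inverse (m x))" using gap[OF m] .
  show "\<exists>p q n. AQ (nxt G) tinf p \<and> AQ (nxt G) tinf q \<and> m \<doteq> (\<lambda>x. exp (p x + ln x * (real_of_int n + q x)))"
   using a AQ_group_mono[OF _ subset_nxt] by blast
  assume "m' \<in> nxt G"
  then obtain p' q' n' where b: "AQ G tinf p'" "AQ G tinf q'" "m' \<doteq> (\<lambda>x. exp (p' x + ln x * (real_of_int n' + q' x)))"
   unfolding nxt_def by blast
  have "(\<lambda>x. m x * m' x) \<doteq> (\<lambda>x. exp ((p x + p' x) + ln x * (real_of_int (n + n') + (q x + q' x))))"
   using a(3) b(3) unfolding eveq_def by eventually_elim (simp add: exp_add[symmetric] algebra_simps)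
  then show "(\<lambda>x. m x * m' x) \<in> nxt G"
   using AQ_add[OF a(1) b(1) ev_closed_tinf] AQ_add[OF a(2) b(2) ev_closed_tinf] unfolding nxt_def by blast
 qed
qed

end

definition G0 :: "fn set" where "G0 = {m. m \<doteq> (\<lambda>x. 1)}"

lemma ogrp_G0: "ogrp G0"
proof -
 interpret A: mgrp G0
 proof
  fix m m' assume "m \<in> G0"
  then have m: "m \<doteq> (\<lambda>x. 1)" by (simp add: G0_def)
  show "m \<doteq> m' ==> m' \<in> G0" using eveq_trans[OF eveq_sym m] unfolding G0_def by blast
  show "m' \<in> G0 ==> (\<lambda>x. m x * m' x) \<in> G0" using eveq_mult[OF m, of m' "\<lambda>x. 1"] by (simp add: G0_def)
  show "(\<lambda>x. inverse (m x)) \<in> G0" using eveq_comp[OF m, of inverse] by (simp add: G0_def)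
  show "EV x. 0 < m x" using m unfolding eveq_def by eventually_elim simp
  show "m \<doteq> (\<lambda>x. 1) \<or> vanish m \<or> tinf m" using m ..
 qed (simp add: G0_def)
 show ?thesis
 proof
  fix m assume "m \<in> G0"
  then have m: "m \<doteq> (\<lambda>x. 1)" by (simp add: G0_def)
  then have "m \<doteq> (\<lambda>x. exp (real_of_int 0 * ln x))" by simp
  then show "(\<exists>k::int. m \<doteq> (\<lambda>x. exp (k * ln x))) \<or> super m \<or> super (\<lambda>x. inverse (m x))" by blast
  have "m \<doteq> (\<lambda>x. exp (0 + ln x * (real_of_int 0 + 0)))" using m by simp
  then show "\<exists>p q n. AQ G0 tinf p \<and> AQ G0 tinf q \<and> m \<doteq> (\<lambda>x. exp (p x + ln x * (real_of_int n + q x)))"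
   using A.AQ_zero by (intro exI conjI)
 qed
qed

definition Gs :: "nat => fn set" where "Gs n = (nxt ^^ n) G0"
definition GG :: "fn set" where "GG = (\<Union>n. Gs n)"

lemma ogrp_Gs: "ogrp (Gs n)"
 by (induct n) (auto simp: Gs_def ogrp_G0 intro: ogrp.ogrp_nxt)

lemma Gs_mono: "i <= j ==> Gs i \<subseteq> Gs j"
proof (induct j rule: dec_induct)
 case (step j)
 then show ?case using ogrp.subset_nxt[OF ogrp_Gs[of j]] by (auto simp: Gs_def)
qed simp

lemma Gs_common: "m \<in> GG ==> m' \<in> GG ==> \<exists>n. m \<in> Gs n \<and> m' \<in> Gs n"
proof -
 assume "m \<in> GG" "m' \<in> GG"
 then obtain i j where "m \<in> Gs i" "m' \<in> Gs j" unfolding GG_def by blast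
 then have "m \<in> Gs (max i j)" "m' \<in> Gs (max i j)" using Gs_mono[of i "max i j"] Gs_mono[of j "max i j"] by auto
 then show ?thesis by blast
qed

lemma finite_subset_Gs:
 assumes "finite S" "S \<subseteq> GG"
 shows "\<exists>n. S \<subseteq> Gs n"
 using assms
proof induct
 case (insert s S)
 then obtain i j where "S \<subseteq> Gs i" "s \<in> Gs j" unfolding GG_def by auto
 then have "insert s S \<subseteq> Gs (max i j)" using Gs_mono[of i "max i j"] Gs_mono[of j "max i j"] by auto
 then show ?case by blast
qed auto

lemma AQ_GG:
 assumes "AQ GG T f"
 shows "\<exists>n. AQ (Gs n) T f"
proof -
 obtain M S r N z where a: "M \<in> GG" "finite S" "S \<subseteq> smalls GG" "0 < r"
  "ser S r (\<lambda>w. T (\<lambda>x. M x * mp w x)) N z" "f \<doteq> (\<lambda>x. M x * z x)" using assms by (rule AQE)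
 have "finite (insert M S)" "insert M S \<subseteq> GG" using a by (auto simp: smalls_def)
 from finite_subset_Gs[OF this] obtain n where n: "insert M S \<subseteq> Gs n" by blast
 then have "AQ (Gs n) T f" using a by (intro AQI[OF _ a(2) _ a(4-6)]) (auto simp: smalls_def)
 then show ?thesis by blast
qed

lemma Gs_subset_GG: "Gs n \<subseteq> GG" unfolding GG_def by blast

interpretation GG: ogrp GG
proof
 show "(\<lambda>_. 1) \<in> GG" using mgrp.G_one[OF ogrp.axioms(1)[OF ogrp_Gs[of 0]]] Gs_subset_GG by blast
 fix m m' assume "m \<in> GG"
 then obtain n where n: "m \<in> Gs n" unfolding GG_def by blast
 interpret A: ogrp "Gs n" by (rule ogrp_Gs)
 show "(\<lambda>x. inverse (m x)) \<in> GG" using A.G_inverse[OF n] Gs_subset_GG by blast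
 show "EV x. 0 < m x" using A.G_pos[OF n] .
 show "m' \<in> GG" if "m \<doteq> m'" using A.G_cong[OF n that] Gs_subset_GG by blast
 show "m \<doteq> (\<lambda>x. 1) \<or> vanish m \<or> tinf m" using A.G_cases[OF n] .
 show "(\<exists>k::int. m \<doteq> (\<lambda>x. exp (k * ln x))) \<or> super m \<or> super (\<lambda>x. inverse (m x))" using A.G_gap[OF n] .
 show "\<exists>p q n. AQ GG tinf p \<and> AQ GG tinf q \<and> m \<doteq> (\<lambda>x. exp (p x + ln x * (real_of_int n + q x)))"
  using A.G_ln[OF n] AQ_group_mono[OF _ Gs_subset_GG] by blast
 assume "m' \<in> GG"
 then obtain j where "m \<in> Gs j" "m' \<in> Gs j" using Gs_common[OF \<open>m \<in> GG\<close>] by blast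
 then show "(\<lambda>x. m x * m' x) \<in> GG" using mgrp.G_mult[OF ogrp.axioms(1)[OF ogrp_Gs[of j]]] Gs_subset_GG by blast
qed

lemma exp_in_GG:
 assumes "AQ GG tinf p" "AQ GG tinf q"
 shows "(\<lambda>x. exp (p x + ln x * (real_of_int n + q x))) \<in> GG"
proof -
 obtain i j where "AQ (Gs i) tinf p" "AQ (Gs j) tinf q" using AQ_GG assms by blast
 then have "AQ (Gs (max i j)) tinf p" "AQ (Gs (max i j)) tinf q"
  using AQ_group_mono[OF _ Gs_mono[of i "max i j"]] AQ_group_mono[OF _ Gs_mono[of j "max i j"]] by auto
 then have "(\<lambda>x. exp (p x + ln x * (real_of_int n + q x))) \<in> Gs (Suc (max i j))"
  unfolding Gs_def by (simp add: nxt_def, intro exI[of _ p] exI[of _ q] exI[of _ n] conjI eveq_refl)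
 then show ?thesis using Gs_subset_GG by blast
qed

section \<open>Skolem functions are purely infinite series up to an integer\<close>

text \<open>The expansions of Skolem functions: no infinitesimal monomials, and an integral constant
 term.\<close>

definition QQ :: "fn => bool" where
 "QQ f \<longleftrightarrow> (\<exists>(n::int) p. AQ GG tinf p \<and> f \<doteq> (\<lambda>x. of_int n + p x))"

lemma QQ_cong: "QQ f ==> f \<doteq> g ==> QQ g"
 unfolding QQ_def using eveq_trans eveq_sym by blast

lemma QQI: "AQ GG tinf p ==> f \<doteq> (\<lambda>x. of_int n + p x) ==> QQ f" unfolding QQ_def by blast

lemma QQ_const: "QQ (\<lambda>x. of_int n)"
 by (rule QQI[OF GG.AQ_zero, of _ n]) simp

lemma ident_in_GG: "(\<lambda>x. x) \<in> GG"
proof (rule GG.G_cong)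
 show "(\<lambda>x. exp (0 + ln x * (real_of_int 1 + 0))) \<in> GG" by (rule exp_in_GG[OF GG.AQ_zero GG.AQ_zero])
 show "(\<lambda>x. exp (0 + ln x * (real_of_int 1 + 0))) \<doteq> (\<lambda>x. x)"
  unfolding eveq_def using eventually_gt_at_top[of 0] by eventually_elim simp
qed

lemma QQ_ident: "QQ (\<lambda>x. x)"
proof (rule QQI)
 show "AQ GG tinf (\<lambda>x. 1 * x)"
  by (rule GG.AQ_monomial[OF ident_in_GG]) (simp add: tinf_def filterlim_ident)
 show "(\<lambda>x. x) \<doteq> (\<lambda>x. of_int 0 + 1 * x)" by simp
qed

lemma QQ_add: "QQ f ==> QQ g ==> QQ (\<lambda>x. f x + g x)"
proof -
 assume "QQ f" "QQ g"
 then obtain m n p q where a: "AQ GG tinf p" "f \<doteq> (\<lambda>x. of_int m + p x)" "AQ GG tinf q" "g \<doteq> (\<lambda>x. of_int n + q x)"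
  unfolding QQ_def by blast
 show ?thesis
  by (rule QQI[OF GG.AQ_add[OF a(1,3) ev_closed_tinf], of _ "m + n"])
   (rule eveq_trans[OF eveq_add[OF a(2,4)]], simp add: algebra_simps)
qed

lemma QQ_mult: "QQ f ==> QQ g ==> QQ (\<lambda>x. f x * g x)"
proof -
 assume "QQ f" "QQ g"
 then obtain m n p q where a: "AQ GG tinf p" "f \<doteq> (\<lambda>x. of_int m + p x)" "AQ GG tinf q" "g \<doteq> (\<lambda>x. of_int n + q x)"
  unfolding QQ_def by blast
 have "AQ GG tinf (\<lambda>x. (of_int m * q x + of_int n * p x) + p x * q x)"
  by (intro GG.AQ_add GG.AQ_cmult a ev_closed_tinf GG.AQ_mult[OF a(1,3)] tinf_mult)
 then show ?thesis
  by (rule QQI[of _ _ "m * n"]) (rule eveq_trans[OF eveq_mult[OF a(2,4)]], simp add: algebra_simps)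
qed

lemma QQ_diff: "QQ f ==> QQ g ==> QQ (\<lambda>x. f x - g x)"
 using QQ_add[of f "\<lambda>x. of_int (-1) * g x"] QQ_mult[OF QQ_const[of "-1"], of g] by simp

text \<open>A nonzero function of this kind is bounded away from zero, by the constant 1.\<close>

lemma QQ_cases:
 assumes "QQ f"
 obtains n :: int where "f \<doteq> (\<lambda>x. of_int n)"
  | "tinf f" | "tinf (\<lambda>x. - f x)"
proof -
 obtain n p where a: "AQ GG tinf p" "f \<doteq> (\<lambda>x. of_int n + p x)" using assms unfolding QQ_def by blast
 from GG.tinf_leading[OF a(1)] show ?thesis
 proof (elim disjE exE conjE)
  assume "p \<doteq> (\<lambda>x. 0)"
  then have "f \<doteq> (\<lambda>x. of_int n)" using a(2) unfolding eveq_def by eventually_elim simp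
  then show ?thesis by (rule that(1))
 next
  fix c m assume m: "c \<noteq> 0" "m \<in> GG" "tinf m" "((\<lambda>x. p x / m x) \<longlongrightarrow> c) at_top"
  have "((\<lambda>x. of_int n / m x + p x / m x) \<longlongrightarrow> 0 + c) at_top"
   using m(3) unfolding tinf_def
   by (intro tendsto_add m tendsto_divide_0[OF tendsto_const filterlim_at_top_imp_at_infinity])
  moreover have "EV x. of_int n / m x + p x / m x = f x / m x"
   using a(2)[unfolded eveq_def] by eventually_elim (simp add: add_divide_distrib)
  ultimately have "((\<lambda>x. f x / m x) \<longlongrightarrow> c) at_top" by (simp add: tendsto_cong)
  then show ?thesis using tinf_of_quotient m(1,3) that(2,3) by blast
 qed
qed

lemma powr_tinf:
 assumes "EV x. 2 <= b x" "tinf e"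
 shows "tinf (\<lambda>x. b x powr e x)"
 unfolding tinf_def
proof (rule filterlim_at_top_mono)
 show "filterlim (\<lambda>x. exp (ln 2 * e x)) at_top at_top"
  by (rule filterlim_compose[OF exp_at_top filterlim_tendsto_pos_mult_at_top[OF tendsto_const]])
    (use assms(2) in \<open>auto simp: tinf_def\<close>)
 have "EV x. 0 <= e x" using assms(2) unfolding tinf_def filterlim_at_top by blast
 then show "EV x. exp (ln 2 * e x) <= b x powr e x" using assms(1)
 proof eventually_elim
  case (elim x)
  have "exp (ln 2 * e x) = 2 powr e x" by (simp add: powr_def mult.commute)
  also have "\<dots> <= b x powr e x" using elim by (intro powr_mono2) auto
  finally show ?case .
 qed
qed

text \<open>A constant times the monomial with the logarithm \<open>p ln b\<close>.\<close>

lemma AQ_power_const: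
 assumes b: "2 <= (b::real)" and p: "AQ GG tinf p" and e: "e \<doteq> (\<lambda>x. of_int N + p x)" "tinf e"
 shows "AQ GG tinf (\<lambda>x. b powr e x)"
proof -
 let ?M = "\<lambda>x. exp (ln b * p x + ln x * (real_of_int 0 + 0))"
 have M: "?M \<in> GG" by (rule exp_in_GG[OF GG.AQ_cmult[OF p] GG.AQ_zero])
 have eq: "(\<lambda>x. b powr e x) \<doteq> (\<lambda>x. exp (ln b * of_int N) * ?M x)"
  using e(1) unfolding eveq_def
  by eventually_elim (use b in \<open>simp add: powr_def exp_add[symmetric] algebra_simps\<close>)
 have "tinf (\<lambda>x. b powr e x)" by (rule powr_tinf) (use b e in auto)
 then have "filterlim (\<lambda>x. exp (- (ln b * of_int N)) * b powr e x) at_top at_top"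
  unfolding tinf_def by (intro filterlim_tendsto_pos_mult_at_top[OF tendsto_const]) auto
 moreover have "(\<lambda>x. exp (- (ln b * of_int N)) * b powr e x) \<doteq> ?M"
  using eq unfolding eveq_def by eventually_elim (simp add: exp_minus)
 ultimately have "tinf ?M" using ev_closedD[OF ev_closed_tinf] unfolding tinf_def by blast
 then show ?thesis using AQ_cong[OF GG.AQ_monomial[OF M] eveq_sym[OF eq]] by blast
qed

text \<open>Powers with an infinite base \<open>b = c m (1 + d)\<close>. The exponent times \<open>ln m\<close> is again an exponent
 of a monomial; the exponent times the logarithm of the rest is a series whose infinite part goes
 into the monomial and whose infinitesimal part is exponentiated as a power series. All monomials
 that occur in the result are infinite, since no power of \<open>m\<close> makes up for the full power.\<close>

lemma AQ_power_infinite: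
 assumes b: "QQ b" "tinf b" and p: "AQ GG tinf p" and e: "e \<doteq> (\<lambda>x. of_int N + p x)" "tinf e"
 shows "AQ GG tinf (\<lambda>x. b x powr e x)"
proof -
 define T1 where "T1 h \<longleftrightarrow> h \<doteq> (\<lambda>x. 1) \<or> tinf h" for h
 have T1c: "ev_closed T1"
  unfolding ev_closed_def T1_def using eveq_trans eveq_sym ev_closedD[OF ev_closed_tinf] by blast
 obtain N0 p0 where p0: "AQ GG tinf p0" "b \<doteq> (\<lambda>x. of_int N0 + p0 x)" using b(1) unfolding QQ_def by blast
 have "AQ GG T1 (\<lambda>x. of_int N0 * 1)" by (rule GG.AQ_monomial[OF GG.G_one]) (simp add: T1_def)
 moreover have "AQ GG T1 p0" by (rule GG.AQ_mono[OF p0(1)]) (simp add: T1_def)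
 ultimately have "AQ GG T1 (\<lambda>x. of_int N0 * 1 + p0 x)" by (rule GG.AQ_add[OF _ _ T1c])
 then have bT: "AQ GG T1 b" by (rule AQ_cong) (use eveq_sym[OF p0(2)] in simp)
 have b2: "EV x. 2 <= b x" using b(2) unfolding tinf_def filterlim_at_top by blast
 have nz: "\<not> b \<doteq> (\<lambda>x. 0)"
 proof
  assume "b \<doteq> (\<lambda>x. 0)"
  then have "EV x. False" using b2 unfolding eveq_def by eventually_elim simp
  then show False by simp
 qed
 obtain c m d where m: "c \<noteq> 0" "m \<in> GG" "T1 m" "AQ GG (\<lambda>h. vanish h \<and> T1 (\<lambda>x. m x * h x)) d"
  "b \<doteq> (\<lambda>x. c * m x * (1 + d x))" using GG.leading_term[OF bT T1c] nz by blast
 have d0: "vanish d" by (rule GG.AQ_vanish[OF GG.AQ_mono[OF m(4)]]) auto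
 have mpos: "EV x. 0 < m x" using GG.G_pos[OF m(2)] .
 have dpos: "EV x. -1 < d x" using d0 unfolding vanish_def by (rule order_tendstoD) simp
 have c: "0 < c"
 proof (rule ccontr)
  assume "\<not> 0 < c"
  then have "c < 0" using m(1) by simp
  have "EV x. False" using b2 mpos dpos m(5)[unfolded eveq_def]
  proof eventually_elim
   case (elim x)
   have "c * m x * (1 + d x) <= 0" using elim \<open>c < 0\<close> by (intro mult_nonpos_nonneg) (auto simp: mult_le_0_iff)
   then show ?case using elim by simp
  qed
  then show False by simp
 qed
 define T3 where "T3 h \<longleftrightarrow> (\<exists>k::nat. EV x. 1 <= h x * m x ^ k)" for h
 have T3c: "ev_closed T3"
  unfolding ev_closed_def
 proof (intro allI impI)
  fix g h assume "g \<doteq> h" "T3 g"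
  then obtain k where "EV x. g x = h x" "EV x. 1 <= g x * m x ^ k" unfolding T3_def eveq_def by blast
  then have "EV x. 1 <= h x * m x ^ k" by eventually_elim simp
  then show "T3 h" unfolding T3_def by blast
 qed
 have T3_mult: "T3 (\<lambda>x. g x * h x)" if "T3 g" "T3 h" for g h
 proof -
  obtain j k where "EV x. 1 <= g x * m x ^ j" "EV x. 1 <= h x * m x ^ k"
   using \<open>T3 g\<close> \<open>T3 h\<close> unfolding T3_def by blast
  then have "EV x. 1 <= (g x * h x) * m x ^ (j + k)"
  proof eventually_elim
   case (elim x)
   then have "1 * 1 <= (g x * m x ^ j) * (h x * m x ^ k)" by (intro mult_mono) auto
   then show ?case by (simp add: power_add mult_ac)
  qed
  then show ?thesis unfolding T3_def by blast
 qed
 have T3_tinf: "T3 h" if "tinf h" for h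
 proof -
  have "EV x. 1 <= h x * m x ^ 0" using that unfolding tinf_def filterlim_at_top by simp
  then show ?thesis unfolding T3_def by blast
 qed
 have T3_m: "T3 h" if "T1 (\<lambda>x. m x * h x)" for h
 proof -
  have "EV x. 1 <= h x * m x ^ 1"
   using that unfolding T1_def
  proof
   assume "(\<lambda>x. m x * h x) \<doteq> (\<lambda>x. 1)"
   then show ?thesis unfolding eveq_def by eventually_elim (simp add: mult.commute)
  next
   assume "tinf (\<lambda>x. m x * h x)"
   then have "EV x. 1 <= m x * h x" unfolding tinf_def filterlim_at_top by blast
   then show ?thesis by eventually_elim (simp add: mult.commute)
  qed
  then show ?thesis unfolding T3_def by blast
 qed
 define l where "l x = ln (1 + d x)" for x
 have "AQ GG (\<lambda>h. vanish h \<and> T3 h) d" by (rule GG.AQ_mono[OF m(4)]) (use T3_m in auto)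
 then have l: "AQ GG (\<lambda>h. vanish h \<and> T3 h) l"
  unfolding l_def[abs_def] by (rule GG.AQ_ln) (use T3_mult in auto)
 define A where "A x = (ln c * p x + of_int N * l x) + p x * l x" for x
 have pT: "AQ GG T3 p" by (rule GG.AQ_mono[OF p]) (use T3_tinf in auto)
 have lT: "AQ GG T3 l" by (rule GG.AQ_mono[OF l]) auto
 have "AQ GG T3 (\<lambda>x. p x * l x)" by (rule GG.AQ_mult[OF pT lT]) (use T3_mult in auto)
 then have "AQ GG T3 A"
  unfolding A_def[abs_def] by (intro GG.AQ_add GG.AQ_cmult pT lT T3c)
 then obtain pA cA dA where A: "AQ GG (\<lambda>h. tinf h \<and> T3 h) pA" "AQ GG (\<lambda>h. vanish h \<and> T3 h) dA"
  "A \<doteq> (\<lambda>x. pA x + cA + dA x)" by (rule GG.AQ_split[OF _ T3c])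
 have pA: "AQ GG tinf pA" by (rule GG.AQ_mono[OF A(1)]) auto
 obtain p1 q1 n1 where lm: "AQ GG tinf p1" "AQ GG tinf q1" "m \<doteq> (\<lambda>x. exp (p1 x + ln x * (real_of_int n1 + q1 x)))"
  using GG.G_ln[OF m(2)] by blast
 define M where "M x = exp ((pA x + (of_int N * p1 x + p x * p1 x)) +
  ln x * (real_of_int (N * n1) + (of_int N * q1 x + (of_int n1 * p x + p x * q1 x))))" for x
 have M: "M \<in> GG"
  unfolding M_def[abs_def]
  by (intro exp_in_GG GG.AQ_add GG.AQ_cmult pA p lm ev_closed_tinf GG.AQ_mult[OF p lm(1)] GG.AQ_mult[OF p lm(2)] tinf_mult)
 define K where "K = exp (ln c * of_int N + cA)"
 define s where "s x = exp (dA x) - 1" for x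
 have sT: "AQ GG (\<lambda>h. vanish h \<and> T3 h) s"
  unfolding s_def[abs_def] by (rule GG.AQ_exp[OF A(2)]) (use T3_mult in auto)
 have s0: "vanish s" by (rule GG.AQ_vanish[OF GG.AQ_mono[OF sT]]) auto
 have main: "(\<lambda>x. b x powr e x) \<doteq> (\<lambda>x. K * M x * (1 + s x))"
  unfolding eveq_def using b2 mpos dpos m(5)[unfolded eveq_def] e(1)[unfolded eveq_def] A(3)[unfolded eveq_def]
   lm(3)[unfolded eveq_def]
 proof eventually_elim
  case (elim x)
  have lnm: "ln (m x) = p1 x + ln x * (real_of_int n1 + q1 x)" using elim(7) by simp
  have lb: "ln (b x) = ln c + ln (m x) + l x"
  proof -
   have "0 < 1 + d x" using elim by simp
   have "ln (b x) = ln (c * m x * (1 + d x))" using elim by simp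
   also have "\<dots> = ln (c * m x) + ln (1 + d x)"
    using c elim \<open>0 < 1 + d x\<close> by (intro ln_mult_pos) (auto intro: mult_pos_pos)
   also have "ln (c * m x) = ln c + ln (m x)" using c elim by (intro ln_mult_pos) auto
   finally show ?thesis by (simp add: l_def)
  qed
  have "b x \<noteq> 0" using elim(1) by linarith
  then have "b x powr e x = exp (e x * ln (b x))" by (simp only: powr_def if_False)
  also have "e x * ln (b x) = ln c * of_int N + A x + (of_int N + p x) * ln (m x)"
   using elim(5) by (simp add: lb A_def algebra_simps)
  also have "\<dots> = (ln c * of_int N + cA) + ((pA x + (of_int N * p1 x + p x * p1 x)) +
    ln x * (real_of_int (N * n1) + (of_int N * q1 x + (of_int n1 * p x + p x * q1 x)))) + dA x"
   by (simp add: elim(6) lnm algebra_simps)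
  also have "exp \<dots> = K * M x * exp (dA x)" by (simp only: exp_add K_def M_def)
  finally show ?case by (simp add: s_def)
 qed
 have inf: "tinf (\<lambda>x. M x / m x ^ k)" for k :: nat
 proof -
  have "tinf (\<lambda>x. b x powr (e x - real k))"
   by (rule powr_tinf[OF b2])
    (use e(2) filterlim_tendsto_add_at_top[OF tendsto_const[of "- real k"], of e] in \<open>simp add: tinf_def\<close>)
  moreover have lim: "((\<lambda>x. (c * (1 + d x)) ^ k / (K * (1 + s x))) \<longlongrightarrow> (c * (1 + 0)) ^ k / (K * (1 + 0))) at_top"
   using d0 s0 unfolding vanish_def by (intro tendsto_intros) (auto simp: K_def)
  ultimately have "filterlim (\<lambda>x. (c * (1 + d x)) ^ k / (K * (1 + s x)) * b x powr (e x - real k)) at_top at_top"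
   unfolding tinf_def by (intro filterlim_tendsto_pos_mult_at_top[OF lim]) (use c in \<open>auto simp: K_def\<close>)
  moreover have "EV x. -1 < s x" using s0 unfolding vanish_def by (rule order_tendstoD) simp
  then have "EV x. (c * (1 + d x)) ^ k / (K * (1 + s x)) * b x powr (e x - real k) = M x / m x ^ k"
   using main[unfolded eveq_def] b2 mpos dpos m(5)[unfolded eveq_def]
  proof eventually_elim
   case (elim x)
   have "K > 0" "1 + s x > 0" using elim by (auto simp: K_def)
   have "b x powr (e x - real k) = b x powr e x / b x ^ k" using elim by (simp add: powr_diff powr_realpow)
   also have "\<dots> = K * M x * (1 + s x) / (c * m x * (1 + d x)) ^ k" using elim by simp
   finally show ?case using c elim \<open>K > 0\<close> \<open>1 + s x > 0\<close> by (simp add: power_mult_distrib)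
  qed
  ultimately show ?thesis unfolding tinf_def by (rule filterlim_cong[OF refl refl, THEN iffD1, rotated])
 qed
 have "tinf M" using inf[of 0] by simp
 have "AQ GG (\<lambda>h. h \<doteq> M) (\<lambda>x. K * M x)" by (rule GG.AQ_monomial[OF M]) simp
 then have "AQ GG tinf (\<lambda>x. K * M x * s x)"
 proof (rule GG.AQ_mult[OF _ sT])
  fix g h assume gh: "g \<doteq> M" "vanish h \<and> T3 h"
  then obtain k where k: "EV x. 1 <= h x * m x ^ k" unfolding T3_def by blast
  have Mp: "EV x. 0 < M x" using GG.G_pos[OF M] .
  show "tinf (\<lambda>x. g x * h x)"
   unfolding tinf_def
  proof (rule filterlim_at_top_mono)
   show "filterlim (\<lambda>x. M x / m x ^ k) at_top at_top" using inf[of k] by (simp add: tinf_def)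
   show "EV x. M x / m x ^ k <= g x * h x"
    using k Mp mpos gh(1)[unfolded eveq_def]
   proof eventually_elim
    case (elim x)
    then have "M x * 1 <= M x * (h x * m x ^ k)" by (intro mult_left_mono) auto
    then show ?case using elim by (simp add: field_simps)
   qed
  qed
 qed
 moreover have "AQ GG tinf (\<lambda>x. K * M x)" using GG.AQ_monomial[OF M] \<open>tinf M\<close> by blast
 ultimately have "AQ GG tinf (\<lambda>x. K * M x + K * M x * s x)" by (intro GG.AQ_add ev_closed_tinf)
 then show ?thesis by (rule AQ_cong) (use eveq_sym[OF main] in \<open>simp add: algebra_simps\<close>)
qed

text \<open>A finite base is a constant, an infinite one has a leading monomial.\<close>

lemma QQ_power:
 assumes b: "QQ b" "EV x. 2 <= b x" and e: "QQ e" "tinf e"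
 shows "QQ (\<lambda>x. b x powr e x)"
proof -
 obtain N p where p: "AQ GG tinf p" "e \<doteq> (\<lambda>x. of_int N + p x)" using e(1) unfolding QQ_def by blast
 have "AQ GG tinf (\<lambda>x. b x powr e x)"
 proof (rule QQ_cases[OF b(1)])
  fix n :: int assume n: "b \<doteq> (\<lambda>x. of_int n)"
  have "EV x. (2::real) <= of_int n" using n b(2) unfolding eveq_def by eventually_elim simp
  then have "(2::real) <= of_int n" by simp
  from AQ_power_const[OF this p e(2)] show ?thesis
   by (rule AQ_cong) (use n in \<open>auto simp: eveq_def elim: eventually_mono\<close>)
 next
  assume "tinf b"
  from AQ_power_infinite[OF b(1) this p e(2)] show ?thesis .
 next
  assume "tinf (\<lambda>x. - b x)"
  then have "EV x. 0 <= - b x" unfolding tinf_def filterlim_at_top by blast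
  then have "EV x. False" using b(2) by eventually_elim simp
  then show ?thesis by simp
 qed
 then show ?thesis by (rule QQI[of _ _ 0]) simp
qed

lemma QQ_AQ: "QQ f ==> AQ GG (\<lambda>_. True) f"
proof -
 assume "QQ f"
 then obtain N p where p: "AQ GG tinf p" "f \<doteq> (\<lambda>x. of_int N + p x)" unfolding QQ_def by blast
 have "AQ GG (\<lambda>_. True) (\<lambda>x. of_int N * 1 + p x)"
  by (intro GG.AQ_add GG.AQ_monomial GG.G_one GG.AQ_mono[OF p(1)]) auto
 then show ?thesis by (rule AQ_cong) (use eveq_sym[OF p(2)] in simp)
qed

lemma QQ_leading:
 assumes "QQ f" "EV x. 0 < f x"
 obtains c m where "0 < c" "m \<in> GG" "((\<lambda>x. f x / m x) \<longlongrightarrow> c) at_top"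
proof -
 have "\<not> f \<doteq> (\<lambda>x. 0)"
 proof
  assume "f \<doteq> (\<lambda>x. 0)"
  then have "EV x. False" using assms(2) unfolding eveq_def by eventually_elim simp
  then show False by simp
 qed
 then obtain c m d where m: "c \<noteq> 0" "m \<in> GG" "AQ GG (\<lambda>h. vanish h \<and> True) d" "f \<doteq> (\<lambda>x. c * m x * (1 + d x))"
  using GG.leading_term[OF QQ_AQ[OF assms(1)] ev_closed_True] by blast
 have "vanish d" by (rule GG.AQ_vanish) (use m(3) in simp)
 then have "((\<lambda>x. c * (1 + d x)) \<longlongrightarrow> c * (1 + 0)) at_top" unfolding vanish_def by (intro tendsto_intros)
 moreover have "EV x. c * (1 + d x) = f x / m x"
  using m(4)[unfolded eveq_def] GG.eventually_ne[OF m(2)] by eventually_elim simp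
 ultimately have lim: "((\<lambda>x. f x / m x) \<longlongrightarrow> c) at_top" by (simp add: tendsto_cong)
 moreover have "EV x. 0 <= f x / m x" using assms(2) GG.G_pos[OF m(2)] by eventually_elim simp
 then have "0 <= c" using lim by (intro tendsto_lowerbound[OF lim]) auto
 ultimately show ?thesis using that m by force
qed

text \<open>The gap: two positive functions of this kind are either of the same size, or differ in size at
 least by a factor of the size of the identity.\<close>

lemma QQ_gap:
 assumes f: "QQ f" "EV x. 0 < f x" and g: "QQ g" "EV x. 0 < g x"
 shows "\<exists>n::nat. (EV x. f x <= real n * g x \<and> g x <= real n * f x)
  \<or> (EV x. x * f x <= real n * g x) \<or> (EV x. x * g x <= real n * f x)"
proof -
 obtain c m where m: "0 < c" "m \<in> GG" "((\<lambda>x. f x / m x) \<longlongrightarrow> c) at_top" using QQ_leading[OF f] by blast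
 obtain c' m' where m': "0 < c'" "m' \<in> GG" "((\<lambda>x. g x / m' x) \<longlongrightarrow> c') at_top" using QQ_leading[OF g] by blast
 have bnds: "EV x. h x <= 2 * a * w x \<and> a * w x <= 2 * h x"
  if "0 < a" "w \<in> GG" "((\<lambda>x. h x / w x) \<longlongrightarrow> a) at_top" for a w h
 proof -
  have "EV x. h x / w x < 2 * a" "EV x. a / 2 < h x / w x"
   by (rule order_tendstoD[OF that(3)], use that(1) in simp)+
  then show ?thesis using GG.G_pos[OF that(2)] by eventually_elim (auto simp: field_simps)
 qed
 note bf = bnds[OF m] and bg = bnds[OF m']
 note pos = GG.G_pos[OF m(2)] GG.G_pos[OF m'(2)]
 have far: "\<exists>n::nat. EV x. x * h x <= real n * k x"
  if "0 < a" "0 < a'" "w \<in> GG" "w' \<in> GG" "EV x. h x <= 2 * a * w x \<and> a * w x <= 2 * h x"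
   "EV x. k x <= 2 * a' * w' x \<and> a' * w' x <= 2 * k x" "EV x. 0 < k x"
   "tinf (\<lambda>x. w' x * inverse (w x))" for h k w w' a a'
 proof -
  obtain n :: nat where n: "4 * a / a' <= real n" using real_arch_simple by blast
  have "EV x. x <= w' x * inverse (w x)"
   by (rule GG.tinf_ge_ident[OF GG.G_mult[OF that(4) GG.G_inverse[OF that(3)]] that(8)])
  then have "EV x. x * h x <= real n * k x"
   using that(5-7) GG.G_pos[OF that(3)] GG.G_pos[OF that(4)] eventually_gt_at_top[of 0]
  proof eventually_elim
   case (elim x)
   have "x * h x <= x * (2 * a * w x)" using elim by (intro mult_left_mono) auto
   also have "\<dots> = 2 * a * (x * w x)" by simp
   also have "\<dots> <= 2 * a * w' x" using elim \<open>0 < a\<close> by (intro mult_left_mono) (auto simp: field_simps)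
   also have "\<dots> = (2 * a / a') * (a' * w' x)" using \<open>0 < a'\<close> by simp
   also have "\<dots> <= (2 * a / a') * (2 * k x)" using elim \<open>0 < a'\<close> \<open>0 < a\<close> by (intro mult_left_mono) auto
   also have "\<dots> = 4 * a / a' * k x" by simp
   also have "\<dots> <= real n * k x" using elim n by (intro mult_right_mono) auto
   finally show ?case .
  qed
  then show ?thesis by blast
 qed
 have "(\<lambda>x. m x * inverse (m' x)) \<in> GG" using m m' GG.G_mult GG.G_inverse by blast
 from GG.G_cases[OF this] show ?thesis
 proof (elim disjE)
  assume eq: "(\<lambda>x. m x * inverse (m' x)) \<doteq> (\<lambda>x. 1)"
  obtain n :: nat where n: "4 * c / c' + 4 * c' / c <= real n" using real_arch_simple by blast
  have n12: "4 * c / c' <= real n" "4 * c' / c <= real n" using n m(1) m'(1) by (auto intro: order_trans[rotated])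
  have "EV x. f x <= real n * g x \<and> g x <= real n * f x"
   using eq[unfolded eveq_def] bf bg pos f(2) g(2)
  proof eventually_elim
   case (elim x)
   then have "m x = m' x" by (simp add: field_simps)
   have "f x <= 2 * c / c' * (c' * m' x)" using elim \<open>m x = m' x\<close> m'(1) by simp
   also have "\<dots> <= 2 * c / c' * (2 * g x)" using elim m(1) m'(1) by (intro mult_left_mono) auto
   also have "\<dots> <= real n * g x" using mult_right_mono[OF n12(1), of "g x"] elim by simp
   finally have 1: "f x <= real n * g x" .
   have "g x <= 2 * c' / c * (c * m x)" using elim \<open>m x = m' x\<close> m(1) by simp
   also have "\<dots> <= 2 * c' / c * (2 * f x)" using elim m(1) m'(1) by (intro mult_left_mono) auto
   also have "\<dots> <= real n * f x" using mult_right_mono[OF n12(2), of "f x"] elim by simp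
   finally show ?case using 1 by simp
  qed
  then show ?thesis by blast
 next
  assume "tinf (\<lambda>x. m x * inverse (m' x))"
  from far[OF m'(1) m(1) m'(2) m(2) bg bf f(2) this] show ?thesis by blast
 next
  assume "vanish (\<lambda>x. m x * inverse (m' x))"
  then have v: "((\<lambda>x. m x * inverse (m' x)) \<longlongrightarrow> 0) at_top" by (simp add: vanish_def)
  have "EV x. 0 < m x * inverse (m' x)" using pos by eventually_elim simp
  then have "filterlim (\<lambda>x. inverse (m x * inverse (m' x))) at_top at_top"
   by (rule filterlim_inverse_at_top[OF v])
  then have "tinf (\<lambda>x. m' x * inverse (m x))" by (simp add: tinf_def mult.commute)
  from far[OF m(1) m'(1) m(2) m'(2) bf bg g(2) this] show ?thesis by blast
 qed
qed

section \<open>An ordered field of germs with logarithms\<close>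

text \<open>The logarithm of the identity is added as a further monomial; it lies below all infinite
 monomials in \<open>GG\<close>. Then the logarithms of Skolem functions have expansions, too.\<close>

definition GL :: "fn set" where
 "GL = {h. \<exists>m\<in>GG. \<exists>k::int. h \<doteq> (\<lambda>x. m x * exp (k * ln (ln x)))}"

lemma log_powers:
 fixes k :: real
 shows "k > 0 ==> filterlim (\<lambda>x. exp (k * ln (ln x))) at_top at_top"
  "k < 0 ==> ((\<lambda>x. exp (k * ln (ln x))) \<longlongrightarrow> 0) at_top"
  "filterlim (\<lambda>x. x * exp (k * ln (ln x))) at_top at_top"
 by real_asymp+

interpretation GL: mgrp GL
proof
 show "(\<lambda>x. 1) \<in> GL" unfolding GL_def using GG.G_one by (auto intro!: bexI[of _ "\<lambda>x. 1"] exI[of _ 0])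
 fix h h' assume "h \<in> GL"
 then obtain m and k :: int where h: "m \<in> GG" "h \<doteq> (\<lambda>x. m x * exp (k * ln (ln x)))" unfolding GL_def by blast
 show "h' \<in> GL" if "h \<doteq> h'" using h eveq_trans[OF eveq_sym[OF that] h(2)] unfolding GL_def by blast
 show "EV x. 0 < h x" using GG.G_pos[OF h(1)] h(2)[unfolded eveq_def] by eventually_elim simp
 have inv: "(\<lambda>x. inverse (h x)) \<doteq> (\<lambda>x. inverse (m x) * exp (real_of_int (- k) * ln (ln x)))"
  using h(2) unfolding eveq_def by eventually_elim (simp add: exp_minus)
 then show "(\<lambda>x. inverse (h x)) \<in> GL"
  unfolding GL_def by (intro CollectI bexI[OF _ GG.G_inverse[OF h(1)]] exI[of _ "- k"])
 have big: "tinf g" if w: "w \<in> GG" "tinf w" and g: "g \<doteq> (\<lambda>x. w x * exp (real_of_int j * ln (ln x)))" for g w j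
 proof -
  have "filterlim (\<lambda>x. w x * exp (real_of_int j * ln (ln x))) at_top at_top"
   by (rule filterlim_at_top_mono[OF log_powers(3)[of "real_of_int j"]])
    (use GG.tinf_ge_ident[OF w] in \<open>auto elim!: eventually_mono simp: mult_right_mono\<close>)
  then show ?thesis using ev_closedD[OF ev_closed_tinf eveq_sym[OF g]] by (simp add: tinf_def)
 qed
 show "h \<doteq> (\<lambda>x. 1) \<or> vanish h \<or> tinf h"
  using GG.G_cases[OF h(1)]
 proof (elim disjE)
  assume "m \<doteq> (\<lambda>x. 1)"
  then have eq: "h \<doteq> (\<lambda>x. exp (k * ln (ln x)))" using h(2) unfolding eveq_def by eventually_elim simp
  consider "k = 0" | "k > 0" | "k < 0" by linarith
  then show ?thesis
  proof cases
   case 1 then show ?thesis using eq by simp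
  next
   case 2
   then have "tinf (\<lambda>x. exp (k * ln (ln x)))" unfolding tinf_def by (intro log_powers) simp
   then show ?thesis using ev_closedD[OF ev_closed_tinf eveq_sym[OF eq]] by blast
  next
   case 3
   then have "vanish (\<lambda>x. exp (k * ln (ln x)))" unfolding vanish_def by (intro log_powers) simp
   then show ?thesis using ev_closedD[OF ev_closed_vanish eveq_sym[OF eq]] by blast
  qed
 next
  assume "tinf m"
  then show ?thesis using big[OF h(1) _ h(2)] by blast
 next
  assume "vanish m"
  then have "filterlim (\<lambda>x. inverse (m x)) at_top at_top"
   unfolding vanish_def by (rule filterlim_inverse_at_top[OF _ GG.G_pos[OF h(1)]])
  then have "tinf (\<lambda>x. inverse (h x))" using big[OF GG.G_inverse[OF h(1)] _ inv] by (simp add: tinf_def)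
  then show ?thesis using tinf_inverse_vanish by blast
 qed
 assume "h' \<in> GL"
 then obtain m' and k' :: int where h': "m' \<in> GG" "h' \<doteq> (\<lambda>x. m' x * exp (k' * ln (ln x)))" unfolding GL_def by blast
 have "(\<lambda>x. h x * h' x) \<doteq> (\<lambda>x. (m x * m' x) * exp (real_of_int (k + k') * ln (ln x)))"
  using h(2) h'(2) unfolding eveq_def by eventually_elim (simp add: exp_add algebra_simps)
 then show "(\<lambda>x. h x * h' x) \<in> GL"
  unfolding GL_def by (intro CollectI bexI[OF _ GG.G_mult[OF h(1) h'(1)]] exI[of _ "k + k'"])
qed

lemma GG_subset_GL: "GG \<subseteq> GL"
proof
 fix m assume "m \<in> GG"
 then show "m \<in> GL" unfolding GL_def by (auto intro!: bexI[of _ m] exI[of _ 0])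
qed

definition AL :: "fn => bool" where "AL f \<longleftrightarrow> AQ GL (\<lambda>_. True) f"

lemma AL_cong: "AL f ==> f \<doteq> g ==> AL g" unfolding AL_def by (rule AQ_cong)

lemma AL_const: "AL (\<lambda>x. c)"
 using GL.AQ_monomial[OF GL.G_one, of "\<lambda>_. True" c] by (simp add: AL_def)

lemma AL_add: "AL f ==> AL g ==> AL (\<lambda>x. f x + g x)" unfolding AL_def by (rule GL.AQ_add) auto
lemma AL_mult: "AL f ==> AL g ==> AL (\<lambda>x. f x * g x)" unfolding AL_def by (rule GL.AQ_mult) auto

lemma AL_leading:
 assumes "AL f"
 shows "f \<doteq> (\<lambda>x. 0) \<or> (\<exists>c m d. c \<noteq> 0 \<and> m \<in> GL \<and> AQ GL vanish d \<and> f \<doteq> (\<lambda>x. c * m x * (1 + d x)))"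
 using GL.leading_term[OF assms[unfolded AL_def] ev_closed_True] by simp

lemma vanish_gt: "vanish d ==> EV x. -1 < d x"
 unfolding vanish_def by (erule order_tendstoD) simp

text \<open>The inverse of \<open>c m (1 + d)\<close>, by the geometric series.\<close>

lemma AL_inverse:
 assumes "AL f"
 shows "AL (\<lambda>x. inverse (f x))"
 using AL_leading[OF assms]
proof (elim disjE exE conjE)
 assume "f \<doteq> (\<lambda>x. 0)"
 then have "(\<lambda>x. 0) \<doteq> (\<lambda>x. inverse (f x))" unfolding eveq_def by eventually_elim simp
 then show ?thesis using AL_cong[OF AL_const[of 0]] by blast
next
 fix c m d assume m: "c \<noteq> 0" "m \<in> GL" "AQ GL vanish d" "f \<doteq> (\<lambda>x. c * m x * (1 + d x))"
 have "AL (\<lambda>x. (1 / c * inverse (m x)) * (1 + (1 / (1 + d x) - 1)))"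
  unfolding AL_def
  by (intro AL_mult[unfolded AL_def] AL_add[unfolded AL_def] AL_const[unfolded AL_def] GL.AQ_monomial GL.G_inverse m(2)
    GL.AQ_mono[OF GL.AQ_reciprocal[OF m(3)]]) auto
 moreover have "(\<lambda>x. (1 / c * inverse (m x)) * (1 + (1 / (1 + d x) - 1))) \<doteq> (\<lambda>x. inverse (f x))"
  using m(4) vanish_gt[OF GL.AQ_vanish[OF m(3)]] GL.eventually_ne[OF m(2)] unfolding eveq_def
  by eventually_elim (use m(1) in \<open>simp add: field_simps\<close>)
 ultimately show ?thesis by (rule AL_cong)
qed

lemma AL_sign:
 assumes "AL f"
 shows "f \<doteq> (\<lambda>x. 0) \<or> (EV x. 0 < f x) \<or> (EV x. f x < 0)"
 using AL_leading[OF assms]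
proof (elim disjE exE conjE)
 fix c m d assume m: "c \<noteq> 0" "m \<in> GL" "AQ GL vanish d" "f \<doteq> (\<lambda>x. c * m x * (1 + d x))"
 note ev = m(4)[unfolded eveq_def] vanish_gt[OF GL.AQ_vanish[OF m(3)]] GL.G_pos[OF m(2)]
 show ?thesis
 proof (cases "c > 0")
  case True
  have "EV x. 0 < f x" using ev by eventually_elim (use True in \<open>auto intro!: mult_pos_pos\<close>)
  then show ?thesis by blast
 next
  case False
  have "EV x. f x < 0"
   using ev by eventually_elim (use False m(1) in \<open>auto simp: mult_less_0_iff zero_less_mult_iff\<close>)
  then show ?thesis by blast
 qed
qed simp

lemma AQ_AL: "AQ GG T f ==> AL f"
 unfolding AL_def by (rule AQ_group_mono[OF GG.AQ_mono[of T] GG_subset_GL]) auto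

lemma QQ_AL: "QQ f ==> AL f" by (rule AQ_AL[OF QQ_AQ])

lemma AL_ln_ident: "AL ln"
proof -
 have "(\<lambda>x. exp (real_of_int 1 * ln (ln x))) \<doteq> ln"
  unfolding eveq_def using eventually_gt_at_top[of 1] by eventually_elim simp
 moreover from this have "(\<lambda>x. exp (real_of_int 1 * ln (ln x))) \<in> GL"
  unfolding GL_def using GG.G_one by (intro CollectI bexI[of _ "\<lambda>x. 1"] exI[of _ 1]) auto
 ultimately show ?thesis
  using AL_cong GL.AQ_monomial[of "\<lambda>x. exp (real_of_int 1 * ln (ln x))" "\<lambda>_. True" 1] unfolding AL_def by simp
qed

lemma AL_ln:
 assumes "QQ f" "EV x. 0 < f x"
 shows "AL (\<lambda>x. ln (f x))"
proof -
 have "\<not> f \<doteq> (\<lambda>x. 0)"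
 proof
  assume "f \<doteq> (\<lambda>x. 0)"
  then have "EV x. False" using assms(2) unfolding eveq_def by eventually_elim simp
  then show False by simp
 qed
 then obtain c m d where m: "c \<noteq> 0" "m \<in> GG" "AQ GG (\<lambda>h. vanish h \<and> True) d" "f \<doteq> (\<lambda>x. c * m x * (1 + d x))"
  using GG.leading_term[OF QQ_AQ[OF assms(1)] ev_closed_True] by blast
 have d: "EV x. -1 < d x" by (rule vanish_gt, rule GG.AQ_vanish) (use m(3) in simp)
 note ev = m(4)[unfolded eveq_def] d GG.G_pos[OF m(2)] assms(2)
 have c: "0 < c"
 proof (rule ccontr)
  assume "\<not> 0 < c"
  have "EV x. False"
   using ev by eventually_elim (use \<open>\<not> 0 < c\<close> in \<open>auto simp: zero_less_mult_iff\<close>)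
  then show False by simp
 qed
 obtain p q n where pq: "AQ GG tinf p" "AQ GG tinf q" "m \<doteq> (\<lambda>x. exp (p x + ln x * (real_of_int n + q x)))"
  using GG.G_ln[OF m(2)] by blast
 have "AL (\<lambda>x. (ln c + (p x + ln x * (real_of_int n + q x))) + ln (1 + d x))"
  by (intro AL_add AL_mult AL_const AL_ln_ident AQ_AL[OF pq(1)] AQ_AL[OF pq(2)] AQ_AL[OF GG.AQ_ln[OF m(3)]]) auto
 moreover have "(\<lambda>x. (ln c + (p x + ln x * (real_of_int n + q x))) + ln (1 + d x)) \<doteq> (\<lambda>x. ln (f x))"
  unfolding eveq_def using ev pq(3)[unfolded eveq_def]
 proof eventually_elim
  case (elim x)
  have "0 < 1 + d x" using elim by simp
  have "ln (f x) = ln (c * m x * (1 + d x))" using elim by simp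
  also have "\<dots> = ln (c * m x) + ln (1 + d x)"
   using c elim(3) \<open>0 < 1 + d x\<close> by (intro ln_mult_pos) (auto intro: mult_pos_pos)
  also have "ln (c * m x) = ln c + ln (m x)" using c elim by (intro ln_mult_pos) auto
  also have "ln (m x) = p x + ln x * (real_of_int n + q x)" using elim(5) by simp
  finally show ?case by simp
 qed
 ultimately show ?thesis by (rule AL_cong)
qed

text \<open>The germs of functions with an expansion over \<open>GL\<close>. The leading terms make them an ordered
 field; in it differences, quotients and logarithms of Skolem functions can be compared.\<close>

quotient_type tf = fn / partial: "\<lambda>f g. AL f \<and> AL g \<and> f \<doteq> g"
 morphisms rep_tf Tf
proof (rule part_equivpI)
 show "\<exists>f. AL f \<and> AL f \<and> f \<doteq> f" using AL_const by (intro exI[of _ "\<lambda>x. 0"]) simp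
 show "symp (\<lambda>f g. AL f \<and> AL g \<and> f \<doteq> g)" by (intro sympI) (simp add: eveq_sym)
 show "transp (\<lambda>f g. AL f \<and> AL g \<and> f \<doteq> g)" by (intro transpI) (use eveq_trans in blast)
qed

lemma AL_uminus: "AL f ==> AL (\<lambda>x. - f x)" using AL_mult[OF AL_const[of "-1"], of f] by simp
lemma AL_diff: "AL f ==> AL g ==> AL (\<lambda>x. f x - g x)" using AL_add[OF _ AL_uminus, of f g] by simp

instantiation tf :: linordered_field
begin

lift_definition zero_tf :: tf is "\<lambda>x. 0" using AL_const by simp
lift_definition one_tf :: tf is "\<lambda>x. 1" using AL_const by simp
lift_definition plus_tf :: "tf => tf => tf" is "\<lambda>f g x. f x + g x" by (simp add: AL_add eveq_add)
lift_definition times_tf :: "tf => tf => tf" is "\<lambda>f g x. f x * g x" by (simp add: AL_mult eveq_mult)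
lift_definition uminus_tf :: "tf => tf" is "\<lambda>f x. - f x" by (simp add: AL_uminus eveq_comp)
lift_definition minus_tf :: "tf => tf => tf" is "\<lambda>f g x. f x - g x"
 by (auto simp: AL_diff eveq_def elim: eventually_elim2)
lift_definition inverse_tf :: "tf => tf" is "\<lambda>f x. inverse (f x)" by (simp add: AL_inverse eveq_comp)
lift_definition less_tf :: "tf => tf => bool" is "\<lambda>f g. EV x. f x < g x"
proof -
 fix f f' g g' :: fn assume "AL f \<and> AL f' \<and> f \<doteq> f'" "AL g \<and> AL g' \<and> g \<doteq> g'"
 then have "EV x. f x = f' x" "EV x. g x = g' x" by (auto simp: eveq_def)
 then have "EV x. (f x < g x) = (f' x < g' x)" by eventually_elim simp
 then show "(EV x. f x < g x) = (EV x. f' x < g' x)" by (rule eventually_subst)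
qed
lift_definition less_eq_tf :: "tf => tf => bool" is "\<lambda>f g. EV x. f x <= g x"
proof -
 fix f f' g g' :: fn assume "AL f \<and> AL f' \<and> f \<doteq> f'" "AL g \<and> AL g' \<and> g \<doteq> g'"
 then have "EV x. f x = f' x" "EV x. g x = g' x" by (auto simp: eveq_def)
 then have "EV x. (f x <= g x) = (f' x <= g' x)" by eventually_elim simp
 then show "(EV x. f x <= g x) = (EV x. f' x <= g' x)" by (rule eventually_subst)
qed
definition divide_tf :: "tf => tf => tf" where "divide_tf a b = a * inverse b"
definition abs_tf :: "tf => tf" where "abs_tf a = (if a < 0 then - a else a)"
definition sgn_tf :: "tf => tf" where "sgn_tf a = (if a = 0 then 0 else if 0 < a then 1 else -1)"

instance
proof
 fix a b c :: tf
 show "a + b + c = a + (b + c)" by transfer (simp add: AL_add add.assoc)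
 show "a + b = b + a" by transfer (simp add: AL_add add.commute)
 show "0 + a = a" by transfer simp
 show "- a + a = 0" by transfer (simp add: AL_const)
 show "a - b = a + - b" by transfer (simp add: AL_diff)
 show "a * b * c = a * (b * c)" by transfer (simp add: AL_mult mult.assoc)
 show "a * b = b * a" by transfer (simp add: AL_mult mult.commute)
 show "1 * a = a" by transfer simp
 show "(a + b) * c = a * c + b * c" by transfer (simp add: AL_mult AL_add distrib_right)
 show "a + b - a = b" by transfer (simp add: AL_add AL_diff)
 show "a - b - c = a - (b + c)" by transfer (simp add: AL_add AL_diff diff_diff_add)
 show "0 * a = 0" by transfer (simp add: AL_const)
 show "a * 0 = 0" by transfer (simp add: AL_const)
 show "(0::tf) \<noteq> 1" by transfer (simp add: AL_const eveq_def)
 show "inverse (0::tf) = 0" by transfer (simp add: AL_const)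
 show "a div b = a * inverse b" by (simp add: divide_tf_def)
 show "\<bar>a\<bar> = (if a < 0 then - a else a)" by (simp add: abs_tf_def)
 show "sgn a = (if a = 0 then 0 else if 0 < a then 1 else -1)" by (simp add: sgn_tf_def)
 show "a <= a" by transfer simp
 show "a <= b ==> b <= c ==> a <= c"
 proof transfer
  fix f g h :: fn assume "EV x. f x <= g x" "EV x. g x <= h x"
  then show "EV x. f x <= h x" by eventually_elim simp
 qed
 show "a <= b ==> b <= a ==> a = b"
 proof transfer
  fix f g :: fn assume "AL f \<and> AL f \<and> f \<doteq> f" "AL g \<and> AL g \<and> g \<doteq> g"
   and le: "EV x. f x <= g x" "EV x. g x <= f x"
  moreover have "f \<doteq> g" unfolding eveq_def using le by eventually_elim simp
  ultimately show "AL f \<and> AL g \<and> f \<doteq> g" by simp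
 qed
 show "a <= b ==> c + a <= c + b" by transfer simp
 have sign: "a <= b \<or> b < a" for a b :: tf
 proof transfer
  fix f g :: fn assume "AL f \<and> AL f \<and> f \<doteq> f" "AL g \<and> AL g \<and> g \<doteq> g"
  then have "AL (\<lambda>x. f x - g x)" using AL_diff by blast
  from AL_sign[OF this] show "(EV x. f x <= g x) \<or> (EV x. g x < f x)"
   by (auto simp: eveq_def elim: eventually_mono)
 qed
 have less_le: "a < b ==> a <= b" for a b :: tf by transfer (auto elim: eventually_mono)
 have nle: "a < b ==> \<not> b <= a" for a b :: tf
 proof transfer
  fix f g :: fn assume lt: "EV x. f x < g x"
  show "\<not> (EV x. g x <= f x)"
  proof
   assume "EV x. g x <= f x"
   then have "EV x. False" using lt by eventually_elim simp
   then show False by simp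
  qed
 qed
 show "(a < b) = (a <= b \<and> \<not> b <= a)" using sign less_le nle by blast
 show "a <= b \<or> b <= a" using sign less_le by blast
 show "a < b ==> 0 < c ==> c * a < c * b"
 proof transfer
  fix f g h :: fn assume "EV x. f x < g x" "EV x. 0 < h x"
  then show "EV x. h x * f x < h x * g x" by eventually_elim simp
 qed
 show "a \<noteq> 0 ==> inverse a * a = 1"
 proof transfer
  fix f :: fn assume f: "AL f \<and> AL f \<and> f \<doteq> f" and nz: "\<not> (AL f \<and> AL (\<lambda>x. 0) \<and> f \<doteq> (\<lambda>x. 0))"
  then have "(EV x. 0 < f x) \<or> (EV x. f x < 0)" using AL_sign AL_const by blast
  then have "(\<lambda>x. inverse (f x) * f x) \<doteq> (\<lambda>x. 1)" unfolding eveq_def by (auto elim!: eventually_mono)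
  then show "AL (\<lambda>x. inverse (f x) * f x) \<and> AL (\<lambda>x. 1) \<and> (\<lambda>x. inverse (f x) * f x) \<doteq> (\<lambda>x. 1)"
   using f AL_mult AL_inverse AL_const by blast
 qed
qed

end

context includes lifting_syntax begin

lemma of_nat_transfer [transfer_rule]: "((=) ===> pcr_tf) (\<lambda>n x. real n) of_nat"
proof (intro rel_funI, simp)
 fix n :: nat
 show "pcr_tf (\<lambda>x. real n) (of_nat n)"
 proof (induct n)
  case 0
  then show ?case using zero_tf.transfer by simp
 next
  case (Suc n)
  from plus_tf.transfer[THEN rel_funD, THEN rel_funD, OF one_tf.transfer this] show ?case by simp
 qed
qed

lemma of_int_transfer [transfer_rule]: "((=) ===> pcr_tf) (\<lambda>n x. real_of_int n) of_int"
proof (intro rel_funI, simp)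
 fix n :: int
 note nat = of_nat_transfer[THEN rel_funD, OF refl]
 show "pcr_tf (\<lambda>x. real_of_int n) (of_int n)"
 proof (cases n)
  case (nonneg m)
  then show ?thesis using nat[of m] by simp
 next
  case (neg m)
  from uminus_tf.transfer[THEN rel_funD, OF nat[of "Suc m"]] show ?thesis using neg by simp
 qed
qed

lemma power_transfer [transfer_rule]: "(pcr_tf ===> (=) ===> pcr_tf) (\<lambda>f n x. f x ^ n) (^)"
proof (intro rel_funI, simp)
 fix f a and n :: nat assume a: "pcr_tf f a"
 show "pcr_tf (\<lambda>x. f x ^ n) (a ^ n)"
 proof (induct n)
  case 0
  then show ?case using one_tf.transfer by simp
 next
  case (Suc n)
  from times_tf.transfer[THEN rel_funD, THEN rel_funD, OF a this] show ?case by simp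
 qed
qed

end

lift_definition X :: tf is "\<lambda>x. x" using QQ_AL[OF QQ_ident] by simp

lift_definition qq :: "tf => bool" is QQ using QQ_cong eveq_sym by blast

text \<open>The default values only serve to make logarithm and power total on the field.\<close>

definition lnf :: "fn => fn" where "lnf f = (if AL (\<lambda>x. ln (f x)) then (\<lambda>x. ln (f x)) else (\<lambda>x. 0))"

definition powf :: "fn => fn => fn" where
 "powf f g = (if AL (\<lambda>x. f x powr g x) then (\<lambda>x. f x powr g x) else (\<lambda>x. 0))"

lemma lnf_eq [simp]: "AL (\<lambda>x. ln (f x)) ==> lnf f = (\<lambda>x. ln (f x))" by (simp add: lnf_def)

lemma powf_eq [simp]: "AL (\<lambda>x. f x powr g x) ==> powf f g = (\<lambda>x. f x powr g x)" by (simp add: powf_def)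

lift_definition Ln :: "tf => tf" is lnf
proof -
 fix f g :: fn assume a: "AL f \<and> AL g \<and> f \<doteq> g"
 then have "(\<lambda>x. ln (f x)) \<doteq> (\<lambda>x. ln (g x))" by (auto intro: eveq_comp)
 then show "?thesis f g" using AL_cong AL_const eveq_sym[of "\<lambda>x. ln (f x)"] unfolding lnf_def by auto
qed

lift_definition pw :: "tf => tf => tf" is powf
proof -
 fix f f' g g' :: fn assume a: "AL f \<and> AL f' \<and> f \<doteq> f'" "AL g \<and> AL g' \<and> g \<doteq> g'"
 then have "(\<lambda>x. f x powr g x) \<doteq> (\<lambda>x. f' x powr g' x)" unfolding eveq_def by (auto elim: eventually_elim2)
 then show "?thesis f f' g g'" using AL_cong AL_const eveq_sym[of "\<lambda>x. f x powr g x"] unfolding powf_def by auto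
qed

lift_definition lnok :: "tf => bool" is "\<lambda>f. AL (\<lambda>x. ln (f x)) \<and> (EV x. 0 < f x)"
proof -
 fix f g :: fn assume a: "AL f \<and> AL g \<and> f \<doteq> g"
 then have "(\<lambda>x. ln (f x)) \<doteq> (\<lambda>x. ln (g x))" by (auto intro: eveq_comp)
 moreover have "EV x. (0 < f x) = (0 < g x)" using a unfolding eveq_def by (auto elim: eventually_mono)
 ultimately show "?thesis f g" using AL_cong eveq_sym[of "\<lambda>x. ln (f x)"] eventually_subst by metis
qed

lift_definition tgerm :: "tf => germ" is "\<lambda>f. f" by (simp add: eveq_def)

definition infl :: "tf => bool" where "infl a \<longleftrightarrow> (\<forall>n::nat. of_nat n <= a)"

lemma infl_transfer [transfer_rule]: "rel_fun pcr_tf (=) tinf infl"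
proof (intro rel_funI)
 fix f a assume a: "pcr_tf f a"
 have "infl a \<longleftrightarrow> (\<forall>n::nat. EV x. real n <= f x)"
  unfolding infl_def
  using less_eq_tf.transfer[THEN rel_funD, THEN rel_funD, OF of_nat_transfer[THEN rel_funD, OF refl] a] by simp
 also have "\<dots> \<longleftrightarrow> tinf f"
  unfolding tinf_def filterlim_at_top
 proof (intro iffI allI)
  fix Z :: real assume h: "\<forall>n::nat. EV x. real n <= f x"
  obtain n :: nat where "Z <= real n" using real_arch_simple by blast
  with h[rule_format, of n] show "EV x. Z <= f x" by (auto elim: eventually_mono)
 qed simp
 finally show "tinf f = infl a" by simp
qed

subsection \<open>Integral differences\<close>

lemma qq_of_int: "qq (of_int n)" by transfer (rule QQ_const)
lemma qq_of_nat: "qq (of_nat n)" using qq_of_int[of "int n"] by simp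
lemma qq_1: "qq 1" using qq_of_nat[of 1] by simp
lemma qq_X: "qq X" by transfer (rule QQ_ident)
lemma qq_add: "qq a ==> qq b ==> qq (a + b)" by transfer (rule QQ_add)
lemma qq_mult: "qq a ==> qq b ==> qq (a * b)" by transfer (rule QQ_mult)
lemma qq_diff: "qq a ==> qq b ==> qq (a - b)" by transfer (rule QQ_diff)

lemma infl_X: "infl X" by transfer (simp add: tinf_def filterlim_ident)

lemma qq_cases: "qq a ==> (\<exists>n. a = of_int n) \<or> infl a \<or> infl (- a)"
proof transfer
 fix f assume f: "AL f \<and> AL f \<and> f \<doteq> f" "QQ f"
 show "(\<exists>n. AL f \<and> AL (\<lambda>x. real_of_int n) \<and> f \<doteq> (\<lambda>x. real_of_int n)) \<or> tinf f \<or> tinf (\<lambda>x. - f x)"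
  by (rule QQ_cases[OF f(2)]) (use f AL_const in auto)
qed

lemma qq_gap:
 assumes "qq a" "0 < a" "qq b" "0 < b"
 shows "\<exists>n::nat. (a <= of_nat n * b \<and> b <= of_nat n * a) \<or> X * a <= of_nat n * b \<or> X * b <= of_nat n * a"
 using assms
proof transfer
 fix f g assume "QQ f" "EV x. 0 < f x" "QQ g" "EV x. 0 < g x"
 from QQ_gap[OF this] show "\<exists>n. (EV x. f x <= real n * g x) \<and> (EV x. g x <= real n * f x) \<or>
   (EV x. x * f x <= real n * g x) \<or> (EV x. x * g x <= real n * f x)"
  by (simp add: eventually_conj_iff)
qed

subsection \<open>Logarithms\<close>

lemma qq_lnok: "qq a ==> 0 < a ==> lnok a" by transfer (simp add: AL_ln)

lemma lnok_mult: "lnok a ==> lnok b ==> lnok (a * b) \<and> Ln (a * b) = Ln a + Ln b"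
proof transfer
 fix f g assume fg: "AL f \<and> AL f \<and> f \<doteq> f" "AL g \<and> AL g \<and> g \<doteq> g"
  and a: "AL (\<lambda>x. ln (f x)) \<and> (EV x. 0 < f x)" "AL (\<lambda>x. ln (g x)) \<and> (EV x. 0 < g x)"
 then have p: "EV x. 0 < f x" "EV x. 0 < g x" by auto
 have eq: "(\<lambda>x. ln (f x * g x)) \<doteq> (\<lambda>x. ln (f x) + ln (g x))"
  unfolding eveq_def using p by eventually_elim (simp add: ln_mult_pos)
 have "EV x. 0 < f x * g x" using p by eventually_elim simp
 moreover have "AL (\<lambda>x. ln (f x * g x))" using AL_cong[OF AL_add eveq_sym[OF eq]] a by blast
 moreover have "AL (\<lambda>x. ln (f x) + ln (g x))" using AL_add a by blast
 ultimately show "(AL (\<lambda>x. ln (f x * g x)) \<and> (EV x. 0 < f x * g x)) \<and>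
   AL (lnf (\<lambda>x. f x * g x)) \<and> AL (\<lambda>x. lnf f x + lnf g x) \<and>
   lnf (\<lambda>x. f x * g x) \<doteq> (\<lambda>x. lnf f x + lnf g x)"
  using a eq by simp
qed

lemma Ln_le_iff: "lnok a ==> lnok b ==> Ln a <= Ln b \<longleftrightarrow> a <= b"
proof transfer
 fix f g assume a: "AL (\<lambda>x. ln (f x)) \<and> (EV x. 0 < f x)" "AL (\<lambda>x. ln (g x)) \<and> (EV x. 0 < g x)"
 then have p: "EV x. 0 < f x" "EV x. 0 < g x" by auto
 then have "EV x. (ln (f x) <= ln (g x)) = (f x <= g x)" by eventually_elim simp
 then have "(EV x. ln (f x) <= ln (g x)) = (EV x. f x <= g x)" by (rule eventually_subst)
 then show "(EV x. lnf f x <= lnf g x) = (EV x. f x <= g x)"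
  using a by simp
qed

lemma Ln_1 [simp]: "Ln 1 = 0" by transfer (simp add: AL_const)
lemma lnok_1 [simp]: "lnok 1" using qq_lnok[OF qq_1] by simp

lemma Ln_diff_le:
 assumes "lnok a" "lnok b" shows "Ln a - Ln b <= (a - b) / b"
 unfolding divide_tf_def using assms
proof transfer
 fix f g assume a: "AL (\<lambda>x. ln (f x)) \<and> (EV x. 0 < f x)" "AL (\<lambda>x. ln (g x)) \<and> (EV x. 0 < g x)"
 then have p: "EV x. 0 < f x" "EV x. 0 < g x" by auto
 then have "EV x. ln (f x) - ln (g x) <= (f x - g x) * inverse (g x)"
  by eventually_elim (use ln_diff_le in \<open>simp add: divide_inverse\<close>)
 then show "EV x. lnf f x - lnf g x <= (f x - g x) * inverse (g x)"
  using a by simp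
qed

lemma exp_le_1_2: "0 <= (v::real) ==> v <= 1 ==> exp v <= 1 + 2 * v"
proof -
 assume "0 <= v" "v <= 1"
 then have "exp v <= 1 + v + v^2" by (rule exp_bound)
 also have "v^2 <= v" using \<open>0 <= v\<close> \<open>v <= 1\<close> by (simp add: power2_eq_square mult_left_le)
 finally show ?thesis by simp
qed

lemma le_of_Ln_diff:
 assumes "lnok a" "lnok b" "Ln a - Ln b <= v" "0 <= v" "v <= 1"
 shows "a <= b + b * v + b * v"
 using assms
proof transfer
 fix f g v assume a: "AL (\<lambda>x. ln (f x)) \<and> (EV x. 0 < f x)" "AL (\<lambda>x. ln (g x)) \<and> (EV x. 0 < g x)"
  and v: "EV x. 0 <= v x" "EV x. v x <= 1"
  and le: "EV x. lnf f x - lnf g x <= v x"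
 from le have le': "EV x. ln (f x) - ln (g x) <= v x" using a by simp
 have p: "EV x. 0 < f x" "EV x. 0 < g x" using a by auto
 show "EV x. f x <= g x + g x * v x + g x * v x"
  using p v le'
 proof eventually_elim
  case (elim x)
  have "f x = exp (ln (f x))" using elim by simp
  also have "\<dots> <= exp (ln (g x) + v x)" using elim by (subst exp_le_cancel_iff) linarith
  also have "\<dots> = g x * exp (v x)" using elim by (simp add: exp_add)
  also have "\<dots> <= g x * (1 + 2 * v x)" using elim exp_le_1_2 by (intro mult_left_mono) auto
  finally show ?case by (simp add: algebra_simps)
 qed
qed

lemma le_of_Ln_diff_nat:
 assumes "lnok a" "lnok b" "Ln a - Ln b <= of_nat n"
 shows "a <= of_nat (4 ^ n) * b"
 using assms
proof transfer
 fix f g and n :: nat assume a: "AL (\<lambda>x. ln (f x)) \<and> (EV x. 0 < f x)" "AL (\<lambda>x. ln (g x)) \<and> (EV x. 0 < g x)"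
  and le: "EV x. lnf f x - lnf g x <= real n"
 from le have le': "EV x. ln (f x) - ln (g x) <= real n" using a by simp
 have p: "EV x. 0 < f x" "EV x. 0 < g x" using a by auto
 show "EV x. f x <= real (4 ^ n) * g x"
  using p le'
 proof eventually_elim
  case (elim x)
  have "f x = exp (ln (f x))" using elim by simp
  also have "\<dots> <= exp (ln (g x) + real n)" using elim by (subst exp_le_cancel_iff) linarith
  also have "\<dots> = g x * exp 1 ^ n" using elim by (simp add: exp_add exp_of_nat_mult[of n 1, simplified])
  also have "\<dots> <= g x * 4 ^ n" using elim exp_le by (intro mult_left_mono power_mono) auto
  finally show ?case by (simp add: mult.commute)
 qed
qed

lemma Ln_2: "1 <= 2 * Ln 2" "Ln 2 <= 1"
proof -
 have n: "(2::tf) = of_nat 2" by simp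
 have l: "ln (2::real) \<ge> 1/2" using ln_le_minus_one[of "1/2 :: real"] by (simp add: ln_div)
 have "1 <= of_nat 2 * Ln (of_nat 2)" by transfer (simp add: AL_const, use l in linarith)
 then show "1 <= 2 * Ln 2" by simp
 have "Ln (of_nat 2) <= 1" by transfer (simp add: AL_const, use ln_2_less_1 in linarith)
 then show "Ln 2 <= 1" by simp
qed

lemma infl_Ln:
 assumes "lnok a" "infl a"
 shows "of_nat n * Ln a <= a" "infl (Ln a)"
proof -
 have lim: "filterlim (\<lambda>x::real. x - real n * ln x) at_top at_top" by real_asymp
 show "of_nat n * Ln a <= a"
  using assms
 proof transfer
  fix f and n :: nat assume a: "AL (\<lambda>x. ln (f x)) \<and> (EV x. 0 < f x)" "tinf f"
  have lim: "filterlim (\<lambda>x::real. x - real n * ln x) at_top at_top" by real_asymp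
  have "filterlim (\<lambda>x. f x - real n * ln (f x)) at_top at_top"
   by (rule filterlim_compose[OF lim a(2)[unfolded tinf_def]])
  then have "EV x. 0 <= f x - real n * ln (f x)" unfolding filterlim_at_top by blast
  then show "EV x. real n * lnf f x <= f x"
   using a by simp
 qed
 show "infl (Ln a)"
  using assms by transfer (auto simp: tinf_def intro: filterlim_compose[OF ln_at_top])
qed

subsection \<open>Powers\<close>

lemma pw_infl:
 assumes "qq b" "2 <= b" "qq e" "infl e"
 shows "qq (pw b e)" "Ln (pw b e) = e * Ln b" "infl (pw b e)"
proof -
 have b: "of_nat 2 <= b" using assms(2) by simp
 have main: "qq (pw b e) \<and> Ln (pw b e) = e * Ln b \<and> infl (pw b e)"
  using assms(1,3,4) b
 proof transfer
  fix f g assume fg: "AL f \<and> AL f \<and> f \<doteq> f" "AL g \<and> AL g \<and> g \<doteq> g" and q: "QQ f" "QQ g" "tinf g"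
   "EV x. real 2 <= f x"
  have f2: "EV x. 2 <= f x" using q(4) by simp
  have Q: "QQ (\<lambda>x. f x powr g x)" by (rule QQ_power[OF q(1) f2 q(2,3)])
  have pos: "EV x. 0 < f x powr g x" using f2 by eventually_elim simp
  have "EV x. 0 < f x" using f2 by eventually_elim simp
  then have l: "AL (\<lambda>x. ln (f x powr g x))" "AL (\<lambda>x. ln (f x))" using AL_ln Q q(1) pos by blast+
  have eq: "(\<lambda>x. ln (f x powr g x)) \<doteq> (\<lambda>x. g x * ln (f x))"
   unfolding eveq_def using f2 by eventually_elim (simp add: ln_powr)
  show "QQ (powf f g) \<and> (AL (lnf (powf f g)) \<and> AL (\<lambda>x. g x * lnf f x) \<and>
    lnf (powf f g) \<doteq> (\<lambda>x. g x * lnf f x)) \<and> tinf (powf f g)"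
   using QQ_AL[OF Q] Q l eq AL_mult[OF _ l(2)] fg powr_tinf[OF f2 q(3)] by simp
 qed
 then show "qq (pw b e)" "Ln (pw b e) = e * Ln b" "infl (pw b e)" by blast+
qed

lemma pw_1: "pw 1 e = 1"
 by transfer (simp add: AL_const powf_def)

lemma pw_of_nat: "0 < b ==> pw b (of_nat n) = b ^ n"
proof transfer
 fix f :: fn and n :: nat assume f: "AL f \<and> AL f \<and> f \<doteq> f" "EV x. 0 < f x"
 have eq: "(\<lambda>x. f x powr real n) \<doteq> (\<lambda>x. f x ^ n)"
  unfolding eveq_def using f(2) by eventually_elim (simp add: powr_realpow)
 have "AL (\<lambda>x. f x ^ n)" using f(1) by (induct n) (auto intro: AL_const AL_mult)
 then show "AL (powf f (\<lambda>x. real n)) \<and> AL (\<lambda>x. f x ^ n) \<and> powf f (\<lambda>x. real n) \<doteq> (\<lambda>x. f x ^ n)"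
  using AL_cong[OF _ eveq_sym[OF eq]] eq by simp
qed

subsection \<open>Skolem functions in the field\<close>

inductive_set SK :: "tf set" where
 SK_one: "1 \<in> SK"
| SK_X: "X \<in> SK"
| SK_add: "a \<in> SK ==> b \<in> SK ==> a + b \<in> SK"
| SK_mult: "a \<in> SK ==> b \<in> SK ==> a * b \<in> SK"
| SK_pw: "a \<in> SK ==> b \<in> SK ==> pw a b \<in> SK"

lemma of_nat_or_ge_2: "1 <= (of_int n :: tf) ==> \<exists>k::nat. k \<ge> 1 \<and> of_int n = (of_nat k :: tf)"
 by (intro exI[of _ "nat n"]) (metis le_nat_iff of_int_1_le_iff of_nat_1 of_nat_nat order_trans zero_le_one int_eq_iff zero_less_one nat_le_iff nat_1 nat_mono)

lemma SK_qq:
 assumes "a \<in> SK"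
 shows "qq a \<and> 1 <= a"
 using assms
proof induct
 case (SK_pw a b)
 have ca: "(\<exists>k::nat. k \<ge> 1 \<and> c = of_nat k) \<or> infl c" if "qq c" "1 <= c" for c
  using qq_cases[OF that(1)]
 proof (elim disjE exE)
  assume "infl (- c)"
  then have "of_nat 0 <= - c" unfolding infl_def by blast
  then show ?thesis using that(2) by simp
 qed (use that of_nat_or_ge_2 in auto)
 have "(\<exists>k::nat. k \<ge> 1 \<and> a = of_nat k) \<or> infl a" using ca SK_pw by blast
 then have a2: "a = 1 \<or> 2 <= a"
 proof (elim disjE exE conjE)
  fix k :: nat assume "1 <= k" "a = of_nat k"
  then have "k = 1 \<or> 2 <= k" "of_nat 2 = (2::tf)" by auto
  then show ?thesis using \<open>a = of_nat k\<close> of_nat_mono[of 2 k, where 'a = tf] by auto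
 next
  assume "infl a"
  then have "of_nat 2 <= a" unfolding infl_def by blast
  then show ?thesis by simp
 qed
 have q: "qq (a ^ n)" for n using SK_pw by (induct n) (auto intro: qq_1 qq_mult)
 from a2 show ?case
 proof
  assume "a = 1"
  then show ?case by (simp add: pw_1 qq_1)
 next
  assume "2 <= a"
  then have "0 < a" "1 <= a" by auto
  consider n :: nat where "n \<ge> 1" "b = of_nat n" | "infl b" using ca[of b] SK_pw by blast
  then show ?case
  proof cases
   case 1
   then show ?thesis using pw_of_nat[OF \<open>0 < a\<close>] q \<open>1 <= a\<close> by (simp add: one_le_power)
  next
   case 2
   then have "qq (pw a b)" "infl (pw a b)" using pw_infl SK_pw \<open>2 <= a\<close> by blast+
   then have "of_nat 1 <= pw a b" unfolding infl_def by blast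
   then show ?thesis using \<open>qq (pw a b)\<close> by simp
  qed
 qed
next
 case (SK_mult a b)
 then have "1 * 1 <= a * b" by (intro mult_mono) auto
 then show ?case using SK_mult qq_mult by simp
qed (auto simp: qq_1 qq_X qq_add intro: add_increasing infl_X[unfolded infl_def, rule_format, of 1, simplified])

lemma SK_qqD: "a \<in> SK ==> qq a" "a \<in> SK ==> 1 <= a" "a \<in> SK ==> 0 < a" "a \<in> SK ==> lnok a"
 using SK_qq[of a] qq_lnok[of a] by auto

lemma SK_cases:
 assumes "a \<in> SK"
 obtains k :: nat where "k \<ge> 1" "a = of_nat k" | "infl a"
proof -
 note a = SK_qqD(1,2)[OF assms]
 from qq_cases[OF a(1)] show ?thesis
 proof (elim disjE exE)
  fix n assume n: "a = of_int n"
  then have "1 <= (of_int n :: tf)" using a(2) by simp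
  from of_nat_or_ge_2[OF this] show ?thesis using n that(1) by auto
 next
  assume "infl (- a)"
  then have "of_nat 0 <= - a" unfolding infl_def by blast
  then show ?thesis using a(2) by simp
 qed (rule that(2))
qed

lemma SK_discrete: "a \<in> SK ==> b \<in> SK ==> a < b ==> a + 1 <= b"
proof -
 assume a: "a \<in> SK" "b \<in> SK" "a < b"
 have "qq (b - a)" using a SK_qqD qq_diff by blast
 from qq_cases[OF this] show ?thesis
 proof (elim disjE exE)
  fix n assume n: "b - a = of_int n"
  have "0 < b - a" using a(3) by simp
  then have "0 < n" unfolding n by simp
  then have "1 <= (of_int n :: tf)" by simp
  then show ?thesis using n by (simp add: algebra_simps)
 next
  assume "infl (b - a)"
  then have "of_nat 1 <= b - a" unfolding infl_def by blast
  then show ?thesis by (simp add: algebra_simps)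
 next
  assume "infl (- (b - a))"
  then have "of_nat 0 <= - (b - a)" unfolding infl_def by blast
  then show ?thesis using a(3) by simp
 qed
qed

lemma SK_of_nat: "1 <= n ==> of_nat n \<in> SK"
 by (induct n rule: nat_induct_at_least) (auto intro: SK_one SK_add)

lemma SK_2: "2 \<in> SK" using SK_of_nat[of 2] by simp

lemma SK_power: "a \<in> SK ==> a ^ n \<in> SK"
 by (induct n) (auto intro: SK_one SK_mult)

lemma SK_1_or_ge_2: "a \<in> SK ==> a = 1 \<or> 2 <= a"
 using SK_discrete[OF SK_one, of a] SK_qqD(2)[of a] by (cases "a = 1") auto

subsection \<open>Comparison with germs\<close>

lemma tgerm_ops: "tgerm 1 = 1" "tgerm X = germ_of (\<lambda>x. x)" "tgerm (a + b) = tgerm a + tgerm b" "tgerm (a * b) = tgerm a * tgerm b"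
 by (transfer, simp)+

lemma tgerm_less: "tgerm a < tgerm b \<longleftrightarrow> a < b"
 by transfer simp

lemma tgerm_eq: "tgerm a = tgerm b \<longleftrightarrow> a = b"
 by transfer (simp add: eveq_def)

lemma tgerm_le: "tgerm a <= tgerm b \<longleftrightarrow> a <= b"
 unfolding less_eq_germ_def tgerm_less tgerm_eq by auto

lemma tgerm_pw_one: "tgerm (pw 1 b) = germ_powr (tgerm 1) (tgerm b)"
 by transfer (simp add: AL_const)

lemma tgerm_pw_nat: "0 < a ==> tgerm (pw a (of_nat n)) = germ_powr (tgerm a) (tgerm (of_nat n))"
proof -
 assume "0 < a"
 then have "tgerm (a ^ n) = germ_powr (tgerm a) (tgerm (of_nat n))"
  by transfer (auto elim!: eventually_mono simp: powr_realpow)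
 then show ?thesis using pw_of_nat[OF \<open>0 < a\<close>] by simp
qed

lemma tgerm_pw_infl:
 "qq a ==> 2 <= a ==> qq b ==> infl b ==> tgerm (pw a b) = germ_powr (tgerm a) (tgerm b)"
proof -
 assume a: "qq a" "2 <= a" "qq b" "infl b"
 then have "of_nat 2 <= a" by simp
 with a(1,3,4) show ?thesis
 proof transfer
  fix f g :: fn assume q: "QQ f" "QQ g" "tinf g" "EV x. real 2 <= f x"
  have "EV x. 2 <= f x" using q(4) by simp
  from QQ_AL[OF QQ_power[OF q(1) this q(2,3)]]
  show "EV x. powf f g x = f x powr g x" by simp
 qed
qed

lemma tgerm_pw:
 assumes "a \<in> SK" "b \<in> SK"
 shows "tgerm (pw a b) = germ_powr (tgerm a) (tgerm b)"
 using SK_1_or_ge_2[OF assms(1)]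
proof
 assume "2 <= a"
 with tgerm_pw_nat[OF SK_qqD(3)[OF assms(1)]] tgerm_pw_infl[OF SK_qqD(1)[OF assms(1)] _ SK_qqD(1)[OF assms(2)]]
 show ?thesis by - (rule SK_cases[OF assms(2)], auto)
qed (simp add: tgerm_pw_one)

lemma Sk_eq: "Sk = tgerm ` SK"
proof
 show "Sk \<subseteq> tgerm ` SK"
 proof
  fix f assume "f \<in> Sk"
  then show "f \<in> tgerm ` SK"
  proof induct
   case one
   show ?case using tgerm_ops(1) SK_one by (metis image_eqI)
  next
   case ident
   show ?case using tgerm_ops(2) SK_X by (metis image_eqI)
  next
   case (add f g)
   then show ?case using tgerm_ops(3) SK_add by (auto simp: image_iff) metis
  next
   case (mult f g)
   then show ?case using tgerm_ops(4) SK_mult by (auto simp: image_iff) metis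
  next
   case (powr f g)
   then show ?case using tgerm_pw SK_pw by (auto simp: image_iff) metis
  qed
 qed
 show "tgerm ` SK \<subseteq> Sk"
 proof safe
  fix a assume "a \<in> SK"
  then show "tgerm a \<in> Sk"
   by induct (auto simp: tgerm_ops tgerm_pw intro: Sk.intros)
 qed
qed

definition arch :: "tf => tf => bool" where "arch a b \<longleftrightarrow> (\<exists>n::nat. a <= of_nat n * b)"

lemma tgerm_bigo:
 assumes f: "EV x. (0::real) < f x" and g: "EV x. 0 < g x"
 shows "f \<in> O(g) \<longleftrightarrow> (\<exists>n::nat. EV x. f x <= real n * g x)"
proof
 assume "f \<in> O(g)"
 then obtain c where c: "EV x. norm (f x) <= c * norm (g x)" by (rule landau_o.bigE)
 obtain n :: nat where n: "c <= real n" using real_arch_simple by blast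
 have "EV x. f x <= real n * g x" using c f g
 proof eventually_elim
  case (elim x)
  then have "f x <= c * g x" by simp
  also have "\<dots> <= real n * g x" using n elim by (intro mult_right_mono) auto
  finally show ?case .
 qed
 then show "\<exists>n::nat. EV x. f x <= real n * g x" by blast
next
 assume "\<exists>n::nat. EV x. f x <= real n * g x"
 then obtain n :: nat where n: "EV x. f x <= real n * g x" by blast
 then have "EV x. norm (f x) <= real n * norm (g x)" using f g by eventually_elim simp
 then have "EV x. norm (f x) <= (real n + 1) * norm (g x)"
  by eventually_elim (simp add: distrib_right add_increasing2)
 then show "f \<in> O(g)" by (rule landau_o.bigI[rotated]) simp
qed

lemma tgerm_asymp: "0 < a ==> 0 < b ==> germ_asymp (tgerm a) (tgerm b) \<longleftrightarrow> arch a b \<and> arch b a"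
 unfolding arch_def by transfer (simp add: tgerm_bigo)

primrec El :: "nat => nat => tf" where
 "El 0 m = X ^ m"
| "El (Suc j) m = pw 2 (El j m)"

lemma El_in_SK: "El j m \<in> SK"
 by (induct j) (auto intro: SK_power SK_X SK_pw SK_2)

lemma tgerm_El: "tgerm (El j m) = germ_of (\<lambda>x. tower2 j (x ^ m))"
proof (induct j)
 case 0
 show ?case by (simp, transfer, simp)
next
 case (Suc j)
 have "tgerm 2 = germ_of (\<lambda>x. 2)"
 proof -
  have "tgerm (of_nat 2) = germ_of (\<lambda>x. real 2)" by transfer simp
  then show ?thesis by simp
 qed
 then have "tgerm (El (Suc j) m) = germ_powr (germ_of (\<lambda>x. 2)) (germ_of (\<lambda>x. tower2 j (x ^ m)))"
  using tgerm_pw[OF SK_2 El_in_SK] Suc by simp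
 then show ?case by simp (transfer, simp)
qed

section \<open>Terms and the embedding order\<close>

text \<open>Terms are sums of components; a component is the product of a list of factors, and a factor
 is the identity or a power. The constant \<open>1\<close> is the empty component.\<close>

datatype sk = S "fac list list" and fac = V | P sk sk

primrec val :: "sk => tf" and valf :: "fac => tf" where
 "val (S cs) = sum_list (map prod_list (map (map valf) cs))"
| "valf V = X"
| "valf (P b e) = pw (val b) (val e)"

abbreviation valc :: "fac list => tf" where "valc fs \<equiv> prod_list (map valf fs)"

declare val.simps [simp del]

lemma val_S [simp]: "val (S cs) = sum_list (map valc cs)" by (simp add: val.simps o_def)

text \<open>Powers are restricted to bases from \<open>2\<close> on and infinite exponents. The other powers of Skolem
 functions are products.\<close>

inductive wf_sk :: "sk => bool" and wf_fac :: "fac => bool" where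
 "cs \<noteq> [] ==> (\<forall>fs\<in>set cs. \<forall>f\<in>set fs. wf_fac f) ==> wf_sk (S cs)"
| "wf_fac V"
| "wf_sk b ==> wf_sk e ==> 2 <= val b ==> infl (val e) ==> wf_fac (P b e)"

inductive_simps wf_S [simp]: "wf_sk (S cs)"
inductive_simps wf_V [simp]: "wf_fac V"
inductive_simps wf_P [simp]: "wf_fac (P b e)"

definition wf_comp :: "fac list => bool" where "wf_comp fs \<longleftrightarrow> (\<forall>f\<in>set fs. wf_fac f)"

text \<open>Homeomorphic embedding: components are inserted into sums, factors into products, and a term is
 embedded in what is a power with base or exponent above it.\<close>

inductive emb :: "sk => sk => bool" and facrel :: "fac => fac => bool" where
 emb_root: "list_emb (list_emb facrel) cs cs' ==> emb (S cs) (S cs')"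
| emb_base: "fs \<in> set cs ==> P b e \<in> set fs ==> emb t b ==> emb t (S cs)"
| emb_expo: "fs \<in> set cs ==> P b e \<in> set fs ==> emb t e ==> emb t (S cs)"
| facrel_V: "facrel V V"
| facrel_P: "emb b b' ==> emb e e' ==> facrel (P b e) (P b' e')"
monos list_emb_mono

definition child :: "sk => sk => bool" where
 "child t u \<longleftrightarrow> (\<exists>cs fs b e. u = S cs \<and> fs \<in> set cs \<and> P b e \<in> set fs \<and> (t = b \<or> t = e))"

lemma size_child: "child t u ==> size t < size u"
proof -
 assume "child t u"
 then obtain cs fs b e where a: "u = S cs" "fs \<in> set cs" "P b e \<in> set fs" "t = b \<or> t = e" unfolding child_def by blast
 have "size (P b e) <= size_list size fs" by (rule size_list_estimation'[OF a(3)]) simp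
 moreover have "size_list size fs <= size_list (size_list size) cs" by (rule size_list_estimation'[OF a(2)]) simp
 ultimately show ?thesis using a(1,4) by auto
qed

text \<open>Kruskal's theorem for these terms. In a minimal bad sequence the bases and exponents of
 the factors are well-quasi-ordered; then the terms are, by Higman's lemma for lists of lists.\<close>

theorem wqo_emb: "wqo_on emb UNIV"
proof (rule ccontr)
 assume "\<not> ?thesis"
 then obtain m where bad: "bad emb m" and children: "wqo_on emb {y. \<exists>i. child y (m i)}"
 proof (rule minimal_bad_sequence[where part = child and \<mu> = size])
  fix a y x assume "child y x" "emb a y"
  then show "emb a x" unfolding child_def using emb_base emb_expo by blast
 qed (use size_child in auto)
 let ?A = "{y. \<exists>i. child y (m i)}"
 let ?F = "{V} \<union> (\<lambda>(b, e). P b e) ` (?A \<times> ?A)"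
 have "wqo_on facrel ((\<lambda>(b, e). P b e) ` (?A \<times> ?A))"
  by (rule wqo_on_image[OF wqo_on_prod[OF children children]]) (auto intro: facrel_P)
 moreover have "wqo_on facrel {V}" by (rule wqo_on_finite) (auto intro: facrel_V)
 ultimately have "wqo_on facrel ?F" using wqo_on_Un by blast
 then have w: "wqo_on (list_emb (list_emb facrel)) (lists (lists ?F))" by (intro wqo_on_lists)
 define cs where "cs i = (case m i of S cs => cs)" for i
 have m: "m i = S (cs i)" for i by (cases "m i") (simp add: cs_def)
 have "cs i \<in> lists (lists ?F)" for i
 proof -
  have "f \<in> ?F" if "fs \<in> set (cs i)" "f \<in> set fs" for fs f
  proof (cases f)
   case (P b e)
   then have "child b (m i)" "child e (m i)" unfolding child_def m using that by blast+
   then show ?thesis using P by blast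
  qed simp
  then show ?thesis by blast
 qed
 then obtain i j where "i < j" "list_emb (list_emb facrel) (cs i) (cs j)"
  using wqo_onD[where s = cs, OF w] by blast
 then have "emb (m i) (m j)" using emb_root m by metis
 then show False using bad \<open>i < j\<close> unfolding bad_def by blast
qed

lemma wqo_facrel: "wqo_on facrel UNIV"
proof -
 have "wqo_on facrel ((\<lambda>(b, e). P b e) ` (UNIV \<times> UNIV))"
  by (rule wqo_on_image[OF wqo_on_prod[OF wqo_emb wqo_emb]]) (auto intro: facrel_P)
 moreover have "wqo_on facrel {V}" by (rule wqo_on_finite) (auto intro: facrel_V)
 ultimately have "wqo_on facrel ({V} \<union> (\<lambda>(b, e). P b e) ` (UNIV \<times> UNIV))" using wqo_on_Un by blast
 moreover have "f \<in> {V} \<union> (\<lambda>(b, e). P b e) ` (UNIV \<times> UNIV)" for f by (cases f) auto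
 then have "{V} \<union> (\<lambda>(b, e). P b e) ` (UNIV \<times> UNIV) = UNIV" by blast
 ultimately show ?thesis by simp
qed

lemma wqo_comp: "wqo_on (list_emb facrel) UNIV"
 using wqo_on_lists[OF wqo_facrel] by simp

subsection \<open>Values\<close>

lemma pw_Ln: "a \<in> SK ==> 2 <= a ==> b \<in> SK ==> infl b ==> Ln (pw a b) = b * Ln a"
 using pw_infl(2) SK_qqD by blast

lemma SK_le_iff: "a \<in> SK ==> b \<in> SK ==> a <= b \<longleftrightarrow> Ln a <= Ln b"
 using Ln_le_iff SK_qqD(4) by blast

lemma Ln_mult: "a \<in> SK ==> b \<in> SK ==> Ln (a * b) = Ln a + Ln b"
 using lnok_mult SK_qqD(4) by blast

lemma Ln_power: "a \<in> SK ==> Ln (a ^ n) = of_nat n * Ln a"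
 by (induct n) (auto simp: Ln_mult SK_power algebra_simps)

lemma Ln_nonneg: "a \<in> SK ==> 0 <= Ln a"
 using SK_le_iff[OF SK_one, of a] SK_qqD(2) by simp

lemma Ln_ge_half: "a \<in> SK ==> 2 <= a ==> 1 <= 2 * Ln a"
 using SK_le_iff[OF SK_2, of a] Ln_2(1) by linarith

lemma Ln_le: "a \<in> SK ==> Ln a <= a"
 using Ln_diff_le[of a 1] SK_qqD(4)[of a] by simp

lemma pw_mono:
 assumes "a \<in> SK" "2 <= a" "b \<in> SK" "infl b" "a <= a'" "a' \<in> SK" "b <= b'" "b' \<in> SK"
 shows "pw a b <= pw a' b'"
proof -
 have "infl b'" using assms unfolding infl_def by (meson order_trans)
 then have "Ln (pw a b) = b * Ln a" "Ln (pw a' b') = b' * Ln a'" using assms by (auto intro!: pw_Ln)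
 moreover have "b * Ln a <= b' * Ln a'"
  using assms SK_le_iff[of a a'] Ln_nonneg SK_qqD(2) by (intro mult_mono) (auto intro: order_trans[of 0 1])
 ultimately show ?thesis using SK_le_iff SK_pw assms by simp
qed

lemma pw_ge_power:
 assumes "b \<in> SK" "2 <= b" "e \<in> SK" "infl e"
 shows "b ^ n <= pw b e" "e ^ n <= pw b e"
proof -
 note L = pw_Ln[OF assms]
 have "of_nat n * Ln b <= e * Ln b"
  using assms Ln_nonneg unfolding infl_def by (intro mult_right_mono) auto
 then show "b ^ n <= pw b e" using SK_le_iff SK_power SK_pw assms L Ln_power by simp
 have "of_nat n * Ln e <= e * Ln b"
 proof -
  have "2 * (of_nat n * Ln e) <= e * 1" using infl_Ln(1)[OF SK_qqD(4)[OF assms(3)] assms(4), of "2 * n"] by (simp add: mult.assoc)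
  also have "\<dots> <= e * (2 * Ln b)" using Ln_ge_half assms SK_qqD(3)[OF assms(3)] by (intro mult_left_mono) auto
  finally show ?thesis by simp
 qed
 then show "e ^ n <= pw b e" using SK_le_iff SK_power SK_pw assms L Ln_power by simp
qed

lemma SK_sum_list: "xs \<noteq> [] ==> (\<forall>a\<in>set xs. a \<in> SK) ==> sum_list xs \<in> SK"
 by (induct xs rule: list_nonempty_induct) (auto intro: SK_add)

lemma SK_prod_list: "(\<forall>a\<in>set xs. a \<in> SK) ==> prod_list xs \<in> SK"
 by (induct xs) (auto intro: SK_mult SK_one)

lemma wf_SK: "wf_sk t ==> val t \<in> SK" "wf_fac f ==> valf f \<in> SK \<and> infl (valf f)"
proof (induct rule: wf_sk_wf_fac.inducts)
 case (1 cs)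
 then show ?case by (auto intro!: SK_sum_list SK_prod_list)
next
 case (3 b e)
 then show ?case using SK_pw pw_infl(3) SK_qqD(1) by simp
qed (auto intro: SK_X infl_X)

lemma wf_comp_SK: "wf_comp fs ==> valc fs \<in> SK"
 unfolding wf_comp_def using wf_SK(2) by (auto intro!: SK_prod_list)

lemma wf_comp_simps [simp]: "wf_comp []" "wf_comp (f # fs) \<longleftrightarrow> wf_fac f \<and> wf_comp fs" "wf_comp (fs @ gs) \<longleftrightarrow> wf_comp fs \<and> wf_comp gs"
 by (auto simp: wf_comp_def)

lemma wf_S_comp: "wf_sk (S cs) \<longleftrightarrow> cs \<noteq> [] \<and> (\<forall>fs\<in>set cs. wf_comp fs)"
 by (auto simp: wf_comp_def)

lemma val_comp_nonneg: "\<forall>fs\<in>set cs. wf_comp fs ==> 0 <= sum_list (map valc cs)"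
 using SK_qqD(3) wf_comp_SK by (intro sum_list_nonneg) (auto intro: less_imp_le)

lemma comp_le: "fs \<in> set cs ==> \<forall>gs\<in>set cs. wf_comp gs ==> valc fs <= val (S cs)"
 using SK_qqD(3) wf_comp_SK by (simp, intro member_le_sum_list) (auto intro: less_imp_le)

lemma factor_le_comp: "f \<in> set fs ==> wf_comp fs ==> valf f <= valc fs"
proof (induct fs)
 case (Cons g fs)
 have g: "1 <= valf g" "1 <= valc fs" using Cons(3) SK_qqD(2)[OF wf_comp_SK, of fs] wf_SK(2)[of g] SK_qqD(2) by auto
 show ?case
 proof (cases "f = g")
  case True
  then show ?thesis using g mult_left_mono[of 1 "valc fs" "valf g"] by simp
 next
  case False
  then have "1 * valf f <= valf g * valc fs" using Cons g SK_qqD(3) wf_SK(2)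
   by (intro mult_mono) (auto simp: wf_comp_def intro: order_trans[of 0 1] less_imp_le)
  then show ?thesis by simp
 qed
qed simp

lemma factor_le:
 "fs \<in> set cs ==> f \<in> set fs ==> \<forall>gs\<in>set cs. wf_comp gs ==> valf f <= val (S cs)"
 using factor_le_comp comp_le order_trans by blast

text \<open>All values are at least \<open>1\<close>, and \<open>val b\<close> and \<open>val e\<close> are at most the value of \<open>P b e\<close>.\<close>

lemma emb_val:
 "emb t t' ==> wf_sk t ==> wf_sk t' ==> val t <= val t'"
 "facrel f f' ==> wf_fac f ==> wf_fac f' ==> valf f <= valf f'"
proof (induct rule: emb_facrel.inducts)
 case (emb_root cs cs')
 let ?R = "\<lambda>f f'. facrel f f' \<and> (wf_fac f \<longrightarrow> wf_fac f' \<longrightarrow> valf f <= valf f')"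
 have c: "valc fs <= valc fs'" if "list_emb ?R fs fs'" "wf_comp fs" "wf_comp fs'" for fs fs'
  using that
 proof induct
  case (list_emb_Nil ys)
  then show ?case using SK_qqD(2)[OF wf_comp_SK] by simp
 next
  case (list_emb_Cons xs ys y)
  then have "1 * valc xs <= valf y * valc ys"
   using wf_SK(2)[of y] SK_qqD(2) SK_qqD(3)[OF wf_comp_SK, of xs] by (intro mult_mono) (auto intro: order_trans[of 0 1])
  then show ?case by simp
 next
  case (list_emb_Cons2 x y xs ys)
  then show ?case
   using wf_SK(2)[of y] SK_qqD(3) SK_qqD(3)[OF wf_comp_SK, of xs] by (simp, intro mult_mono) (auto intro: less_imp_le)
 qed
 have "sum_list (map valc cs) <= sum_list (map valc cs')" if "list_emb (list_emb ?R) cs cs'"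
  "\<forall>fs\<in>set cs. wf_comp fs" "\<forall>fs\<in>set cs'. wf_comp fs" for cs cs'
  using that
 proof induct
  case (list_emb_Nil ys)
  then show ?case using val_comp_nonneg by simp
 next
  case (list_emb_Cons xs ys y)
  then show ?case using SK_qqD(3)[OF wf_comp_SK, of y] by simp
 next
  case (list_emb_Cons2 x y xs ys)
  then show ?case using c by (simp add: add_mono)
 qed
 moreover have "list_emb (list_emb ?R) cs cs'" using emb_root(1) .
 ultimately show ?case using emb_root(2,3) unfolding wf_S_comp by simp
next
 case (emb_base fs cs b e t)
 have w': "\<forall>gs\<in>set cs. wf_comp gs" using emb_base(6) unfolding wf_S_comp by blast
 then have "wf_fac (P b e)" using emb_base(1,2) unfolding wf_comp_def by blast
 note w = this w'
 have "val t <= val b" using emb_base w by simp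
 also have "\<dots> <= valf (P b e)" using pw_ge_power(1)[of "val b" "val e" 1] w wf_SK(1) by simp
 also have "\<dots> <= val (S cs)" using factor_le[OF emb_base(1,2) w(2)] by simp
 finally show ?case .
next
 case (emb_expo fs cs b e t)
 have w': "\<forall>gs\<in>set cs. wf_comp gs" using emb_expo(6) unfolding wf_S_comp by blast
 then have "wf_fac (P b e)" using emb_expo(1,2) unfolding wf_comp_def by blast
 note w = this w'
 have "val t <= val e" using emb_expo w by simp
 also have "\<dots> <= valf (P b e)" using pw_ge_power(2)[of "val b" "val e" 1] w wf_SK(1) by simp
 also have "\<dots> <= val (S cs)" using factor_le[OF emb_expo(1,2) w(2)] by simp
 finally show ?case .
next
 case facrel_V
 then show ?case by simp
next
 case (facrel_P b b' e e')
 then show ?case using pw_mono wf_SK(1) by simp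
qed

lemma val_mult:
 assumes "\<exists>t. wf_sk t \<and> val t = a" "\<exists>t. wf_sk t \<and> val t = b"
 shows "\<exists>t. wf_sk t \<and> val t = a * b"
 proof -
  obtain cs ds where c: "wf_sk (S cs)" "val (S cs) = a" "wf_sk (S ds)" "val (S ds) = b" using assms by (metis sk.exhaust)
  define prods where "prods = concat (map (\<lambda>fs. map (\<lambda>gs. fs @ gs) ds) cs)"
  have "sum_list (map valc (concat (map (\<lambda>fs. map (\<lambda>gs. fs @ gs) ds) cs))) = sum_list (map valc cs) * sum_list (map valc ds)" for cs
   by (induct cs) (auto simp: distrib_right sum_list_const_mult o_def)
  then have "val (S prods) = a * b" unfolding prods_def using c by simp
  moreover have "wf_sk (S prods)"
   using c unfolding prods_def wf_S_comp by auto
  ultimately show ?thesis by blast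
 qed

lemma SK_is_val:
 assumes "a \<in> SK"
 shows "\<exists>t. wf_sk t \<and> val t = a"
 using assms
proof induct
 case SK_one
 show ?case by (rule exI[of _ "S [[]]"]) simp
next
 case SK_X
 show ?case by (rule exI[of _ "S [[V]]"]) simp
next
 case (SK_add a b)
 then obtain cs ds where "wf_sk (S cs)" "val (S cs) = a" "wf_sk (S ds)" "val (S ds) = b" by (metis sk.exhaust)
 then show ?case by (intro exI[of _ "S (cs @ ds)"]) auto
next
 case (SK_mult a b)
 show ?case using val_mult SK_mult by blast
next
 case (SK_pw a b)
 from SK_1_or_ge_2[OF SK_pw(1)] show ?case
 proof
  assume "a = 1"
  then show ?thesis by (intro exI[of _ "S [[]]"]) (simp add: pw_1)
 next
  assume a2: "2 <= a"
  show ?thesis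
  proof (rule SK_cases[OF SK_pw(3)])
   fix k :: nat assume k: "1 <= k" "b = of_nat k"
   have pa: "0 < a" using SK_qqD(3) SK_pw by blast
   have "\<exists>t. wf_sk t \<and> val t = a ^ n" for n
   proof (induct n)
    case 0
    show ?case by (rule exI[of _ "S [[]]"]) simp
   next
    case (Suc n)
    then show ?case using val_mult[OF SK_pw(2)] by simp
   qed
   then show ?thesis using k pw_of_nat[OF pa] by simp
  next
   assume "infl b"
   obtain t u where "wf_sk t" "val t = a" "wf_sk u" "val u = b" using SK_pw by blast
   then show ?thesis using a2 \<open>infl b\<close> by (intro exI[of _ "S [[P t u]]"]) simp
  qed
 qed
qed

subsection \<open>The well-order\<close>

text \<open>The well-order of the Skolem functions: values are monotone for embeddings, so that a
 least value in a finite basis of the terms is least.\<close>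

lemma SK_least:
 assumes "A \<subseteq> SK" "A \<noteq> {}"
 obtains a where "a \<in> A" "!!b. b \<in> A ==> a <= b"
proof -
 define B where "B = {t. wf_sk t \<and> val t \<in> A}"
 obtain C where C: "finite C" "C \<subseteq> B" "!!t. t \<in> B ==> \<exists>u\<in>C. emb u t"
  by (rule wqo_on_finite_basis[OF wqo_on_subset[OF wqo_emb, of B]]) auto
 have ne: "C \<noteq> {}" using assms SK_is_val C(3) unfolding B_def by (metis (mono_tags, lifting) bex_empty ex_in_conv mem_Collect_eq subsetD)
 have "Min (val ` C) \<in> A"
 proof -
  have "Min (val ` C) \<in> val ` C" using C(1) ne by (intro Min_in) auto
  then show ?thesis using C(2) unfolding B_def by auto
 qed
 moreover have "Min (val ` C) <= b" if "b \<in> A" for b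
 proof -
  obtain t where t: "wf_sk t" "val t = b" using SK_is_val assms(1) \<open>b \<in> A\<close> by blast
  then obtain u where "u \<in> C" "emb u t" using C(3)[of t] \<open>b \<in> A\<close> unfolding B_def by blast
  then have "val u <= b" using emb_val(1) t C(2) unfolding B_def by blast
  then show ?thesis using C(1) \<open>u \<in> C\<close> by (meson Min_le finite_imageI imageI order_trans)
 qed
 ultimately show ?thesis using that by blast
qed

lemma SK_less_induct [consumes 1, case_names less]:
 assumes "a \<in> SK" "!!a. a \<in> SK ==> (!!b. b \<in> SK ==> b < a ==> Q b) ==> Q a"
 shows "Q a"
proof (rule ccontr)
 assume "\<not> Q a"
 then have "{a \<in> SK. \<not> Q a} \<noteq> {}" using assms(1) by blast
 then obtain c where c: "c \<in> {a \<in> SK. \<not> Q a}" "!!b. b \<in> {a \<in> SK. \<not> Q a} ==> c <= b"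
  by (rule SK_least[rotated]) auto
 have "Q b" if "b \<in> SK" "b < c" for b using c(2)[of b] that by force
 then show False using assms(2)[of c] c(1) by blast
qed

section \<open>Infinitesimal differences\<close>

text \<open>\<open>le s p q\<close>: if \<open>p\<close> exceeds \<open>q\<close> at all, then only infinitesimally relative to \<open>s\<close>. For
 Skolem functions and \<open>s = 1\<close> this is \<open>p <= q\<close> because distinct values differ at least by \<open>1\<close>.\<close>

definition le :: "tf => tf => tf => bool" where
 "le s p q \<longleftrightarrow> (\<forall>n::nat. of_nat n * (p - q) <= s)"

lemma leD: "le s p q ==> of_nat n * (p - q) <= s" unfolding le_def by blast

lemma leI: "0 <= s ==> (!!n::nat. n \<ge> 1 ==> q < p ==> of_nat n * (p - q) <= s) ==> le s p q"
 unfolding le_def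
proof
 fix n :: nat assume a: "0 <= s" "!!n::nat. n \<ge> 1 ==> q < p ==> of_nat n * (p - q) <= s"
 show "of_nat n * (p - q) <= s"
 proof (cases "n \<ge> 1 \<and> q < p")
  case False
  then have "of_nat n * (p - q) <= 0" by (auto simp: not_less_eq_eq mult_nonneg_nonpos)
  then show ?thesis using a(1) by simp
 qed (use a in blast)
qed

lemma le_of_le: "0 <= s ==> p <= q ==> le s p q" by (rule leI) auto

lemma le_refl: "0 <= s ==> le s p p" by (rule le_of_le) auto

lemma le_add: "le s a a' ==> le s b b' ==> le s (a + b) (a' + b')"
 unfolding le_def
proof
 fix n :: nat assume "\<forall>n::nat. of_nat n * (a - a') <= s" "\<forall>n::nat. of_nat n * (b - b') <= s"
 then have "of_nat (2 * n) * (a - a') <= s" "of_nat (2 * n) * (b - b') <= s" by blast+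
 then show "of_nat n * (a + b - (a' + b')) <= s" by (simp add: algebra_simps)
qed

lemma le_trans: "le s a b ==> le s b c ==> le s a c"
 using le_add[of s a b b c] by (simp add: le_def)

lemma le_weaken: "le s p q ==> s <= of_nat k * s' ==> 0 <= s' ==> le s' p q"
proof (rule leI)
 fix n :: nat assume a: "le s p q" "s <= of_nat k * s'" "0 <= s'" "n \<ge> 1" "q < p"
 have "of_nat (n * Suc k) * (p - q) <= s" using a(1) by (rule leD)
 also have "\<dots> <= of_nat (Suc k) * s'" using a(2,3) by (simp add: distrib_right)
 finally have "of_nat (Suc k) * (of_nat n * (p - q)) <= of_nat (Suc k) * s'" by (simp only: of_nat_mult mult_ac)
 then show "of_nat n * (p - q) <= s'" using mult_le_cancel_left_pos[of "of_nat (Suc k)" "of_nat n * (p - q)" s'] of_nat_0_less_iff[of "Suc k", where 'a = tf]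
  by blast
qed

lemma le_mono: "le s p q ==> s <= s' ==> 0 <= s' ==> le s' p q"
 using le_weaken[of s p q 1 s'] by simp

lemma le_SK: "le 1 p q ==> p \<in> SK ==> q \<in> SK ==> p <= q"
proof (rule ccontr)
 assume a: "le 1 p q" "p \<in> SK" "q \<in> SK" "\<not> p <= q"
 then have "1 <= p - q" using SK_discrete[of q p] by (simp add: algebra_simps)
 moreover have "of_nat 2 * (p - q) <= 1" using a(1) by (rule leD)
 ultimately show False by simp
qed

text \<open>A difference of the logarithms is a relative difference of the values.\<close>

lemma le_exp:
 assumes le: "le \<nu> (Ln w) (Ln w')" and w: "w \<in> SK" "w' \<in> SK" "w' <= c" and c: "\<nu> * c <= s" "\<nu> <= 1" "0 <= \<nu>"
 shows "le s w w'"
proof (rule leI)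
 have cpos: "0 < c" using w SK_qqD(3) less_le_trans by blast
 show "0 <= s" using c cpos by (meson mult_nonneg_nonneg order_trans less_imp_le)
 fix n :: nat assume "n \<ge> 1" "w' < w"
 let ?d = "Ln w - Ln w'"
 have "0 <= ?d" using \<open>w' < w\<close> SK_le_iff[OF w(2,1)] by simp
 have "?d <= \<nu>" using leD[OF le, of 1] by simp
 then have "w <= w' + w' * ?d + w' * ?d"
  using w SK_qqD(4) \<open>0 <= ?d\<close> c by (intro le_of_Ln_diff) auto
 then have "w - w' <= 2 * (w' * ?d)" by simp
 also have "w' * ?d <= c * ?d" using w(3) \<open>0 <= ?d\<close> by (rule mult_right_mono)
 finally have "w - w' <= 2 * (c * ?d)" by simp
 then have "of_nat n * (w - w') <= of_nat n * (2 * (c * ?d))" by (rule mult_left_mono) simp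
 also have "\<dots> = c * (of_nat (2 * n) * ?d)" by simp
 also have "\<dots> <= c * \<nu>" using leD[OF le, of "2 * n"] cpos by (intro mult_left_mono) auto
 also have "\<dots> <= s" using c by (simp add: mult.commute)
 finally show "of_nat n * (w - w') <= s" .
qed

text \<open>With exponents up to \<open>r\<close> and bases from \<open>b0\<close> on, the precision of the logarithm of the
 power is \<open>r / b0\<close> times that of the base.\<close>

lemma le_power:
 assumes b: "b \<in> SK" "b' \<in> SK" "b0 <= b'" "0 < b0" and e: "0 <= e" "e <= r"
  and le: "le \<sigma> b b'" and s: "r * \<sigma> <= b0 * \<nu>" "0 <= \<nu>"
 shows "le \<nu> (e * Ln b) (e * Ln b')"
proof (rule leI[OF s(2)])
 fix n :: nat assume n: "n \<ge> 1" "e * Ln b' < e * Ln b"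
 then have "Ln b' < Ln b" using e(1) by (simp add: mult_less_cancel_left)
 then have lt: "b' < b" using SK_le_iff[OF b(1,2)] by (simp add: not_le[symmetric])
 have "Ln b - Ln b' <= (b - b') / b'" using b SK_qqD(4) by (intro Ln_diff_le) auto
 also have "\<dots> <= (b - b') / b0" using b lt by (intro divide_left_mono) (auto intro: mult_pos_pos less_le_trans)
 finally have "e * (Ln b - Ln b') <= r * ((b - b') / b0)"
  using e \<open>Ln b' < Ln b\<close> by (intro mult_mono) (auto intro: order_trans)
 then have "of_nat n * (e * (Ln b - Ln b')) <= of_nat n * (r * ((b - b') / b0))" by (rule mult_left_mono) simp
 also have "\<dots> = r * (of_nat n * (b - b')) / b0" by simp
 also have "\<dots> <= r * \<sigma> / b0" using leD[OF le, of n] e b by (intro divide_right_mono mult_left_mono) auto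
 also have "\<dots> <= \<nu>" using s b by (simp add: field_simps)
 finally show "of_nat n * (e * Ln b - e * Ln b') <= \<nu>" by (simp add: algebra_simps)
qed

section \<open>Families of values above a term\<close>

lemma facrel_list_le:
 assumes "list_all2 facrel fs fs'" "wf_comp fs" "wf_comp fs'"
 shows "valc fs <= valc fs' \<and> list_all2 (\<lambda>f f'. facrel f f' \<and> wf_fac f \<and> wf_fac f' \<and> valf f' * valc fs <= valf f * valc fs') fs fs'"
 using assms
proof (induct rule: list_all2_induct)
 case (Cons f fs f' fs')
 have p: "valf f <= valf f'" "valf f \<in> SK" "valf f' \<in> SK" "valc fs \<in> SK" "valc fs' \<in> SK" "valc fs <= valc fs'"
  using Cons emb_val(2) wf_SK(2) wf_comp_SK by auto
 note pos = p(2-5)[THEN SK_qqD(3), THEN less_imp_le]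
 have IH: "list_all2 (\<lambda>f f'. facrel f f' \<and> wf_fac f \<and> wf_fac f' \<and> valf f' * valc fs <= valf f * valc fs') fs fs'"
  using Cons by auto
 have "valf f * valc fs <= valf f' * valc fs'" using p pos by (intro mult_mono) auto
 moreover have "valf f' * (valf f * valc fs) <= valf f * (valf f' * valc fs')"
  using p pos by (simp add: mult.left_commute[of "valf f'"] mult_left_mono)
 moreover have step: "valf g' * (valf f * valc fs) <= valf g * (valf f' * valc fs')"
  if "valf g' * valc fs <= valf g * valc fs'" "wf_fac g" "wf_fac g'" for g g'
 proof -
  have "0 <= valf g'" using wf_SK(2)[OF that(3)] SK_qqD(3) by (auto intro: less_imp_le)
  then have "0 <= valf g' * valc fs" using pos by simp
  have "valf f * (valf g' * valc fs) <= valf f * (valf g * valc fs')"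
   using that(1) pos by (intro mult_left_mono) auto
  also have "\<dots> <= valf f' * (valf g * valc fs')"
   using that(1) \<open>0 <= valf g' * valc fs\<close> p by (intro mult_right_mono) auto
  finally show ?thesis by (simp add: mult_ac)
 qed
 ultimately have "list_all2 (\<lambda>g g'. facrel g g' \<and> wf_fac g \<and> wf_fac g' \<and>
   valf g' * (valf f * valc fs) <= valf g * (valf f' * valc fs')) (f # fs) (f' # fs')"
  using Cons by (auto intro!: list_all2_mono[OF IH] step)
 then show ?case using \<open>valf f * valc fs <= valf f' * valc fs'\<close> by simp
qed simp

lemma emb_sums:
 assumes "list_emb (list_emb facrel) cs cs'" "\<forall>c\<in>set cs. wf_comp c" "\<forall>c\<in>set cs'. wf_comp c"
 shows "sum_list (map valc cs) <= sum_list (map valc cs')"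
proof (cases "cs = []")
 case True
 then show ?thesis using val_comp_nonneg[OF assms(3)] by simp
next
 case False
 then have "cs' \<noteq> []" using assms(1) by auto
 then show ?thesis using emb_val(1)[OF emb_root[OF assms(1)]] False assms(2,3) unfolding wf_S_comp by simp
qed

lemma emb_comp_le: "list_emb facrel c v ==> wf_comp c ==> wf_comp v ==> valc c <= valc v"
 using emb_sums[of "[c]" "[v]"] by auto

text \<open>An embedding of products extends each factor and adds further factors, collected in \<open>g\<close>.\<close>

lemma emb_comp_split:
 assumes "list_emb facrel c v" "wf_comp v"
 obtains c1 g where "list_all2 facrel c c1" "wf_comp c1" "wf_comp g" "valc v = valc g * valc c1" "g = [] \<longrightarrow> c1 = v"
proof -
 have "\<exists>c1 g. list_all2 facrel c c1 \<and> wf_comp c1 \<and> wf_comp g \<and> valc v = valc g * valc c1 \<and> (g = [] \<longrightarrow> c1 = v)"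
  using assms
 proof induct
  case (list_emb_Nil ys)
  then show ?case by (intro exI[of _ "[]"] exI[of _ ys]) auto
 next
  case (list_emb_Cons xs ys y)
  then obtain c1 g where "list_all2 facrel xs c1" "wf_comp c1" "wf_comp g" "valc ys = valc g * valc c1" by auto
  then show ?case using list_emb_Cons(3) by (intro exI[of _ c1] exI[of _ "y # g"]) (auto simp: mult_ac)
 next
  case (list_emb_Cons2 x y xs ys)
  then obtain c1 g where "list_all2 facrel xs c1" "wf_comp c1" "wf_comp g" "valc ys = valc g * valc c1" "g = [] \<longrightarrow> c1 = ys" by auto
  then show ?case using list_emb_Cons2 by (intro exI[of _ "y # c1"] exI[of _ g]) (auto simp: mult_ac)
 qed
 then show ?thesis using that by blast
qed

lemma wf_comp_infl: "wf_comp g ==> g \<noteq> [] ==> infl (valc g)"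
 using factor_le_comp[of "hd g" g] wf_SK(2)[of "hd g"] unfolding infl_def wf_comp_def
 by (meson hd_in_set order_trans)

text \<open>As the logarithms of products add up, the factors can be treated one by one.\<close>

lemma fsz_factors:
 assumes "!!f. f \<in> set fs ==> fsz R U (A f)"
  and R: "R 0 0" "!!a a' b b'. R a a' ==> R b b' ==> R (a + b) (a' + b')"
  and U: "0 \<in> U" "!!u v. u \<in> U ==> v \<in> U ==> u + v \<in> U"
 shows "fsz R U {a. \<exists>fs'. wf_comp fs' \<and> list_all2 (\<lambda>f f'. Ln (valf f') \<in> A f) fs fs' \<and> a = Ln (valc fs')}"
 using assms(1)
proof (induct fs)
 case Nil
 show ?case by (rule fsz_subset[OF fsz_finite[of "{0}"]]) (use R U in auto)
next
 case (Cons f fs)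
 show ?case
 proof (rule fsz_image2[where f = "(+)", of R U "A f" R U])
  show "fsz R U {a. \<exists>fs'. wf_comp fs' \<and> list_all2 (\<lambda>f f'. Ln (valf f') \<in> A f) fs fs' \<and> a = Ln (valc fs')}"
   using Cons by auto
  fix c assume "c \<in> {a. \<exists>fs'. wf_comp fs' \<and> list_all2 (\<lambda>f f'. Ln (valf f') \<in> A f) (f # fs) fs' \<and> a = Ln (valc fs')}"
  then obtain f' gs where g: "wf_fac f'" "wf_comp gs" "Ln (valf f') \<in> A f" "list_all2 (\<lambda>f f'. Ln (valf f') \<in> A f) fs gs" "c = Ln (valf f' * valc gs)"
   by (auto simp: list_all2_Cons1)
  moreover from this have "c = Ln (valf f') + Ln (valc gs)" using Ln_mult wf_SK(2) wf_comp_SK by simp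
  ultimately show "\<exists>a\<in>A f. \<exists>b\<in>{a. \<exists>fs'. wf_comp fs' \<and> list_all2 (\<lambda>f f'. Ln (valf f') \<in> A f) fs fs' \<and> a = Ln (valc fs')}. c = a + b"
   by blast
 qed (use Cons(2) R U in auto)
qed

lemma wf_PD:
 assumes "wf_fac (P b e)"
 shows "val b \<in> SK" "2 <= val b" "val e \<in> SK" "infl (val e)" "2 <= val e" "0 < val b" "0 < val e"
  "1 <= 2 * Ln (val b)" "0 < Ln (val b)"
proof -
 show b: "val b \<in> SK" "2 <= val b" "val e \<in> SK" "infl (val e)" using assms wf_SK(1) by auto
 show "2 <= val e" using b(4)[unfolded infl_def, rule_format, of 2] by simp
 then show "0 < val b" "0 < val e" using b by auto
 show "1 <= 2 * Ln (val b)" using Ln_ge_half b by blast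
 then show "0 < Ln (val b)" by linarith
qed

text \<open>Exponent and base both increase, so that the difference of the logarithms bounds the
 contribution of either; and \<open>1 <= e\<close> bounds the base itself.\<close>

lemma factor_above:
 assumes wf: "wf_fac (P b e)" and f: "facrel (P b e) f'" "wf_fac f'" "Ln (valf f') - Ln (valf (P b e)) <= l"
 obtains b' e' where "f' = P b' e'" "emb b b'" "emb e e'" "wf_sk b'" "wf_sk e'" "val b <= val b'"
  "(val e' - val e) * Ln (val b) <= l" "val e * (Ln (val b') - Ln (val b)) <= l"
  "!!\<rho>. valf f' <= \<rho> * valf (P b e) ==> val b' <= val b * \<rho>"
proof -
 obtain b' e' where f': "f' = P b' e'" "emb b b'" "emb e e'" using f(1) by (auto elim: facrel.cases)
 let ?b = "val b" and ?e = "val e" and ?b' = "val b'" and ?e' = "val e'"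
 have w: "wf_fac (P b' e')" using f(2) f'(1) by simp
 note b = wf_PD[OF wf] and b' = wf_PD[OF w]
 have le: "?b <= ?b'" "?e <= ?e'" using emb_val(1) f' wf w by auto
 have Lle: "Ln ?b <= Ln ?b'" using SK_le_iff le b(1) b'(1) by blast
 have L: "Ln (valf (P b e)) = ?e * Ln ?b" "Ln (valf (P b' e')) = ?e' * Ln ?b'" using pw_Ln b b' by auto
 have eq: "?e' * Ln ?b' - ?e * Ln ?b = (?e' - ?e) * Ln ?b + ?e * (Ln ?b' - Ln ?b) + (?e' - ?e) * (Ln ?b' - Ln ?b)"
  by (simp add: algebra_simps)
 have p: "0 <= (?e' - ?e) * (Ln ?b' - Ln ?b)" "0 <= (?e' - ?e) * Ln ?b" "0 <= ?e * (Ln ?b' - Ln ?b)"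
  using le Lle b by auto
 have d: "(?e' - ?e) * Ln ?b <= l" "?e * (Ln ?b' - Ln ?b) <= l" using f(3) f'(1) L eq p by auto
 have "?b' <= ?b * \<rho>" if \<rho>: "valf f' <= \<rho> * valf (P b e)" for \<rho>
 proof -
  have vS: "valf (P b e) \<in> SK" "valf f' \<in> SK" using wf_SK(2) wf f(2) by blast+
  note vpos = vS[THEN SK_qqD(3)]
  have "Ln ?b' - Ln ?b <= ?e * (Ln ?b' - Ln ?b)" using b(5) Lle by (intro mult_le_cancel_right1[THEN iffD2]) auto
  also have "\<dots> <= ?e' * Ln ?b' - ?e * Ln ?b" using eq p by linarith
  finally have "Ln (?b' * valf (P b e)) <= Ln (?b * valf f')" using Ln_mult b(1) b'(1) vS L f'(1) by simp
  then have "?b' * valf (P b e) <= ?b * valf f'" using SK_le_iff SK_mult b(1) b'(1) vS by blast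
  also have "\<dots> <= ?b * (\<rho> * valf (P b e))" using \<rho> b by (intro mult_left_mono) auto
  finally have "?b' * valf (P b e) <= (?b * \<rho>) * valf (P b e)" by (simp add: mult_ac)
  then show ?thesis using vpos by (simp only: mult_le_cancel_right_pos)
 qed
 then show ?thesis using that[OF f'] w le(1) d by simp
qed

text \<open>A convex set of bounds closed under sums and products stands for what counts as a bounded
 ratio: the finite numbers, or the germs below exponentials of a given level.\<close>

locale bset =
 fixes Bd :: "tf set"
 assumes Bd_one: "1 \<in> Bd"
  and Bd_add: "a \<in> Bd ==> b \<in> Bd ==> a + b \<in> Bd"
  and Bd_mult: "a \<in> Bd ==> b \<in> Bd ==> 0 <= a ==> 0 <= b ==> a * b \<in> Bd"
  and Bd_down: "b \<in> Bd ==> a <= b ==> a \<in> Bd"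

text \<open>At every scale \<open>s\<close>, there are few values below \<open>s\<close> times a bound, as far as they can be
 distinguished at that scale. The restriction to values below \<open>t\<close> makes an induction on \<open>t\<close>
 possible.\<close>

definition Good :: "tf set => nat => tf => bool" where
 "Good Bd k t \<longleftrightarrow> (\<forall>s>0. \<forall>\<beta>\<in>Bd. fsz (le s) (Hset k) {e \<in> SK. e < t \<and> e <= s * \<beta>})"

definition above :: "sk => tf => tf => tf set" where
 "above \<tau> t d = {a. \<exists>\<tau>'. wf_sk \<tau>' \<and> emb \<tau> \<tau>' \<and> a = val \<tau>' \<and> a < t \<and> a - val \<tau> <= d}"

context bset
begin

lemma Bd_of_nat: "of_nat n \<in> Bd"
 by (induct n) (auto intro: Bd_add Bd_one Bd_down[OF Bd_one])

lemma Bd_max: "a \<in> Bd ==> b \<in> Bd ==> max a b \<in> Bd" by (auto simp: max_def)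

text \<open>The logarithm of \<open>b'\<^sup>e\<^sup>'\<close> is \<open>e'\<close> times that of \<open>b'\<close>; it is known to the precision \<open>\<nu>\<close> if
 exponents are known at the scale \<open>\<nu> / ln b\<close> and bases at the scale \<open>b \<nu> / e\<close>.\<close>

lemma fsz_above_factor:
 assumes IH: "!!s \<beta>. 0 < s ==> \<beta> \<in> Bd ==> fsz (le s) (Hset k) (above b t (s * \<beta>))"
   "!!s \<beta>. 0 < s ==> \<beta> \<in> Bd ==> fsz (le s) (Hset k) (above e t (s * \<beta>))"
  and wf: "wf_fac (P b e)" and \<nu>: "0 < \<nu>" "\<nu> * \<beta> <= 1" "\<beta> \<in> Bd"
 shows "fsz (le \<nu>) (Hset k) {a. \<exists>f'. facrel (P b e) f' \<and> wf_fac f' \<and> valf f' < t \<and> a = Ln (valf f') \<and> a - Ln (valf (P b e)) <= \<nu> * \<beta>}"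
proof -
 let ?b = "val b" and ?e = "val e"
 note b = wf_PD[OF wf]
 have A: "fsz (le (\<nu> / Ln ?b)) (Hset k) (above e t (\<nu> / Ln ?b * \<beta>))" using IH(2)[of "\<nu> / Ln ?b" \<beta>] \<nu> b(9) by simp
 have B: "fsz (le (?b * \<nu> / ?e)) (Hset k) (above b t (?b * \<nu> / ?e * (\<beta> + \<beta>)))"
  by (rule IH(1)) (use \<nu> b(6,7) Bd_add[OF \<nu>(3,3)] in auto)
 show ?thesis
 proof (rule fsz_image2[where f = "\<lambda>x y. x * Ln y", OF A B Hset_add])
  fix a assume "a \<in> {a. \<exists>f'. facrel (P b e) f' \<and> wf_fac f' \<and> valf f' < t \<and> a = Ln (valf f') \<and> a - Ln (valf (P b e)) <= \<nu> * \<beta>}"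
  then obtain f' where f': "facrel (P b e) f'" "wf_fac f'" "valf f' < t" "a = Ln (valf f')" "Ln (valf f') - Ln (valf (P b e)) <= \<nu> * \<beta>"
   by blast
  from factor_above[OF wf f'(1,2,5)] obtain b' e' where f: "f' = P b' e'" "emb b b'" "emb e e'" "wf_sk b'" "wf_sk e'" "?b <= val b'"
   "(val e' - ?e) * Ln ?b <= \<nu> * \<beta>" "?e * (Ln (val b') - Ln ?b) <= \<nu> * \<beta>" by metis
  let ?b' = "val b'" and ?e' = "val e'"
  note b' = wf_PD[OF f'(2)[unfolded f(1)]]
  have "?e' < t" "?b' < t" using pw_ge_power[OF b'(1-4), of 1] f'(3) f(1) by auto
  moreover have "?e' - ?e <= \<nu> / Ln ?b * \<beta>" using f(7) b(9) by (simp add: field_simps)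
  ultimately have eA: "?e' \<in> above e t (\<nu> / Ln ?b * \<beta>)" using f unfolding above_def by auto
  have "0 <= ?e * (Ln ?b' - Ln ?b)" using b b'(1) f(6) SK_le_iff by simp
  then have nb: "0 <= \<nu> * \<beta>" using f(8) by linarith
  have "Ln ?b' - Ln ?b <= \<nu> * \<beta> / ?e" using f(8) b by (simp add: field_simps)
  moreover have "\<nu> * \<beta> / ?e <= 1" using \<nu>(2) b(5) by (simp add: field_simps)
  ultimately have "?b' <= ?b + ?b * (\<nu> * \<beta> / ?e) + ?b * (\<nu> * \<beta> / ?e)"
   using b(7) nb by (intro le_of_Ln_diff SK_qqD(4) b(1) b'(1)) auto
  then have "?b' - ?b <= ?b * \<nu> / ?e * (\<beta> + \<beta>)" by (simp add: algebra_simps)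
  then have bB: "?b' \<in> above b t (?b * \<nu> / ?e * (\<beta> + \<beta>))" using f \<open>?b' < t\<close> unfolding above_def by auto
  have "a = ?e' * Ln ?b'" using f'(4) f(1) pw_Ln b' by simp
  then show "\<exists>x\<in>above e t (\<nu> / Ln ?b * \<beta>). \<exists>y\<in>above b t (?b * \<nu> / ?e * (\<beta> + \<beta>)). a = x * Ln y"
   using eA bB by blast
 next
  fix x x' y y'
  assume "x \<in> above e t (\<nu> / Ln ?b * \<beta>)" "x' \<in> above e t (\<nu> / Ln ?b * \<beta>)"
   "y \<in> above b t (?b * \<nu> / ?e * (\<beta> + \<beta>))" "y' \<in> above b t (?b * \<nu> / ?e * (\<beta> + \<beta>))"
  then have x: "x \<in> SK" "?e <= x" "x - ?e <= \<nu> / Ln ?b * \<beta>" and x': "x' \<in> SK"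
   and y: "y \<in> SK" and y': "y' \<in> SK" "?b <= y'" "y' - ?b <= ?b * \<nu> / ?e * (\<beta> + \<beta>)"
   unfolding above_def using wf_SK(1) emb_val(1) wf by auto
  assume lx: "le (\<nu> / Ln ?b) x x'" and ly: "le (?b * \<nu> / ?e) y y'"
  have "x - ?e <= \<nu> * \<beta> / Ln ?b" using x(3) by simp
  also have "\<dots> <= 1 / Ln ?b" using \<nu>(2) b(9) by (simp add: divide_right_mono)
  also have "\<dots> <= 2" using b(8,9) by (simp add: field_simps)
  finally have xe: "x <= 2 * ?e" using b(5) by simp
  have 1: "le \<nu> (x * Ln y) (x * Ln y')"
  proof (rule le_power[of y y' ?b x "2 * ?e" "?b * \<nu> / ?e / 2"])
   show "le (?b * \<nu> / ?e / 2) y y'" by (rule le_weaken[OF ly, of 2]) (use \<nu> b(6,7) in auto)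
  qed (use y y' b(6,7) xe x b(5) \<nu> in auto)
  have 2: "le \<nu> (x * Ln y') (x' * Ln y')"
  proof (rule leI)
   fix n :: nat assume "n \<ge> 1" "x' * Ln y' < x * Ln y'"
   then have xx: "0 <= x - x'" using Ln_nonneg[OF y'(1)] by (auto simp: mult_less_cancel_right)
   have "Ln y' - Ln ?b <= (y' - ?b) / ?b" using y' b SK_qqD(4) by (intro Ln_diff_le) auto
   also have "\<dots> <= (?b * \<nu> / ?e * (\<beta> + \<beta>)) / ?b" using y' b(6,7) by (intro divide_right_mono) auto
   also have "\<dots> = (2 / ?e) * (\<nu> * \<beta>)" using b(6,7) by (simp add: field_simps)
   also have "\<dots> <= (2 / ?e) * 1" using \<nu> b by (intro mult_left_mono) auto
   also have "\<dots> <= 1" using b(5) by (simp add: field_simps)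
   finally have "Ln y' <= 3 * Ln ?b" using b(8) by linarith
   then have "of_nat n * (x * Ln y' - x' * Ln y') <= of_nat n * ((x - x') * (3 * Ln ?b))"
    using xx by (simp add: left_diff_distrib[symmetric] mult_left_mono)
   also have "\<dots> = (of_nat (3 * n) * (x - x')) * Ln ?b" by simp
   also have "\<dots> <= \<nu> / Ln ?b * Ln ?b" using leD[OF lx] b(9) by (intro mult_right_mono) (auto simp del: of_nat_mult)
   also have "\<dots> = \<nu>" using b(9) by simp
   finally show "of_nat n * (x * Ln y' - x' * Ln y') <= \<nu>" .
  qed (use \<nu> in simp)
  show "le \<nu> (x * Ln y) (x' * Ln y')" using 1 2 by (rule le_trans)
 qed
qed

text \<open>Values above a component.  If the difference may exceed the component then the values are
 controlled directly.  Otherwise no factor is added, the logarithms of the factors differ by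
 little, and the differences of bases and exponents are controlled at their own scales.\<close>

lemma fsz_above_comp:
 assumes good: "Good Bd k t" and wf: "wf_comp c"
  and IH: "!!b e s \<beta> u. P b e \<in> set c ==> u = b \<or> u = e ==> 0 < s ==> \<beta> \<in> Bd ==> fsz (le s) (Hset k) (above u t (s * \<beta>))"
  and s: "0 < s" "\<beta> \<in> Bd" "1 <= \<beta>"
 shows "fsz (le s) (Hset k) {a. \<exists>v. list_emb facrel c v \<and> wf_comp v \<and> a = valc v \<and> a < t \<and> a - valc c <= s * \<beta>}"
  (is "fsz _ _ ?W")
proof -
 have C: "valc c \<in> SK" "0 < valc c" using wf_comp_SK[OF wf] SK_qqD by auto
 show ?thesis
 proof (cases "valc c < s * \<beta>")
  case True
  have "fsz (le s) (Hset k) {e \<in> SK. e < t \<and> e <= s * (\<beta> + \<beta>)}"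
   using good s Bd_add unfolding Good_def by blast
  then show ?thesis
   by (rule fsz_subset) (use True wf_comp_SK in \<open>auto simp: algebra_simps\<close>)
 next
  case False
  define \<nu> where "\<nu> = s / valc c"
  have \<nu>: "0 < \<nu>" "\<nu> * \<beta> <= 1" "\<nu> * valc c = s" using s C False by (auto simp: \<nu>_def)
  define A where "A f = {a. \<exists>f'. facrel f f' \<and> wf_fac f' \<and> valf f' < t \<and> a = Ln (valf f') \<and> a - Ln (valf f) <= \<nu> * \<beta>}" for f
  have fA: "fsz (le \<nu>) (Hset k) (A f)" if "f \<in> set c" for f
  proof (cases f)
   case V
   have "A f \<subseteq> {Ln X}" unfolding A_def V by (auto elim: facrel.cases)
   then show ?thesis by (rule fsz_subset[OF fsz_finite, rotated -1]) (use \<nu> in \<open>auto simp: zero_in_Hset le_refl\<close>)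
  next
   case (P b e)
   have w: "wf_fac (P b e)" using that wf P unfolding wf_comp_def by blast
   have m: "P b e \<in> set c" using that P by simp
   show ?thesis unfolding A_def P
    by (rule fsz_above_factor[OF IH[OF m disjI1[OF refl]] IH[OF m disjI2[OF refl]] w \<nu>(1,2) s(2)])
  qed
  have logs: "fsz (le \<nu>) (Hset k) {a. \<exists>fs'. wf_comp fs' \<and> list_all2 (\<lambda>f f'. Ln (valf f') \<in> A f) c fs' \<and> a = Ln (valc fs')}"
   by (rule fsz_factors[OF fA]) (use \<nu> in \<open>auto simp: le_refl le_add zero_in_Hset Hset_add\<close>)
  have small: "list_all2 (\<lambda>f f'. Ln (valf f') \<in> A f) c v \<and> valc v <= 2 * valc c"
   if v: "list_emb facrel c v" "wf_comp v" "valc v < t" "valc v - valc c <= s * \<beta>" for v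
  proof -
   have v2: "valc v <= 2 * valc c" using v(4) False by simp
   obtain c1 g where g: "list_all2 facrel c c1" "wf_comp c1" "wf_comp g" "valc v = valc g * valc c1" "g = [] \<longrightarrow> c1 = v"
    using emb_comp_split[OF v(1,2)] .
   have cc1: "valc c <= valc c1" using facrel_list_le[OF g(1) wf g(2)] by simp
   have "g = []"
   proof (rule ccontr)
    assume "g \<noteq> []"
    then have "3 <= valc g" using wf_comp_infl[OF g(3)] unfolding infl_def by (metis of_nat_numeral)
    then have "3 * valc c <= valc g * valc c1" using cc1 C by (intro mult_mono) auto
    then show False using v2 g(4) C by simp
   qed
   then have all2: "list_all2 facrel c v" using g by simp
   show ?thesis
   proof
    show "list_all2 (\<lambda>f f'. Ln (valf f') \<in> A f) c v"
    proof (rule list_all2_all_nthI)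
     show "length c = length v" using all2 by (rule list_all2_lengthD)
     fix i assume i: "i < length c"
     let ?f = "c ! i" and ?f' = "v ! i"
     have r: "facrel ?f ?f'" "wf_fac ?f" "wf_fac ?f'" "valf ?f' * valc c <= valf ?f * valc v"
      using facrel_list_le[OF all2 wf v(2)] i by (auto dest: list_all2_nthD)
     have f: "valf ?f \<in> SK" "valf ?f' \<in> SK" "0 < valf ?f" using wf_SK(2) r SK_qqD(3) by auto
     have "valf ?f' * valc c <= valf ?f * (valc c + s * \<beta>)"
     proof -
      have "valc v <= valc c + s * \<beta>" using v(4) by simp
      then have "valf ?f * valc v <= valf ?f * (valc c + s * \<beta>)" using f(3) by (intro mult_left_mono) auto
      then show ?thesis using r(4) by linarith
     qed
     also have "\<dots> = (valf ?f * (1 + \<nu> * \<beta>)) * valc c" using \<nu>(3) by (simp add: algebra_simps)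
     finally have "valf ?f' <= valf ?f * (1 + \<nu> * \<beta>)" using C by (simp add: mult_le_cancel_right)
     then have "(valf ?f' - valf ?f) / valf ?f <= \<nu> * \<beta>" using f by (simp add: field_simps)
     then have "Ln (valf ?f') - Ln (valf ?f) <= \<nu> * \<beta>"
      using Ln_diff_le[OF SK_qqD(4)[OF f(2)] SK_qqD(4)[OF f(1)]] by linarith
     moreover have "valf ?f' < t"
      using factor_le_comp[OF _ v(2), of ?f'] i all2 v(3) by (auto dest: list_all2_lengthD)
     ultimately show "Ln (valf ?f') \<in> A ?f" unfolding A_def using r by blast
    qed
   qed (rule v2)
  qed
  show ?thesis
  proof (rule fsz_rel[OF logs, where E = "\<lambda>z w. z = Ln w"])
   fix w assume "w \<in> ?W"
   then obtain v where v: "list_emb facrel c v" "wf_comp v" "w = valc v" "valc v < t" "valc v - valc c <= s * \<beta>" by blast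
   then show "\<exists>z\<in>{a. \<exists>fs'. wf_comp fs' \<and> list_all2 (\<lambda>f f'. Ln (valf f') \<in> A f) c fs' \<and> a = Ln (valc fs')}. z = Ln w"
    using small by blast
  next
   fix z z' w w' assume w: "w \<in> ?W" "w' \<in> ?W" and z: "z = Ln w" "z' = Ln w'" "le \<nu> z z'"
   have ww: "w \<in> SK" "w' \<in> SK" "w' <= 2 * valc c" using w small wf_comp_SK by auto
   show "le s w w'"
   proof -
    have "\<nu> <= \<nu> * \<beta>" using \<nu> s(3) by simp
    then have n1: "\<nu> <= 1" using \<nu>(2) by linarith
    have "le (2 * s) w w'"
     by (rule le_exp[OF _ ww]) (use z n1 \<nu> in \<open>auto simp: algebra_simps\<close>)
    then show ?thesis by (rule le_weaken[of _ _ _ 2]) (use s in auto)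
   qed
  qed
 qed
qed

text \<open>A term that contains another one in a base or an exponent has at least twice its value.
 Its value is then bounded in terms of the difference, so that the terms above \<open>\<tau>\<close> in this way
 are controlled by \<open>Good\<close>.\<close>

lemma emb_child_double:
 assumes "fs \<in> set cs" "P b e \<in> set fs" "emb \<tau> u" "u = b \<or> u = e" "wf_sk \<tau>" "wf_sk (S cs)"
 shows "2 * val \<tau> <= val (S cs)"
proof -
 have w': "\<forall>gs\<in>set cs. wf_comp gs" using assms(6) unfolding wf_S_comp by blast
 then have w: "wf_fac (P b e)" using assms(1,2) unfolding wf_comp_def by blast
 have be: "val b \<in> SK" "2 <= val b" "val e \<in> SK" "infl (val e)" using w wf_SK(1) by auto
 have e2: "2 <= val e" using be(4)[unfolded infl_def, rule_format, of 2] by simp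
 have u: "val \<tau> <= val u" "2 <= val u" using emb_val(1)[OF assms(3,5)] assms(4) w be e2 by auto
 have "0 <= val \<tau>" using SK_qqD(3)[OF wf_SK(1)[OF assms(5)]] by simp
 then have "2 * val \<tau> <= val u * val u" using u by (intro mult_mono) auto
 also have "\<dots> <= valf (P b e)" using pw_ge_power[OF be, of 2] assms(4) by (auto simp: power2_eq_square)
 also have "\<dots> <= val (S cs)" by (rule factor_le[OF assms(1,2) w'])
 finally show ?thesis .
qed

text \<open>By induction on terms \<open>Good\<close> controls the differences above any term, at all scales.
 Relative to an embedded sum, a sum has extended components and added ones; the added ones form
 a value below the difference.\<close>

theorem fsz_above:
 assumes good: "Good Bd k t" and "wf_sk \<tau>" "0 < s" "\<beta> \<in> Bd"
 shows "fsz (le s) (Hset k) (above \<tau> t (s * \<beta>))"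
 using assms(2-)
proof (induct \<tau> arbitrary: s \<beta> rule: measure_induct_rule[where f = size])
 case (less \<tau>)
 obtain cs where \<tau>: "\<tau> = S cs" by (cases \<tau>)
 define \<gamma> where "\<gamma> = max \<beta> 1"
 have \<gamma>: "\<gamma> \<in> Bd" "1 <= \<gamma>" "\<beta> <= \<gamma>" using less(4) Bd_one Bd_max by (auto simp: \<gamma>_def)
 define E0 where "E0 = insert 0 {e \<in> SK. e < t \<and> e <= s * \<gamma>}"
 have fE0: "fsz (le s) (Hset k) E0"
 proof -
  have "fsz (le s) (Hset k) ({0} \<union> {e \<in> SK. e < t \<and> e <= s * \<gamma>})"
  proof (rule fsz_Un)
   show "fsz (le s) (Hset k) {0}" using less(3) by (intro fsz_finite) (auto simp: le_refl zero_in_Hset)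
   show "fsz (le s) (Hset k) {e \<in> SK. e < t \<and> e <= s * \<gamma>}" using good less(3) \<gamma>(1) unfolding Good_def by blast
  qed
  then show ?thesis by (simp add: E0_def)
 qed
 have extra: "sum_list (map valc us) \<in> E0"
  if "\<forall>c\<in>set us. wf_comp c" "sum_list (map valc us) < t" "sum_list (map valc us) <= s * \<gamma>" for us
 proof (cases "us = []")
  case False
  then have "wf_sk (S us)" using that(1) unfolding wf_S_comp by blast
  then show ?thesis using wf_SK(1)[of "S us"] that by (simp add: E0_def)
 qed (simp add: E0_def)
 define RC where "RC c = {a. \<exists>v. list_emb facrel c v \<and> wf_comp v \<and> a = valc v \<and> a < t \<and> a - valc c <= s * \<gamma>}" for c
 have fRC: "fsz (le s) (Hset k) (RC c)" if c: "c \<in> set cs" for c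
  unfolding RC_def
 proof (rule fsz_above_comp[OF good _ _ less(3) \<gamma>(1,2)])
  show wc: "wf_comp c" using c less(2) unfolding \<tau> wf_S_comp by blast
  fix b e u and s \<beta> :: tf assume a: "P b e \<in> set c" "u = b \<or> u = e" "0 < s" "\<beta> \<in> Bd"
  have "child u \<tau>" unfolding child_def \<tau> using a(1,2) c by blast
  then have "size u < size \<tau>" by (rule size_child)
  moreover have "wf_fac (P b e)" using wc a(1) unfolding wf_comp_def by blast
  then have "wf_sk u" using a(2) by auto
  ultimately show "fsz (le s) (Hset k) (above u t (s * \<beta>))" using less(1) a by blast
 qed
 define RL where "RL ds = {a. \<exists>ds'. list_emb (list_emb facrel) ds ds' \<and> (\<forall>c\<in>set ds'. wf_comp c) \<and> a = sum_list (map valc ds')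
   \<and> a < t \<and> a - sum_list (map valc ds) <= s * \<gamma>}" for ds
 have fRL: "fsz (le s) (Hset k) (RL ds)" if "set ds \<subseteq> set cs" for ds
  using that
 proof (induct ds)
  case Nil
  show ?case by (rule fsz_subset[OF fE0]) (use extra in \<open>auto simp: RL_def\<close>)
 next
  case (Cons c ds)
  let ?G = "{a. \<exists>x\<in>RC c. \<exists>y\<in>RL ds. a = x + y}"
  have G: "fsz (le s) (Hset k) ?G"
   by (rule fsz_image2[where f = "(+)", OF fRC[of c] Cons(1) Hset_add]) (use Cons(2) in \<open>auto intro: le_add\<close>)
  show ?case
  proof (rule fsz_image2[where f = "(+)", OF fE0 G Hset_add])
   fix a assume "a \<in> RL (c # ds)"
   then obtain ds' where d: "list_emb (list_emb facrel) (c # ds) ds'" "\<forall>c\<in>set ds'. wf_comp c" "a = sum_list (map valc ds')"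
    "a < t" "a - sum_list (map valc (c # ds)) <= s * \<gamma>" unfolding RL_def by blast
   from list_emb_ConsD[OF d(1)] obtain us v vs where u: "ds' = us @ v # vs" "list_emb facrel c v" "list_emb (list_emb facrel) ds vs" by blast
   have wf: "wf_comp v" "\<forall>c\<in>set us. wf_comp c" "\<forall>c\<in>set vs. wf_comp c" using d(2) u(1) by auto
   have wfc: "wf_comp c" "\<forall>c\<in>set ds. wf_comp c" using Cons(2) less(2) unfolding \<tau> wf_S_comp by auto
   have le: "valc c <= valc v" "sum_list (map valc ds) <= sum_list (map valc vs)" "0 <= sum_list (map valc us)"
    using emb_comp_le[OF u(2) wfc(1) wf(1)] emb_sums[OF u(3) wfc(2) wf(3)] val_comp_nonneg[OF wf(2)] by auto
   have p: "0 < valc v" "0 <= sum_list (map valc vs)" "0 < valc c" "0 <= sum_list (map valc ds)"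
    using SK_qqD(3)[OF wf_comp_SK] wf wfc val_comp_nonneg by auto
   have a: "a = sum_list (map valc us) + (valc v + sum_list (map valc vs))" using d(3) u(1) by simp
   have "valc v \<in> RC c" unfolding RC_def using u(2) wf(1) le p d(4,5) a by auto
   moreover have "sum_list (map valc vs) \<in> RL ds" unfolding RL_def using u(3) wf(3) le p d(4,5) a by auto
   moreover have "sum_list (map valc us) \<in> E0" by (rule extra[OF wf(2)]) (use le p d(4,5) a in auto)
   ultimately show "\<exists>x\<in>E0. \<exists>y\<in>?G. a = x + y" using a by blast
  qed (auto intro: le_add)
 qed
 have sub: "above \<tau> t (s * \<beta>) \<subseteq> RL cs \<union> {e \<in> SK. e < t \<and> e <= s * (\<gamma> + \<gamma>)}"
 proof
  fix a assume "a \<in> above \<tau> t (s * \<beta>)"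
  then obtain \<tau>' where a': "wf_sk \<tau>'" "emb \<tau> \<tau>'" "a = val \<tau>'" "a < t" "a - val \<tau> <= s * \<beta>"
   unfolding above_def by blast
  obtain cs' where cs': "\<tau>' = S cs'" by (cases \<tau>')
  note a = a'[unfolded cs']
  have ag: "a - val \<tau> <= s * \<gamma>" using a(5) \<gamma>(3) less(3) by (meson mult_left_mono less_imp_le order_trans)
  have aS: "a \<in> SK" unfolding a(3) by (rule wf_SK(1)[OF a(1)])
  have dbl: "a \<in> RL cs \<union> {e \<in> SK. e < t \<and> e <= s * (\<gamma> + \<gamma>)}" if "2 * val \<tau> <= a"
   using ag that a(4) aS by (auto simp: algebra_simps)
  from a(2) show "a \<in> RL cs \<union> {e \<in> SK. e < t \<and> e <= s * (\<gamma> + \<gamma>)}"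
  proof (cases rule: emb.cases)
   case (emb_root cs0)
   then have "list_emb (list_emb facrel) cs cs'" using \<tau> by simp
   then have "a \<in> RL cs" unfolding RL_def using a ag \<tau> unfolding wf_S_comp by auto
   then show ?thesis by blast
  next
   case (emb_base fs b e)
   then show ?thesis using dbl emb_child_double[of fs cs' b e \<tau> b] a less(2) by auto
  next
   case (emb_expo fs b e)
   then show ?thesis using dbl emb_child_double[of fs cs' b e \<tau> e] a less(2) by auto
  qed
 qed
 have "fsz (le s) (Hset k) {e \<in> SK. e < t \<and> e <= s * (\<gamma> + \<gamma>)}"
  using good less(3) Bd_add[OF \<gamma>(1,1)] unfolding Good_def by blast
 from fsz_subset[OF fsz_Un[OF fRL[OF subset_refl] this] sub] show ?case .
qed

end

section \<open>Components of one size\<close>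

context bset
begin

lemma not_Bd_less: "t \<notin> Bd ==> b \<in> Bd ==> b < t"
 using Bd_down not_less by blast

lemma subterm_less:
 assumes "t \<notin> Bd" "\<beta> \<in> Bd" "wf_fac (P b e)" "valf (P b e) <= t * \<beta>"
 shows "val b < t" "val e < t"
proof -
 have t: "1 < t" "\<beta> < t" using not_Bd_less[OF assms(1)] Bd_one assms(2) by auto
 have small: "x < t" if "x ^ 2 <= valf (P b e)" for x
 proof (rule ccontr)
  assume "\<not> x < t"
  then have "t * t <= x ^ 2" using t by (simp add: power2_eq_square mult_mono)
  also have "\<dots> <= t * \<beta>" using that assms(4) by simp
  finally show False using t by (simp add: mult_le_cancel_left)
 qed
 have be: "val b \<in> SK" "2 <= val b" "val e \<in> SK" "infl (val e)" using assms(3) wf_SK(1) by auto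
 show "val b < t" "val e < t" using small pw_ge_power[OF be, of 2] by auto
qed

text \<open>Here the powers may differ by a bounded factor \<open>\<rho>\<close>. Then exponents differ at most by
 \<open>2 \<rho>\<close>, bases by at most \<open>b / e\<close> times a bound, and the scale \<open>\<sigma>\<close> of the bases is chosen such
 that the largest exponents in question preserve the precision \<open>\<nu>\<close> of the logarithm.\<close>

lemma fsz_ratio_factor:
 assumes good: "Good Bd k t" and t: "t \<notin> Bd" and wf: "wf_fac (P b e)"
  and \<rho>: "\<rho> \<in> Bd" "1 <= \<rho>" and \<nu>: "0 < \<nu>" "1 / \<nu> \<in> Bd" and \<beta>: "\<beta> \<in> Bd" "1 <= \<beta>"
 shows "fsz (le \<nu>) (Hset k) {a. \<exists>f'. facrel (P b e) f' \<and> wf_fac f' \<and> a = Ln (valf f') \<and>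
  valf f' <= \<rho> * valf (P b e) \<and> valf f' <= t * \<beta>}"
proof -
 let ?b = "val b" and ?e = "val e"
 note b = wf_PD[OF wf]
 note pos = b(6,7)
 define \<rho>' where "\<rho>' = 1 + 2 * \<rho>"
 define \<sigma> where "\<sigma> = ?b * \<nu> / (?e * \<rho>')"
 have \<rho>': "0 < \<rho>'" using \<rho> by (simp add: \<rho>'_def)
 have \<sigma>: "0 < \<sigma>" using pos \<nu> \<rho>' by (simp add: \<sigma>_def)
 define \<beta>' where "\<beta>' = 2 * (\<rho> * \<rho>) * \<rho>' * (1 / \<nu>)"
 have two: "2 * a = a + a" for a :: tf by simp
 have "\<beta>' \<in> Bd"
  unfolding \<beta>'_def \<rho>'_def two using \<rho> \<nu> by (intro Bd_mult Bd_add Bd_one) auto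
 then have B: "fsz (le \<sigma>) (Hset k) (above b t (\<sigma> * \<beta>'))"
  using \<sigma> wf by (intro fsz_above[OF good]) auto
 have \<sigma>\<beta>: "\<sigma> * \<beta>' = ?b / ?e * (2 * (\<rho> * \<rho>))"
  using pos \<nu> \<rho>' by (simp add: \<sigma>_def \<beta>'_def)
 have A: "fsz (le 1) (Hset k) (above e t (1 * (\<rho> + \<rho>)))"
  using wf \<rho> by (intro fsz_above[OF good] Bd_add) auto
 show ?thesis
 proof (rule fsz_image2[where f = "\<lambda>x y. x * Ln y", OF A B Hset_add])
  fix a assume "a \<in> {a. \<exists>f'. facrel (P b e) f' \<and> wf_fac f' \<and> a = Ln (valf f') \<and>
   valf f' <= \<rho> * valf (P b e) \<and> valf f' <= t * \<beta>}"
  then obtain f' where f': "facrel (P b e) f'" "wf_fac f'" "a = Ln (valf f')" "valf f' <= \<rho> * valf (P b e)" "valf f' <= t * \<beta>"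
   by blast
  have vS: "valf (P b e) \<in> SK" "valf f' \<in> SK" using wf_SK(2) wf f'(2) by blast+
  have "Ln (valf f') - Ln (valf (P b e)) <= (valf f' - valf (P b e)) / valf (P b e)"
   using vS SK_qqD(4) by (intro Ln_diff_le)
  also have "\<dots> <= \<rho>" using f'(4) vS[THEN SK_qqD(3)] by (simp add: field_simps)
  finally have "Ln (valf f') - Ln (valf (P b e)) <= \<rho>" .
  from factor_above[OF wf f'(1,2) this] obtain b' e' where f: "f' = P b' e'" "emb b b'" "emb e e'" "wf_sk b'" "wf_sk e'" "?b <= val b'"
   "(val e' - ?e) * Ln ?b <= \<rho>" "?e * (Ln (val b') - Ln ?b) <= \<rho>" "val b' <= ?b * \<rho>" using f'(4) by metis
  let ?b' = "val b'" and ?e' = "val e'"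
  note b' = wf_PD[OF f'(2)[unfolded f(1)]]
  have "?e <= ?e'" using emb_val(1) f wf by auto
  then have "(?e' - ?e) * 1 <= (?e' - ?e) * (2 * Ln ?b)" using b(8) by (intro mult_left_mono) auto
  then have ee: "?e' - ?e <= \<rho> + \<rho>" using f(7) by simp
  have "?e' < t" "?b' < t" using subterm_less[OF t \<beta>(1)] f'(2,5) f(1) by auto
  then have eA: "?e' \<in> above e t (1 * (\<rho> + \<rho>))" using f ee unfolding above_def by auto
  have d2: "?e * (Ln ?b' - Ln ?b) <= \<rho>" by (rule f(8))
  have Ld: "Ln ?b' - Ln ?b <= \<rho> / ?e" using d2 pos by (simp add: field_simps)
  have "?b' - ?b <= ?b / ?e * (2 * (\<rho> * \<rho>))"
  proof (cases "\<rho> <= ?e")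
   case True
   then have "\<rho> / ?e <= 1" "0 <= \<rho> / ?e" using pos \<rho> by auto
   with Ld have "?b' <= ?b + ?b * (\<rho> / ?e) + ?b * (\<rho> / ?e)"
    by (intro le_of_Ln_diff SK_qqD(4) b(1) b'(1)) auto
   then have "?b' - ?b <= ?b / ?e * (2 * \<rho>)" by (simp add: algebra_simps)
   also have "\<dots> <= ?b / ?e * (2 * (\<rho> * \<rho>))" using pos \<rho> by (intro mult_left_mono) auto
   finally show ?thesis .
  next
   case False
   have "?b' <= ?b * \<rho>" by (rule f(9))
   also have "\<dots> <= ?b / ?e * (\<rho> * \<rho>)" using False pos \<rho> by (simp add: field_simps mult_mono)
   also have "\<dots> <= ?b / ?e * (2 * (\<rho> * \<rho>))" using pos \<rho> by (intro mult_left_mono) auto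
   finally show ?thesis using pos by simp
  qed
  then have bB: "?b' \<in> above b t (\<sigma> * \<beta>')" using f \<open>?b' < t\<close> \<sigma>\<beta> unfolding above_def by auto
  have "a = ?e' * Ln ?b'" using f'(3) f(1) pw_Ln b' by simp
  then show "\<exists>x\<in>above e t (1 * (\<rho> + \<rho>)). \<exists>y\<in>above b t (\<sigma> * \<beta>'). a = x * Ln y"
   using eA bB by blast
 next
  fix x x' y y'
  assume "x \<in> above e t (1 * (\<rho> + \<rho>))" "x' \<in> above e t (1 * (\<rho> + \<rho>))" "y \<in> above b t (\<sigma> * \<beta>')" "y' \<in> above b t (\<sigma> * \<beta>')"
  then have x: "x \<in> SK" "?e <= x" "x - ?e <= \<rho> + \<rho>" and x': "x' \<in> SK" and y: "y \<in> SK" and y': "y' \<in> SK" "?b <= y'"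
   unfolding above_def using wf_SK(1) emb_val(1) wf by auto
  assume lx: "le 1 x x'" and ly: "le \<sigma> y y'"
  have "x <= ?e * 1 + 1 * (2 * \<rho>)" using x by simp
  also have "\<dots> <= ?e * 1 + ?e * (2 * \<rho>)" using b(5) \<rho> by (intro add_left_mono mult_right_mono) auto
  finally have xe: "x <= ?e * \<rho>'" by (simp add: \<rho>'_def algebra_simps)
  have "le \<nu> (x * Ln y) (x * Ln y')"
   by (rule le_power[of y y' ?b x "?e * \<rho>'" \<sigma>]) (use y y' pos xe x b(5) \<nu> ly \<rho>' in \<open>auto simp: \<sigma>_def\<close>)
  moreover have "x * Ln y' <= x' * Ln y'" using le_SK[OF lx x(1) x'] Ln_nonneg[OF y'(1)] by (rule mult_right_mono)
  then have "le \<nu> (x * Ln y') (x' * Ln y')" using \<nu> by (intro le_of_le) auto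
  ultimately show "le \<nu> (x * Ln y) (x' * Ln y')" by (rule le_trans)
 qed
qed

text \<open>Components of the size of \<open>t\<close> lie above finitely many of them.  Relative to such a component,
 the logarithms split into the contributions of the factors and of the added factors.\<close>

lemma fsz_comp_logs:
 assumes extra: "!!\<rho>. \<rho> \<in> Bd ==> fsz R U {a. \<exists>f\<in>SK. f <= \<rho> \<and> a = Ln f}"
  and factor: "!!b e \<rho>. wf_fac (P b e) ==> valf (P b e) <= t * \<beta> ==> \<rho> \<in> Bd ==> 1 <= \<rho> ==>
   fsz R U {a. \<exists>f'. facrel (P b e) f' \<and> wf_fac f' \<and> a = Ln (valf f') \<and> valf f' <= \<rho> * valf (P b e) \<and> valf f' <= t * \<beta>}"
  and R: "!!a. R a a" "!!a a' b b'. R a a' ==> R b b' ==> R (a + b) (a' + b')"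
  and U: "0 \<in> U" "!!u v. u \<in> U ==> v \<in> U ==> u + v \<in> U"
  and \<beta>: "\<beta> \<in> Bd" "1 <= \<beta>"
 shows "fsz R U {a. \<exists>c. wf_comp c \<and> a = Ln (valc c) \<and> valc c <= t * \<beta> \<and> t <= valc c * \<beta>}"
proof -
 define K where "K = {c. wf_comp c \<and> valc c <= t * \<beta> \<and> t <= valc c * \<beta>}"
 define \<rho> where "\<rho> = \<beta> * \<beta>"
 have \<rho>: "\<rho> \<in> Bd" "1 <= \<rho>" using \<beta> Bd_mult mult_mono[of 1 \<beta> 1 \<beta>] by (auto simp: \<rho>_def)
 obtain B where B: "finite B" "B \<subseteq> K" "!!c. c \<in> K ==> \<exists>b\<in>B. list_emb facrel b c"
  by (rule wqo_on_finite_basis[OF wqo_on_subset[OF wqo_comp, of K]]) auto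
 let ?R = "\<lambda>c0. {a. \<exists>c\<in>K. list_emb facrel c0 c \<and> a = Ln (valc c)}"
 have "fsz R U (?R c0)" if c0: "c0 \<in> B" for c0
 proof -
  have w0: "wf_comp c0" "t <= valc c0 * \<beta>" "valc c0 <= t * \<beta>" using c0 B unfolding K_def by auto
  have C: "valc c0 \<in> SK" "0 < valc c0" using wf_comp_SK[OF w0(1)] SK_qqD by auto
  define A where "A f = {a. \<exists>f'. facrel f f' \<and> wf_fac f' \<and> a = Ln (valf f') \<and> valf f' <= \<rho> * valf f \<and> valf f' <= t * \<beta>}" for f
  have fA: "fsz R U (A f)" if "f \<in> set c0" for f
  proof (cases f)
   case V
   have "A f \<subseteq> {Ln X}" unfolding A_def V by (auto elim: facrel.cases)
   then show ?thesis by (rule fsz_subset[OF fsz_finite, rotated -1]) (use R U in auto)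
  next
   case (P b e)
   then have "wf_fac (P b e)" "valf (P b e) <= t * \<beta>"
    using that w0 factor_le_comp[OF that w0(1)] unfolding wf_comp_def by auto
   from factor[OF this \<rho>] show ?thesis unfolding A_def P .
  qed
  let ?L = "{a. \<exists>fs'. wf_comp fs' \<and> list_all2 (\<lambda>f f'. Ln (valf f') \<in> A f) c0 fs' \<and> a = Ln (valc fs')}"
  have logs: "fsz R U ?L"
   by (rule fsz_factors[OF fA]) (use R U in auto)
  show ?thesis
  proof (rule fsz_image2[where f = "(+)", OF extra[OF \<rho>(1)] logs U(2)])
   fix w assume "w \<in> ?R c0"
   then obtain c where c: "wf_comp c" "valc c <= t * \<beta>" "list_emb facrel c0 c" "w = Ln (valc c)" unfolding K_def by auto
   obtain c1 g where g: "list_all2 facrel c0 c1" "wf_comp c1" "wf_comp g" "valc c = valc g * valc c1"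
    using emb_comp_split[OF c(3,1)] by metis
   have S: "valc c1 \<in> SK" "valc g \<in> SK" using wf_comp_SK g by auto
   note p = S[THEN SK_qqD(3)] S[THEN SK_qqD(2)]
   have cc1: "valc c0 <= valc c1" using facrel_list_le[OF g(1) w0(1) g(2)] by simp
   have c1c: "valc c1 <= valc c" using g(4) p by simp
   have "t * \<beta> <= (valc c0 * \<beta>) * \<beta>" using w0(2) \<beta> by (intro mult_right_mono) auto
   then have rat: "valc c <= \<rho> * valc c0" using c(2) by (simp add: \<rho>_def mult_ac)
   have "valc g * valc c1 <= \<rho> * valc c1"
   proof -
    have "\<rho> * valc c0 <= \<rho> * valc c1" using cc1 \<rho> by (intro mult_left_mono) auto
    then show ?thesis using rat g(4) by simp
   qed
   then have gr: "valc g <= \<rho>" using p by (simp only: mult_le_cancel_right_pos)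
   have "list_all2 (\<lambda>f f'. Ln (valf f') \<in> A f) c0 c1"
   proof (rule list_all2_all_nthI)
    show len: "length c0 = length c1" using g(1) by (rule list_all2_lengthD)
    fix i assume i: "i < length c0"
    let ?f = "c0 ! i" and ?f' = "c1 ! i"
    have r: "facrel ?f ?f'" "wf_fac ?f" "wf_fac ?f'" "valf ?f' * valc c0 <= valf ?f * valc c1"
     using facrel_list_le[OF g(1) w0(1) g(2)] i by (auto dest: list_all2_nthD)
    have f: "0 < valf ?f" using wf_SK(2)[OF r(2)] SK_qqD(3) by auto
    have "valf ?f * valc c1 <= valf ?f * (\<rho> * valc c0)" using c1c rat f by (intro mult_left_mono) auto
    then have "valf ?f' * valc c0 <= (\<rho> * valf ?f) * valc c0" using r(4) by (simp add: mult_ac)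
    then have "valf ?f' <= \<rho> * valf ?f" using C by (simp only: mult_le_cancel_right_pos)
    moreover have "valf ?f' <= t * \<beta>"
     using factor_le_comp[OF _ g(2), of ?f'] i len c1c c(2) by (auto intro: order_trans)
    ultimately show "Ln (valf ?f') \<in> A ?f" unfolding A_def using r by blast
   qed
   then have "Ln (valc c1) \<in> ?L" using g(2) by blast
   moreover have "w = Ln (valc g) + Ln (valc c1)" using c(4) g(4) Ln_mult S by simp
   ultimately show "\<exists>x\<in>{a. \<exists>f\<in>SK. f <= \<rho> \<and> a = Ln f}. \<exists>y\<in>?L. w = x + y" using gr S by blast
  qed (use R in auto)
 qed
 then have "fsz R U (\<Union>c0\<in>B. ?R c0)" using B(1) by (intro fsz_UN)
 then show ?thesis
 proof (rule fsz_subset)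
  show "{a. \<exists>c. wf_comp c \<and> a = Ln (valc c) \<and> valc c <= t * \<beta> \<and> t <= valc c * \<beta>} \<subseteq> (\<Union>c0\<in>B. ?R c0)"
  proof safe
   fix c assume "wf_comp c" "valc c <= t * \<beta>" "t <= valc c * \<beta>"
   then have "c \<in> K" by (simp add: K_def)
   with B(3)[OF this] show "Ln (valc c) \<in> (\<Union>c0\<in>B. ?R c0)" by auto
  qed
 qed
qed

text \<open>From precision \<open>\<nu>\<close> of the logarithms to precision \<open>s\<close> of the values, which are at most
 \<open>t \<beta>\<close>.\<close>

lemma fsz_comps:
 assumes good: "Good Bd k t" and exact: "!!\<beta>. \<beta> \<in> Bd ==> fsz (<=) (Hset k) {f \<in> SK. f <= \<beta>}"
  and t: "t \<notin> Bd" and \<beta>: "\<beta> \<in> Bd" "1 <= \<beta>" and s: "0 < s" "s <= t" "t <= s * \<beta>"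
 shows "fsz (le s) (Hset k) {a. \<exists>c. wf_comp c \<and> a = valc c \<and> a <= t * \<beta> \<and> t <= a * \<beta>}"
proof -
 have t0: "0 < t" using s by simp
 define \<nu> where "\<nu> = s / (t * \<beta>)"
 have \<nu>0: "0 < \<nu>" using s t0 \<beta> by (simp add: \<nu>_def)
 have "t * \<beta> <= (s * \<beta>) * \<beta>" using s(3) \<beta> by (intro mult_right_mono) auto
 then have "1 / \<nu> <= \<beta> * \<beta>" using s t0 \<beta> by (simp add: \<nu>_def field_simps)
 then have \<nu>B: "1 / \<nu> \<in> Bd" using \<beta> by (intro Bd_down[OF Bd_mult[OF \<beta>(1,1)]]) auto
 have \<nu>1: "\<nu> <= 1" using s t0 \<beta> mult_mono[of s t 1 \<beta>] by (simp add: \<nu>_def field_simps)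
 have "fsz (le \<nu>) (Hset k) {a. \<exists>c. wf_comp c \<and> a = Ln (valc c) \<and> valc c <= t * \<beta> \<and> t <= valc c * \<beta>}"
 proof (rule fsz_comp_logs)
  fix \<rho> assume "\<rho> \<in> Bd"
  show "fsz (le \<nu>) (Hset k) {a. \<exists>f\<in>SK. f <= \<rho> \<and> a = Ln f}"
   by (rule fsz_image[OF exact[OF \<open>\<rho> \<in> Bd\<close>], of _ Ln]) (use SK_le_iff \<nu>0 in \<open>auto intro!: le_of_le\<close>)
 qed (use fsz_ratio_factor[OF good t _ _ _ \<nu>0 \<nu>B \<beta>] \<beta> \<nu>0 in \<open>auto simp: le_refl le_add zero_in_Hset Hset_add simp del: valf.simps wf_P\<close>)
 then show ?thesis
 proof (rule fsz_rel[where E = "\<lambda>z w. z = Ln w"])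
  fix z z' w w'
  assume w: "w \<in> {a. \<exists>c. wf_comp c \<and> a = valc c \<and> a <= t * \<beta> \<and> t <= a * \<beta>}"
   "w' \<in> {a. \<exists>c. wf_comp c \<and> a = valc c \<and> a <= t * \<beta> \<and> t <= a * \<beta>}"
   and z: "z = Ln w" "z' = Ln w'" "le \<nu> z z'"
  show "le s w w'"
   by (rule le_exp[where \<nu> = \<nu> and c = "t * \<beta>"])
    (use w z \<nu>0 \<nu>1 t0 \<beta> wf_comp_SK in \<open>auto simp: \<nu>_def\<close>)
 qed auto
qed

text \<open>The scales in a bounded ratio to a value \<open>t\<close>. They suffice, by \<open>Good_step\<close>.\<close>

definition Good_at :: "nat => tf => bool" where
 "Good_at k t \<longleftrightarrow> (\<forall>\<beta>\<in>Bd. \<forall>s. 0 < s \<longrightarrow> s <= t \<longrightarrow> t <= s * \<beta> \<longrightarrow> fsz (le s) (Hset k) {f \<in> SK. f <= t * \<beta>})"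

text \<open>The least value \<open>u\<close> below \<open>t\<close> that is not negligible at the scale \<open>s\<close> is in a bounded
 ratio to \<open>s\<close>, so that the hypothesis for \<open>u\<close> applies; what is negligible need not be
 distinguished.\<close>

lemma Good_from_below:
 assumes "!!u. u \<in> SK ==> u < t ==> Good_at k u"
 shows "Good Bd k t"
 unfolding Good_def
proof (intro allI impI ballI)
 fix s \<beta> :: tf assume s: "0 < s" and \<beta>: "\<beta> \<in> Bd"
 define \<gamma> where "\<gamma> = max \<beta> 1"
 have \<gamma>: "\<gamma> \<in> Bd" "1 <= \<gamma>" "\<beta> <= \<gamma>" using \<beta> Bd_one Bd_max by (auto simp: \<gamma>_def)
 let ?Z = "{e \<in> SK. e < t \<and> e <= s * \<beta>}"
 let ?U = "{e \<in> SK. e < t \<and> s <= e \<and> e <= s * \<gamma>}"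
 have low: "fsz (le s) (Hset k) {e \<in> SK. \<forall>n::nat. of_nat n * e <= s}"
 proof (rule fsz_trivial)
  fix p q assume a: "p \<in> {e \<in> SK. \<forall>n::nat. of_nat n * e <= s}" "q \<in> {e \<in> SK. \<forall>n::nat. of_nat n * e <= s}"
  show "le s q p"
   unfolding le_def
  proof
   fix n :: nat
   have "of_nat n * (q - p) <= of_nat n * q" using a SK_qqD(3)[of p] by (intro mult_left_mono) auto
   then show "of_nat n * (q - p) <= s" using a by (auto intro: order_trans)
  qed
 qed (simp add: zero_in_Hset)
 show "fsz (le s) (Hset k) ?Z"
 proof (cases "{e \<in> SK. e < t \<and> e <= s * \<gamma> \<and> (\<exists>n::nat. s < of_nat n * e)} = {}")
  case True
  have "?Z \<subseteq> {e \<in> SK. \<forall>n::nat. of_nat n * e <= s}"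
  proof safe
   fix e and n :: nat assume e: "e \<in> SK" "e < t" "e <= s * \<beta>"
   have "s * \<beta> <= s * \<gamma>" using \<gamma> s by simp
   then have "\<not> s < of_nat n * e" using True e by (auto intro: order_trans)
   then show "of_nat n * e <= s" by simp
  qed
  then show ?thesis by (rule fsz_subset[OF low])
 next
  case False
  then obtain u where u: "u \<in> {e \<in> SK. e < t \<and> e <= s * \<gamma> \<and> (\<exists>n::nat. s < of_nat n * e)}"
   "!!e. e \<in> {e \<in> SK. e < t \<and> e <= s * \<gamma> \<and> (\<exists>n::nat. s < of_nat n * e)} ==> u <= e"
   by (rule SK_least[rotated]) auto
  then obtain n :: nat where n: "u \<in> SK" "u < t" "u <= s * \<gamma>" "s < of_nat n * u" by auto
  have u0: "0 < u" using n SK_qqD by blast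
  define s' where "s' = min s u"
  have s': "0 < s'" "s' <= u" "s' <= s" using s u0 by (auto simp: s'_def)
  have "u <= s' * \<gamma>" using n(3) \<gamma>(2) u0 by (auto simp: s'_def min_def mult_le_cancel_left1)
  have "of_nat n * \<gamma> \<in> Bd" using Bd_of_nat \<gamma> by (intro Bd_mult) auto
  then have \<delta>B: "\<gamma> + of_nat n * \<gamma> \<in> Bd" using \<gamma>(1) by (intro Bd_add)
  have "u <= s' * (\<gamma> + of_nat n * \<gamma>)" using \<open>u <= s' * \<gamma>\<close> s' \<gamma>(2) by (simp add: distrib_left add_increasing2)
  then have "fsz (le s') (Hset k) {f \<in> SK. f <= u * (\<gamma> + of_nat n * \<gamma>)}"
   using assms[OF n(1,2)] \<delta>B s' unfolding Good_at_def by blast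
  then have hi: "fsz (le s) (Hset k) {f \<in> SK. f <= u * (\<gamma> + of_nat n * \<gamma>)}"
   by (rule fsz_order_mono) (use s' s in \<open>auto intro: le_mono\<close>)
  have "?Z \<subseteq> {e \<in> SK. \<forall>n::nat. of_nat n * e <= s} \<union> {f \<in> SK. f <= u * (\<gamma> + of_nat n * \<gamma>)}"
  proof
   fix e assume e: "e \<in> ?Z"
   have "s * \<beta> <= s * \<gamma>" using \<gamma> s by simp
   have "e <= s * \<gamma>" using e \<open>s * \<beta> <= s * \<gamma>\<close> by auto
   also have "\<dots> <= (of_nat n * u) * \<gamma>" using n \<gamma> by (intro mult_right_mono) auto
   also have "\<dots> <= u * (\<gamma> + of_nat n * \<gamma>)" using u0 \<gamma> by (simp add: algebra_simps)
   finally show "e \<in> {e \<in> SK. \<forall>n::nat. of_nat n * e <= s} \<union> {f \<in> SK. f <= u * (\<gamma> + of_nat n * \<gamma>)}" using e by auto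
  qed
  then show ?thesis by (rule fsz_subset[OF fsz_Un[OF low hi]])
 qed
qed

lemma Good_step:
 assumes "!!t. t \<in> SK ==> Good Bd k t ==> Good_at k t"
 shows "Good Bd k t"
proof -
 have "Good_at k u" if "u \<in> SK" for u
  using that
 proof (induct rule: SK_less_induct)
  case (less u)
  then show ?case using assms Good_from_below by blast
 qed
 then show ?thesis using Good_from_below by blast
qed

end

section \<open>Sums of components\<close>

lemma fsz_bounded_fold:
 fixes f :: "'a => 'a => 'a"
 assumes "fsz R U C" "0 \<in> U" "!!u v. u \<in> U ==> v \<in> U ==> u + v \<in> U"
  and D: "u \<in> D" "C \<subseteq> D" "!!a b. a \<in> D ==> b \<in> D ==> f a b \<in> D" "R u u"
  and R: "!!a a' b b'. a \<in> D ==> a' \<in> D ==> b \<in> D ==> b' \<in> D ==> R a a' ==> R b b' ==> R (f a b) (f a' b')"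
 shows "fsz R U {a. \<exists>xs. set xs \<subseteq> C \<and> length xs <= K \<and> a = foldr f xs u}"
proof (induct K)
 case 0
 show ?case by (rule fsz_subset[OF fsz_finite[of "{u}"]]) (use assms in auto)
next
 case (Suc K)
 have fD: "foldr f xs u \<in> D" if "set xs \<subseteq> C" for xs
  using that by (induct xs) (use D in auto)
 let ?F = "\<lambda>K. {a. \<exists>xs. set xs \<subseteq> C \<and> length xs <= K \<and> a = foldr f xs u}"
 have "fsz R U {a. \<exists>x\<in>C. \<exists>y\<in>?F K. a = f x y}"
 proof (rule fsz_image2[where f = f, OF assms(1) Suc assms(3)])
  fix a a' b b' assume a: "a \<in> C" "a' \<in> C" "b \<in> ?F K" "b' \<in> ?F K" "R a a'" "R b b'"
  then have "a \<in> D" "a' \<in> D" "b \<in> D" "b' \<in> D" using D(2) fD by auto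
  then show "R (f a b) (f a' b')" using R a(5,6) by blast
 qed auto
 moreover have "fsz R U {u}" by (rule fsz_finite) (use assms in auto)
 ultimately have "fsz R U ({a. \<exists>x\<in>C. \<exists>y\<in>?F K. a = f x y} \<union> {u})" by (rule fsz_Un)
 then show ?case
 proof (rule fsz_subset, safe)
  fix xs assume xs: "set xs \<subseteq> C" "length xs <= Suc K" "foldr f xs u \<noteq> u"
  then obtain y ys where "xs = y # ys" by (cases xs) auto
  then show "\<exists>x\<in>C. \<exists>z\<in>?F K. foldr f xs u = f x z" using xs by auto
 qed
qed

definition sumset :: "tf set => tf set" where "sumset C = {a. \<exists>xs. set xs \<subseteq> C \<and> a = sum_list xs}"

lemma sum_list_partition: "sum_list xs = sum_list (filter Q xs) + sum_list (filter (\<lambda>x. \<not> Q x) xs)" for xs :: "tf list"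
 by (induct xs) (auto simp: add_ac)

lemma sum_list_ge: "(!!x. x \<in> set xs ==> c <= x) ==> of_nat (length xs) * c <= sum_list xs" for c :: tf
 by (induct xs) (auto simp: algebra_simps intro: add_mono)

lemma sum_list_le: "(!!x. x \<in> set xs ==> x <= c) ==> sum_list xs <= of_nat (length xs) * c" for c :: tf
 by (induct xs) (auto simp: algebra_simps intro: add_mono)

lemma fsz_sums_Union:
 assumes "finite \<Z>" "0 < s" "0 \<in> U" "!!u v. u \<in> U ==> v \<in> U ==> u + v \<in> U"
  "!!Z. Z \<in> \<Z> ==> fsz (le s) U (sumset Z)"
 shows "fsz (le s) U (sumset (\<Union>\<Z>))"
 using assms(1,5)
proof (induct \<Z>)
 case empty
 show ?case by (rule fsz_subset[OF fsz_finite[of "{0}"]]) (use assms in \<open>auto simp: sumset_def le_refl\<close>)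
next
 case (insert Z \<Z>)
 show ?case
 proof (rule fsz_image2[where f = "(+)", of "le s" U "sumset Z" "le s" U "sumset (\<Union>\<Z>)"])
  fix a assume "a \<in> sumset (\<Union>(insert Z \<Z>))"
  then obtain xs where xs: "set xs \<subseteq> \<Union>(insert Z \<Z>)" "a = sum_list xs" unfolding sumset_def by blast
  have "sum_list (filter (\<lambda>x. x \<in> Z) xs) \<in> sumset Z" "sum_list (filter (\<lambda>x. x \<notin> Z) xs) \<in> sumset (\<Union>\<Z>)"
   unfolding sumset_def using xs(1)
   by (intro CollectI exI[of _ "filter (\<lambda>x. x \<in> Z) xs"] exI[of _ "filter (\<lambda>x. x \<notin> Z) xs"]; auto)+
  then show "\<exists>x\<in>sumset Z. \<exists>y\<in>sumset (\<Union>\<Z>). a = x + y" using sum_list_partition xs(2) by blast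
 qed (use insert assms le_add in auto)
qed

lemma arch_refl: "a \<in> SK ==> arch a a" unfolding arch_def by (intro exI[of _ 1]) simp

lemma arch_trans: "arch a b ==> arch b c ==> arch a c"
proof -
 assume "arch a b" "arch b c"
 then obtain m n :: nat where mn: "a <= of_nat m * b" "b <= of_nat n * c" unfolding arch_def by blast
 have "a <= of_nat m * (of_nat n * c)" using mn mult_left_mono[OF mn(2), of "of_nat m"] by simp
 then have "a <= of_nat (m * n) * c" by (simp add: mult_ac)
 then show ?thesis unfolding arch_def by blast
qed

lemma arch_of_le: "a <= b ==> arch a b" unfolding arch_def by (intro exI[of _ 1]) simp

lemma arch_mult: "a \<in> SK ==> a' \<in> SK ==> b \<in> SK ==> b' \<in> SK ==> arch a a' ==> arch b b' ==> arch (a * b) (a' * b')"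
proof -
 assume S: "a \<in> SK" "a' \<in> SK" "b \<in> SK" "b' \<in> SK" and "arch a a'" "arch b b'"
 then obtain m n :: nat where mn: "a <= of_nat m * a'" "b <= of_nat n * b'" unfolding arch_def by blast
 have "0 <= a'" "0 <= b" using S SK_qqD(3) by (auto intro: less_imp_le)
 then have "a * b <= (of_nat m * a') * (of_nat n * b')" using mn by (intro mult_mono) auto
 also have "\<dots> = of_nat (m * n) * (a' * b')" by (simp add: mult_ac)
 finally show ?thesis unfolding arch_def by blast
qed

text \<open>Sums of arbitrary length cost one exponential over the exponent of the classes of the
 summands: below a given sum, only boundedly many summands are of the size of its largest
 summand or larger, and the others are in smaller classes, to which the induction applies.\<close>

lemma sz_sums:
 assumes "sz arch C \<gamma>" "C \<subseteq> SK" "fsz (le s) {..<om \<zeta>} C" "0 < s"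
 shows "sz (le s) (sumset C) (om (\<zeta> + \<gamma>))"
proof -
 have "\<forall>C'\<subseteq>C. C' \<subseteq> SK \<longrightarrow> fsz (le s) {..<om \<zeta>} C' \<longrightarrow> sz (le s) (sumset C') (om (\<zeta> + \<gamma>))"
  using assms(1)
 proof (induct rule: sz_induct)
  case (step Z \<gamma>)
  show ?case
  proof (intro allI impI)
   fix C assume C: "C \<subseteq> Z" "C \<subseteq> SK" "fsz (le s) {..<om \<zeta>} C"
   let ?U = "{..<om (\<zeta> + \<gamma>)}"
   have U: "0 \<in> ?U" "!!u v. u \<in> ?U ==> v \<in> ?U ==> u + v \<in> ?U" using add_less_om by auto
   show "sz (le s) (sumset C) (om (\<zeta> + \<gamma>))"
    unfolding sz_iff
   proof
    fix q assume "q \<in> sumset C"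
    then obtain qs where qs: "set qs \<subseteq> C" "q = sum_list qs" unfolding sumset_def by blast
    have nonneg: "0 <= sum_list xs" if "set xs \<subseteq> C" for xs
     using that C(2) SK_qqD(3) by (intro sum_list_nonneg) (auto intro: less_imp_le)
    have sub: "{p \<in> sumset C. \<not> le s q p} \<subseteq> {p \<in> sumset C. p < q}"
     using le_of_le[of s q] assms(4) by (auto simp: not_le[symmetric])
    show "fsz (le s) ?U {p \<in> sumset C. \<not> le s q p}"
    proof (cases "qs = []")
     case True
     then have "{p \<in> sumset C. p < q} = {}" using qs nonneg by (auto simp: sumset_def not_less)
     then have "{p \<in> sumset C. \<not> le s q p} = {}" using sub by blast
     then show ?thesis by (simp only: fsz_empty)
    next
     case False
     define q0 where "q0 = Max (set qs)"
     have q0: "q0 \<in> C" "!!x. x \<in> set qs ==> x <= q0" using False qs(1) Max_in[of "set qs"] by (auto simp: q0_def)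
     obtain q1 where q1: "q1 \<in> {c \<in> C. arch q0 c}" "!!c. c \<in> {c \<in> C. arch q0 c} ==> q1 <= c"
      by (rule SK_least[of "{c \<in> C. arch q0 c}"]) (use C(2) q0(1) arch_refl in auto)
     obtain n :: nat where n: "q0 <= of_nat n * q1" using q1(1) unfolding arch_def by blast
     have q1p: "0 < q1" using q1(1) C(2) SK_qqD(3) by blast
     define K where "K = length qs * n"
     have qK: "q <= of_nat K * q1"
     proof -
      have "q <= of_nat (length qs) * q0" unfolding qs(2) by (rule sum_list_le) (rule q0(2))
      also have "\<dots> <= of_nat (length qs) * (of_nat n * q1)" using n by (intro mult_left_mono) auto
      finally show ?thesis by (simp add: K_def mult_ac)
     qed
     obtain \<Z> where \<Z>: "finite \<Z>" "{p \<in> Z. \<not> arch q0 p} \<subseteq> \<Union>\<Z>"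
      "\<forall>Z'\<in>\<Z>. \<exists>\<mu>'. \<mu>' < \<gamma> \<and> (\<forall>C'\<subseteq>Z'. C' \<subseteq> SK \<longrightarrow> fsz (le s) {..<om \<zeta>} C' \<longrightarrow> sz (le s) (sumset C') (om (\<zeta> + \<mu>')))"
      using step(2)[of q0] q0(1) C(1) by blast
     have small: "fsz (le s) ?U (sumset (\<Union>((\<lambda>Z'. Z' \<inter> C) ` \<Z>)))"
     proof (rule fsz_sums_Union[OF _ assms(4) U])
      fix Y assume "Y \<in> (\<lambda>Z'. Z' \<inter> C) ` \<Z>"
      then obtain Z' where Z': "Z' \<in> \<Z>" "Y = Z' \<inter> C" by blast
      then obtain \<mu>' where \<mu>': "\<mu>' < \<gamma>" "\<forall>C'\<subseteq>Z'. C' \<subseteq> SK \<longrightarrow> fsz (le s) {..<om \<zeta>} C' \<longrightarrow> sz (le s) (sumset C') (om (\<zeta> + \<mu>'))"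
       using \<Z>(3) by blast
      have "sz (le s) (sumset Y) (om (\<zeta> + \<mu>'))"
       using \<mu>'(2)[rule_format, of Y] C(2) fsz_subset[OF C(3), of Y] Z'(2) by auto
      then show "fsz (le s) ?U (sumset Y)" by (rule fszI) (use \<mu>'(1) add_strict_left_mono in auto)
     qed (use \<Z>(1) in simp)
     have big: "fsz (le s) ?U {a. \<exists>xs. set xs \<subseteq> C \<and> length xs <= K \<and> a = foldr (+) xs 0}"
     proof (rule fsz_bounded_fold[where D = UNIV])
      have "\<zeta> <= \<zeta> + \<gamma>" by (rule hmset_le_add)
      then have "om \<zeta> <= om (\<zeta> + \<gamma>)" by simp
      then show "fsz (le s) ?U C" by (intro fsz_mono[OF C(3)]) (auto intro: less_le_trans)
     qed (use U le_add le_refl assms(4) in auto)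
     have "fsz (le s) ?U {p \<in> sumset C. p < q}"
     proof (rule fsz_image2[where f = "(+)", OF small big U(2)])
      fix p assume "p \<in> {p \<in> sumset C. p < q}"
      then obtain ps where ps: "set ps \<subseteq> C" "p = sum_list ps" "p < q" unfolding sumset_def by blast
      let ?B = "filter (arch q0) ps" and ?S = "filter (\<lambda>c. \<not> arch q0 c) ps"
      have "set ?S \<subseteq> \<Union>((\<lambda>Z'. Z' \<inter> C) ` \<Z>)" using ps(1) \<Z>(2) C(1) by fastforce
      then have 1: "sum_list ?S \<in> sumset (\<Union>((\<lambda>Z'. Z' \<inter> C) ` \<Z>))" unfolding sumset_def by blast
      have "of_nat (length ?B) * q1 <= sum_list ?B" by (rule sum_list_ge) (use q1(2) ps(1) in auto)
      also have "\<dots> <= p"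
       using sum_list_partition[of ps "arch q0"] nonneg[of ?S] ps(1,2) by auto
      also have "\<dots> <= of_nat K * q1" using ps(3) qK by simp
      finally have "length ?B <= K" using q1p by (simp add: mult_le_cancel_right_pos)
      then have 2: "sum_list ?B \<in> {a. \<exists>xs. set xs \<subseteq> C \<and> length xs <= K \<and> a = foldr (+) xs 0}"
       using ps(1) by (auto simp: sum_list.eq_foldr intro!: exI[of _ ?B])
      show "\<exists>x\<in>sumset (\<Union>((\<lambda>Z'. Z' \<inter> C) ` \<Z>)). \<exists>y\<in>{a. \<exists>xs. set xs \<subseteq> C \<and> length xs <= K \<and> a = foldr (+) xs 0}. p = x + y"
       using 1 2 sum_list_partition[of ps "\<lambda>c. \<not> arch q0 c"] ps(2) by auto
     qed (use le_add in auto)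
     then show ?thesis by (rule fsz_subset[OF _ sub])
    qed
   qed
  qed
 qed
 then show ?thesis using assms(2,3) by blast
qed

definition comps :: "tf => tf => tf set" where
 "comps s d = {a. \<exists>c. wf_comp c \<and> a = valc c \<and> a <= d \<and> (\<exists>n::nat. s < of_nat n * a)}"

lemma comps_SK: "comps s d \<subseteq> SK" unfolding comps_def using wf_comp_SK by blast

lemma comps_lower: "\<exists>n::nat. \<forall>a\<in>comps s d. s < of_nat n * a"
proof (cases "comps s d = {}")
 case False
 then obtain a0 where a0: "a0 \<in> comps s d" "!!a. a \<in> comps s d ==> a0 <= a"
  by (rule SK_least[OF comps_SK]) auto
 obtain n :: nat where "s < of_nat n * a0" using a0(1) unfolding comps_def by blast
 then have "s < of_nat n * a" if "a \<in> comps s d" for a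
  using mult_left_mono[OF a0(2)[OF that], of "of_nat n"] by simp
 then show ?thesis by blast
qed simp

text \<open>Up to the precision \<open>s\<close>, a value is the sum of its components that are not negligible.\<close>

lemma sum_of_components:
 assumes "f \<in> SK" "f <= d" "0 < s"
 obtains xs where "set xs \<subseteq> comps s d" "sum_list xs <= f" "le s f (sum_list xs)"
proof -
 obtain \<tau> where "wf_sk \<tau>" "val \<tau> = f" using SK_is_val assms(1) by blast
 then obtain cs where cs: "\<forall>c\<in>set cs. wf_comp c" "f = sum_list (map valc cs)"
  by (cases \<tau>) (auto simp: wf_comp_def)
 let ?Q = "\<lambda>a. \<exists>n::nat. s < of_nat n * a"
 let ?xs = "filter ?Q (map valc cs)" and ?ys = "filter (\<lambda>a. \<not> ?Q a) (map valc cs)"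
 have eq: "f = sum_list ?xs + sum_list ?ys" using sum_list_partition[of "map valc cs" ?Q] cs(2) by simp
 have "a <= d" if "a \<in> set (map valc cs)" for a
 proof -
  have "a <= f" unfolding cs(2) using that cs(1) wf_comp_SK SK_qqD(3)
   by (intro member_le_sum_list) (auto intro: less_imp_le)
  then show ?thesis using assms(2) by simp
 qed
 then have "set ?xs \<subseteq> comps s d" using cs(1) unfolding comps_def by auto
 moreover have "0 <= sum_list ?ys" using cs(1) wf_comp_SK SK_qqD(3)
  by (intro sum_list_nonneg) (auto intro: less_imp_le)
 then have "sum_list ?xs <= f" using eq by simp
 moreover have "le s (sum_list ys) 0" if "\<forall>a\<in>set ys. \<not> ?Q a" for ys
  using that
 proof (induct ys)
  case (Cons y ys)
  then have "le s y 0" unfolding le_def by (simp add: not_less)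
  then show ?case using le_add[of s y 0 "sum_list ys" 0] Cons by simp
 qed (use assms(3) in \<open>simp add: le_refl\<close>)
 then have "le s (sum_list ?xs + sum_list ?ys) (sum_list ?xs + 0)" using assms(3) by (intro le_add le_refl) auto
 then have "le s f (sum_list ?xs)" using eq by simp
 ultimately show ?thesis using that by blast
qed

lemma fsz_of_sums:
 assumes "fsz (le s) U Y" "0 < s" "!!f. f \<in> W ==> \<exists>a\<in>Y. a <= f \<and> le s f a"
 shows "fsz (le s) U W"
proof (rule fsz_rel[OF assms(1), where E = "\<lambda>z w. z <= w \<and> le s w z"])
 fix z z' w w' assume "z <= w \<and> le s w z" "z' <= w' \<and> le s w' z'" "le s z z'"
 then show "le s w w'" using le_trans[of s w z z'] le_trans[of s w z' w'] le_of_le[of s z' w'] assms(2) by auto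
qed (use assms(3) in blast)

section \<open>The base of the induction\<close>

definition Fin :: "tf set" where "Fin = {a. \<exists>n::nat. a <= of_nat n}"

interpretation Fin: bset Fin
proof
 show "1 \<in> Fin" unfolding Fin_def by (auto intro: exI[of _ 1])
 fix a b :: tf
 show "b \<in> Fin ==> a <= b ==> a \<in> Fin" unfolding Fin_def by (auto intro: order_trans)
 assume "a \<in> Fin" "b \<in> Fin"
 then obtain m n :: nat where mn: "a <= of_nat m" "b <= of_nat n" unfolding Fin_def by blast
 have "a + b <= of_nat (m + n)" using mn by (simp add: add_mono)
 then show "a + b \<in> Fin" unfolding Fin_def by blast
 assume "0 <= a" "0 <= b"
 then have "a * b <= of_nat (m * n)" using mn by (simp add: mult_mono)
 then show "a * b \<in> Fin" unfolding Fin_def by blast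
qed

lemma finite_Fin: "\<beta> \<in> Fin ==> finite {f \<in> SK. f <= \<beta>}"
proof -
 assume "\<beta> \<in> Fin"
 then obtain n :: nat where n: "\<beta> <= of_nat n" unfolding Fin_def by blast
 have "{f \<in> SK. f <= \<beta>} \<subseteq> of_nat ` {..n}"
 proof safe
  fix f assume f: "f \<in> SK" "f <= \<beta>"
  then have fn: "f <= of_nat n" using n by simp
  from f(1) show "f \<in> of_nat ` {..n}"
  proof (rule SK_cases)
   fix k :: nat assume "f = of_nat k"
   then show ?thesis using fn by auto
  next
   assume "infl f"
   then have "of_nat (Suc n) <= f" unfolding infl_def by blast
   then have "of_nat (Suc n) <= (of_nat n :: tf)" using fn by simp
   then show ?thesis by simp
  qed
 qed
 then show ?thesis by (rule finite_subset) simp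
qed

text \<open>In a range bounded by a finite multiple of the scale there are only finitely many values
 up to infinitesimal differences: a value is the sum of boundedly many components that are not
 negligible.\<close>

theorem Good_Fin: "Good Fin 0 t"
proof (rule Fin.Good_step)
 fix t assume t: "t \<in> SK" and good: "Good Fin 0 t"
 show "Fin.Good_at 0 t"
  unfolding Fin.Good_at_def
 proof (intro ballI allI impI)
  fix \<beta> s assume \<beta>: "\<beta> \<in> Fin" and s: "0 < s" "s <= t" "t <= s * \<beta>"
  obtain N :: nat where N: "\<beta> <= of_nat N" using \<beta> unfolding Fin_def by blast
  have t0: "0 < t" using t SK_qqD by blast
  show "fsz (le s) (Hset 0) {f \<in> SK. f <= t * \<beta>}"
  proof (cases "t \<in> Fin")
   case True
   have "0 < \<beta>" using s t0 by (metis less_le_trans not_less mult_pos_neg zero_less_mult_pos)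
   then have "t * \<beta> \<in> Fin" using Fin.Bd_mult[OF True \<beta>] t0 by simp
   then show ?thesis using s by (intro fsz_finite finite_Fin zero_in_Hset) (auto simp: le_refl)
  next
   case False
   let ?C = "comps s (t * \<beta>)"
   obtain n :: nat where n: "!!a. a \<in> ?C ==> s < of_nat n * a" using comps_lower by blast
   define \<beta>' where "\<beta>' = (of_nat (1 + N + N * n) :: tf)"
   have \<beta>': "\<beta>' \<in> Fin" "1 <= \<beta>'" "\<beta> <= \<beta>'" using Fin.Bd_of_nat[of "1 + N + N * n"] N by (auto simp: \<beta>'_def add_increasing2 add_increasing)
   have "s * \<beta> <= s * of_nat N" using N s by (intro mult_left_mono) auto
   then have ts: "t <= of_nat N * s" using s(3) unfolding mult.commute[of "of_nat N"] by linarith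
   have C: "fsz (le s) (Hset 0) ?C"
   proof (rule fsz_subset[OF Fin.fsz_comps[OF good _ False \<beta>'(1,2) s(1,2)]])
    show "t <= s * \<beta>'" using s \<beta>'(3) by (meson mult_left_mono less_imp_le order_trans)
    show "fsz (<=) (Hset 0) {f \<in> SK. f <= \<beta>}" if "\<beta> \<in> Fin" for \<beta>
     using finite_Fin[OF that] by (intro fsz_finite zero_in_Hset) auto
    show "?C \<subseteq> {a. \<exists>c. wf_comp c \<and> a = valc c \<and> a <= t * \<beta>' \<and> t <= a * \<beta>'}"
    proof safe
     fix a assume a: "a \<in> ?C"
     then obtain c where c: "wf_comp c" "a = valc c" "a <= t * \<beta>" unfolding comps_def by blast
     have "a \<in> SK" using a comps_SK by blast
     then have a0: "0 <= a" using SK_qqD(3)[of a] by simp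
     have "t * \<beta> <= t * \<beta>'" using \<beta>'(3) t0 by simp
     moreover have "t <= a * \<beta>'"
     proof -
      have "t <= of_nat N * (of_nat n * a)" using ts mult_left_mono[OF less_imp_le[OF n[OF a]], of "of_nat N"] by simp
      also have "\<dots> <= a * \<beta>'" using a0 by (simp add: \<beta>'_def algebra_simps)
      finally show ?thesis .
     qed
     ultimately show "\<exists>c. wf_comp c \<and> a = valc c \<and> a <= t * \<beta>' \<and> t <= a * \<beta>'" using c by auto
    qed
   qed
   define K where "K = N * N * n"
   let ?Y = "{a. \<exists>xs. set xs \<subseteq> ?C \<and> length xs <= K \<and> a = foldr (+) xs 0}"
   have "fsz (le s) (Hset 0) ?Y"
    by (rule fsz_bounded_fold[where D = UNIV, OF C]) (use s in \<open>auto intro: zero_in_Hset Hset_add le_add le_refl\<close>)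
   then show ?thesis
   proof (rule fsz_of_sums[OF _ s(1)])
    fix f assume "f \<in> {f \<in> SK. f <= t * \<beta>}"
    then have f: "f \<in> SK" "f <= t * \<beta>" by auto
    obtain xs where xs: "set xs \<subseteq> ?C" "sum_list xs <= f" "le s f (sum_list xs)"
     using sum_of_components[OF f s(1)] .
    have "of_nat (length xs) * s <= of_nat n * sum_list xs"
    proof -
     have "of_nat (length ys) * s <= of_nat n * sum_list ys" if "set ys \<subseteq> ?C" for ys
      using that
     proof (induct ys)
      case (Cons y ys)
      then have "s + of_nat (length ys) * s <= of_nat n * y + of_nat n * sum_list ys"
       using n[of y] by (intro add_mono) auto
      then show ?case by (simp add: distrib_left distrib_right)
     qed simp
     then show ?thesis using xs(1) .
    qed
    also have "\<dots> <= of_nat n * (t * \<beta>)" using xs(2) f(2) by (intro mult_left_mono) auto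
    also have "\<dots> <= of_nat n * (t * of_nat N)" using N t0 by (intro mult_left_mono) auto
    also have "\<dots> <= of_nat n * ((of_nat N * s) * of_nat N)" using ts by (intro mult_left_mono mult_right_mono) auto
    also have "\<dots> = of_nat K * s" by (simp add: K_def)
    finally have "length xs <= K" using s by (simp add: mult_le_cancel_right_pos)
    then have "sum_list xs \<in> ?Y" using xs(1) by (auto simp: sum_list.eq_foldr)
    then show "\<exists>a\<in>?Y. a <= f \<and> le s f a" using xs(2,3) by blast
   qed
  qed
 qed
qed

text \<open>For a lower bound other than zero: the window lies above the values of finitely many of
 its terms.\<close>

lemma fsz_window:
 assumes "0 < s"
 shows "fsz (le s) (Hset 0) {p \<in> SK. p < t \<and> f0 <= p \<and> p <= f0 + of_nat N * s}"
proof -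
 define K where "K = {\<tau>. wf_sk \<tau> \<and> val \<tau> < t \<and> f0 <= val \<tau> \<and> val \<tau> <= f0 + of_nat N * s}"
 obtain B where B: "finite B" "B \<subseteq> K" "!!c. c \<in> K ==> \<exists>b\<in>B. emb b c"
  by (rule wqo_on_finite_basis[OF wqo_on_subset[OF wqo_emb, of K]]) auto
 have "fsz (le s) (Hset 0) (\<Union>\<tau>\<in>B. above \<tau> t (s * of_nat N))"
 proof (rule fsz_UN[OF B(1)])
  fix \<tau> assume "\<tau> \<in> B"
  then have "wf_sk \<tau>" using B(2) unfolding K_def by blast
  then show "fsz (le s) (Hset 0) (above \<tau> t (s * of_nat N))"
   by (rule Fin.fsz_above[OF Good_Fin _ assms Fin.Bd_of_nat])
 qed
 then show ?thesis
 proof (rule fsz_subset, safe)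
  fix p assume p: "p \<in> SK" "p < t" "f0 <= p" "p <= f0 + of_nat N * s"
  obtain \<tau> where \<tau>: "wf_sk \<tau>" "val \<tau> = p" using SK_is_val p(1) by blast
  then have "\<tau> \<in> K" using p unfolding K_def by simp
  then obtain \<sigma> where \<sigma>: "\<sigma> \<in> B" "emb \<sigma> \<tau>" using B(3) by blast
  then have "f0 <= val \<sigma>" using B(2) unfolding K_def by blast
  then have "p - val \<sigma> <= s * of_nat N" using p(4) by (simp add: algebra_simps)
  then have "p \<in> above \<sigma> t (s * of_nat N)" unfolding above_def using \<tau> \<sigma> p(2) by blast
  then show "p \<in> (\<Union>\<tau>\<in>B. above \<tau> t (s * of_nat N))" using \<sigma>(1) by blast
 qed
qed

text \<open>What counts as a bounded ratio at the level \<open>j\<close>.\<close>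

definition O' :: "nat => tf set" where "O' j = {a. \<exists>m\<ge>1. a <= El j m}"

lemma infl_mono: "infl a ==> a <= b ==> infl b" unfolding infl_def by (meson order_trans)

lemma X_pow_infl: "1 <= m ==> infl (X ^ m)"
proof -
 assume "1 <= m"
 have "1 <= X" using SK_qqD(2) SK_X by blast
 then have "X ^ 1 <= X ^ m" using \<open>1 <= m\<close> by (rule power_increasing[rotated])
 then show ?thesis using infl_X infl_mono by simp
qed

lemma El_infl: "1 <= m ==> infl (El j m)"
 using X_pow_infl by (induct j) (auto intro!: pw_infl(3) qq_of_nat[of 2, simplified] SK_qqD(1) El_in_SK)

lemma Ln_El: "1 <= m ==> Ln (El (Suc j) m) = El j m * Ln 2"
 using pw_Ln[OF SK_2 _ El_in_SK El_infl] by simp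

lemma El_ge: "1 <= m ==> of_nat n <= El j m" using El_infl unfolding infl_def by blast

lemma El_add_le: "1 <= m ==> 1 <= n ==> El j m + El j n <= El j m * El j n"
proof -
 assume "1 <= m" "1 <= n"
 then have "2 <= El j m" "2 <= El j n" using El_ge[of _ 2] by auto
 then have "2 * El j n <= El j m * El j n" "El j m * 2 <= El j m * El j n" by (auto intro: mult_right_mono mult_left_mono)
 then show ?thesis by simp
qed

lemma El_mult: "1 <= m ==> 1 <= n ==> \<exists>k\<ge>1. El j m * El j n <= El j k"
proof (induct j arbitrary: m n)
 case 0
 then show ?case by (intro exI[of _ "m + n"]) (simp add: power_add)
next
 case (Suc j)
 then obtain k where k: "k \<ge> 1" "El j m * El j n <= El j k" by blast
 have "Ln (El (Suc j) m * El (Suc j) n) = (El j m + El j n) * Ln 2"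
  by (simp only: Ln_mult[OF El_in_SK El_in_SK] Ln_El[OF Suc(2)] Ln_El[OF Suc(3)] distrib_right)
 also have "\<dots> <= El j k * Ln 2"
  using k(2) El_add_le[OF Suc(2,3), of j] Ln_2(1) by (intro mult_right_mono) linarith+
 also have "\<dots> = Ln (El (Suc j) k)" using Ln_El k(1) by simp
 finally have "El (Suc j) m * El (Suc j) n <= El (Suc j) k" by (subst SK_le_iff) (intro SK_mult El_in_SK)+
 then show ?case using k(1) by blast
qed

lemma bset_O: "bset (O' j)"
proof
 show "1 \<in> O' j" unfolding O'_def using El_ge[of 1 1 j] by auto
 fix a b :: tf
 show "b \<in> O' j ==> a <= b ==> a \<in> O' j" unfolding O'_def by (auto intro: order_trans)
 assume "a \<in> O' j" "b \<in> O' j"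
 then obtain m n where mn: "1 <= m" "a <= El j m" "1 <= n" "b <= El j n" unfolding O'_def by blast
 obtain k where k: "k \<ge> 1" "El j m * El j n <= El j k" using El_mult mn(1,3) by blast
 have "a + b <= El j k" using mn El_add_le[OF mn(1,3), of j] k(2) by linarith
 then show "a + b \<in> O' j" unfolding O'_def using k(1) by blast
 assume "0 <= a" "0 <= b"
 then have "a * b <= El j m * El j n" using mn SK_qqD(3)[OF El_in_SK] by (intro mult_mono) (auto intro: less_imp_le)
 then have "a * b <= El j k" using k(2) by simp
 then show "a * b \<in> O' j" unfolding O'_def using k(1) by blast
qed

text \<open>Let values agree up to differences infinitesimal relative to \<open>s X\<close>. By the gap, all
 differences between them that are not infinitesimal relative to \<open>s\<close> are of one size \<open>u\<close>, and
 within finite multiples of \<open>u\<close> there are finitely many values. So passing from \<open>s X\<close> to \<open>s\<close>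
 costs one factor \<open>\<omega>\<close>.\<close>

lemma sz_gap:
 assumes s: "0 < s" and q: "q \<in> SK"
 shows "sz (le s) {p \<in> SK. p < t \<and> le (s * X) p q \<and> le (s * X) q p} hone"
proof -
 let ?D = "{p \<in> SK. p < t \<and> le (s * X) p q \<and> le (s * X) q p}"
 have X0: "0 < X" using SK_qqD(3) SK_X by blast
 have sX: "0 < s * X" using s X0 by simp
 show ?thesis
 proof (cases "\<forall>p\<in>?D. \<forall>p'\<in>?D. le s p p'")
  case True
  then show ?thesis by (intro sz_trivial) blast
 next
  case False
  then obtain p1 p2 where p: "p1 \<in> ?D" "p2 \<in> ?D" "\<not> le s p1 p2" by blast
  define u where "u = p1 - p2"
  have u0: "0 < u" using p(3) le_of_le[of s p1 p2] s by (auto simp: u_def not_le[symmetric])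
  obtain n0 :: nat where n0: "s < of_nat n0 * u" using p(3) unfolding le_def u_def by (auto simp: not_le)
  have small: "of_nat n * (a - b) <= s * X" if "a \<in> ?D" "b \<in> ?D" for a b and n :: nat
   using le_trans[of "s * X" a q b] that by (auto intro: leD)
  have nxt: "\<not> X * d <= of_nat n * d'" if d: "s < of_nat k * d" and d': "!!n::nat. of_nat n * d' <= s * X" for d d' n k
  proof
   assume a: "X * d <= of_nat n * d'"
   have "s * X < (of_nat k * d) * X" using d X0 by simp
   also have "\<dots> = of_nat k * (X * d)" by simp
   also have "\<dots> <= of_nat k * (of_nat n * d')" using a by (intro mult_left_mono) auto
   also have "\<dots> = of_nat (k * n) * d'" by simp
   also have "\<dots> <= s * X" by (rule d')
   finally show False by simp
  qed
  have gap: "le s a b \<or> (\<exists>n::nat. a - b <= of_nat n * u \<and> u <= of_nat n * (a - b))" if ab: "a \<in> ?D" "b \<in> ?D" for a b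
  proof (cases "le s a b")
   case False
   then obtain k :: nat where k: "s < of_nat k * (a - b)" unfolding le_def by (auto simp: not_le)
   have "0 < a - b" using False le_of_le[of s a b] s by (auto simp: not_le[symmetric])
   moreover have "qq (a - b)" "qq u" unfolding u_def using ab p SK_qqD(1) qq_diff by auto
   moreover have "of_nat n * u <= s * X" for n unfolding u_def using small p by blast
   ultimately show ?thesis
    using qq_gap[of "a - b" u] u0 nxt[OF k, of u] nxt[OF n0, of "a - b"] small[OF ab] by blast
  qed blast
  have "sz (le u) ?D hone"
   unfolding sz_iff
  proof
   fix r assume r: "r \<in> ?D"
   obtain f0 where f0: "f0 \<in> ?D" "!!f. f \<in> ?D ==> f0 <= f" by (rule SK_least[of ?D]) (use r in auto)
   obtain N :: nat where N: "r - f0 <= of_nat N * u"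
   proof -
    have "le s r f0 ==> r - f0 <= of_nat n0 * u" using leD[of s r f0 1] n0 by simp
    then show ?thesis using gap[OF r f0(1)] that by blast
   qed
   have "fsz (le u) {..<hone} {p \<in> SK. p < t \<and> f0 <= p \<and> p <= f0 + of_nat N * u}"
    by (rule fsz_mono[OF fsz_window[OF u0]]) (auto simp: Hset_0 hone_def zero_hmset_def[symmetric])
   then show "fsz (le u) {..<hone} {p \<in> ?D. \<not> le u r p}"
   proof (rule fsz_subset, safe)
    fix f assume f: "f \<in> SK" "f < t" "le (s * X) f q" "le (s * X) q f" and n: "\<not> le u r f"
    show "f0 <= f" by (rule f0(2)) (use f in blast)
    have "f < r" using n le_of_le[of u r f] u0 by (auto simp: not_le[symmetric])
    then show "f <= f0 + of_nat N * u" using N by simp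
   qed
  qed
  then show ?thesis
  proof (rule sz_order_mono)
   fix a b assume ab: "a \<in> ?D" "b \<in> ?D" "le u a b"
   show "le s a b"
   proof (rule ccontr)
    assume "\<not> le s a b"
    then obtain n :: nat where n: "u <= of_nat n * (a - b)" using gap[OF ab(1,2)] by blast
    have "of_nat (2 * n) * (a - b) <= u" using ab(3) by (rule leD)
    then have "2 * (of_nat n * (a - b)) <= u" by (simp add: mult.assoc)
    then show False using n u0 by linarith
   qed
  qed
 qed
qed

text \<open>The scale is refined from \<open>s X\<^sup>m\<close> to \<open>s\<close> in \<open>m\<close> steps.\<close>

lemma Good_0: "Good (O' 0) 1 t"
 unfolding Good_def
proof (intro allI impI ballI)
 fix s \<beta> :: tf assume s: "0 < s" and "\<beta> \<in> O' 0"
 then obtain m where m: "\<beta> <= X ^ m" unfolding O'_def by auto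
 have X0: "0 < X" using SK_qqD(3) SK_X by blast
 have "fsz (le s) (Hset 1) {e \<in> SK. e < t \<and> e <= s * X ^ m}" if "0 < s" for s
  using that
 proof (induct m arbitrary: s)
  case 0
  have "fsz (le s) (Hset 0) {e \<in> SK. e < t \<and> e <= s * 1}"
   using Good_Fin[unfolded Good_def] 0 Fin.Bd_one by blast
  then show ?case using fsz_mono Hset_mono[of 0 1] by fastforce
 next
  case (Suc m)
  have "fsz (le (s * X)) (Hset 1) {e \<in> SK. e < t \<and> e <= (s * X) * X ^ m}" using Suc X0 by simp
  then have "fsz (le s) (Hset 1) {e \<in> SK. e < t \<and> e <= (s * X) * X ^ m}"
  proof (rule fsz_lexicographic)
   fix q assume "q \<in> {e \<in> SK. e < t \<and> e <= (s * X) * X ^ m}"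
   then show "sz (le s) {p \<in> {e \<in> SK. e < t \<and> e <= (s * X) * X ^ m}. le (s * X) p q \<and> le (s * X) q p} hone"
    by (intro sz_subset[OF sz_gap[OF Suc(2), of q t]]) auto
  next
   fix p q assume "\<not> le s q p"
   then have "p <= q" using le_of_le[of s q p] Suc(2) linear[of p q] by auto
   then show "le (s * X) p q" using Suc(2) X0 by (intro le_of_le) auto
  qed (use Suc(2) X0 hone_in_Hset[of 0] in \<open>auto intro!: le_refl Hset_add\<close>)
  then show ?case by (simp add: mult.assoc)
 qed
 then have "fsz (le s) (Hset 1) {e \<in> SK. e < t \<and> e <= s * X ^ m}" using s by blast
 then show "fsz (le s) (Hset 1) {e \<in> SK. e < t \<and> e <= s * \<beta>}"
  by (rule fsz_subset) (use m s in \<open>auto intro: order_trans mult_left_mono\<close>)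
qed

lemma arch_pow:
 assumes "f \<in> SK" "f <= X ^ m"
 shows "\<exists>i\<le>m. arch f (X ^ i) \<and> arch (X ^ i) f"
proof -
 let ?I = "{i. i <= m \<and> arch (X ^ i) f}"
 have "0 \<in> ?I" using SK_qqD(2)[OF assms(1)] by (auto intro: arch_of_le)
 define i where "i = Max ?I"
 have "i \<in> ?I" unfolding i_def using \<open>0 \<in> ?I\<close> by (intro Max_in) auto
 then have i: "i <= m" "arch (X ^ i) f" by auto
 have imax: "k <= i" if "k \<in> ?I" for k unfolding i_def using that by (intro Max_ge) auto
 show ?thesis
 proof (cases "i = m")
  case True
  then show ?thesis using i assms(2) arch_of_le by blast
 next
  case False
  then have "\<not> arch (X ^ Suc i) f" using imax[of "Suc i"] i(1) by auto
  then have no: "\<not> X * X ^ i <= of_nat n * f" for n :: nat unfolding arch_def by auto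
  have p: "0 < f" "0 < X ^ i" "qq f" "qq (X ^ i)" using SK_qqD assms(1) SK_power SK_X by auto
  obtain n0 :: nat where n0: "X ^ i <= of_nat n0 * f" using i(2) unfolding arch_def by blast
  have no2: "\<not> X * f <= of_nat n * X ^ i" for n :: nat
  proof
   assume "X * f <= of_nat n * X ^ i"
   also have "\<dots> <= of_nat n * (of_nat n0 * f)" using n0 by (intro mult_left_mono) auto
   finally have "X * f <= of_nat (n * n0) * f" by (simp add: mult_ac)
   then have "X <= of_nat (n * n0)" using p(1) by (simp only: mult_le_cancel_right_pos)
   moreover have "of_nat (Suc (n * n0)) <= X" using infl_X unfolding infl_def by blast
   ultimately have "of_nat (Suc (n * n0)) <= (of_nat (n * n0) :: tf)" by (rule order_trans[rotated])
   then show False by (simp only: of_nat_le_iff)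
  qed
  show ?thesis using qq_gap[OF p(3,1,4,2)] no no2 i unfolding arch_def by blast
 qed
qed

text \<open>Again by the gap, the powers of the identity represent all sizes.\<close>

lemma classes_0: "fsz arch (Hset 0) {f \<in> SK. f <= X ^ m}"
proof -
 have "fsz arch (Hset 0) (\<Union>i\<in>{..m}. {f \<in> SK. arch f (X ^ i) \<and> arch (X ^ i) f})"
  by (rule fsz_UN, simp, rule fsz_trivial[OF _ zero_in_Hset]) (auto intro: arch_trans)
 then show ?thesis by (rule fsz_subset) (use arch_pow in fastforce)
qed

section \<open>Logarithmic classes\<close>

lemma arch_mult_left: "arch a b ==> 0 <= c ==> arch (c * a) (c * b)"
proof -
 assume "arch a b" "0 <= c"
 then obtain n :: nat where "a <= of_nat n * b" unfolding arch_def by blast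
 then have "c * a <= c * (of_nat n * b)" using \<open>0 <= c\<close> by (rule mult_left_mono)
 then have "c * a <= of_nat n * (c * b)" by (simp add: mult.left_commute)
 then show ?thesis unfolding arch_def by blast
qed

lemma arch_of_Ln:
 assumes "a \<in> SK" "b \<in> SK" "Ln a - Ln b <= of_nat n"
 shows "arch a b"
 using le_of_Ln_diff_nat[OF SK_qqD(4)[OF assms(1)] SK_qqD(4)[OF assms(2)] assms(3)] unfolding arch_def by blast

lemma Ln_of_arch:
 assumes "a \<in> SK" "b \<in> SK" "arch a b"
 shows "\<exists>n::nat. Ln a - Ln b <= of_nat n"
proof -
 obtain n :: nat where n: "a <= of_nat n * b" using assms(3) unfolding arch_def by blast
 have b: "0 < b" using assms SK_qqD by blast
 have "Ln a - Ln b <= (a - b) / b" using assms SK_qqD(4) by (intro Ln_diff_le)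
 also have "\<dots> <= of_nat n" using n b by (simp add: field_simps)
 finally show ?thesis by blast
qed

lemma largest_comp:
 assumes "wf_sk (S cs)"
 obtains c where "c \<in> set cs" "wf_comp c" "valc c <= val (S cs)" "arch (val (S cs)) (valc c)"
proof -
 have cs: "cs \<noteq> []" "\<forall>c\<in>set cs. wf_comp c" using assms unfolding wf_S_comp by auto
 have "Max (valc ` set cs) \<in> valc ` set cs" using cs(1) by (intro Max_in) auto
 then obtain c where c: "c \<in> set cs" "valc c = Max (valc ` set cs)" by auto
 have "sum_list (map valc cs) <= of_nat (length (map valc cs)) * valc c"
  by (rule sum_list_le) (use c(2) in auto)
 then have "arch (val (S cs)) (valc c)" unfolding arch_def by auto
 then show ?thesis using that[OF c(1)] cs(2) c(1) comp_le[OF c(1) cs(2)] by blast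
qed

lemma SK_largest_comp:
 assumes "f \<in> SK"
 obtains c where "wf_comp c" "valc c <= f" "arch f (valc c)"
proof -
 obtain \<tau> where "wf_sk \<tau>" "val \<tau> = f" using SK_is_val assms by blast
 moreover obtain cs where "\<tau> = S cs" by (cases \<tau>)
 ultimately show ?thesis using largest_comp[of cs] that by metis
qed

lemma Ln_valc: "wf_comp c ==> Ln (valc c) = sum_list (map (\<lambda>f. Ln (valf f)) c)"
 by (induct c) (auto simp: Ln_mult wf_SK(2) wf_comp_SK)

lemma Ln_SK_pos: "infl a ==> a \<in> SK ==> infl (Ln a)"
 using infl_Ln(2) SK_qqD(4) by blast

lemma infl_pos: "infl a ==> of_nat n < a" "infl a ==> 0 < a"
proof -
 show "of_nat n < a" if "infl a" for n
 proof -
  have "of_nat (Suc n) <= a" using that unfolding infl_def by blast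
  moreover have "of_nat n < (of_nat (Suc n) :: tf)" by simp
  ultimately show ?thesis by (rule less_le_trans[rotated])
 qed
 from this[of 0] show "infl a ==> 0 < a" by simp
qed

definition sim :: "tf => tf => bool" where "sim a b \<longleftrightarrow> arch a b \<and> arch b a"

lemma sim_trans: "sim a b ==> sim b c ==> sim a c" unfolding sim_def using arch_trans by blast

lemma sim_mult_left: "sim a b ==> 0 <= c ==> sim (c * a) (c * b)" unfolding sim_def using arch_mult_left by blast

text \<open>Up to a constant factor the logarithm of a value is a value or a value times the logarithm
 of the identity: it is of the size of the logarithm of a largest factor, \<open>e\<close> times the
 logarithm of the base, to which the statement applies again.\<close>

lemma log_class:
 assumes "wf_sk \<tau>" "2 <= val \<tau>"
 shows "\<exists>e\<in>SK. sim (Ln (val \<tau>)) e \<or> sim (Ln (val \<tau>)) (e * Ln X)"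
 using assms
proof (induct \<tau> rule: measure_induct_rule[where f = size])
 case (less \<tau>)
 let ?f = "val \<tau>"
 have fS: "?f \<in> SK" using wf_SK less(2) by blast
 show ?case
 proof (rule SK_cases[OF fS])
  fix k :: nat assume k: "?f = of_nat k"
  have "Ln ?f <= of_nat k * 1" using Ln_le[OF fS] k by simp
  moreover have "1 <= of_nat 2 * Ln ?f" using Ln_ge_half[OF fS less(3)] by simp
  ultimately have "sim (Ln ?f) 1" unfolding sim_def arch_def by blast
  then show ?thesis using SK_one by blast
 next
  assume inf: "infl ?f"
  obtain cs where \<tau>: "\<tau> = S cs" by (cases \<tau>)
  obtain c where c: "c \<in> set cs" "wf_comp c" "valc c <= ?f" "arch ?f (valc c)"
   using largest_comp less(2) unfolding \<tau> by blast
  have cS: "valc c \<in> SK" using wf_comp_SK c(2) by blast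
  obtain n :: nat where n: "Ln ?f - Ln (valc c) <= of_nat n" using Ln_of_arch[OF fS cS c(4)] by blast
  have iLf: "infl (Ln ?f)" by (rule Ln_SK_pos[OF inf fS])
  have Lc: "1 <= Ln (valc c)"
  proof -
   have "of_nat (n + 1) <= Ln ?f" using iLf unfolding infl_def by blast
   then show ?thesis using n by simp
  qed
  have "Ln ?f <= of_nat (n + 1) * Ln (valc c)"
  proof -
   have "of_nat n * 1 <= of_nat n * Ln (valc c)" using Lc by (intro mult_left_mono) auto
   then show ?thesis using n by (simp add: distrib_right)
  qed
  moreover have "Ln (valc c) <= Ln ?f" using SK_le_iff[OF cS fS] c(3) by simp
  ultimately have s1: "sim (Ln ?f) (Ln (valc c))" unfolding sim_def using arch_of_le arch_def by blast
  have ne: "c \<noteq> []" using Lc by auto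
  let ?L = "map (\<lambda>f. Ln (valf f)) c"
  have "Max (set ?L) \<in> set ?L" using ne by (intro Max_in) auto
  then obtain g where g: "g \<in> set c" "Ln (valf g) = Max (set ?L)" by auto
  have wg: "wf_fac g" using g c(2) unfolding wf_comp_def by blast
  have gS: "valf g \<in> SK" using wf_SK(2)[OF wg] by blast
  have "sum_list ?L <= of_nat (length ?L) * Ln (valf g)" by (rule sum_list_le) (use g(2) in auto)
  then have "arch (Ln (valc c)) (Ln (valf g))" unfolding arch_def Ln_valc[OF c(2)] by blast
  moreover have "Ln (valf g) <= Ln (valc c)" using factor_le_comp[OF g(1) c(2)] SK_le_iff[OF gS cS] by simp
  ultimately have s2: "sim (Ln ?f) (Ln (valf g))" using s1 sim_trans arch_of_le unfolding sim_def by blast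
  show ?thesis
  proof (cases g)
   case V
   then show ?thesis using s2 SK_one by (intro bexI[of _ 1]) auto
  next
   case (P b e)
   have be: "wf_sk b" "val b \<in> SK" "2 <= val b" "val e \<in> SK" "infl (val e)" using wg P wf_SK(1) by auto
   have "child b \<tau>" unfolding child_def \<tau> using c(1) g(1) P by blast
   then obtain e1 where e1: "e1 \<in> SK" "sim (Ln (val b)) e1 \<or> sim (Ln (val b)) (e1 * Ln X)"
    using less(1)[OF size_child be(1,3)] by blast
   have L: "Ln (valf g) = val e * Ln (val b)" using pw_Ln be P by simp
   have "0 <= val e" using be SK_qqD(3) by (auto intro: less_imp_le)
   then have "sim (Ln ?f) (val e * e1) \<or> sim (Ln ?f) (val e * e1 * Ln X)"
    using e1(2) s2 sim_mult_left sim_trans unfolding L by (metis mult.assoc)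
   then show ?thesis using SK_mult be(4) e1(1) by blast
  qed
 qed
qed

definition larch :: "tf => tf => bool" where "larch f g \<longleftrightarrow> arch (Ln f) (Ln g)"

text \<open>Bases that agree in this sense give powers of the same size for exponents up to \<open>\<theta>\<close>, see
 \<open>pw_arch\<close>.\<close>

definition fine :: "tf => tf => tf => bool" where
 "fine \<theta> p q \<longleftrightarrow> (\<exists>N::nat. \<theta> * (Ln p - Ln q) <= of_nat N)"

lemma fine_of_le: "0 <= \<theta> ==> p \<in> SK ==> q \<in> SK ==> p <= q ==> fine \<theta> p q"
proof -
 assume "0 <= \<theta>" "p \<in> SK" "q \<in> SK" "p <= q"
 then have "\<theta> * (Ln p - Ln q) <= 0" using SK_le_iff by (intro mult_nonneg_nonpos) auto
 then have "\<theta> * (Ln p - Ln q) <= of_nat 0" by simp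
 then show ?thesis unfolding fine_def by blast
qed

lemma pw_arch:
 assumes b: "b \<in> SK" "2 <= b" "b' \<in> SK" "2 <= b'" and e: "e \<in> SK" "infl e" "e' \<in> SK" "infl e'"
  and le: "e <= e'" "e <= \<theta>" "fine \<theta> b b'"
 shows "arch (pw b e) (pw b' e')"
proof -
 obtain N :: nat where N: "\<theta> * (Ln b - Ln b') <= of_nat N" using le(3) unfolding fine_def by blast
 have "e * Ln b - e' * Ln b' <= e * (Ln b - Ln b')"
  using le(1) Ln_nonneg[OF b(3)] by (simp add: algebra_simps mult_right_mono)
 also have "\<dots> <= of_nat N"
 proof (cases "Ln b <= Ln b'")
  case True
  then have "e * (Ln b - Ln b') <= 0" using SK_qqD(3)[OF e(1)] by (intro mult_nonneg_nonpos) auto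
  then show ?thesis by (rule order_trans) simp
 next
  case False
  then have "e * (Ln b - Ln b') <= \<theta> * (Ln b - Ln b')" using le(2) by (intro mult_right_mono) auto
  then show ?thesis using N by simp
 qed
 finally have "Ln (pw b e) - Ln (pw b' e') <= of_nat N" using pw_Ln b e by simp
 then show ?thesis using arch_of_Ln SK_pw b e by blast
qed

section \<open>From one level of exponentials to the next\<close>

lemma GoodD: "Good Bd k t ==> 0 < s ==> \<beta> \<in> Bd ==> fsz (le s) (Hset k) {e \<in> SK. e < t \<and> e <= s * \<beta>}"
 unfolding Good_def by blast

text \<open>The induction hypotheses: values up to a precision at all scales, and sizes of values.\<close>

locale level =
 fixes j :: nat
 assumes good: "Good (O' j) (2 * j + 1) t"
  and classes: "1 <= m ==> fsz arch (Hset (2 * j)) {f \<in> SK. f <= El j m}"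
begin

sublocale lo: bset "O' j" by (rule bset_O)
sublocale hi: bset "O' (Suc j)" by (rule bset_O)

lemma exact:
 assumes "\<beta> \<in> O' j"
 shows "fsz (<=) (Hset (2 * j + 1)) {f \<in> SK. f <= \<beta>}"
proof -
 have "fsz (le 1) (Hset (2 * j + 1)) {e \<in> SK. e < \<beta> + 1 \<and> e <= 1 * \<beta>}"
  by (rule GoodD[OF good]) (use assms in auto)
 then have "fsz (<=) (Hset (2 * j + 1)) {e \<in> SK. e < \<beta> + 1 \<and> e <= 1 * \<beta>}"
  by (rule fsz_order_mono) (use le_SK in auto)
 then show ?thesis by (rule fsz_subset) (auto intro: le_less_trans)
qed

text \<open>Within one size, \<open>fine \<theta>\<close> distinguishes values only at a scale of a bounded ratio to them.
 So the refinement costs an exponent that \<open>Good\<close> provides.\<close>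

lemma refine:
 assumes D: "D \<subseteq> SK" "fsz arch U D" and \<theta>: "\<theta> \<in> O' j" "1 <= \<theta>" and W: "!!u. u \<in> U ==> Om (2 * j + 1) + u \<in> W"
 shows "fsz (fine \<theta>) W D"
proof (rule fsz_lexicographic[OF D(2) _ _ _ W])
 fix q assume q: "q \<in> D"
 let ?K = "{p \<in> D. arch p q \<and> arch q p}"
 show "sz (fine \<theta>) ?K (Om (2 * j + 1))"
  unfolding sz_iff
 proof
  fix r assume r: "r \<in> ?K"
  have r0: "0 < r" "r \<in> SK" using r D(1) SK_qqD by auto
  have "fsz (le (r / \<theta>)) (Hset (2 * j + 1)) {e \<in> SK. e < r \<and> e <= r / \<theta> * \<theta>}"
   by (rule GoodD[OF good]) (use \<theta> r0(1) in auto)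
  then have "fsz (le (r / \<theta>)) (Hset (2 * j + 1)) {p \<in> ?K. \<not> fine \<theta> r p}"
  proof (rule fsz_subset, safe)
   fix p assume p: "p \<in> D" "\<not> fine \<theta> r p"
   show "p \<in> SK" using p(1) D(1) by blast
   then show "p < r" using fine_of_le[of \<theta> r p] p(2) \<theta> r0(2) by (auto simp: not_le[symmetric])
   then show "p <= r / \<theta> * \<theta>" using \<theta> by simp
  qed
  then have "fsz (fine \<theta>) (Hset (2 * j + 1)) {p \<in> ?K. \<not> fine \<theta> r p}"
  proof (rule fsz_order_mono)
   fix p p' assume p: "p \<in> {p \<in> ?K. \<not> fine \<theta> r p}" "p' \<in> {p \<in> ?K. \<not> fine \<theta> r p}" "le (r / \<theta>) p p'"
   have S: "p \<in> SK" "p' \<in> SK" "0 < p'" using p D(1) SK_qqD by auto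
   have "arch r p'" using r p arch_trans by blast
   then obtain n :: nat where n: "r <= of_nat n * p'" unfolding arch_def by blast
   show "fine \<theta> p p'"
   proof (cases "p <= p'")
    case True
    then show ?thesis using fine_of_le S \<theta> by simp
   next
    case False
    have "Ln p - Ln p' <= (p - p') / p'" using S SK_qqD(4) by (intro Ln_diff_le)
    also have "\<dots> <= (r / \<theta>) / p'" using leD[OF p(3), of 1] S by (intro divide_right_mono) auto
    finally have "\<theta> * (Ln p - Ln p') <= \<theta> * ((r / \<theta>) / p')" using \<theta> by (intro mult_left_mono) auto
    also have "\<dots> = r / p'" using \<theta> by simp
    also have "\<dots> <= of_nat n" using n S by (simp add: field_simps)
    finally show ?thesis unfolding fine_def by blast
   qed
  qed
  then show "fsz (fine \<theta>) {..<Om (2 * j + 1)} {p \<in> ?K. \<not> fine \<theta> r p}"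
   by (rule fsz_mono) (auto simp del: Om.simps dest: less_Om)
 qed
next
 fix p q assume "p \<in> D" "q \<in> D" "\<not> fine \<theta> q p"
 then show "arch p q" using fine_of_le[of \<theta> q p] \<theta> D(1) linear[of p q] by (auto intro: arch_of_le)
next
 fix q assume "q \<in> D"
 then show "arch q q" using arch_refl D(1) by blast
qed

definition Y :: "nat => tf set" where "Y m = {f \<in> SK. infl f \<and> f <= El (Suc j) m}"

lemma Ln_Y:
 assumes "1 <= m" "f \<in> SK" "f <= El (Suc j) m"
 shows "Ln f <= El j m"
proof -
 have "Ln f <= Ln (El (Suc j) m)" using SK_le_iff El_in_SK assms by blast
 also have "\<dots> = El j m * Ln 2" by (rule Ln_El[OF assms(1)])
 also have "\<dots> <= El j m * 1" using Ln_2 SK_qqD(3)[OF El_in_SK] by (intro mult_left_mono) (auto intro: less_imp_le)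
 finally show ?thesis by simp
qed

text \<open>By \<open>log_class\<close> the sizes of the logarithms are sizes of values of the lower level, up to a
 factor \<open>ln x\<close>.\<close>

lemma log_rank:
 assumes m: "1 <= m"
 obtains r h where "h \<in> Hset (2 * j + 1)" "!!p. p \<in> Y m ==> r p < h"
  "!!p q. p \<in> Y m ==> q \<in> Y m ==> \<not> larch q p ==> r p < r q"
proof -
 obtain k where k: "k \<ge> 1" "El j m * El j m <= El j k" using El_mult m by blast
 let ?Z = "{e \<in> SK. e <= El j k}"
 have iX: "infl (Ln X)" by (rule Ln_SK_pos[OF infl_X SK_X])
 then have X1: "1 <= Ln X" using infl_pos(1)[of "Ln X" 1] by simp
 have bound: "e \<in> ?Z" if "e \<in> SK" "arch e (Ln f)" "f \<in> Y m" for e f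
 proof -
  have "arch e (Ln f)" by (rule that(2))
  then obtain n :: nat where n: "e <= of_nat n * Ln f" unfolding arch_def by blast
  have "of_nat n * Ln f <= El j m * El j m"
   using \<open>f \<in> Y m\<close> Ln_Y[OF m] El_ge[OF m, of n j] Ln_nonneg SK_qqD(3)[OF El_in_SK] unfolding Y_def
   by (intro mult_mono) (auto intro: less_imp_le)
  then show ?thesis using n k(2) \<open>e \<in> SK\<close> by auto
 qed
 have 1: "fsz larch (Hset (2 * j)) {f \<in> Y m. \<exists>e\<in>SK. sim (Ln f) e}"
 proof (rule fsz_rel[OF classes[OF k(1)], where E = "\<lambda>e f. sim (Ln f) e"])
  fix f assume "f \<in> {f \<in> Y m. \<exists>e\<in>SK. sim (Ln f) e}"
  then show "\<exists>e\<in>?Z. sim (Ln f) e" using bound unfolding sim_def by blast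
 next
  fix e e' f f' assume "sim (Ln f) e" "sim (Ln f') e'" "arch e e'"
  then show "larch f f'" unfolding larch_def sim_def using arch_trans by blast
 qed
 have 2: "fsz larch (Hset (2 * j)) {f \<in> Y m. \<exists>e\<in>SK. sim (Ln f) (e * Ln X)}"
 proof (rule fsz_rel[OF classes[OF k(1)], where E = "\<lambda>e f. sim (Ln f) (e * Ln X)"])
  fix f assume "f \<in> {f \<in> Y m. \<exists>e\<in>SK. sim (Ln f) (e * Ln X)}"
  then obtain e where e: "f \<in> Y m" "e \<in> SK" "sim (Ln f) (e * Ln X)" by blast
  have "e <= e * Ln X" using X1 SK_qqD(3)[OF e(2)] by simp
  then have "arch e (Ln f)" using e(3) arch_of_le arch_trans unfolding sim_def by blast
  then show "\<exists>e\<in>?Z. sim (Ln f) (e * Ln X)" using bound e by blast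
 next
  fix e e' f f' assume "sim (Ln f) (e * Ln X)" "sim (Ln f') (e' * Ln X)" "arch e e'"
  moreover have "arch (e * Ln X) (e' * Ln X)" using arch_mult_left[OF \<open>arch e e'\<close>, of "Ln X"] X1 by (simp add: mult.commute)
  ultimately show "larch f f'" unfolding larch_def sim_def using arch_trans by blast
 qed
 have "Y m \<subseteq> {f \<in> Y m. \<exists>e\<in>SK. sim (Ln f) e} \<union> {f \<in> Y m. \<exists>e\<in>SK. sim (Ln f) (e * Ln X)}"
 proof
  fix f assume f: "f \<in> Y m"
  then obtain \<tau> where "wf_sk \<tau>" "val \<tau> = f" using SK_is_val unfolding Y_def by blast
  moreover have "2 <= f" using f infl_pos(1)[of f 2] unfolding Y_def by simp
  ultimately show "f \<in> {f \<in> Y m. \<exists>e\<in>SK. sim (Ln f) e} \<union> {f \<in> Y m. \<exists>e\<in>SK. sim (Ln f) (e * Ln X)}"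
   using log_class[of \<tau>] f by auto
 qed
 then have "fsz larch (Hset (2 * j)) (Y m)" by (rule fsz_subset[OF fsz_Un[OF 1 2]])
 then show ?thesis
 proof (rule fsz_rank)
  show "larch p q \<or> larch q p" for p q unfolding larch_def using linear[of "Ln p" "Ln q"] arch_of_le by blast
  show "larch p q ==> larch q r ==> larch p r" for p q r unfolding larch_def by (rule arch_trans)
  fix r h assume "h \<in> Hset (Suc (2 * j))" "!!p. p \<in> Y m ==> r p < h"
   "!!p q. p \<in> Y m ==> q \<in> Y m ==> \<not> larch q p ==> r p < r q"
  then show ?thesis by (intro that[of h r]) simp_all
 qed
qed

end

definition Lo :: "tf => tf set" where "Lo y = {f \<in> SK. \<not> larch y f}"

definition Big :: "tf => nat => tf set" where
 "Big y n = {a. \<exists>f. wf_fac f \<and> a = valf f \<and> larch y a \<and> a <= y ^ n}"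

lemma LoD: "f \<in> Lo y ==> of_nat n * Ln f < Ln y" "f \<in> Lo y ==> f \<in> SK"
 unfolding Lo_def larch_def arch_def by (auto simp: not_le)

lemma LoI: "f \<in> SK ==> (!!n::nat. of_nat n * Ln f < Ln y) ==> f \<in> Lo y"
 unfolding Lo_def larch_def arch_def by (auto simp: not_le)

lemma Lo_less: "f \<in> Lo y ==> y \<in> SK ==> f < y"
 using LoD(1)[of f y 1] LoD(2) SK_le_iff[of y f] by (auto simp: not_le[symmetric])

lemma Lo_one: "y \<in> SK ==> infl y ==> 1 \<in> Lo y"
 using infl_pos(2)[OF Ln_SK_pos] by (intro LoI SK_one) auto

lemma Lo_mult: "f \<in> Lo y ==> g \<in> Lo y ==> f * g \<in> Lo y"
proof (rule LoI)
 fix n :: nat assume fg: "f \<in> Lo y" "g \<in> Lo y"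
 then have "of_nat (2 * n) * Ln f < Ln y" "of_nat (2 * n) * Ln g < Ln y" using LoD by blast+
 then show "of_nat n * Ln (f * g) < Ln y" using fg LoD(2) by (simp add: Ln_mult algebra_simps)
qed (auto intro: SK_mult LoD(2))

text \<open>What lies below an element \<open>q\<close> of \<open>Lo y\<close> are values up to \<open>q\<close>, to which a recursion
 applies; below a finite \<open>q\<close> there are only finitely many.\<close>

lemma sz_Lo:
 assumes y: "y \<in> SK" "infl y" and R: "!!p. p \<in> SK ==> R p p" "!!p q. p \<in> SK ==> q \<in> SK ==> \<not> R q p ==> p <= q" and \<mu>: "0 < \<mu>"
  and IH: "!!q. q \<in> Lo y ==> infl q ==> fsz R {..<\<mu>} {p \<in> SK. p <= q}"
 shows "sz R (Lo y) \<mu>"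
 unfolding sz_iff
proof
 fix q assume q: "q \<in> Lo y"
 have "fsz R {..<\<mu>} {p \<in> SK. p <= q}"
 proof (rule SK_cases[OF LoD(2)[OF q]])
  fix k :: nat assume "q = of_nat k"
  then have "q \<in> Fin" by (auto simp: Fin_def)
  then show ?thesis using finite_Fin R(1) \<mu> by (intro fsz_finite) auto
 qed (rule IH[OF q])
 then show "fsz R {..<\<mu>} {p \<in> Lo y. \<not> R q p}"
  by (rule fsz_subset) (use R(2) LoD(2) q in auto)
qed

text \<open>Each big factor contributes at least a fixed part of the logarithm of \<open>y\<^sup>n\<close>, so that their
 number is bounded. The product of the other factors is in \<open>Lo y\<close>.\<close>

lemma comp_split:
 assumes y: "y \<in> SK" "infl y"
 shows "\<exists>K. \<forall>c. wf_comp c \<and> valc c <= y ^ n \<longrightarrow>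
  (\<exists>a\<in>Lo y. \<exists>xs. set xs \<subseteq> Big y n \<and> length xs <= K \<and> valc c = a * foldr (*) xs 1)"
proof -
 obtain y1 where y1: "y1 \<in> {f \<in> SK. larch y f}" "!!f. f \<in> {f \<in> SK. larch y f} ==> y1 <= f"
  by (rule SK_least[of "{f \<in> SK. larch y f}"]) (use y in \<open>auto simp: larch_def intro: arch_of_le\<close>)
 obtain k :: nat where k: "Ln y <= of_nat k * Ln y1" using y1(1) unfolding larch_def arch_def by blast
 have "0 < Ln y" using infl_pos(2) Ln_SK_pos y by blast
 then have Ly1: "0 < Ln y1" using k by (metis not_le mult_nonneg_nonpos of_nat_0_le_iff less_le_trans)
 have "\<exists>a\<in>Lo y. \<exists>xs. set xs \<subseteq> Big y n \<and> length xs <= n * k \<and> valc c = a * foldr (*) xs 1"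
  if c: "wf_comp c" "valc c <= y ^ n" for c
 proof -
  let ?xs = "filter (larch y) (map valf c)" and ?ys = "filter (\<lambda>a. \<not> larch y a) (map valf c)"
  have fS: "valf f \<in> SK" "wf_fac f" "valf f <= y ^ n" if "f \<in> set c" for f
   using that c wf_SK(2) factor_le_comp[OF that c(1)] unfolding wf_comp_def by auto
  have 1: "valc c = prod_list ?ys * foldr (*) ?xs 1"
   by (induct c) (auto simp: mult_ac)
  have "prod_list as \<in> Lo y" if "set as \<subseteq> Lo y" for as
   using that by (induct as) (auto intro: Lo_one Lo_mult y)
  moreover have "set ?ys \<subseteq> Lo y" using fS unfolding Lo_def by auto
  ultimately have 2: "prod_list ?ys \<in> Lo y" by blast
  have 3: "set ?xs \<subseteq> Big y n" using fS unfolding Big_def by auto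
  have "of_nat (length ?xs) * Ln y1 <= Ln (valc c)"
  proof -
   have "of_nat (length (filter (larch y) (map valf d))) * Ln y1 <= Ln (valc d)" if "wf_comp d" for d
    using that
   proof (induct d)
    case (Cons f d)
    have fd: "valf f \<in> SK" "valc d \<in> SK" using Cons(2) wf_SK(2) wf_comp_SK by auto
    show ?case
    proof (cases "larch y (valf f)")
     case True
     then have "Ln y1 <= Ln (valf f)" using y1 fd SK_le_iff by auto
     then show ?thesis using Cons True fd by (simp add: Ln_mult distrib_right add_mono)
    next
     case False
     then show ?thesis using Cons fd Ln_nonneg[OF fd(1)] by (simp add: Ln_mult add_increasing)
    qed
   qed simp
   then show ?thesis using c(1) by blast
  qed
  also have "\<dots> <= Ln (y ^ n)" using c SK_le_iff wf_comp_SK SK_power y by blast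
  also have "\<dots> <= of_nat n * (of_nat k * Ln y1)" using k by (simp add: Ln_power y mult_left_mono)
  finally have "of_nat (length ?xs) * Ln y1 <= of_nat (n * k) * Ln y1" by (simp add: mult.assoc)
  then have "length ?xs <= n * k" using Ly1 by (simp only: mult_le_cancel_right_pos of_nat_le_iff)
  then show ?thesis using 1 2 3 by blast
 qed
 then show ?thesis by blast
qed

lemma fsz_comps_below:
 assumes y: "y \<in> SK" "infl y" and R: "!!p. p \<in> SK ==> R p p"
   "!!a a' b b'. a \<in> SK ==> a' \<in> SK ==> b \<in> SK ==> b' \<in> SK ==> R a a' ==> R b b' ==> R (a * b) (a' * b')"
  and U: "0 \<in> U" "!!u v. u \<in> U ==> v \<in> U ==> u + v \<in> U"
  and Lo: "fsz R U (Lo y)" and Big: "fsz R U (Big y n)"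
 shows "fsz R U {a. \<exists>c. wf_comp c \<and> a = valc c \<and> a <= y ^ n}"
proof -
 obtain K where K: "!!c. wf_comp c ==> valc c <= y ^ n ==>
  \<exists>a\<in>Lo y. \<exists>xs. set xs \<subseteq> Big y n \<and> length xs <= K \<and> valc c = a * foldr (*) xs 1"
  using comp_split[OF y] by blast
 let ?F = "{a. \<exists>xs. set xs \<subseteq> Big y n \<and> length xs <= K \<and> a = foldr (*) xs 1}"
 have BS: "Big y n \<subseteq> SK" unfolding Big_def using wf_SK(2) by blast
 have F: "fsz R U ?F"
  by (rule fsz_bounded_fold[where D = SK, OF Big U _ BS]) (use R SK_one SK_mult in auto)
 have FS: "?F \<subseteq> SK"
 proof safe
  fix xs assume "set xs \<subseteq> Big y n"
  then show "foldr (*) xs 1 \<in> SK" using BS by (induct xs) (auto intro: SK_one SK_mult)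
 qed
 show ?thesis
 proof (rule fsz_image2[where f = "(*)", OF Lo F U(2)])
  fix a a' b b' assume "a \<in> Lo y" "a' \<in> Lo y" "b \<in> ?F" "b' \<in> ?F" "R a a'" "R b b'"
  then show "R (a * b) (a' * b')" using R(2) LoD(2) FS by blast
 next
  fix c assume "c \<in> {a. \<exists>c. wf_comp c \<and> a = valc c \<and> a <= y ^ n}"
  then obtain d where d: "wf_comp d" "c = valc d" "valc d <= y ^ n" by blast
  from K[OF d(1,3)] obtain a xs where "a \<in> Lo y" "set xs \<subseteq> Big y n" "length xs <= K" "valc d = a * foldr (*) xs 1" by blast
  then show "\<exists>a\<in>Lo y. \<exists>b\<in>?F. c = a * b" using d(2) by blast
 qed auto
qed

lemma arch_total: "\<not> arch q p ==> p <= q"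
 using linear[of p q] arch_of_le by blast

text \<open>The exponents up to finite multiples of \<open>\<omega>\<^sup>a\<close>.\<close>

definition U :: "hmset => hmset set" where "U a = {\<mu>. \<forall>b>a. \<mu> < om b}"

lemma U_zero: "0 \<in> U a" unfolding U_def by simp
lemma U_add: "u \<in> U a ==> v \<in> U a ==> u + v \<in> U a" unfolding U_def using add_less_om by blast
lemma U_om: "b <= a ==> om b \<in> U a" unfolding U_def by auto
lemma U_less: "\<mu> < om b ==> b <= a ==> \<mu> \<in> U a" unfolding U_def by (auto simp: less_le_trans intro: less_trans)
lemma U_D: "\<mu> \<in> U a ==> a < b ==> \<mu> < om b" unfolding U_def by blast

context level
begin

text \<open>An infinite exponent makes the logarithm of the power larger in size than that of the
 base; so the base is in \<open>Lo y\<close>. The exponent is at most twice the logarithm of the power, and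
 this is of the lower level.\<close>

lemma Big_factor:
 assumes m: "1 <= m" and y: "y \<in> Y m" and f: "wf_fac (P b e)" "larch y (valf (P b e))" "valf (P b e) <= y ^ n"
 shows "val b \<in> Lo y" "val e <= of_nat (2 * n) * El j m"
proof -
 have be: "val b \<in> SK" "2 <= val b" "val e \<in> SK" "infl (val e)" using f(1) wf_SK(1) by auto
 have yS: "y \<in> SK" "infl y" using y unfolding Y_def by auto
 have L: "Ln (valf (P b e)) = val e * Ln (val b)" using pw_Ln be by simp
 have "Ln (valf (P b e)) <= Ln (y ^ n)" using SK_le_iff f(3) wf_SK(2)[OF f(1)] SK_power yS by blast
 then have le: "val e * Ln (val b) <= of_nat n * Ln y" using L Ln_power yS by simp
 have Lb: "1 <= 2 * Ln (val b)" using Ln_ge_half be by blast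
 have Ly: "Ln y <= El j m" using Ln_Y[OF m] y unfolding Y_def by blast
 have e0: "0 < val e" using be SK_qqD by blast
 have "val e * 1 <= val e * (2 * Ln (val b))" using Lb e0 by (intro mult_left_mono) auto
 also have "\<dots> <= 2 * (of_nat n * El j m)" using le mult_left_mono[OF Ly, of "of_nat n"] by simp
 finally show "val e <= of_nat (2 * n) * El j m" by (simp add: mult.assoc)
 show "val b \<in> Lo y"
 proof (rule LoI[OF be(1)])
  fix k :: nat
  have Lb0: "0 < Ln (val b)" using Lb by linarith
  have Ly0: "0 < Ln y" using infl_pos(2) Ln_SK_pos yS by blast
  show "of_nat k * Ln (val b) < Ln y"
  proof (rule ccontr)
   assume "\<not> ?thesis"
   then have "Ln y <= of_nat k * Ln (val b)" by simp
   then have "of_nat n * Ln y <= of_nat n * (of_nat k * Ln (val b))" by (intro mult_left_mono) auto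
   then have "val e * Ln (val b) <= of_nat (n * k) * Ln (val b)" using le by (simp add: mult.assoc)
   then have "val e <= of_nat (n * k)" using Lb0 by (simp only: mult_le_cancel_right_pos)
   then show False using infl_pos(1)[OF be(4), of "n * k"] by simp
  qed
 qed
qed

text \<open>For sizes, \<open>Q \<theta>\<close> is \<open>fine \<theta>\<close>: the larger the exponents the more precisely the bases have
 to be known. For the values themselves, it is \<open>\<le>\<close>.\<close>

lemma fsz_Big:
 assumes m: "1 <= m" and y: "y \<in> Y m" and R: "R X X"
  and W: "0 \<in> W" "Hset (2 * j + 1) \<subseteq> W" "!!u v. u \<in> W ==> v \<in> W ==> u + v \<in> W"
  and Q: "!!\<theta>. \<theta> \<in> O' j ==> 1 <= \<theta> ==> fsz (Q \<theta>) W {b \<in> Lo y. 2 <= b}"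
   "!!\<theta> b b' e e'. b \<in> SK ==> 2 <= b ==> b' \<in> SK ==> 2 <= b' ==> e \<in> SK ==> infl e ==> e' \<in> SK ==> infl e' ==>
     e <= e' ==> e <= \<theta> ==> Q \<theta> b b' ==> R (pw b e) (pw b' e')"
 shows "fsz R W (Big y n)"
proof -
 define \<theta> where "\<theta> = of_nat (2 * n) * El j m + 1"
 have E0: "0 <= El j m" using SK_qqD(3)[OF El_in_SK] by (auto intro: less_imp_le)
 have "El j m \<in> O' j" using m unfolding O'_def by blast
 then have \<theta>: "\<theta> \<in> O' j" "1 <= \<theta>" unfolding \<theta>_def using E0
  by (auto intro!: lo.Bd_add lo.Bd_mult lo.Bd_one lo.Bd_of_nat simp del: of_nat_mult)
 let ?E = "{e \<in> SK. infl e \<and> e <= \<theta>}"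
 have E: "fsz (<=) W ?E" by (rule fsz_subset[OF fsz_mono[OF exact[OF \<theta>(1)] W(2)]]) auto
 let ?A = "{a. \<exists>e\<in>?E. \<exists>b\<in>{b \<in> Lo y. 2 <= b}. a = pw b e}"
 have "fsz R W ?A"
 proof (rule fsz_image2[where f = "\<lambda>e b. pw b e", OF E Q(1)[OF \<theta>] W(3)])
  fix e e' b b' assume "e \<in> ?E" "e' \<in> ?E" "b \<in> {b \<in> Lo y. 2 <= b}" "b' \<in> {b \<in> Lo y. 2 <= b}" "e <= e'" "Q \<theta> b b'"
  then show "R (pw b e) (pw b' e')" using Q(2)[of b b' e e' \<theta>] LoD(2) by blast
 qed auto
 moreover have "fsz R W {X}" by (rule fsz_finite) (use R W in auto)
 ultimately have "fsz R W (?A \<union> {X})" by (rule fsz_Un)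
 then show ?thesis
 proof (rule fsz_subset)
  show "Big y n \<subseteq> ?A \<union> {X}"
  proof
   fix a assume "a \<in> Big y n"
   then obtain f where f: "wf_fac f" "a = valf f" "larch y a" "a <= y ^ n" unfolding Big_def by blast
   show "a \<in> ?A \<union> {X}"
   proof (cases f)
    case V
    then show ?thesis using f by simp
   next
    case (P b e)
    have be: "val b \<in> SK" "2 <= val b" "val e \<in> SK" "infl (val e)" using f(1) P wf_SK(1) by auto
    have "val b \<in> Lo y" "val e <= of_nat (2 * n) * El j m" using Big_factor[OF m y, of b e n] f P by auto
    then have "val e \<in> ?E" "val b \<in> {b \<in> Lo y. 2 <= b}" using be by (auto simp: \<theta>_def add_increasing2)
    then show ?thesis using f(2) P by auto
   qed
  qed
 qed
qed

text \<open>The sizes below powers of \<open>y\<close>, by recursion on \<open>y\<close>. The exponent depends on the rank \<open>r y\<close>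
 of its logarithm only, and what is below elements of \<open>Lo y\<close> has smaller rank.\<close>

lemma classes_below:
 assumes m: "1 <= m" and r: "!!p q. p \<in> Y m ==> q \<in> Y m ==> \<not> larch q p ==> r p < r q"
  and y: "y \<in> Y m"
 shows "fsz arch (U (Om (2 * j) + r y)) {f \<in> SK. f <= y ^ n}"
proof -
 have "y \<in> SK" using y unfolding Y_def by blast
 then have "\<forall>n. y \<in> Y m \<longrightarrow> fsz arch (U (Om (2 * j) + r y)) {f \<in> SK. f <= y ^ n}"
 proof (induct rule: SK_less_induct)
  case (less y)
  show ?case
  proof (intro allI impI)
   fix n assume y: "y \<in> Y m"
   have yS: "y \<in> SK" "infl y" "y <= El (Suc j) m" using y unfolding Y_def by auto
   let ?\<zeta> = "Om (2 * j)" and ?W = "U (Om (2 * j) + r y)"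
   have \<zeta>le: "?\<zeta> <= ?\<zeta> + r y" by (rule hmset_le_add)
   have HW: "Hset (2 * j + 1) \<subseteq> ?W"
   proof
    fix u assume "u \<in> Hset (2 * j + 1)"
    then have "u < om ?\<zeta>" using less_Om[of u "2 * j + 1"] by simp
    then show "u \<in> ?W" using \<zeta>le by (rule U_less)
   qed
   have szLo: "sz arch (Lo y) (om (?\<zeta> + r y))"
   proof (rule sz_Lo[OF yS(1,2)])
    fix q assume q: "q \<in> Lo y" "infl q"
    have qS: "q \<in> SK" "q < y" using LoD(2)[OF q(1)] Lo_less[OF q(1) yS(1)] by auto
    have qY: "q \<in> Y m" using qS q(2) yS(3) unfolding Y_def by auto
    have "\<not> larch y q" using q(1) unfolding Lo_def by blast
    then have "?\<zeta> + r q < ?\<zeta> + r y" using r[OF qY y] by (intro add_strict_left_mono)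
    then have "U (?\<zeta> + r q) \<subseteq> {..<om (?\<zeta> + r y)}" using U_D by blast
    moreover have "fsz arch (U (?\<zeta> + r q)) {f \<in> SK. f <= q ^ 1}" using less(2)[OF qS] qY by blast
    ultimately show "fsz arch {..<om (?\<zeta> + r y)} {p \<in> SK. p <= q}" using fsz_mono by fastforce
   qed (auto intro: arch_refl arch_total)
   have Lo: "fsz arch ?W (Lo y)" by (rule fszI[OF szLo U_om]) simp
   have fine: "fsz (fine \<theta>) ?W {b \<in> Lo y. 2 <= b}" if "\<theta> \<in> O' j" "1 <= \<theta>" for \<theta>
   proof (rule fsz_subset[OF refine[of "Lo y" "{om (?\<zeta> + r y)}", OF _ _ that]])
    show "fsz arch {om (?\<zeta> + r y)} (Lo y)" by (rule fszI[OF szLo]) simp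
    fix u assume "u \<in> {om (?\<zeta> + r y)}"
    moreover have "Om (2 * j + 1) = om ?\<zeta>" by simp
    ultimately show "Om (2 * j + 1) + u \<in> ?W" using U_add U_om \<zeta>le by (metis order_refl singletonD)
   qed (auto dest: LoD(2))
   have Big: "fsz arch ?W (Big y n)"
    by (rule fsz_Big[OF m y _ U_zero HW U_add fine])
     (auto intro: U_add arch_refl SK_X pw_arch)
   have comps: "fsz arch ?W {a. \<exists>c. wf_comp c \<and> a = valc c \<and> a <= y ^ n}"
    by (rule fsz_comps_below[OF yS(1,2) arch_refl arch_mult U_zero U_add Lo Big])
   show "fsz arch ?W {f \<in> SK. f <= y ^ n}"
   proof (rule fsz_rel[OF comps, where E = sim])
    fix f assume f: "f \<in> {f \<in> SK. f <= y ^ n}"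
    then obtain c where "wf_comp c" "valc c <= f" "arch f (valc c)" using SK_largest_comp by blast
    then show "\<exists>a\<in>{a. \<exists>c. wf_comp c \<and> a = valc c \<and> a <= y ^ n}. sim a f"
     using f arch_of_le unfolding sim_def by fastforce
   next
    fix z z' w w' assume "sim z w" "sim z' w'" "arch z z'"
    then show "arch w w'" unfolding sim_def using arch_trans by blast
   qed
  qed
 qed
 then show ?thesis using y by blast
qed

text \<open>The values themselves are arbitrary sums of components, so that by \<open>sz_sums\<close> each step of
 the recursion adds the exponent \<open>\<gamma>\<close> of the sizes. Multiplication of the rank by \<open>\<omega>\<^sup>\<kappa>\<close> makes
 room for it.\<close>

lemma exact_below:
 assumes m: "1 <= m" and r: "!!p q. p \<in> Y m ==> q \<in> Y m ==> \<not> larch q p ==> r p < r q"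
  and \<gamma>: "!!y n. y \<in> Y m ==> sz arch {f \<in> SK. f <= y ^ n} \<gamma>"
  and d: "d = Om (2 * j) + hone + \<gamma>" "d < om \<kappa>"
  and y: "y \<in> Y m"
 shows "sz (<=) {f \<in> SK. f <= y ^ n} (om (shift \<kappa> (r y) + d))"
proof -
 have "y \<in> SK" using y unfolding Y_def by blast
 then have "\<forall>n. y \<in> Y m \<longrightarrow> sz (<=) {f \<in> SK. f <= y ^ n} (om (shift \<kappa> (r y) + d))"
 proof (induct rule: SK_less_induct)
  case (less y)
  show ?case
  proof (intro allI impI)
   fix n assume y: "y \<in> Y m"
   have yS: "y \<in> SK" "infl y" "y <= El (Suc j) m" using y unfolding Y_def by auto
   let ?\<eta> = "shift \<kappa> (r y)"
   let ?\<zeta> = "?\<eta> + (Om (2 * j) + hone)"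
   let ?W = "{..<om ?\<zeta>}"
   have W: "0 \<in> ?W" "!!u v. u \<in> ?W ==> v \<in> ?W ==> u + v \<in> ?W" using add_less_om by auto
   have "Om (2 * j) <= Om (2 * j) + hone" by (rule hmset_le_add)
   also have "\<dots> <= ?\<zeta>" by (rule hmset_le_add)
   finally have \<zeta>le: "Om (2 * j) <= ?\<zeta>" .
   have HW: "Hset (2 * j + 1) \<subseteq> ?W"
   proof
    fix u assume "u \<in> Hset (2 * j + 1)"
    then have "u < om (Om (2 * j))" using less_Om[of u "2 * j + 1"] by simp
    also have "\<dots> <= om ?\<zeta>" using \<zeta>le by simp
    finally show "u \<in> ?W" by simp
   qed
   have \<eta>\<zeta>: "?\<eta> < ?\<zeta>"
   proof -
    have "?\<eta> < ?\<eta> + hone" by (rule less_add_hone)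
    also have "\<dots> <= ?\<zeta>" by (intro add_left_mono hmset_le_add)
    finally show ?thesis .
   qed
   have szLo: "sz (<=) (Lo y) (om ?\<eta>)"
   proof (rule sz_Lo[OF yS(1,2)])
    fix q assume q: "q \<in> Lo y" "infl q"
    have qS: "q \<in> SK" "q < y" using LoD(2)[OF q(1)] Lo_less[OF q(1) yS(1)] by auto
    have qY: "q \<in> Y m" using qS q(2) yS(3) unfolding Y_def by auto
    have "\<not> larch y q" using q(1) unfolding Lo_def by blast
    then have "shift \<kappa> (r q) + d < ?\<eta>" using r[OF qY y] d(2) by (intro shift_add_less)
    moreover have "sz (<=) {f \<in> SK. f <= q ^ 1} (om (shift \<kappa> (r q) + d))" using less(2)[OF qS] qY by blast
    ultimately show "fsz (<=) {..<om ?\<eta>} {p \<in> SK. p <= q}" by (intro fszI) auto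
   qed auto
   have Lo: "fsz (<=) ?W (Lo y)" by (rule fszI[OF szLo]) (use \<eta>\<zeta> in simp)
   have Big: "fsz (<=) ?W (Big y n)"
   proof (rule fsz_Big[where Q = "\<lambda>_. (<=)", OF m y _ W(1) HW W(2)])
    show "fsz (<=) ?W {b \<in> Lo y. 2 <= b}" by (rule fsz_subset[OF Lo]) auto
   qed (use pw_mono in auto)
   have pos: "0 < a" if "a \<in> SK" for a using that SK_qqD by blast
   have comps: "fsz (<=) ?W {a. \<exists>c. wf_comp c \<and> a = valc c \<and> a <= y ^ n}"
    by (rule fsz_comps_below[OF yS(1,2) _ _ W Lo Big]) (auto intro!: mult_mono dest: pos)
   let ?C = "{a. \<exists>c. wf_comp c \<and> a = valc c \<and> a <= y ^ n}"
   have CS: "?C \<subseteq> SK" using wf_comp_SK by blast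
   have "fsz (le 1) ?W ?C" by (rule fsz_order_mono[OF comps]) (auto intro: le_of_le)
   moreover have "sz arch ?C \<gamma>" by (rule sz_subset[OF \<gamma>[OF y, of n]]) (use CS in auto)
   ultimately have "sz (le 1) (sumset ?C) (om (?\<zeta> + \<gamma>))" using CS by (intro sz_sums) auto
   moreover have "{f \<in> SK. f <= y ^ n} \<subseteq> sumset ?C"
   proof safe
    fix f assume f: "f \<in> SK" "f <= y ^ n"
    then obtain \<tau> where "wf_sk \<tau>" "val \<tau> = f" using SK_is_val by blast
    then obtain cs where cs: "wf_sk (S cs)" "f = val (S cs)" by (cases \<tau>) auto
    then have w: "\<forall>c\<in>set cs. wf_comp c" unfolding wf_S_comp by blast
    have "set (map valc cs) \<subseteq> ?C" using w comp_le[OF _ w] cs(2) f(2) by (auto intro: order_trans)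
    then show "f \<in> sumset ?C" unfolding sumset_def using cs(2) by (intro CollectI exI[of _ "map valc cs"]) simp
   qed
   ultimately have "sz (le 1) {f \<in> SK. f <= y ^ n} (om (?\<zeta> + \<gamma>))" by (rule sz_subset)
   then have "sz (<=) {f \<in> SK. f <= y ^ n} (om (?\<zeta> + \<gamma>))"
    by (rule sz_order_mono) (use le_SK in auto)
   moreover have "?\<zeta> + \<gamma> = ?\<eta> + d" by (simp add: d(1) add.assoc)
   ultimately show "sz (<=) {f \<in> SK. f <= y ^ n} (om (?\<eta> + d))" by simp
  qed
 qed
 then show ?thesis using y by blast
qed

lemma next_classes_exact:
 assumes m: "1 <= m"
 shows "fsz arch (Hset (2 * j + 2)) {f \<in> SK. f <= El (Suc j) m}"
  and "fsz (<=) (Hset (2 * j + 3)) {f \<in> SK. f <= El (Suc j) m}"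
proof -
 obtain r h where rh: "h \<in> Hset (2 * j + 1)" "!!p. p \<in> Y m ==> r p < h"
  "!!p q. p \<in> Y m ==> q \<in> Y m ==> \<not> larch q p ==> r p < r q"
  by (rule log_rank[OF m]) (rule that)
 have E: "El (Suc j) m \<in> Y m" unfolding Y_def using El_in_SK El_infl[OF m] by blast
 define \<gamma> where "\<gamma> = om (Om (2 * j) + h)"
 have hH: "Om (2 * j) + h \<in> Hset (2 * j + 1)" using Om_in_Hset[of "2 * j"] rh(1) by (intro Hset_add) auto
 have \<gamma>H: "\<gamma> \<in> Hset (2 * j + 2)" unfolding \<gamma>_def using om_in_Hset[OF hH] by simp
 have Usub: "U (Om (2 * j) + r y) \<subseteq> {..<\<gamma>}" if "y \<in> Y m" for y
  using U_D add_strict_left_mono[OF rh(2)[OF that]] unfolding \<gamma>_def by blast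
 have cls: "fsz arch {..<\<gamma>} {f \<in> SK. f <= y ^ n}" if "y \<in> Y m" for y n
  by (rule fsz_mono[OF classes_below[of m r y n] Usub]) (use m rh(3) that in auto)
 have "fsz arch {..<\<gamma>} {f \<in> SK. f <= El (Suc j) m}" using cls[OF E, of 1] by simp
 then show "fsz arch (Hset (2 * j + 2)) {f \<in> SK. f <= El (Suc j) m}"
  by (rule fsz_mono) (use \<gamma>H Hset_downward in \<open>auto intro: less_imp_le\<close>)
 define d where "d = Om (2 * j) + hone + \<gamma>"
 have OmH: "Om (2 * j) \<in> Hset (2 * j + 2)" using Om_in_Hset[of "2 * j"] Hset_mono[of "2 * j + 1" "2 * j + 2"] by auto
 have "hone \<in> Hset (2 * j + 2)" using hone_in_Hset[of "2 * j + 1"] by simp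
 then have dH: "d \<in> Hset (2 * j + 2)" unfolding d_def using OmH \<gamma>H by (intro Hset_add)
 obtain \<kappa> where \<kappa>: "\<kappa> \<in> Hset (2 * j + 1)" "d < om \<kappa>"
  using Hset_om_bound[of "{d}" "2 * j"] dH by auto
 have "sz (<=) {f \<in> SK. f <= El (Suc j) m ^ 1} (om (shift \<kappa> (r (El (Suc j) m)) + d))"
 proof (rule exact_below[OF m _ _ d_def \<kappa>(2) E])
  show "r p < r q" if "p \<in> Y m" "q \<in> Y m" "\<not> larch q p" for p q by (rule rh(3)[OF that])
  show "sz arch {f \<in> SK. f <= y ^ n} \<gamma>" if "y \<in> Y m" for y n by (rule fsz_sz[OF cls[OF that]])
 qed
 moreover have "om (shift \<kappa> (r (El (Suc j) m)) + d) \<in> Hset (2 * j + 3)"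
 proof -
  have "r (El (Suc j) m) \<in> Hset (2 * j + 1)" using Hset_downward[OF less_imp_le[OF rh(2)[OF E]] rh(1)] .
  then have "r (El (Suc j) m) \<in> Hset (Suc (2 * j + 1))" using Hset_mono[of "2 * j + 1" "Suc (2 * j + 1)"] by auto
  from shift_in_Hset[OF \<kappa>(1) this] have "shift \<kappa> (r (El (Suc j) m)) \<in> Hset (2 * j + 2)" by simp
  then have "shift \<kappa> (r (El (Suc j) m)) + d \<in> Hset (2 * j + 2)" using dH by (rule Hset_add)
  from om_in_Hset[OF this] show ?thesis by (simp add: eval_nat_numeral)
 qed
 ultimately show "fsz (<=) (Hset (2 * j + 3)) {f \<in> SK. f <= El (Suc j) m}"
  using fszI by fastforce
qed

end

lemma fsz_om_bound:
 assumes "fsz R (Hset (Suc (Suc k))) Z"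
 obtains \<zeta> where "\<zeta> \<in> Hset (Suc k)" "fsz R {..<om \<zeta>} Z"
proof -
 obtain \<Z> where \<Z>: "finite \<Z>" "Z \<subseteq> \<Union>\<Z>" "\<forall>Z'\<in>\<Z>. \<exists>\<mu>\<in>Hset (Suc (Suc k)). sz R Z' \<mu>"
  using assms unfolding fsz_def by blast
 obtain \<mu> where \<mu>: "\<forall>Z'\<in>\<Z>. \<mu> Z' \<in> Hset (Suc (Suc k)) \<and> sz R Z' (\<mu> Z')"
  using bchoice[OF \<Z>(3)[unfolded Bex_def]] by blast
 obtain \<zeta> where \<zeta>: "\<zeta> \<in> Hset (Suc k)" "!!a. a \<in> \<mu> ` \<Z> ==> a < om \<zeta>"
  by (rule Hset_om_bound[of "\<mu> ` \<Z>" k]) (use \<Z>(1) \<mu> in auto)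
 have "fsz R {..<om \<zeta>} Z"
  unfolding fsz_def using \<Z>(1,2) \<mu> \<zeta>(2) by (intro exI[of _ \<Z>]) auto
 then show ?thesis using that \<zeta>(1) by blast
qed

lemma fsz_strict_bound:
 assumes "fsz R (Hset (Suc k)) Z"
 obtains \<gamma> where "\<gamma> \<in> Hset (Suc k)" "sz R Z \<gamma>"
proof -
 obtain \<Z> where \<Z>: "finite \<Z>" "Z \<subseteq> \<Union>\<Z>" "\<forall>Z'\<in>\<Z>. \<exists>\<mu>\<in>Hset (Suc k). sz R Z' \<mu>"
  using assms unfolding fsz_def by blast
 obtain \<mu> where \<mu>: "\<forall>Z'\<in>\<Z>. \<mu> Z' \<in> Hset (Suc k) \<and> sz R Z' (\<mu> Z')"
  using bchoice[OF \<Z>(3)[unfolded Bex_def]] by blast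
 obtain \<gamma> where \<gamma>: "\<gamma> \<in> Hset (Suc k)" "!!a. a \<in> \<mu> ` \<Z> ==> a < \<gamma>"
  by (rule Hset_strict_bound[of "\<mu> ` \<Z>" k]) (use \<Z>(1) \<mu> in auto)
 have "fsz R {..<\<gamma>} Z"
  unfolding fsz_def using \<Z>(1,2) \<mu> \<gamma>(2) by (intro exI[of _ \<Z>]) auto
 then show ?thesis using that \<gamma>(1) fsz_sz by blast
qed

text \<open>The order of sizes in terms of the logarithms.\<close>

definition lfin :: "tf => tf => bool" where "lfin p q \<longleftrightarrow> (\<exists>N::nat. p - q <= of_nat N)"

lemma lfin_refl: "lfin a a" unfolding lfin_def by (intro exI[of _ 0]) simp

lemma lfin_add: "lfin a a' ==> lfin b b' ==> lfin (a + b) (a' + b')"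
proof -
 assume "lfin a a'" "lfin b b'"
 then obtain m n :: nat where "a - a' <= of_nat m" "b - b' <= of_nat n" unfolding lfin_def by blast
 then have "a + b - (a' + b') <= of_nat (m + n)" by simp
 then show ?thesis unfolding lfin_def by blast
qed

lemma lfin_Ln: "a \<in> SK ==> b \<in> SK ==> lfin (Ln a) (Ln b) \<longleftrightarrow> arch a b"
 unfolding lfin_def using arch_of_Ln Ln_of_arch by blast

lemma lfin_trans: "lfin a b ==> lfin b c ==> lfin a c"
 using lfin_add[of a b b c] by (simp add: lfin_def)

context level
begin

text \<open>If \<open>e\<close> is of the lower level then only sizes of the bases are known; they are refined as
 the exponents demand. Otherwise the bases differ so little that \<open>Good\<close> at the level \<open>j\<close>
 controls them at the scale \<open>b / e\<close>.\<close>

lemma fsz_class_factor: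
 assumes IH: "!!\<rho>. \<rho> \<in> O' (Suc j) ==> fsz arch (Hset (2 * j + 2)) {f \<in> SK. f <= val b * \<rho> \<and> val b <= f * \<rho>}"
  and t: "t \<notin> O' (Suc j)" and wf: "wf_fac (P b e)"
  and \<rho>: "\<rho> \<in> O' (Suc j)" "1 <= \<rho>" and \<beta>: "\<beta> \<in> O' (Suc j)"
 shows "fsz lfin (Hset (2 * j + 2)) {a. \<exists>f'. facrel (P b e) f' \<and> wf_fac f' \<and> a = Ln (valf f') \<and>
  valf f' <= \<rho> * valf (P b e) \<and> valf f' <= t * \<beta>}" (is "fsz _ _ ?S")
proof -
 let ?b = "val b" and ?e = "val e"
 note b = wf_PD[OF wf]
 note pos = b(6,7)
 obtain m where m: "1 <= m" "\<rho> <= El (Suc j) m" using \<rho>(1) unfolding O'_def by blast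
 define l where "l = El j m"
 have l: "l \<in> O' j" "0 <= l" using m(1) SK_qqD(3)[OF El_in_SK] unfolding l_def O'_def by (auto intro: less_imp_le)
 let ?A = "above e t (1 * (l + l))"
 have A: "fsz (le 1) (Hset (2 * j + 1)) ?A"
  using wf l by (intro lo.fsz_above[OF good] lo.Bd_add) auto
 have AS: "x \<in> SK \<and> infl x \<and> x <= ?e + (l + l)" if "x \<in> ?A" for x
  using that wf wf_SK(1) emb_val(1) infl_mono[OF b(4)] unfolding above_def by (auto simp: algebra_simps)
 \<comment> \<open>What the factors above \<open>b\<^sup>e\<close> look like.\<close>
 have look: "\<exists>x\<in>?A. \<exists>y\<in>SK. a = Ln (pw y x) \<and> ?b <= y \<and> y < t \<and> y <= ?b * \<rho> \<and> ?e * (Ln y - Ln ?b) <= l \<and> (\<exists>b'. wf_sk b' \<and> emb b b' \<and> y = val b')"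
  if a: "a \<in> ?S" for a
 proof -
  obtain f' where f': "facrel (P b e) f'" "wf_fac f'" "a = Ln (valf f')" "valf f' <= \<rho> * valf (P b e)" "valf f' <= t * \<beta>"
   using a by blast
  have vS: "valf (P b e) \<in> SK" "valf f' \<in> SK" using wf_SK(2) wf f'(2) by blast+
  have "valf f' <= El (Suc j) m * valf (P b e)"
   using f'(4) m(2) SK_qqD(3)[OF vS(1)] by (meson mult_right_mono less_imp_le order_trans)
  then have "Ln (valf f') <= Ln (El (Suc j) m * valf (P b e))" using SK_le_iff SK_mult El_in_SK vS by blast
  also have "\<dots> = Ln (El (Suc j) m) + Ln (valf (P b e))" by (rule Ln_mult[OF El_in_SK vS(1)])
  also have "Ln (El (Suc j) m) <= l" unfolding l_def by (rule Ln_Y[OF m(1) El_in_SK order_refl])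
  finally have "Ln (valf f') - Ln (valf (P b e)) <= l" by simp
  from factor_above[OF wf f'(1,2) this] obtain b' e' where f: "f' = P b' e'" "emb b b'" "emb e e'" "wf_sk b'" "wf_sk e'" "?b <= val b'"
   "(val e' - ?e) * Ln ?b <= l" "?e * (Ln (val b') - Ln ?b) <= l" "val b' <= ?b * \<rho>" using f'(4) by metis
  let ?b' = "val b'" and ?e' = "val e'"
  note b' = wf_PD[OF f'(2)[unfolded f(1)]]
  have "?e <= ?e'" using emb_val(1) f wf by auto
  then have "(?e' - ?e) * 1 <= (?e' - ?e) * (2 * Ln ?b)" using b(8) by (intro mult_left_mono) auto
  then have ee: "?e' - ?e <= l + l" using f(7) by simp
  have lt: "?e' < t" "?b' < t" using hi.subterm_less[OF t \<beta>] f'(2,5) f(1) by auto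
  have "?e' \<in> ?A" using f ee lt unfolding above_def by auto
  moreover have "a = Ln (pw ?b' ?e')" using f'(3) f(1) by simp
  ultimately show ?thesis using b'(1) f lt(2) by (intro bexI[of _ ?e'] bexI[of _ ?b']) auto
 qed
 \<comment> \<open>The bases are known up to the precision that the exponents require.\<close>
 have "\<exists>\<theta> B. fsz (fine \<theta>) (Hset (2 * j + 2)) B \<and> B \<subseteq> {y \<in> SK. 2 <= y} \<and> (\<forall>x\<in>?A. x <= \<theta>) \<and>
   (\<forall>a\<in>?S. \<exists>x\<in>?A. \<exists>y\<in>B. a = Ln (pw y x))"
 proof (cases "?e \<in> O' j")
  case True
  let ?B = "{f \<in> SK. f <= ?b * \<rho> \<and> ?b <= f * \<rho>} \<inter> {y. 2 <= y}"
  have \<theta>: "?e + (l + l) \<in> O' j" using True l by (intro lo.Bd_add)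
  have "fsz (fine (?e + (l + l))) (Hset (2 * j + 2)) {f \<in> SK. f <= ?b * \<rho> \<and> ?b <= f * \<rho>}"
  proof (rule refine[OF _ IH[OF \<rho>(1)] \<theta>])
   fix u assume u: "u \<in> Hset (2 * j + 2)"
   have "Om (2 * j + 1) \<in> Hset (2 * j + 2)" using Om_in_Hset[of "2 * j + 1"] by (simp del: Om.simps)
   then show "Om (2 * j + 1) + u \<in> Hset (2 * j + 2)" using u by (rule Hset_add)
  qed (use b(5) l in auto)
  then have 1: "fsz (fine (?e + (l + l))) (Hset (2 * j + 2)) ?B" by (rule fsz_subset) auto
  have 2: "\<exists>x\<in>?A. \<exists>y\<in>?B. a = Ln (pw y x)" if a: "a \<in> ?S" for a
  proof -
   obtain x y where xy: "x \<in> ?A" "y \<in> SK" "a = Ln (pw y x)" "?b <= y" "y <= ?b * \<rho>" using look[OF a] by blast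
   have "y * 1 <= y * \<rho>" using \<rho>(2) SK_qqD(3)[OF xy(2)] by (intro mult_left_mono) auto
   then have "?b <= y * \<rho>" using xy(4) by simp
   then have "y \<in> ?B" using xy b(2) by auto
   then show ?thesis using xy by blast
  qed
  show ?thesis
   by (rule exI[of _ "?e + (l + l)"], rule exI[of _ ?B]) (use 1 2 AS in auto)
 next
  case False
  then have le: "l < ?e" using lo.not_Bd_less l(1) by blast
  let ?B = "above b t (?b / ?e * (l + l))"
  have BS: "?b <= y \<and> y \<in> SK" if "y \<in> ?B" for y
   using that wf wf_SK(1) emb_val(1) unfolding above_def by auto
  have "fsz (le (?b / ?e)) (Hset (2 * j + 1)) ?B"
   using wf l pos by (intro lo.fsz_above[OF good] lo.Bd_add) auto
  then have "fsz (fine (3 * ?e)) (Hset (2 * j + 1)) ?B"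
  proof (rule fsz_order_mono)
   fix p q assume pq: "p \<in> ?B" "q \<in> ?B" "le (?b / ?e) p q"
   show "fine (3 * ?e) p q"
   proof (cases "p <= q")
    case True
    then show ?thesis using fine_of_le[of "3 * ?e"] pos BS pq by auto
   next
    case F: False
    have q0: "0 < q" using BS[OF pq(2)] pos by simp
    have "Ln p - Ln q <= (p - q) / q" using BS pq SK_qqD(4) by (intro Ln_diff_le) auto
    also have "\<dots> <= (p - q) / ?b" using F BS[OF pq(2)] pos q0 by (intro divide_left_mono) auto
    also have "\<dots> <= (?b / ?e) / ?b" using leD[OF pq(3), of 1] pos by (intro divide_right_mono) auto
    finally have "3 * ?e * (Ln p - Ln q) <= 3 * ?e * ((?b / ?e) / ?b)" using pos by (intro mult_left_mono) auto
    also have "\<dots> = of_nat 3" using pos by simp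
    finally show ?thesis unfolding fine_def by blast
   qed
  qed
  then have 1: "fsz (fine (3 * ?e)) (Hset (2 * j + 2)) ?B" by (rule fsz_mono) (simp add: Hset_mono)
  have 2: "\<exists>x\<in>?A. \<exists>y\<in>?B. a = Ln (pw y x)" if a: "a \<in> ?S" for a
  proof -
   obtain x y b' where xy: "x \<in> ?A" "y \<in> SK" "a = Ln (pw y x)" "?b <= y" "y < t" "?e * (Ln y - Ln ?b) <= l"
    "wf_sk b'" "emb b b'" "y = val b'" using look[OF a] by blast
   have "Ln y - Ln ?b <= l / ?e" using xy(6) pos by (simp add: field_simps)
   moreover have "l / ?e <= 1" "0 <= l / ?e" using le l pos by auto
   ultimately have "y <= ?b + ?b * (l / ?e) + ?b * (l / ?e)"
    by (intro le_of_Ln_diff SK_qqD(4) b(1) xy(2)) auto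
   then have "y - ?b <= ?b / ?e * (l + l)" by (simp add: algebra_simps)
   then have "y \<in> ?B" unfolding above_def using xy by blast
   then show ?thesis using xy(1,3) by blast
  qed
  show ?thesis
   by (rule exI[of _ "3 * ?e"], rule exI[of _ ?B]) (use 1 2 AS BS b(2) le in fastforce)
 qed
 then obtain \<theta> B where B: "fsz (fine \<theta>) (Hset (2 * j + 2)) B" "B \<subseteq> {y \<in> SK. 2 <= y}" "\<forall>x\<in>?A. x <= \<theta>"
  "\<forall>a\<in>?S. \<exists>x\<in>?A. \<exists>y\<in>B. a = Ln (pw y x)" by blast
 have A': "fsz (le 1) (Hset (2 * j + 2)) ?A" by (rule fsz_mono[OF A]) (simp add: Hset_mono)
 show ?thesis
 proof (rule fsz_image2[where f = "\<lambda>x y. Ln (pw y x)", OF A' B(1) Hset_add])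
  fix a assume "a \<in> ?S"
  then show "\<exists>x\<in>?A. \<exists>y\<in>B. a = Ln (pw y x)" using B(4) by blast
 next
  fix x x' y y' assume xy: "x \<in> ?A" "x' \<in> ?A" "y \<in> B" "y' \<in> B" "le 1 x x'" "fine \<theta> y y'"
  have S: "x \<in> SK" "infl x" "x' \<in> SK" "infl x'" "y \<in> SK" "2 <= y" "y' \<in> SK" "2 <= y'" "x <= \<theta>"
   using AS xy(1-4) B(2,3) by auto
  have "x <= x'" using le_SK[OF xy(5)] S by blast
  then have "arch (pw y x) (pw y' x')" using S xy(6) by (intro pw_arch) auto
  then show "lfin (Ln (pw y x)) (Ln (pw y' x'))" using lfin_Ln SK_pw S by blast
 qed auto
qed

text \<open>The sizes of germs in a bounded ratio to \<open>t\<close>. For bounded \<open>t\<close> they are known; otherwise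
 \<open>f\<close> is of the size of its largest component, and the bases of its factors are smaller than
 \<open>t\<close>.\<close>

lemma classes_at:
 assumes "t \<in> SK"
 shows "\<forall>\<beta>\<in>O' (Suc j). fsz arch (Hset (2 * j + 2)) {f \<in> SK. f <= t * \<beta> \<and> t <= f * \<beta>}"
 using assms
proof (induct rule: SK_less_induct)
 case (less t)
 have t0: "0 < t" using less(1) SK_qqD by blast
 show ?case
 proof
  fix \<beta> assume \<beta>: "\<beta> \<in> O' (Suc j)"
  define \<gamma> where "\<gamma> = max \<beta> 1"
  have \<gamma>: "\<gamma> \<in> O' (Suc j)" "1 <= \<gamma>" "\<beta> <= \<gamma>" using \<beta> hi.Bd_one hi.Bd_max by (auto simp: \<gamma>_def)
  let ?Z = "{f \<in> SK. f <= t * \<gamma> \<and> t <= f * \<gamma>}"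
  have "fsz arch (Hset (2 * j + 2)) ?Z"
  proof (cases "t \<in> O' (Suc j)")
   case True
   then have "t * \<gamma> \<in> O' (Suc j)" using \<gamma> t0 by (intro hi.Bd_mult) auto
   then obtain m where m: "1 <= m" "t * \<gamma> <= El (Suc j) m" unfolding O'_def by blast
   show ?thesis by (rule fsz_subset[OF next_classes_exact(1)[OF m(1)]]) (use m(2) in auto)
  next
   case False
   let ?C = "comps (t / (2 * \<gamma>)) (t * \<gamma>)"
   obtain n :: nat where n: "!!a. a \<in> ?C ==> t / (2 * \<gamma>) < of_nat n * a" using comps_lower by blast
   define \<delta> where "\<delta> = \<gamma> + of_nat (2 * n) * \<gamma>"
   have \<delta>: "\<delta> \<in> O' (Suc j)" "1 <= \<delta>" "\<gamma> <= \<delta>" unfolding \<delta>_def using \<gamma>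
    by (auto intro!: hi.Bd_add hi.Bd_mult hi.Bd_of_nat simp: add_increasing2 simp del: of_nat_mult)
   let ?L = "{a. \<exists>c. wf_comp c \<and> a = Ln (valc c) \<and> valc c <= t * \<delta> \<and> t <= valc c * \<delta>}"
   have logs: "fsz lfin (Hset (2 * j + 2)) ?L"
   proof (rule hi.fsz_comp_logs)
    fix \<rho> assume "\<rho> \<in> O' (Suc j)"
    then obtain m where m: "1 <= m" "\<rho> <= El (Suc j) m" unfolding O'_def by blast
    show "fsz lfin (Hset (2 * j + 2)) {a. \<exists>f\<in>SK. f <= \<rho> \<and> a = Ln f}"
     by (rule fsz_image[OF next_classes_exact(1)[OF m(1)], of _ Ln]) (use m(2) lfin_Ln in auto)
   next
    fix b e \<rho> assume w: "wf_fac (P b e)" "valf (P b e) <= t * \<delta>" and \<rho>: "\<rho> \<in> O' (Suc j)" "1 <= \<rho>"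
    have bt: "val b \<in> SK" "val b < t" using hi.subterm_less[OF False \<delta>(1) w] w(1) wf_SK(1) by auto
    show "fsz lfin (Hset (2 * j + 2)) {a. \<exists>f'. facrel (P b e) f' \<and> wf_fac f' \<and> a = Ln (valf f') \<and>
      valf f' <= \<rho> * valf (P b e) \<and> valf f' <= t * \<delta>}"
    proof (rule fsz_class_factor[OF _ False w(1) \<rho> \<delta>(1)])
     fix \<rho>' assume "\<rho>' \<in> O' (Suc j)"
     then show "fsz arch (Hset (2 * j + 2)) {f \<in> SK. f <= val b * \<rho>' \<and> val b <= f * \<rho>'}" using less(2)[OF bt] by blast
    qed
   qed (use \<delta> lfin_refl lfin_add Hset_add zero_in_Hset in auto)
   show ?thesis
   proof (rule fsz_rel[OF logs, where E = "\<lambda>z f. lfin z (Ln f) \<and> lfin (Ln f) z"])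
    fix f assume f: "f \<in> ?Z"
    then obtain c where c: "wf_comp c" "valc c <= f" "arch f (valc c)" using SK_largest_comp by blast
    obtain k :: nat where k: "f <= of_nat k * valc c" using c(3) unfolding arch_def by blast
    have "t / (2 * \<gamma>) < t / \<gamma>" using t0 \<gamma> by (simp add: field_simps)
    also have "\<dots> <= f" using f \<gamma> by (simp add: field_simps)
    finally have "t / (2 * \<gamma>) < of_nat k * valc c" using k by simp
    then have "valc c \<in> ?C" unfolding comps_def using c f by auto
    then have "t < (of_nat n * valc c) * (2 * \<gamma>)" using n \<gamma> by (simp add: divide_less_eq)
    also have "\<dots> <= valc c * \<delta>"
     using SK_qqD(3)[OF wf_comp_SK[OF c(1)]] \<gamma> by (simp add: \<delta>_def algebra_simps)
    finally have "t <= valc c * \<delta>" by simp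
    moreover have "valc c <= t * \<delta>"
    proof -
     have "t * \<gamma> <= t * \<delta>" using \<delta>(3) t0 by simp
     then show ?thesis using c(2) f by auto
    qed
    ultimately have "Ln (valc c) \<in> ?L" using c(1) by blast
    moreover have "lfin (Ln (valc c)) (Ln f)" "lfin (Ln f) (Ln (valc c))"
     using lfin_Ln wf_comp_SK[OF c(1)] f c(2,3) arch_of_le by auto
    ultimately show "\<exists>z\<in>?L. lfin z (Ln f) \<and> lfin (Ln f) z" by blast
   next
    fix z z' w w' assume "w \<in> ?Z" "w' \<in> ?Z" "lfin z (Ln w) \<and> lfin (Ln w) z" "lfin z' (Ln w') \<and> lfin (Ln w') z'" "lfin z z'"
    moreover from this have "lfin (Ln w) (Ln w')" using lfin_trans by blast
    ultimately show "arch w w'" using lfin_Ln by blast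
   qed
  qed
  then show "fsz arch (Hset (2 * j + 2)) {f \<in> SK. f <= t * \<beta> \<and> t <= f * \<beta>}"
  proof (rule fsz_subset, safe)
   fix f assume f: "f \<in> SK" "f <= t * \<beta>" "t <= f * \<beta>"
   have "t * \<beta> <= t * \<gamma>" "f * \<beta> <= f * \<gamma>" using \<gamma>(3) t0 SK_qqD(3)[OF f(1)] by simp_all
   then show "f <= t * \<gamma>" "t <= f * \<gamma>" using f by auto
  qed
 qed
qed

text \<open>The values at the scale \<open>s\<close>, up to a bounded multiple: they are sums of components in a
 bounded ratio to \<open>s\<close>. The components are controlled by \<open>fsz_comps\<close> and their sizes by
 \<open>classes_at\<close>.\<close>

lemma next_Good: "Good (O' (Suc j)) (2 * j + 3) t"
proof (rule hi.Good_step)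
 fix t assume t: "t \<in> SK" and gd: "Good (O' (Suc j)) (2 * j + 3) t"
 have t0: "0 < t" using t SK_qqD by blast
 show "hi.Good_at (2 * j + 3) t"
  unfolding hi.Good_at_def
 proof (intro ballI allI impI)
  fix \<beta> s assume \<beta>: "\<beta> \<in> O' (Suc j)" and s: "0 < s" "s <= t" "t <= s * \<beta>"
  have \<beta>0: "0 < \<beta>" using s t0 by (metis less_le_trans not_less mult_pos_neg zero_less_mult_pos)
  have exact': "fsz (<=) (Hset (2 * j + 3)) {f \<in> SK. f <= \<rho>}" if \<rho>: "\<rho> \<in> O' (Suc j)" for \<rho>
  proof -
   obtain m where m: "1 <= m" "\<rho> <= El (Suc j) m" using \<rho> unfolding O'_def by blast
   show ?thesis by (rule fsz_subset[OF next_classes_exact(2)[OF m(1)]]) (use m(2) in auto)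
  qed
  show "fsz (le s) (Hset (2 * j + 3)) {f \<in> SK. f <= t * \<beta>}"
  proof (cases "t \<in> O' (Suc j)")
   case True
   then have "t * \<beta> \<in> O' (Suc j)" using \<beta> t0 \<beta>0 by (intro hi.Bd_mult) auto
   then show ?thesis by (rule fsz_order_mono[OF exact']) (use s in \<open>auto intro: le_of_le\<close>)
  next
   case False
   let ?C = "comps s (t * \<beta>)"
   obtain n :: nat where n: "!!a. a \<in> ?C ==> s < of_nat n * a" using comps_lower by blast
   define \<delta> where "\<delta> = 1 + \<beta> + of_nat n * \<beta>"
   have \<delta>: "\<delta> \<in> O' (Suc j)" "1 <= \<delta>" "\<beta> <= \<delta>" unfolding \<delta>_def using \<beta> \<beta>0
    by (auto intro!: hi.Bd_add hi.Bd_mult hi.Bd_of_nat hi.Bd_one simp: add_increasing2 add_increasing)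
   have C: "a <= t * \<delta> \<and> t <= a * \<delta> \<and> a \<in> SK \<and> (\<exists>c. wf_comp c \<and> a = valc c)" if a: "a \<in> ?C" for a
   proof -
    have aS: "a \<in> SK" "\<exists>c. wf_comp c \<and> a = valc c" "a <= t * \<beta>" using a subsetD[OF comps_SK a] unfolding comps_def by auto
    have "s * \<beta> <= (of_nat n * a) * \<beta>" using n[OF a] \<beta>0 by (intro mult_right_mono) auto
    then have "t <= (of_nat n * a) * \<beta>" using s(3) by linarith
    also have "\<dots> <= a * \<delta>" using SK_qqD(3)[OF aS(1)] \<beta>0 by (simp add: \<delta>_def algebra_simps)
    finally have "t <= a * \<delta>" .
    moreover have "t * \<beta> <= t * \<delta>" using \<delta>(3) t0 by simp
    ultimately show ?thesis using aS by auto
   qed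
   have "fsz (le s) (Hset (2 * j + 3)) ?C"
   proof (rule fsz_subset[OF hi.fsz_comps[OF gd exact' False \<delta>(1,2) s(1,2)]])
    show "t <= s * \<delta>" using s \<delta>(3) by (meson mult_left_mono less_imp_le order_trans)
    show "?C \<subseteq> {a. \<exists>c. wf_comp c \<and> a = valc c \<and> a <= t * \<delta> \<and> t <= a * \<delta>}" using C by auto
   qed
   then have "fsz (le s) (Hset (Suc (Suc (2 * j + 1)))) ?C" by (simp add: eval_nat_numeral)
   then obtain \<zeta> where \<zeta>: "\<zeta> \<in> Hset (Suc (2 * j + 1))" "fsz (le s) {..<om \<zeta>} ?C" by (rule fsz_om_bound)
   have "fsz arch (Hset (2 * j + 2)) ?C"
    by (rule fsz_subset[OF bspec[OF classes_at[OF t] \<delta>(1)]]) (use C in auto)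
   then have "fsz arch (Hset (Suc (2 * j + 1))) ?C" by simp
   then obtain \<gamma> where \<gamma>: "\<gamma> \<in> Hset (Suc (2 * j + 1))" "sz arch ?C \<gamma>" by (rule fsz_strict_bound)
   have "sz (le s) (sumset ?C) (om (\<zeta> + \<gamma>))"
    by (rule sz_sums[OF \<gamma>(2) comps_SK \<zeta>(2) s(1)])
   moreover have "om (\<zeta> + \<gamma>) \<in> Hset (2 * j + 3)"
    using om_in_Hset[OF Hset_add[OF \<zeta>(1) \<gamma>(1)]] by (simp add: eval_nat_numeral)
   ultimately have "fsz (le s) (Hset (2 * j + 3)) (sumset ?C)" by (rule fszI)
   then show ?thesis
   proof (rule fsz_of_sums[OF _ s(1)])
    fix f assume "f \<in> {f \<in> SK. f <= t * \<beta>}"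
    then have f: "f \<in> SK" "f <= t * \<beta>" by auto
    obtain xs where "set xs \<subseteq> ?C" "sum_list xs <= f" "le s f (sum_list xs)"
     using sum_of_components[OF f s(1)] .
    then show "\<exists>a\<in>sumset ?C. a <= f \<and> le s f a" unfolding sumset_def by blast
   qed
  qed
 qed
qed

end

theorem level_all: "level j"
proof (induct j)
 case 0
 show ?case
 proof
  show "Good (O' 0) (2 * 0 + 1) t" for t using Good_0 by simp
  show "fsz arch (Hset (2 * 0)) {f \<in> SK. f <= El 0 m}" for m using classes_0 by simp
 qed
next
 case (Suc j)
 interpret level j by (rule Suc)
 show ?case
 proof
  show "Good (O' (Suc j)) (2 * Suc j + 1) t" for t using next_Good[of t] by (simp add: eval_nat_numeral)
  show "1 <= m ==> fsz arch (Hset (2 * Suc j)) {f \<in> SK. f <= El (Suc j) m}" for m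
   using next_classes_exact(1)[of m] by (simp add: eval_nat_numeral)
 qed
qed

section \<open>Order types of sets of germs\<close>

lemma strict_mono_ge:
 fixes f :: "hmset => hmset"
 assumes "!!x y. x \<in> Hset k ==> y \<in> Hset k ==> x < y ==> f x < f y" "!!x. x \<in> Hset k ==> f x \<in> Hset k" "x \<in> Hset k"
 shows "x <= f x"
 using assms(3)
proof (induct x rule: less_induct)
 case (less x)
 show ?case
 proof (rule ccontr)
  assume "\<not> x <= f x"
  then have lt: "f x < x" by simp
  then have "f (f x) < f x" using assms(1)[of "f x" x] assms(2) less(2) by blast
  moreover have "f x <= f (f x)" using less(1)[OF lt] assms(2) less(2) by blast
  ultimately show False by simp
 qed
qed

text \<open>An embedding of the tower into \<open>r\<close>, followed by the ranks, would be a strictly monotone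
 map of \<open>Hset k\<close> to itself with values below a member \<open>h\<close>.\<close>

lemma ordLess_omega_tower:
 assumes lin: "Linear_order r"
  and f: "!!x y. (x, y) \<in> r ==> x \<noteq> y ==> f x < f y" "!!x. x \<in> Field r ==> f x < h" and h: "h \<in> Hset k"
 shows "r <o omega_tower k"
proof -
 have "r - Id \<subseteq> inv_image {(x, y). x < y} f" using f(1) unfolding inv_image_def by blast
 then have "wf (r - Id)" using wf_subset wf_inv_image[OF wf] by blast
 then have wo: "Well_order r" using lin by (simp add: well_order_on_def)
 show ?thesis
 proof (rule ccontr)
  assume "\<not> ?thesis"
  then have "omega_tower k \<le>o r" using ordLess_or_ordLeq[OF wo Well_order_omega_tower] by blast
  then obtain g where g: "embed (omega_tower k) r g" unfolding ordLeq_def by blast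
  have inj: "inj_on g (Hset k)" by (rule embed_inj_on[OF Well_order_omega_tower g])
  have "compat (omega_tower k) r g" by (rule embed_compat[OF g])
  then have c: "(x, y) \<in> omega_tower k ==> (g x, g y) \<in> r" for x y unfolding compat_def by blast
  have gF: "g x \<in> Field r" if "x \<in> Hset k" for x
   using embed_Field[OF g] that by blast
  have fg: "f (g x) < h" "f (g x) \<in> Hset k" if "x \<in> Hset k" for x
   using f(2)[OF gF[OF that]] Hset_downward[OF less_imp_le h] by blast+
  have "h <= f (g h)"
  proof (rule strict_mono_ge[of k "\<lambda>x. f (g x)", OF _ _ h])
   fix x y assume xy: "x \<in> Hset k" "y \<in> Hset k" "x < y"
   then have "(x, y) \<in> omega_tower k" using less_eq_hmset_iff[OF xy(1,2)] less_imp_le[OF xy(3)] by blast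
   moreover have "g x \<noteq> g y" using inj xy by (auto simp: inj_on_def)
   ultimately show "f (g x) < f (g y)" using c f(1) by blast
  qed (use fg in blast)
  then show False using fg(1)[OF h] by simp
 qed
qed

text \<open>The order of a set of germs and that of its classes are both images of a quasi-order on
 the values, under the map \<open>c\<close>.\<close>

lemma quotient_order_less:
 assumes "fsz Q (Hset k) B" and tot: "!!p q. Q p q \<or> Q q p" and tr: "!!p q r. Q p q ==> Q q r ==> Q p r"
  and F: "Field R = c ` B" and R: "!!p q. p \<in> B ==> q \<in> B ==> (c p, c q) \<in> R \<longleftrightarrow> Q p q"
  and c: "!!p q. p \<in> B ==> q \<in> B ==> Q p q ==> Q q p ==> c p = c q" and K: "Suc k <= K"
 shows "R <o omega_tower K"
proof -
 obtain r h where r: "h \<in> Hset (Suc k)" "!!p. p \<in> B ==> r p < h" "!!p q. p \<in> B ==> q \<in> B ==> \<not> Q q p ==> r p < r q"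
  by (rule fsz_rank[OF assms(1) tot tr]) (auto intro: that)
 have sub: "\<exists>p\<in>B. \<exists>q\<in>B. C = c p \<and> D = c q \<and> Q p q" if CD: "(C, D) \<in> R" for C D
 proof -
  have "C \<in> c ` B" "D \<in> c ` B" using CD F by (auto simp: Field_def)
  then show ?thesis using R CD by blast
 qed
 have lin: "Linear_order R"
  unfolding linear_order_on_def partial_order_on_def preorder_on_def F
 proof (intro conjI)
  show "R \<subseteq> c ` B \<times> c ` B" using F by (auto simp: Field_def)
  show "refl_on (c ` B) R" using R tot by (auto simp: refl_on_def)
  show "trans R"
  proof (rule transI)
   fix C D E assume a: "(C, D) \<in> R" "(D, E) \<in> R"
   obtain p q where p: "p \<in> B" "q \<in> B" "C = c p" "D = c q" "Q p q" using sub[OF a(1)] by blast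
   obtain s where s: "s \<in> B" "E = c s" using sub[OF a(2)] by blast
   have "Q q s" using R[OF p(2) s(1)] a(2) p(4) s(2) by simp
   then show "(C, E) \<in> R" using R[OF p(1) s(1)] tr p s by blast
  qed
  show "antisym R"
  proof (rule antisymI)
   fix C D assume a: "(C, D) \<in> R" "(D, C) \<in> R"
   obtain p q where p: "p \<in> B" "q \<in> B" "C = c p" "D = c q" "Q p q" using sub[OF a(1)] by blast
   then have "Q q p" using R[OF p(2,1)] a(2) by simp
   then show "C = D" using c p by blast
  qed
  show "total_on (c ` B) R"
   unfolding total_on_def
  proof (intro ballI impI)
   fix C D assume "C \<in> c ` B" "D \<in> c ` B"
   then obtain p q where "p \<in> B" "q \<in> B" "C = c p" "D = c q" by blast
   then show "(C, D) \<in> R \<or> (D, C) \<in> R" using R[of p q] R[of q p] tot[of p q] by simp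
  qed
 qed
 let ?rep = "inv_into B c"
 show ?thesis
 proof (rule ordLess_omega_tower[OF lin, where f = "\<lambda>C. r (?rep C)"])
  show "h \<in> Hset K" using r(1) Hset_mono[OF K] by blast
  show "r (?rep C) < h" if "C \<in> Field R" for C using r(2) inv_into_into[of C c B] that F by blast
  fix C D assume CD: "(C, D) \<in> R" "C \<noteq> D"
  then have "C \<in> c ` B" "D \<in> c ` B" using F by (auto simp: Field_def)
  note d = inv_into_into[OF this(1)] inv_into_into[OF this(2)] f_inv_into_f[OF this(1)] f_inv_into_f[OF this(2)]
  have "Q (?rep C) (?rep D)" using R[OF d(1,2)] d(3,4) CD(1) by simp
  then have "\<not> Q (?rep D) (?rep C)" using c[OF d(1,2)] d(3,4) CD(2) by auto
  then show "r (?rep C) < r (?rep D)" using r(3) d by blast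
 qed
qed

lemma germ_order_less:
 assumes "fsz (<=) (Hset k) B" "Suc k <= K"
 shows "germ_order (tgerm ` B) <o omega_tower K"
proof (rule quotient_order_less[where c = tgerm, OF assms(1) linear order_trans _ _ _ assms(2)])
 show "Field (germ_order (tgerm ` B)) = tgerm ` B"
  unfolding germ_order_def by (rule Field_relation_of) (auto simp: tgerm_le)
qed (auto simp: germ_order_def relation_of_iff tgerm_le)

lemma asymp_quotient_order_less:
 assumes "fsz arch (Hset k) B" "B \<subseteq> SK" "Suc k <= K"
 shows "asymp_quotient_order (tgerm ` B) <o omega_tower K"
proof -
 have tot: "arch p q \<or> arch q p" for p q using linear[of p q] arch_of_le by blast
 then have refl: "arch p p" for p by blast
 let ?A = "tgerm ` B"
 \<comment> \<open>A class consists of the values of the size of a representative.\<close>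
 define cls where "cls p = tgerm ` {q \<in> B. arch p q \<and> arch q p}" for p
 have "asymp_on ?A `` {tgerm p} = cls p" if "p \<in> B" for p
 proof -
  have "(tgerm p, tgerm q) \<in> asymp_on ?A \<longleftrightarrow> arch p q \<and> arch q p" if "q \<in> B" for q
  proof -
   have "0 < p" "0 < q" using that \<open>p \<in> B\<close> assms(2) SK_qqD(3) by blast+
   then show ?thesis using that \<open>p \<in> B\<close> by (auto simp: asymp_on_def relation_of_iff tgerm_asymp)
  qed
  then show ?thesis unfolding cls_def by (auto simp: asymp_on_def relation_of_iff)
 qed
 then have Q: "?A // asymp_on ?A = cls ` B" unfolding quotient_def by auto
 have mem: "tgerm q \<in> cls p \<longleftrightarrow> q \<in> B \<and> arch p q \<and> arch q p" for p q
  unfolding cls_def by (auto simp: tgerm_eq)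
 show ?thesis
 proof (rule quotient_order_less[where c = cls, OF assms(1) tot arch_trans _ _ _ assms(3)])
  show "Field (asymp_quotient_order ?A) = cls ` B"
   unfolding asymp_quotient_order_def Q[symmetric]
  proof (rule Field_relation_of)
   fix C assume "C \<in> ?A // asymp_on ?A"
   then obtain p where "p \<in> B" "C = cls p" unfolding Q by blast
   then have "tgerm p \<in> C" using mem refl by blast
   then show "\<exists>f\<in>C. \<exists>g\<in>C. f <= g" using tgerm_le by blast
  qed
  show "cls p = cls q" if "arch p q" "arch q p" for p q unfolding cls_def using that arch_trans by blast
  fix p q assume pq: "p \<in> B" "q \<in> B"
  have "(\<exists>f\<in>cls p. \<exists>g\<in>cls q. f <= g) \<longleftrightarrow> arch p q"
  proof
   assume "\<exists>f\<in>cls p. \<exists>g\<in>cls q. f <= g"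
   then obtain p' q' where "arch p p'" "arch q' q" "p' <= q'" unfolding cls_def by (auto simp: tgerm_le)
   then show "arch p q" using arch_of_le arch_trans by blast
  next
   assume a: "arch p q"
   show "\<exists>f\<in>cls p. \<exists>g\<in>cls q. f <= g"
   proof (cases "p <= q")
    case True
    then show ?thesis using pq refl mem tgerm_le by blast
   next
    case False
    then have "arch q p" using arch_of_le[of q p] by simp
    then have "tgerm p \<in> cls q" "tgerm p \<in> cls p" using a pq refl mem by auto
    then show ?thesis using tgerm_le by blast
   qed
  qed
  then show "(cls p, cls q) \<in> asymp_quotient_order ?A \<longleftrightarrow> arch p q"
   unfolding asymp_quotient_order_def relation_of_iff Q using pq by auto
 qed
qed

lemma Sk_below_eq: "Sk_below (germ_of (\<lambda>x. tower2 n (x ^ m))) = tgerm ` {a \<in> SK. a < El n m}"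
 unfolding Sk_below_def Sk_eq tgerm_El[symmetric] by (auto simp: tgerm_less)

lemma order_types:
 assumes "1 <= m" "1 <= n"
 shows "2 * n + 2 <= K ==> germ_order (Sk_below (germ_of (\<lambda>x. tower2 n (x ^ m)))) <o omega_tower K"
  and "2 * n + 1 <= K ==> asymp_quotient_order (Sk_below (germ_of (\<lambda>x. tower2 n (x ^ m)))) <o omega_tower K"
proof -
 obtain j where n: "n = Suc j" using assms(2) by (cases n) auto
 interpret level j by (rule level_all)
 have sub: "{a \<in> SK. a < El n m} \<subseteq> {f \<in> SK. f <= El (Suc j) m}" unfolding n by auto
 show "germ_order (Sk_below (germ_of (\<lambda>x. tower2 n (x ^ m)))) <o omega_tower K" if "2 * n + 2 <= K"
  unfolding Sk_below_eq
  by (rule germ_order_less[OF fsz_subset[OF next_classes_exact(2)[OF assms(1)] sub]]) (use that n in auto)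
 show "asymp_quotient_order (Sk_below (germ_of (\<lambda>x. tower2 n (x ^ m)))) <o omega_tower K" if "2 * n + 1 <= K"
  unfolding Sk_below_eq
  by (rule asymp_quotient_order_less[OF fsz_subset[OF next_classes_exact(1)[OF assms(1)] sub]]) (use that n in auto)
qed

theorem theorem24p1:
  "(\<forall>m n :: nat. m \<ge> 2 \<longrightarrow> n \<ge> 1 \<longrightarrow>
      germ_order (Sk_below (germ_of (\<lambda>x. tower2 n (x ^ m)))) <o omega_tower (tower_index n) \<and>
      asymp_quotient_order (Sk_below (germ_of (\<lambda>x. tower2 n (x ^ m)))) <o omega_tower (tower_index n - 1)) \<and>
   (\<forall>n :: nat. n \<ge> 1 \<longrightarrow>
      germ_order (Sk_below (germ_of (\<lambda>x. tower2 n x))) <o omega_tower (10 + 4 ^ n))"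
proof (intro conjI allI impI)
 fix m n :: nat assume mn: "2 <= m" "1 <= n"
 have "n * 4 <= n * (n + 3)" using mn(2) by (intro mult_left_mono) auto
 then have idx: "2 * n + 2 <= tower_index n" unfolding tower_index_def by linarith
 show "germ_order (Sk_below (germ_of (\<lambda>x. tower2 n (x ^ m)))) <o omega_tower (tower_index n)"
  using mn idx by (intro order_types) auto
 show "asymp_quotient_order (Sk_below (germ_of (\<lambda>x. tower2 n (x ^ m)))) <o omega_tower (tower_index n - 1)"
  using mn idx by (intro order_types) auto
next
 fix n :: nat assume n: "1 <= n"
 have "1 + 2 * n <= 4 ^ n" by (induct n) auto
 then show "germ_order (Sk_below (germ_of (\<lambda>x. tower2 n x))) <o omega_tower (10 + 4 ^ n)"
  using order_types(1)[of 1 n "10 + 4 ^ n"] n by simp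
qed

end
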